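(* Suppose that $V\in C^\infty(\mathbb R;\mathbb R)$ is $\mathbb Z$-periodic, that $V$ has a single minimum $x_0$ in a fundamental domain of $\mathbb Z$, and that $V(x)=a_0(x-x_0)^2+\mathcal O(|x-x_0|^3)$ as $x\to x_0$, with $a_0>0$. For $h>0$ let $$(P_{\rm d}(h)v)(\gamma):=2v(\gamma)-v(\gamma+1)-v(\gamma-1)+V(h\gamma)v(\gamma),\quad\gamma\in\mathbb Z,$$ on $\ell^2(\mathbb Z)$, and $P_{\rm c}(h)u(x):=-u''(x)+V(hx)u(x)$ on $L^2(\mathbb R)$ with domain $H^2(\mathbb R)$. Then $$d(h):=\frac{\min\operatorname{Spec}(P_{\rm d}(h))}{\min\operatorname{Spec}(P_{\rm c}(h))}=1-\frac{\sqrt{a_0}}{16}h+\mathcal O(h^2)\quad\text{as }h\to0^+.$$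
   Context: "Single minimum $x_0$ in a fundamental domain" means that, up to translation by $\mathbb Z$, $x_0$ is the unique point at which $V$ attains its (global) minimum; by the stated expansion, $\min V=V(x_0)=0$. *)

theory Defs
  imports "HOL-Analysis.Analysis" "HOL-Library.Landau_Symbols"
begin

definition smooth :: "(real \<Rightarrow> real) \<Rightarrow> bool" where
  "smooth f \<longleftrightarrow> (\<forall>n x. ((deriv ^^ n) f) differentiable (at x))"

(* Elements of L^2 are represented by functions; equality in L^2 is equality almost everywhere.
   In particular L2 (count_space UNIV) is the space of square-summable functions, where
   almost everywhere means everywhere. *)
definition L2 :: "'a measure \<Rightarrow> ('a \<Rightarrow> complex) set" where
  "L2 M = {f \<in> borel_measurable M. integrable M (\<lambda>x. (cmod (f x))\<^sup>2)}"

definition L2_norm :: "'a measure \<Rightarrow> ('a \<Rightarrow> complex) \<Rightarrow> real" where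
  "L2_norm M f = sqrt (LINT x|M. (cmod (f x))\<^sup>2)"

(* Resolvent set of the operator T on L^2(M) with domain D: the complex numbers z such that
   T - z maps D bijectively onto L^2(M) with bounded inverse. Injectivity is contained in
   the bound, since L2_norm vanishes only on functions that are zero almost everywhere. *)
definition resolvent_set ::
  "'a measure \<Rightarrow> ('a \<Rightarrow> complex) set \<Rightarrow> (('a \<Rightarrow> complex) \<Rightarrow> 'a \<Rightarrow> complex) \<Rightarrow> complex set" where
  "resolvent_set M D T = {z.
     (\<forall>f\<in>L2 M. \<exists>u\<in>D. AE x in M. T u x - z * u x = f x) \<and>
     (\<exists>C. \<forall>u\<in>D. L2_norm M u \<le> C * L2_norm M (\<lambda>x. T u x - z * u x))}"

definition Spec ::
  "'a measure \<Rightarrow> ('a \<Rightarrow> complex) set \<Rightarrow> (('a \<Rightarrow> complex) \<Rightarrow> 'a \<Rightarrow> complex) \<Rightarrow> complex set" where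
  "Spec M D T = - resolvent_set M D T"

definition is_min_of :: "complex set \<Rightarrow> real \<Rightarrow> bool" where
  "is_min_of S m \<longleftrightarrow> complex_of_real m \<in> S \<and> (\<forall>z\<in>S. z \<in> \<real> \<and> m \<le> Re z)"

definition min_of :: "complex set \<Rightarrow> real" where
  "min_of S = (THE m. is_min_of S m)"

definition test_functions :: "(real \<Rightarrow> real) set" where
  "test_functions = {\<phi>. smooth \<phi> \<and> compact (closure {x. \<phi> x \<noteq> 0})}"

definition has_weak_deriv :: "(real \<Rightarrow> complex) \<Rightarrow> (real \<Rightarrow> complex) \<Rightarrow> bool" where
  "has_weak_deriv u v \<longleftrightarrow> u \<in> L2 lborel \<and> v \<in> L2 lborel \<and>
     (\<forall>\<phi>\<in>test_functions.
        (LINT x|lborel. u x * complex_of_real (deriv \<phi> x)) =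
        - (LINT x|lborel. v x * complex_of_real (\<phi> x)))"

(* Weak derivatives are unique only up to null sets, so a representative is chosen. *)
definition weak_deriv :: "(real \<Rightarrow> complex) \<Rightarrow> real \<Rightarrow> complex" where
  "weak_deriv u = (SOME v. has_weak_deriv u v)"

definition H2 :: "(real \<Rightarrow> complex) set" where
  "H2 = {u. \<exists>v w. has_weak_deriv u v \<and> has_weak_deriv v w}"

definition P_d :: "(real \<Rightarrow> real) \<Rightarrow> real \<Rightarrow> (int \<Rightarrow> complex) \<Rightarrow> int \<Rightarrow> complex" where
  "P_d V h v \<gamma> = 2 * v \<gamma> - v (\<gamma> + 1) - v (\<gamma> - 1) + complex_of_real (V (h * of_int \<gamma>)) * v \<gamma>"

definition P_c :: "(real \<Rightarrow> real) \<Rightarrow> real \<Rightarrow> (real \<Rightarrow> complex) \<Rightarrow> real \<Rightarrow> complex" where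
  "P_c V h u x = - weak_deriv (weak_deriv u) x + complex_of_real (V (h * x)) * u x"

definition Spec_d :: "(real \<Rightarrow> real) \<Rightarrow> real \<Rightarrow> complex set" where
  "Spec_d V h = Spec (count_space UNIV) (L2 (count_space UNIV)) (P_d V h)"

definition Spec_c :: "(real \<Rightarrow> real) \<Rightarrow> real \<Rightarrow> complex set" where
  "Spec_c V h = Spec lborel H2 (P_c V h)"

definition d :: "(real \<Rightarrow> real) \<Rightarrow> real \<Rightarrow> real" where
  "d V h = min_of (Spec_d V h) / min_of (Spec_c V h)"

end

theory Submission imports Defs begin

text \<open>Both operators are nonnegative and self-adjoint, so the minimum of the spectrum exists and is the
  infimum of the Rayleigh quotient. It is bounded from below by a positive supersolution
  \<open>P \<psi> \<ge> E \<psi>\<close> and from above by a compactly supported nonnegative subsolution \<open>P \<psi> \<le> E \<psi>\<close>.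
  In the variable \<open>y = h x - x0\<close> the logarithmic derivative (respectively the ratio of consecutive
  values \<open>1 - s\<close>) of \<open>\<psi>\<close> satisfies a Riccati equation,
  \<open>h s' - s\<^sup>2 + V = E\<close> in the continuous case and
  \<open>s (y + h) - s y - (s y)\<^sup>2 / (1 - s y) + V = E\<close> in the discrete case. A polynomial WKB ansatz
  \<open>s = sqrt a0 * y + \<dots>\<close> solves them up to \<open>O(y ^ 6 + h ^ 3)\<close> with
  \<open>E = sqrt a0 * h + e2 * h\<^sup>2\<close> and \<open>E = sqrt a0 * h + (e2 - a0 / 16) * h\<^sup>2\<close>. Bending \<open>s\<close> at
  distance of order one from the well, where \<open>V\<close> is large compared with \<open>E\<close>, gives global
  sub- and supersolutions with an error \<open>O(h ^ 3)\<close> in \<open>E\<close>; the supersolution is continued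
  periodically. The difference \<open>- a0 / 16 * h\<^sup>2\<close> divided by \<open>sqrt a0 * h\<close> is the claimed term.\<close>

subsection \<open>Square-integrable functions\<close>

text \<open>For periodic \<open>V\<close> no square-integrable ground state can be expected, and for
  irrational h the samples V (h \<gamma>) are not even periodic in \<gamma>. Pointwise comparison
  sees one well at a time and so treats both operators alike. The ratio is wanted up to O(h^2) and
  the energies are of size h, hence the error O(h^3). The ground state lives at |y| ~ sqrt h, where
  y^6 + h^3 is of that size; but y^6 is not small at |y| ~ 1, and this is the obstacle. Multiplying
  s by 1 - t or 1 + t with t ~ y^4 / \<delta>^4 gains t (V - E), which is at least of size y^6 and
  has the right sign; the new errors h y^4 lie between y^6 and h^3. Concavity of s - s^2, or
  convexity of s^2 / (1 - s), gives the bending itself a favourable sign. The Taylor coefficients of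
  \<open>V\<close> enter both h^2 terms alike. What differs is the first-order effect of 2 - 2 cos k
  = k^2 - k^4 / 12 + ...: in the Gaussian ground state of k^2 + a0 h^2 x^2 the mean of k^4 is 3 a0
  h^2 / 4, which gives the shift - a0 h^2 / 16.\<close>

definition ip :: "'a measure \<Rightarrow> ('a \<Rightarrow> complex) \<Rightarrow> ('a \<Rightarrow> complex) \<Rightarrow> complex" where
  "ip M f g = (LINT x|M. f x * cnj (g x))"

lemma L2D:
  assumes "f \<in> L2 M"
  shows "f \<in> borel_measurable M" "integrable M (\<lambda>x. (cmod (f x))\<^sup>2)"
  using assms by (auto simp: L2_def)

lemma L2_dominated:
  assumes "f \<in> borel_measurable M" "integrable M g" "AE x in M. (cmod (f x))\<^sup>2 \<le> g x"
  shows "f \<in> L2 M"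
proof -
  have "integrable M (\<lambda>x. (cmod (f x))\<^sup>2)"
    using assms by (intro Bochner_Integration.integrable_bound[OF assms(2)]) auto
  then show ?thesis using assms(1) by (simp add: L2_def)
qed

lemma L2_AE_cong:
  assumes "f \<in> L2 M" "g \<in> borel_measurable M" "AE x in M. g x = f x"
  shows "g \<in> L2 M"
  using assms by (intro L2_dominated[OF _ L2D(2)[OF assms(1)]]) auto

lemma norm_add_square_le: "(norm (x + y))\<^sup>2 \<le> 2 * (norm x)\<^sup>2 + 2 * (norm y)\<^sup>2"
  for x y :: "'a::real_normed_vector"
proof -
  have "(norm (x + y))\<^sup>2 \<le> (norm x + norm y)\<^sup>2"
    by (simp add: norm_triangle_ineq power_mono)
  also have "\<dots> \<le> 2 * (norm x)\<^sup>2 + 2 * (norm y)\<^sup>2"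
    using sum_squares_bound[of "norm x" "norm y"] by (simp add: power2_sum)
  finally show ?thesis .
qed

lemma L2_add:
  assumes "f \<in> L2 M" "g \<in> L2 M"
  shows "(\<lambda>x. f x + g x) \<in> L2 M"
proof -
  have "integrable M (\<lambda>x. 2 * (cmod (f x))\<^sup>2 + 2 * (cmod (g x))\<^sup>2)"
    using assms by (auto simp: L2_def)
  then show ?thesis
    using assms by (intro L2_dominated[where g = "\<lambda>x. 2 * (cmod (f x))\<^sup>2 + 2 * (cmod (g x))\<^sup>2"])
      (auto simp: norm_add_square_le L2_def)
qed

lemma L2_scale:
  assumes "f \<in> L2 M"
  shows "(\<lambda>x. c * f x) \<in> L2 M"
  using assms by (auto simp: L2_def norm_mult power_mult_distrib)

lemma L2_zero: "(\<lambda>x. 0) \<in> L2 M"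
  by (simp add: L2_def)

lemma L2_diff:
  assumes "f \<in> L2 M" "g \<in> L2 M"
  shows "(\<lambda>x. f x - g x) \<in> L2 M"
  using L2_add[OF assms(1) L2_scale[OF assms(2), of "-1"]] by simp

lemma L2_uminus: "f \<in> L2 M \<Longrightarrow> (\<lambda>x. - f x) \<in> L2 M"
  using L2_scale[of f M "-1"] by simp

lemma L2_sum:
  assumes "\<And>i. i \<in> I \<Longrightarrow> f i \<in> L2 M"
  shows "(\<lambda>x. \<Sum>i\<in>I. f i x) \<in> L2 M"
  using assms by (induction I rule: infinite_finite_induct) (auto intro: L2_add L2_zero)

lemma borel_measurable_cnj [measurable]: "cnj \<in> borel_measurable borel"
  by (intro borel_measurable_continuous_onI continuous_intros)

lemma L2_cnj: "f \<in> L2 M \<Longrightarrow> (\<lambda>x. cnj (f x)) \<in> L2 M"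
  by (auto simp: L2_def)

lemma L2_bounded_mult:
  assumes "f \<in> L2 M" "v \<in> borel_measurable M" "\<And>x. cmod (v x) \<le> B"
  shows "(\<lambda>x. v x * f x) \<in> L2 M"
proof (rule L2_dominated)
  show "integrable M (\<lambda>x. B\<^sup>2 * (cmod (f x))\<^sup>2)" using L2D(2)[OF assms(1)] by simp
  show "(\<lambda>x. v x * f x) \<in> borel_measurable M" using assms L2D(1) by measurable
  show "AE x in M. (cmod (v x * f x))\<^sup>2 \<le> B\<^sup>2 * (cmod (f x))\<^sup>2"
    using assms(3) by (auto simp: norm_mult power_mult_distrib intro!: mult_right_mono power_mono)
qed

lemma L2_mult_integrable:
  assumes "f \<in> L2 M" "g \<in> L2 M"
  shows "integrable M (\<lambda>x. f x * g x)"
proof (rule Bochner_Integration.integrable_bound)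
  show "integrable M (\<lambda>x. (cmod (f x))\<^sup>2 + (cmod (g x))\<^sup>2)" using assms by (auto simp: L2_def)
  show "(\<lambda>x. f x * g x) \<in> borel_measurable M" using assms by (auto simp: L2_def)
  have "norm (a * b) \<le> (cmod a)\<^sup>2 + (cmod b)\<^sup>2" for a b
    using sum_squares_bound[of "cmod a" "cmod b"] mult_nonneg_nonneg[of "cmod a" "cmod b", OF norm_ge_zero norm_ge_zero]
    unfolding norm_mult by linarith
  then show "AE x in M. norm (f x * g x) \<le> norm ((cmod (f x))\<^sup>2 + (cmod (g x))\<^sup>2)" by auto
qed

lemma ip_integrable: "f \<in> L2 M \<Longrightarrow> g \<in> L2 M \<Longrightarrow> integrable M (\<lambda>x. f x * cnj (g x))"
  using L2_mult_integrable[OF _ L2_cnj] .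

lemma ip_add_scale:
  assumes "f \<in> L2 M" "g \<in> L2 M" "k \<in> L2 M"
  shows "ip M (\<lambda>x. f x + c * g x) k = ip M f k + c * ip M g k"
  using ip_integrable[OF assms(1,3)] ip_integrable[OF assms(2,3)]
  by (simp add: ip_def distrib_right mult.assoc)

lemma ip_sym: "ip M f g = cnj (ip M g f)"
proof -
  have "cnj (ip M g f) = (LINT x|M. cnj (g x * cnj (f x)))"
    unfolding ip_def by (rule integral_bounded_linear'[OF bounded_linear_cnj bounded_linear_cnj, symmetric]) simp
  then show ?thesis by (simp add: ip_def mult.commute)
qed

lemma ip_add_scale_right:
  assumes "f \<in> L2 M" "g \<in> L2 M" "k \<in> L2 M"
  shows "ip M k (\<lambda>x. f x + c * g x) = ip M k f + cnj c * ip M k g"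
  using ip_add_scale[OF assms, of c] ip_sym[of M k]
  by (metis complex_cnj_add complex_cnj_mult)

lemma ip_cong_AE:
  assumes "AE x in M. f x = f' x" "AE x in M. g x = g' x"
    "f \<in> borel_measurable M" "g \<in> borel_measurable M" "f' \<in> borel_measurable M" "g' \<in> borel_measurable M"
  shows "ip M f g = ip M f' g'"
proof -
  note [measurable] = assms(3-6)
  show ?thesis unfolding ip_def using assms(1,2) by (intro integral_cong_AE) auto
qed

lemma L2_norm_cong_AE:
  assumes "AE x in M. f x = g x" "f \<in> borel_measurable M" "g \<in> borel_measurable M"
  shows "L2_norm M f = L2_norm M g"
  unfolding L2_norm_def using assms by (intro arg_cong[of _ _ sqrt] integral_cong_AE) auto

lemma ip_self: "ip M f f = complex_of_real ((L2_norm M f)\<^sup>2)"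
proof -
  have "ip M f f = (LINT x|M. complex_of_real ((cmod (f x))\<^sup>2))"
    unfolding ip_def complex_norm_square by simp
  then show ?thesis by (simp add: L2_norm_def del: of_real_power)
qed

lemma L2_norm_nonneg [simp]: "0 \<le> L2_norm M f"
  by (simp add: L2_norm_def)

lemma L2_norm_scale: "L2_norm M (\<lambda>x. c * f x) = cmod c * L2_norm M f"
  by (simp add: L2_norm_def norm_mult power_mult_distrib real_sqrt_mult)

lemma L2_norm_uminus: "L2_norm M (\<lambda>x. - f x) = L2_norm M f"
  by (simp add: L2_norm_def)

lemma L2_norm_eq_0:
  assumes "f \<in> L2 M" "L2_norm M f = 0"
  shows "AE x in M. f x = 0"
  using assms integral_nonneg_eq_0_iff_AE[OF L2D(2)[OF assms(1)]] by (simp add: L2_norm_def)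

lemma L2_norm_bounded_mult:
  assumes "f \<in> L2 M" "v \<in> borel_measurable M" "\<And>x. cmod (v x) \<le> B" "0 \<le> B"
  shows "L2_norm M (\<lambda>x. v x * f x) \<le> B * L2_norm M f"
proof -
  have "(LINT x|M. (cmod (v x * f x))\<^sup>2) \<le> (LINT x|M. B\<^sup>2 * (cmod (f x))\<^sup>2)"
    using L2D(2)[OF L2_bounded_mult[OF assms(1-3)]] L2D(2)[OF assms(1)] assms(3)
    by (intro integral_mono) (auto simp: norm_mult power_mult_distrib intro!: mult_right_mono power_mono)
  then have "L2_norm M (\<lambda>x. v x * f x) \<le> sqrt (B\<^sup>2 * (LINT x|M. (cmod (f x))\<^sup>2))"
    unfolding L2_norm_def by simp
  then show ?thesis using assms(4) by (simp add: real_sqrt_mult L2_norm_def)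
qed

text \<open>Applied to \<open>\<alpha> = Q u u\<close>, \<open>\<beta> = Q v u\<close>, \<open>\<gamma> = Q v v\<close> for a positive semidefinite
  Hermitian form \<open>Q\<close>, this is the Cauchy--Schwarz inequality for \<open>Q\<close>.\<close>

lemma discriminant_le:
  assumes "\<And>c::complex. 0 \<le> \<alpha> + 2 * Re (c * \<beta>) + (cmod c)\<^sup>2 * \<gamma>" "0 \<le> \<gamma>"
  shows "(cmod \<beta>)\<^sup>2 \<le> \<alpha> * \<gamma>"
proof (cases "\<gamma> = 0")
  case True
  have "\<beta> = 0"
  proof (rule ccontr)
    assume "\<beta> \<noteq> 0"
    then have "0 < (cmod \<beta>)\<^sup>2" by simp
    have "Re (- complex_of_real n * cnj \<beta> * \<beta>) = - n * (cmod \<beta>)\<^sup>2" for n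
      using complex_norm_square[of \<beta>] by (simp add: mult.assoc mult.commute[of "cnj \<beta>"] del: of_real_power flip: complex_norm_square)
    then have "0 \<le> \<alpha> - 2 * (n * (cmod \<beta>)\<^sup>2)" for n
      using assms(1)[of "- complex_of_real n * cnj \<beta>"] True by simp
    \<comment> \<open>This n turns the right-hand side into -1.\<close>
    from this[of "(\<alpha> + 1) / (2 * (cmod \<beta>)\<^sup>2)"] \<open>0 < (cmod \<beta>)\<^sup>2\<close> show False
      by (simp add: field_simps)
  qed
  then show ?thesis using True by simp
next
  case False
  \<comment> \<open>The minimiser of the quadratic function of c.\<close>
  define c where "c = - cnj \<beta> / complex_of_real \<gamma>"
  have "c * \<beta> = - complex_of_real ((cmod \<beta>)\<^sup>2 / \<gamma>)"
    unfolding c_def using complex_norm_square[of \<beta>] by (simp add: mult.commute)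
  then have "Re (c * \<beta>) = - ((cmod \<beta>)\<^sup>2 / \<gamma>)" by simp
  moreover have "(cmod c)\<^sup>2 = (cmod \<beta>)\<^sup>2 / \<gamma>\<^sup>2"
    unfolding c_def by (simp add: norm_divide power_divide)
  ultimately have "0 \<le> \<alpha> - 2 * ((cmod \<beta>)\<^sup>2 / \<gamma>) + (cmod \<beta>)\<^sup>2 / \<gamma>\<^sup>2 * \<gamma>"
    using assms(1)[of c] by simp
  then have "(cmod \<beta>)\<^sup>2 / \<gamma> \<le> \<alpha>" using False by (simp add: power2_eq_square)
  then show ?thesis using False assms(2) by (simp add: divide_le_eq)
qed

text \<open>This has the shape required by \<open>discriminant_le\<close>; nonnegativity of the
  square then yields Cauchy-Schwarz, and c = 1 the triangle inequality.\<close>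

lemma L2_norm_add_scale_square:
  assumes "f \<in> L2 M" "g \<in> L2 M"
  shows "(L2_norm M (\<lambda>x. f x + c * g x))\<^sup>2 =
    (L2_norm M f)\<^sup>2 + 2 * Re (c * ip M g f) + (cmod c)\<^sup>2 * (L2_norm M g)\<^sup>2"
proof -
  have "ip M (\<lambda>x. f x + c * g x) (\<lambda>x. f x + c * g x) =
      ip M f f + cnj c * ip M f g + c * (ip M g f + cnj c * ip M g g)"
    using assms L2_add[OF assms(1) L2_scale[OF assms(2), of c]]
    by (simp add: ip_add_scale ip_add_scale_right)
  also have "\<dots> = ip M f f + (c * ip M g f + cnj (c * ip M g f)) + c * cnj c * ip M g g"
    using ip_sym[of M f g] by (simp add: algebra_simps)
  finally have "Re (ip M (\<lambda>x. f x + c * g x) (\<lambda>x. f x + c * g x)) =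
      Re (ip M f f) + 2 * Re (c * ip M g f) + Re (c * cnj c * ip M g g)" by simp
  then show ?thesis by (simp add: ip_self complex_norm_square[symmetric] del: of_real_power flip: of_real_mult)
qed

lemma ip_cauchy_schwarz:
  assumes "f \<in> L2 M" "g \<in> L2 M"
  shows "cmod (ip M f g) \<le> L2_norm M f * L2_norm M g"
proof -
  have "0 \<le> (L2_norm M g)\<^sup>2 + 2 * Re (c * ip M f g) + (cmod c)\<^sup>2 * (L2_norm M f)\<^sup>2" for c
    using L2_norm_add_scale_square[OF assms(2,1), of c]
    by (metis zero_le_power2)
  then have "(cmod (ip M f g))\<^sup>2 \<le> (L2_norm M g)\<^sup>2 * (L2_norm M f)\<^sup>2"
    by (rule discriminant_le) simp
  then have "(cmod (ip M f g))\<^sup>2 \<le> (L2_norm M f * L2_norm M g)\<^sup>2"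
    by (simp add: power_mult_distrib mult.commute)
  then show ?thesis by (rule power2_le_imp_le) simp
qed

lemma L2_norm_triangle:
  assumes "f \<in> L2 M" "g \<in> L2 M"
  shows "L2_norm M (\<lambda>x. f x + g x) \<le> L2_norm M f + L2_norm M g"
proof (rule power2_le_imp_le)
  have "Re (ip M g f) \<le> L2_norm M f * L2_norm M g"
    using ip_cauchy_schwarz[OF assms(2,1)] complex_Re_le_cmod[of "ip M g f"] by (simp add: mult.commute)
  then show "(L2_norm M (\<lambda>x. f x + g x))\<^sup>2 \<le> (L2_norm M f + L2_norm M g)\<^sup>2"
    using L2_norm_add_scale_square[OF assms, of 1] by (simp add: power2_sum)
qed simp

text \<open>Riesz--Fischer for geometrically decaying series, by the weighted estimate
  \<open>\<bar>\<Sum> k n\<bar>\<^sup>2 \<le> (\<Sum> r ^ n) * (\<Sum> \<bar>k n\<bar>\<^sup>2 / r ^ n)\<close>.\<close>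

lemma L2_geometric_series:
  assumes k: "\<And>n. k n \<in> L2 M" and r: "0 < r" "r < 1"
    and bd: "\<And>n. L2_norm M (k n) \<le> A * r ^ n"
  obtains g where "g \<in> L2 M" "(\<lambda>N. L2_norm M (\<lambda>x. g x - (\<Sum>n<N. k n x))) \<longlonglongrightarrow> 0"
proof -
  \<comment> \<open>The squared norms decay like r^(2n); dividing by r^n spends half of this decay
    as a weight and leaves integrals that are still summable.\<close>
  define f where "f n x = (cmod (k n x))\<^sup>2 / r ^ n" for n x
  define H where "H x = (\<Sum>n. f n x)" for x
  define g where "g x = (\<Sum>n. k n x)" for x
  have [measurable]: "k n \<in> borel_measurable M" for n using L2D(1)[OF k] .
  have f0: "0 \<le> f n x" for n x using r by (simp add: f_def)
  have fint: "integrable M (f n)" for n unfolding f_def using L2D(2)[OF k[of n]] by simp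
  have If: "(LINT x|M. f n x) \<le> A\<^sup>2 * r ^ n" for n
  proof -
    have "(LINT x|M. f n x) = (L2_norm M (k n))\<^sup>2 / r ^ n"
      unfolding f_def L2_norm_def by simp
    also have "\<dots> \<le> (A * r ^ n)\<^sup>2 / r ^ n"
      using bd[of n] r by (intro divide_right_mono power_mono) auto
    also have "\<dots> = A\<^sup>2 * r ^ n" using r by (simp add: power2_eq_square)
    finally show ?thesis .
  qed
  have sumgeo: "summable (\<lambda>n. r ^ n)" using r by (intro summable_geometric) simp
  have sI: "summable (\<lambda>n. LINT x|M. f n x)"
    using If f0 by (intro summable_comparison_test'[OF summable_mult[OF sumgeo, of "A\<^sup>2"], of 0])
      (simp add: integral_nonneg_AE)
  have AEs: "AE x in M. summable (\<lambda>n. f n x)"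
  proof -
    have "(\<integral>\<^sup>+x. (\<Sum>n. ennreal (f n x)) \<partial>M) = (\<Sum>n. \<integral>\<^sup>+x. ennreal (f n x) \<partial>M)"
      by (rule nn_integral_suminf) (auto simp: f_def)
    also have "\<dots> = (\<Sum>n. ennreal (LINT x|M. f n x))"
      using fint f0 by (simp add: nn_integral_eq_integral)
    also have "\<dots> = ennreal (\<Sum>n. LINT x|M. f n x)"
      using sI f0 by (intro suminf_ennreal2) (auto simp: integral_nonneg_AE)
    finally have "(\<integral>\<^sup>+x. (\<Sum>n. ennreal (f n x)) \<partial>M) \<noteq> \<infinity>" by simp
    then have "AE x in M. (\<Sum>n. ennreal (f n x)) \<noteq> \<infinity>"
      by (intro nn_integral_PInf_AE) (auto simp: f_def)
    then show ?thesis
      by eventually_elim (auto intro!: summable_suminf_not_top simp: f0)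
  qed
  have Hint: "integrable M H"
    unfolding H_def using AEs fint sI f0 by (intro integrable_suminf) auto
  have part: "(\<Sum>n<N. cmod (k n x))\<^sup>2 \<le> 1 / (1 - r) * H x" if "summable (\<lambda>n. f n x)" for x N
  proof -
    have "(\<Sum>n<N. cmod (k n x))\<^sup>2 = (\<Sum>n<N. sqrt (r ^ n) * sqrt (f n x))\<^sup>2"
      using r by (simp add: f_def real_sqrt_divide flip: real_sqrt_mult)
    also have "\<dots> \<le> (\<Sum>n<N. (sqrt (r ^ n))\<^sup>2) * (\<Sum>n<N. (sqrt (f n x))\<^sup>2)"
      by (rule Cauchy_Schwarz_ineq_sum)
    also have "\<dots> = (\<Sum>n<N. r ^ n) * (\<Sum>n<N. f n x)"
      using r f0 by simp
    also have "\<dots> \<le> 1 / (1 - r) * H x"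
    proof (rule mult_mono)
      show "(\<Sum>n<N. r ^ n) \<le> 1 / (1 - r)"
        using sum_le_suminf[OF sumgeo, of "{..<N}"] r suminf_geometric[of r] by simp
      show "(\<Sum>n<N. f n x) \<le> H x"
        unfolding H_def using sum_le_suminf[OF that, of "{..<N}"] f0 by simp
    qed (use r f0 in \<open>auto intro: sum_nonneg\<close>)
    finally show ?thesis .
  qed
  have sumk: "summable (\<lambda>n. k n x)" if "summable (\<lambda>n. f n x)" for x
  proof (rule summable_comparison_test'[of "\<lambda>n. r ^ n + f n x" 0])
    show "summable (\<lambda>n. r ^ n + f n x)" using sumgeo that by (rule summable_add)
    show "norm (k n x) \<le> r ^ n + f n x" for n
    proof -
      have "cmod (k n x) = sqrt (r ^ n) * sqrt (f n x)"
        using r by (simp add: f_def real_sqrt_divide flip: real_sqrt_mult)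
      also have "\<dots> \<le> (sqrt (r ^ n))\<^sup>2 + (sqrt (f n x))\<^sup>2"
      proof -
        have "0 \<le> sqrt (r ^ n) * sqrt (f n x)" using r f0 by simp
        then show ?thesis
          using sum_squares_bound[of "sqrt (r ^ n)" "sqrt (f n x)"] unfolding mult.assoc by linarith
      qed
      finally show ?thesis using r f0 by simp
    qed
  qed
  have lim: "(\<lambda>N. \<Sum>n<N. k n x) \<longlonglongrightarrow> g x" if "summable (\<lambda>n. f n x)" for x
    unfolding g_def using summable_LIMSEQ[OF sumk[OF that]] .
  have pk: "(cmod (\<Sum>n<N. k n x))\<^sup>2 \<le> 1 / (1 - r) * H x" if "summable (\<lambda>n. f n x)" for x N
    by (rule order_trans[OF power_mono[OF norm_sum] part[OF that]]) simp
  have gk: "(cmod (g x))\<^sup>2 \<le> 1 / (1 - r) * H x" if "summable (\<lambda>n. f n x)" for x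
  proof (rule LIMSEQ_le_const2)
    show "(\<lambda>N. (cmod (\<Sum>n<N. k n x))\<^sup>2) \<longlonglongrightarrow> (cmod (g x))\<^sup>2"
      by (intro tendsto_intros lim that)
  qed (use pk[OF that] in auto)
  have gm [measurable]: "g \<in> borel_measurable M" unfolding g_def by measurable
  have gL: "g \<in> L2 M"
    using AEs gk by (intro L2_dominated[OF gm, of "\<lambda>x. 1 / (1 - r) * H x"]) (auto simp: Hint)
  have "(\<lambda>N. LINT x|M. (cmod (g x - (\<Sum>n<N. k n x)))\<^sup>2) \<longlonglongrightarrow> (LINT x|M. 0)"
  proof (rule integral_dominated_convergence)
    \<comment> \<open>The factor 4 comes from |a - b|^2 <= 2 |a|^2 + 2 |b|^2, where the squares of
      the limit and of the partial sums are both at most H / (1 - r).\<close>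
    show "integrable M (\<lambda>x. 4 / (1 - r) * H x)" using Hint by simp
    show "AE x in M. (\<lambda>N. (cmod (g x - (\<Sum>n<N. k n x)))\<^sup>2) \<longlonglongrightarrow> 0"
      using AEs
    proof eventually_elim
      case (elim x)
      show ?case using tendsto_power[OF tendsto_norm[OF tendsto_diff[OF tendsto_const lim[OF elim]]], of "g x" 2] by simp
    qed
    show "AE x in M. norm ((cmod (g x - (\<Sum>n<N. k n x)))\<^sup>2) \<le> 4 / (1 - r) * H x" for N
      using AEs
    proof eventually_elim
      case (elim x)
      show ?case
        using norm_add_square_le[of "g x" "- (\<Sum>n<N. k n x)"] gk[OF elim] pk[OF elim, of N] by simp
    qed
  qed auto
  then have "(\<lambda>N. L2_norm M (\<lambda>x. g x - (\<Sum>n<N. k n x))) \<longlonglongrightarrow> sqrt 0"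
    unfolding L2_norm_def by (intro tendsto_real_sqrt) simp
  with gL that show ?thesis by simp
qed

subsection \<open>Spectra of semibounded symmetric operators\<close>

text \<open>The surjectivity half of membership in \<open>resolvent_set\<close>. The bounded inverse
  is the easier half for symmetric operators, see \<open>lower_bound\<close>, so surjectivity is
  tracked separately.\<close>

definition onto :: "'a measure \<Rightarrow> ('a \<Rightarrow> complex) set \<Rightarrow> (('a \<Rightarrow> complex) \<Rightarrow> 'a \<Rightarrow> complex) \<Rightarrow> bool" where
  "onto M D T \<longleftrightarrow> (\<forall>f\<in>L2 M. \<exists>u\<in>D. AE x in M. T u x = f x)"

text \<open>Linearity of T is demanded only almost everywhere: \<open>P_c\<close> contains a chosen
  weak derivative and is linear only up to null sets.\<close>

locale l2_operator =
  fixes M :: "'a measure" and D :: "('a \<Rightarrow> complex) set"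
    and T :: "('a \<Rightarrow> complex) \<Rightarrow> 'a \<Rightarrow> complex"
  assumes D_L2: "u \<in> D \<Longrightarrow> u \<in> L2 M"
    and T_L2: "u \<in> D \<Longrightarrow> T u \<in> L2 M"
    and D_add_scale: "u \<in> D \<Longrightarrow> v \<in> D \<Longrightarrow> (\<lambda>x. u x + c * v x) \<in> D"
    and D_zero: "(\<lambda>x. 0) \<in> D"
    and T_add_scale: "u \<in> D \<Longrightarrow> v \<in> D \<Longrightarrow> AE x in M. T (\<lambda>x. u x + c * v x) x = T u x + c * T v x"
begin

lemma D_sum:
  assumes "finite I" "\<And>i. i \<in> I \<Longrightarrow> w i \<in> D"
  shows "(\<lambda>x. \<Sum>i\<in>I. w i x) \<in> D \<and> (AE x in M. T (\<lambda>x. \<Sum>i\<in>I. w i x) x = (\<Sum>i\<in>I. T (w i) x))"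
  using assms
proof (induction I rule: finite_induct)
  case empty
  show ?case using D_zero T_add_scale[OF D_zero D_zero, of 1] by simp
next
  case (insert i I)
  then have *: "w i \<in> D" "(\<lambda>x. \<Sum>i\<in>I. w i x) \<in> D"
    "AE x in M. T (\<lambda>x. \<Sum>i\<in>I. w i x) x = (\<Sum>i\<in>I. T (w i) x)" by auto
  show ?case
    using D_add_scale[OF *(1,2), of 1] T_add_scale[OF *(1,2), of 1] *(3) insert(1,2)
    by (auto elim!: eventually_elim2)
qed

text \<open>Neumann series. With R a right inverse of T, the solution is R g for g = sum of (- B
  R)^n f, which converges geometrically because B R has norm at most b / c < 1. The limit is taken
  in the data: g is an L2 limit and R is applied to it once, after which the lower bound on T
  controls the distance of R g from the partial solutions.\<close>

lemma onto_perturb: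
  assumes onto: "onto M D T"
    and lb: "\<And>u. u \<in> D \<Longrightarrow> c * L2_norm M u \<le> L2_norm M (T u)"
    and B: "\<And>u. u \<in> D \<Longrightarrow> B u \<in> L2 M" "\<And>u. u \<in> D \<Longrightarrow> L2_norm M (B u) \<le> b * L2_norm M u"
      "\<And>u v t x. B (\<lambda>x. u x + t * v x) x = B u x + t * B v x"
    and bc: "0 < b" "b < c"
  shows "onto M D (\<lambda>u x. T u x + B u x)"
  unfolding onto_def
proof
  fix f assume f: "f \<in> L2 M"
  \<comment> \<open>An arbitrary choice of preimages. Linear combinations are therefore formed from
    the elements R (k n) of D and only T and B are distributed over them.\<close>
  define R where "R f = (SOME u. u \<in> D \<and> (AE x in M. T u x = f x))" for f
  have R: "R f \<in> D" "AE x in M. T (R f) x = f x" if "f \<in> L2 M" for f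
  proof -
    from onto that obtain u where "u \<in> D" "AE x in M. T u x = f x" unfolding onto_def by blast
    then have "\<exists>u. u \<in> D \<and> (AE x in M. T u x = f x)" by blast
    then have "R f \<in> D \<and> (AE x in M. T (R f) x = f x)"
      unfolding R_def by (rule someI_ex)
    then show "R f \<in> D" "AE x in M. T (R f) x = f x" by auto
  qed
  have c: "0 < c" using bc by simp
  \<comment> \<open>The n-th Neumann term, (- B R)^n f.\<close>
  define k where "k = rec_nat f (\<lambda>_ g x. - B (R g) x)"
  have k0: "k 0 = f" and kS: "k (Suc n) = (\<lambda>x. - B (R (k n)) x)" for n by (simp_all add: k_def)
  have kL: "k n \<in> L2 M" for n
    by (induction n) (simp_all add: k0 kS f B(1) R(1) L2_uminus)
  have Rn: "c * L2_norm M (R g) \<le> L2_norm M g" if "g \<in> L2 M" for g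
    using lb[OF R(1)[OF that]] L2_norm_cong_AE[OF R(2)[OF that]] L2D(1)[OF T_L2[OF R(1)[OF that]]] L2D(1)[OF that]
    by simp
  define r where "r = b / c"
  have r: "0 < r" "r < 1" using bc by (auto simp: r_def)
  have kn: "L2_norm M (k n) \<le> L2_norm M f * r ^ n" for n
  proof (induction n)
    case (Suc n)
    have "L2_norm M (k (Suc n)) \<le> b * L2_norm M (R (k n))"
      unfolding kS L2_norm_uminus using B(2)[OF R(1)[OF kL]] .
    also have "\<dots> \<le> b * (L2_norm M (k n) / c)"
      using Rn[OF kL[of n]] bc c by (intro mult_left_mono) (auto simp: field_simps)
    also have "\<dots> = r * L2_norm M (k n)" by (simp add: r_def)
    also have "\<dots> \<le> r * (L2_norm M f * r ^ n)" using Suc r by (intro mult_left_mono) auto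
    finally show ?case by (simp add: mult_ac)
  qed (simp add: k0)
  obtain g where g: "g \<in> L2 M" and lim: "(\<lambda>N. L2_norm M (\<lambda>x. g x - (\<Sum>n<N. k n x))) \<longlonglongrightarrow> 0"
    by (rule L2_geometric_series[OF kL r kn])
  define S where "S N x = (\<Sum>n<N. k n x)" for N x
  define U where "U N x = (\<Sum>n<N. R (k n) x)" for N x
  have SL: "S N \<in> L2 M" for N unfolding S_def by (intro L2_sum kL)
  have UD: "U N \<in> D" and TU: "AE x in M. T (U N) x = S N x" for N
  proof -
    have 1: "U N \<in> D \<and> (AE x in M. T (U N) x = (\<Sum>n<N. T (R (k n)) x))"
      unfolding U_def[abs_def] by (intro D_sum) (auto simp: R kL)
    have 2: "AE x in M. \<forall>n\<in>{..<N}. T (R (k n)) x = k n x"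
      by (intro AE_finite_allI) (auto simp: R kL)
    from 1 show "U N \<in> D" by simp
    from 1 have "AE x in M. T (U N) x = (\<Sum>n<N. T (R (k n)) x)" by simp
    with 2 show "AE x in M. T (U N) x = S N x"
      by eventually_elim (simp add: S_def)
  qed
  \<comment> \<open>Telescoping: B (R (k n)) = - k (n + 1), so B applied to the partial solution
    gives back all terms from k 1 on, with a minus sign.\<close>
  have BU: "B (U N) x = f x - S (Suc N) x" for N x
  proof (induction N)
    case 0
    show ?case using B(3)[of "\<lambda>x. 0" 1 "\<lambda>x. 0" x] by (simp add: U_def S_def k0)
  next
    case (Suc N)
    have "U (Suc N) = (\<lambda>x. U N x + 1 * R (k N) x)" by (simp add: U_def fun_eq_iff)
    then have "B (U (Suc N)) x = B (U N) x + B (R (k N)) x" using B(3)[of "U N" 1 "R (k N)" x] by simp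
    then show ?case using Suc by (simp add: S_def kS)
  qed
  \<comment> \<open>The defect of the candidate R g. Its norm is bounded by tails of the series for
    every N, hence vanishes.\<close>
  define e where "e x = T (R g) x + B (R g) x - f x" for x
  have eL: "e \<in> L2 M" unfolding e_def[abs_def] by (intro L2_diff L2_add T_L2 B(1) R f g)
  have "L2_norm M e \<le> L2_norm M (\<lambda>x. g x - S (Suc N) x) + b / c * L2_norm M (\<lambda>x. g x - S N x)" for N
  proof -
    define d where "d x = R g x + (-1) * U N x" for x
    have dD: "d \<in> D" unfolding d_def[abs_def] by (intro D_add_scale R g UD)
    have Td: "AE x in M. T d x = g x - S N x"
      using T_add_scale[OF R(1)[OF g] UD[of N], of "-1"] R(2)[OF g] TU[of N] unfolding d_def[abs_def]
      by eventually_elim simp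
    have "c * L2_norm M d \<le> L2_norm M (\<lambda>x. g x - S N x)"
      using lb[OF dD] L2_norm_cong_AE[OF Td L2D(1)[OF T_L2[OF dD]] L2D(1)[OF L2_diff[OF g SL]]] by simp
    then have "L2_norm M d \<le> L2_norm M (\<lambda>x. g x - S N x) / c" using c by (simp add: field_simps)
    then have Bd: "L2_norm M (B d) \<le> b / c * L2_norm M (\<lambda>x. g x - S N x)"
      using order_trans[OF B(2)[OF dD] mult_left_mono] bc by fastforce
    have Bdx: "B d x = B (R g) x - (f x - S (Suc N) x)" for x
      unfolding d_def[abs_def] B(3) BU by simp
    have "AE x in M. e x = (g x - S (Suc N) x) + B d x"
      using R(2)[OF g] by eventually_elim (simp add: e_def Bdx)
    then have "L2_norm M e = L2_norm M (\<lambda>x. (g x - S (Suc N) x) + B d x)"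
      by (rule L2_norm_cong_AE) (intro L2D(1) eL L2_add L2_diff g SL B(1) dD)+
    also have "\<dots> \<le> L2_norm M (\<lambda>x. g x - S (Suc N) x) + L2_norm M (B d)"
      by (intro L2_norm_triangle L2_diff g SL B(1) dD)
    finally show ?thesis using Bd by simp
  qed
  moreover have "(\<lambda>N. L2_norm M (\<lambda>x. g x - S (Suc N) x) + b / c * L2_norm M (\<lambda>x. g x - S N x)) \<longlonglongrightarrow> 0 + b / c * 0"
    using lim unfolding S_def by (intro tendsto_intros LIMSEQ_Suc)
  ultimately have "L2_norm M e \<le> 0" by (intro LIMSEQ_le_const) auto
  then have "AE x in M. e x = 0" by (intro L2_norm_eq_0 eL) (simp add: antisym)
  then show "\<exists>u\<in>D. AE x in M. T u x + B u x = f x"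
    using R(1)[OF g] by (intro bexI[of _ "R g"]) (auto simp: e_def)
qed

lemma shift: "l2_operator M D (\<lambda>u x. T u x - z * u x)"
proof
  fix u v c assume uv: "u \<in> D" "v \<in> D"
  show "AE x in M. T (\<lambda>x. u x + c * v x) x - z * (u x + c * v x) = T u x - z * u x + c * (T v x - z * v x)"
    using T_add_scale[OF uv, of c] by eventually_elim (simp add: algebra_simps)
  show "(\<lambda>x. T u x - z * u x) \<in> L2 M" by (intro L2_diff L2_scale T_L2 D_L2 uv)
qed (auto intro: D_L2 D_add_scale D_zero)

end

text \<open>A stand-in for selfadjointness that mentions no adjoint: a symmetric nonnegative
  operator with T + \<mu> onto for some \<mu> > 0 is selfadjoint. All large \<mu> are demanded
  because \<open>onto_left\<close> moves the centre of its disc to minus infinity.\<close>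

locale nonneg_operator = l2_operator +
  assumes symmetric: "u \<in> D \<Longrightarrow> v \<in> D \<Longrightarrow> ip M (T u) v = ip M u (T v)"
    and nonneg: "u \<in> D \<Longrightarrow> 0 \<le> Re (ip M (T u) u)"
    and nontrivial: "\<exists>u\<in>D. L2_norm M u \<noteq> 0"
    and onto_neg: "\<exists>\<mu>0. \<forall>\<mu>\<ge>\<mu>0. onto M D (\<lambda>u x. T u x - complex_of_real (- \<mu>) * u x)"
begin

definition bottom :: real where
  "bottom = Inf ((\<lambda>u. Re (ip M (T u) u) / (L2_norm M u)\<^sup>2) ` {u \<in> D. L2_norm M u \<noteq> 0})"

lemma bottom_le:
  assumes "u \<in> D"
  shows "bottom * (L2_norm M u)\<^sup>2 \<le> Re (ip M (T u) u)"
proof (cases "L2_norm M u = 0")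
  case True
  then show ?thesis using nonneg[OF assms] by simp
next
  case False
  have "bottom \<le> Re (ip M (T u) u) / (L2_norm M u)\<^sup>2"
    unfolding bottom_def using False assms nonneg
    by (intro cInf_lower bdd_belowI2[of _ 0]) auto
  then show ?thesis using False by (simp add: field_simps)
qed

lemma bottom_greatest:
  assumes "\<And>u. u \<in> D \<Longrightarrow> E * (L2_norm M u)\<^sup>2 \<le> Re (ip M (T u) u)"
  shows "E \<le> bottom"
  unfolding bottom_def
proof (rule cInf_greatest)
  show "(\<lambda>u. Re (ip M (T u) u) / (L2_norm M u)\<^sup>2) ` {u \<in> D. L2_norm M u \<noteq> 0} \<noteq> {}"
    using nontrivial by auto
qed (use assms in \<open>auto simp: field_simps\<close>)

section \<open>Numerical range and resolvent set\<close>

lemma ip_T_real: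
  assumes "u \<in> D"
  shows "Im (ip M (T u) u) = 0"
  using symmetric[OF assms assms] ip_sym[of M u "T u"] by (simp add: complex_eq_iff)

lemma ip_shift:
  assumes "u \<in> D"
  shows "ip M (\<lambda>x. T u x - z * u x) u = ip M (T u) u - z * complex_of_real ((L2_norm M u)\<^sup>2)"
  using ip_add_scale[OF T_L2[OF assms] D_L2[OF assms] D_L2[OF assms], of "-z"] by (simp add: ip_self)

text \<open>The numerical range of T lies in the half line from \<open>bottom\<close>, so |((T - z)
  u, u)| is at least k times the squared norm of u; Cauchy-Schwarz then divides out one factor. The
  real part serves left of \<open>bottom\<close>, the imaginary part off the axis.\<close>

lemma lower_bound:
  assumes u: "u \<in> D" and k: "k \<le> bottom - Re z \<or> k \<le> \<bar>Im z\<bar>"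
  shows "k * L2_norm M u \<le> L2_norm M (\<lambda>x. T u x - z * u x)"
proof (cases "L2_norm M u = 0")
  case False
  let ?w = "\<lambda>x. T u x - z * u x"
  have wL: "?w \<in> L2 M" by (intro L2_diff L2_scale T_L2 D_L2 u)
  have "k * (L2_norm M u)\<^sup>2 \<le> cmod (ip M ?w u)"
  proof (cases "k \<le> bottom - Re z")
    case True
    then have "k * (L2_norm M u)\<^sup>2 \<le> (bottom - Re z) * (L2_norm M u)\<^sup>2"
      by (intro mult_right_mono) auto
    also have "\<dots> \<le> Re (ip M ?w u)"
      unfolding ip_shift[OF u] using bottom_le[OF u] by (simp add: left_diff_distrib del: of_real_power)
    finally show ?thesis using complex_Re_le_cmod[of "ip M ?w u"] by linarith
  next
    case False
    then have "k * (L2_norm M u)\<^sup>2 \<le> \<bar>Im z\<bar> * (L2_norm M u)\<^sup>2"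
      using k by (intro mult_right_mono) auto
    also have "\<dots> = \<bar>Im (ip M ?w u)\<bar>"
      unfolding ip_shift[OF u] using ip_T_real[OF u] by (simp add: abs_mult del: of_real_power)
    finally show ?thesis using abs_Im_le_cmod[of "ip M ?w u"] by linarith
  qed
  also have "\<dots> \<le> L2_norm M ?w * L2_norm M u" using ip_cauchy_schwarz[OF wL D_L2[OF u]] .
  finally have "(k * L2_norm M u) * L2_norm M u \<le> L2_norm M ?w * L2_norm M u"
    by (simp add: power2_eq_square mult.assoc)
  then show ?thesis using False by (simp add: mult_le_cancel_right order.strict_iff_order)
qed simp

text \<open>The lower bound k at z is the radius of a disc to which the Neumann series carries
  surjectivity, by perturbing T - z with the multiple z - w of the identity.\<close>

lemma onto_move:
  assumes "onto M D (\<lambda>u x. T u x - z * u x)" "cmod (w - z) < k" "k \<le> bottom - Re z \<or> k \<le> \<bar>Im z\<bar>"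
  shows "onto M D (\<lambda>u x. T u x - w * u x)"
proof (cases "w = z")
  case False
  interpret S: l2_operator M D "\<lambda>u x. T u x - z * u x" by (rule shift)
  have "onto M D (\<lambda>u x. T u x - z * u x + (z - w) * u x)"
  proof (rule S.onto_perturb[where c = k and b = "cmod (w - z)"])
    show "0 < cmod (w - z)" using False by simp
    show "k * L2_norm M u \<le> L2_norm M (\<lambda>x. T u x - z * u x)" if "u \<in> D" for u
      using lower_bound[OF that assms(3)] .
    show "L2_norm M (\<lambda>x. (z - w) * u x) \<le> cmod (w - z) * L2_norm M u" for u
      by (simp add: L2_norm_scale norm_minus_commute)
    show "(\<lambda>x. (z - w) * u x) \<in> L2 M" if "u \<in> D" for u by (intro L2_scale D_L2 that)
  qed (use assms in \<open>auto simp: distrib_left mult_ac\<close>)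
  then show ?thesis by (simp add: algebra_simps)
qed (use assms in simp)

text \<open>The disc around - \<mu> of radius \<mu> + \<open>bottom\<close> touches the line Re z =
  \<open>bottom\<close>, and such discs exhaust the half plane to its left as \<mu> grows. One
  application of \<open>onto_move\<close> therefore suffices.\<close>

lemma onto_left:
  assumes "Re z < bottom"
  shows "onto M D (\<lambda>u x. T u x - z * u x)"
proof -
  obtain \<mu>0 where \<mu>0: "\<And>\<mu>. \<mu> \<ge> \<mu>0 \<Longrightarrow> onto M D (\<lambda>u x. T u x - complex_of_real (- \<mu>) * u x)"
    using onto_neg by auto
  \<comment> \<open>In |z + \<mu>|^2 < (\<mu> + bottom)^2 the squares of \<mu> cancel, leaving a
    linear condition on \<mu>; K is where it starts to hold.\<close>
  define K where "K = (\<bar>(Re z)\<^sup>2 + (Im z)\<^sup>2 - bottom\<^sup>2\<bar> + 1) / (2 * (bottom - Re z))"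
  define \<mu> where "\<mu> = max \<mu>0 (max (\<bar>bottom\<bar> + 1) K)"
  have mu: "\<mu>0 \<le> \<mu>" "\<bar>bottom\<bar> + 1 \<le> \<mu>" "K \<le> \<mu>" by (auto simp: \<mu>_def)
  have "\<bar>(Re z)\<^sup>2 + (Im z)\<^sup>2 - bottom\<^sup>2\<bar> + 1 \<le> \<mu> * (2 * (bottom - Re z))"
    using mu(3) assms unfolding K_def by (subst (asm) pos_divide_le_eq) auto
  then have "(Re z + \<mu>)\<^sup>2 + (Im z)\<^sup>2 < (\<mu> + bottom)\<^sup>2"
    by (simp add: power2_eq_square algebra_simps)
  then have "cmod (z - complex_of_real (- \<mu>)) < \<mu> + bottom"
    unfolding cmod_def using mu(2) by (intro real_less_lsqrt) auto
  then show ?thesis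
    by (intro onto_move[OF \<mu>0[OF mu(1)]]) auto
qed

text \<open>From a centre x + i s to the left of \<open>bottom\<close>, covered by
  \<open>onto_left\<close>, the distance |s| to the real axis is an admissible radius. With s of the
  sign of Im z, these discs exhaust the half plane containing z.\<close>

lemma onto_nonreal:
  assumes "Im z \<noteq> 0"
  shows "onto M D (\<lambda>u x. T u x - z * u x)"
proof -
  define x where "x = bottom - 1"
  \<comment> \<open>Chosen so that |z - (x + i s)|^2 = s^2 - 1.\<close>
  define s where "s = ((Re z - x)\<^sup>2 + (Im z)\<^sup>2 + 1) / (2 * Im z)"
  have "(Re z - x)\<^sup>2 + (Im z)\<^sup>2 + 1 = 2 * Im z * s" using assms by (simp add: s_def)
  then have "(Re z - x)\<^sup>2 + (Im z - s)\<^sup>2 < s\<^sup>2"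
    by (simp add: power2_eq_square algebra_simps)
  then have "sqrt ((Re z - x)\<^sup>2 + (Im z - s)\<^sup>2) < sqrt (s\<^sup>2)"
    by (rule real_sqrt_less_mono)
  then have "cmod (z - Complex x s) < \<bar>s\<bar>" by (simp add: cmod_def)
  then show ?thesis
    by (intro onto_move[OF onto_left[of "Complex x s"]]) (auto simp: x_def)
qed

text \<open>The infimum need not be attained, so there is no eigenvector to exhibit. Instead, a
  bounded inverse of S = T - \<open>bottom\<close> would force the form of S to be at least 1 / C,
  which raises the infimum, a contradiction.\<close>

lemma bottom_in_Spec: "complex_of_real bottom \<in> Spec M D T"
proof (rule ccontr)
  assume "complex_of_real bottom \<notin> Spec M D T"
  then have res: "complex_of_real bottom \<in> resolvent_set M D T" by (simp add: Spec_def)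
  define S where "S u x = T u x - complex_of_real bottom * u x" for u x
  from res obtain C0 where C0: "\<And>u. u \<in> D \<Longrightarrow> L2_norm M u \<le> C0 * L2_norm M (S u)"
    unfolding resolvent_set_def S_def by auto
  define C where "C = max C0 1"
  have C: "0 < C" "\<And>u. u \<in> D \<Longrightarrow> L2_norm M u \<le> C * L2_norm M (S u)"
  proof -
    fix u assume "u \<in> D"
    have "C0 * L2_norm M (S u) \<le> C * L2_norm M (S u)" by (intro mult_right_mono) (auto simp: C_def)
    with C0[OF \<open>u \<in> D\<close>] show "L2_norm M u \<le> C * L2_norm M (S u)" by simp
  qed (simp add: C_def)
  have SL: "S u \<in> L2 M" if "u \<in> D" for u
    unfolding S_def[abs_def] by (intro L2_diff L2_scale T_L2 D_L2 that)
  have Snn: "0 \<le> Re (ip M (S u) u)" if "u \<in> D" for u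
    unfolding S_def[abs_def] ip_shift[OF that] using bottom_le[OF that] by (simp del: of_real_power)
  have Ssym: "ip M (S u) v = ip M u (S v)" if "u \<in> D" "v \<in> D" for u v
  proof -
    note L = T_L2[OF that(1)] D_L2[OF that(1)] T_L2[OF that(2)] D_L2[OF that(2)]
    show ?thesis
      using ip_add_scale[OF L(1,2,4), of "- complex_of_real bottom"]
        ip_add_scale_right[OF L(3,4,2), of "- complex_of_real bottom"] symmetric[OF that]
      unfolding S_def[abs_def] by simp
  qed
  \<comment> \<open>Cauchy-Schwarz for the semidefinite form (S u, w).\<close>
  have CS: "(cmod (ip M (S w) u))\<^sup>2 \<le> Re (ip M (S u) u) * Re (ip M (S w) w)" if "u \<in> D" "w \<in> D" for u w
  proof (rule discriminant_le)
    fix c :: complex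
    define q where "q x = u x + c * w x" for x
    have qD: "q \<in> D" unfolding q_def[abs_def] by (intro D_add_scale that)
    have AS: "AE x in M. S q x = S u x + c * S w x"
      using T_add_scale[OF that, of c] unfolding S_def q_def by eventually_elim (simp add: algebra_simps)
    note L = SL[OF that(1)] SL[OF that(2)] D_L2[OF that(1)] D_L2[OF that(2)] D_L2[OF qD]
    have "ip M (S q) q = ip M (\<lambda>x. S u x + c * S w x) q"
      by (rule ip_cong_AE[OF AS]) (use L SL[OF qD] in \<open>auto intro!: L2D(1) L2_add L2_scale\<close>)
    also have "\<dots> = ip M (S u) q + c * ip M (S w) q" using L by (intro ip_add_scale)
    also have "ip M (S u) q = ip M (S u) u + cnj c * ip M (S u) w"
      unfolding q_def[abs_def] using L by (intro ip_add_scale_right)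
    also have "ip M (S w) q = ip M (S w) u + cnj c * ip M (S w) w"
      unfolding q_def[abs_def] using L by (intro ip_add_scale_right)
    also have "ip M (S u) w = cnj (ip M (S w) u)"
      using Ssym[OF that] ip_sym[of M u "S w"] by simp
    finally have "Re (ip M (S q) q) = Re (ip M (S u) u) + 2 * Re (c * ip M (S w) u) + Re (c * cnj c * ip M (S w) w)"
      by (simp add: algebra_simps)
    then show "0 \<le> Re (ip M (S u) u) + 2 * Re (c * ip M (S w) u) + (cmod c)\<^sup>2 * Re (ip M (S w) w)"
      using Snn[OF qD] by (simp add: complex_norm_square[symmetric] del: of_real_power)
  qed (rule Snn[OF that(2)])
  have "(1 / C) * (L2_norm M u)\<^sup>2 \<le> Re (ip M (S u) u)" if u: "u \<in> D" for u
  proof (cases "L2_norm M u = 0")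
    case True
    then show ?thesis using Snn[OF u] by simp
  next
    case False
    \<comment> \<open>With S w = u the form inequality reads |u|^4 <= (S u, u) (S w, w), and (S w,
      w) <= |u| |w| <= C |u|^2.\<close>
    obtain w where w: "w \<in> D" "AE x in M. S w x = u x"
      using res D_L2[OF u] unfolding resolvent_set_def S_def by blast
    let ?n = "L2_norm M u"
    have "ip M (S w) u = ip M u u"
      by (rule ip_cong_AE[OF w(2) AE_I2]) (auto intro!: L2D(1) SL w(1) u D_L2[OF u])
    then have 1: "(cmod (ip M (S w) u))\<^sup>2 = ?n ^ 4" by (simp add: ip_self norm_power flip: power_mult)
    have Sw: "L2_norm M (S w) = ?n" by (rule L2_norm_cong_AE[OF w(2)]) (intro L2D(1) SL w D_L2[OF u])+
    have "Re (ip M (S w) w) \<le> cmod (ip M (S w) w)" by (rule complex_Re_le_cmod)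
    also have "\<dots> \<le> L2_norm M (S w) * L2_norm M w" by (rule ip_cauchy_schwarz[OF SL[OF w(1)] D_L2[OF w(1)]])
    also have "\<dots> \<le> ?n * (C * ?n)" unfolding Sw using C(2)[OF w(1)] Sw by (intro mult_left_mono) auto
    finally have "Re (ip M (S w) w) \<le> C * ?n\<^sup>2" by (simp add: power2_eq_square mult_ac)
    with CS[OF u w(1)] 1 have "?n ^ 4 \<le> Re (ip M (S u) u) * (C * ?n\<^sup>2)"
      using mult_left_mono[OF \<open>Re (ip M (S w) w) \<le> C * ?n\<^sup>2\<close> Snn[OF u]] by linarith
    moreover have "?n ^ 4 = ?n\<^sup>2 * ?n\<^sup>2" by (simp add: power4_eq_xxxx power2_eq_square mult_ac)
    ultimately have "?n\<^sup>2 * ?n\<^sup>2 \<le> (Re (ip M (S u) u) * C) * ?n\<^sup>2" by (simp only: mult.assoc)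
    then have "?n\<^sup>2 \<le> Re (ip M (S u) u) * C" by (rule mult_right_le_imp_le) (use False in simp)
    then show ?thesis using C(1) by (simp add: field_simps)
  qed
  then have "(bottom + 1 / C) * (L2_norm M u)\<^sup>2 \<le> Re (ip M (T u) u)" if u: "u \<in> D" for u
  proof -
    have "Re (ip M (S u) u) = Re (ip M (T u) u) - bottom * (L2_norm M u)\<^sup>2"
      unfolding S_def[abs_def] ip_shift[OF u] by (simp del: of_real_power)
    then show ?thesis using \<open>\<And>u. u \<in> D \<Longrightarrow> 1 / C * (L2_norm M u)\<^sup>2 \<le> Re (ip M (S u) u)\<close>[OF u]
      by (simp add: distrib_right)
  qed
  then have "bottom + 1 / C \<le> bottom" by (rule bottom_greatest)
  then show False using C(1) by simp
qed

lemma is_min_of_Spec: "is_min_of (Spec M D T) bottom"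
  unfolding is_min_of_def
proof (intro conjI ballI bottom_in_Spec)
  fix z assume z: "z \<in> Spec M D T"
  have *: False if "onto M D (\<lambda>u x. T u x - z * u x)" "k \<le> bottom - Re z \<or> k \<le> \<bar>Im z\<bar>" "0 < k" for k
  proof -
    have "L2_norm M u \<le> (1 / k) * L2_norm M (\<lambda>x. T u x - z * u x)" if "u \<in> D" for u
      using lower_bound[OF that \<open>k \<le> bottom - Re z \<or> k \<le> \<bar>Im z\<bar>\<close>] \<open>0 < k\<close> by (simp add: field_simps)
    then have "z \<in> resolvent_set M D T"
      using that(1) unfolding resolvent_set_def onto_def by blast
    then show False using z by (simp add: Spec_def)
  qed
  have "Im z = 0" using *[OF onto_nonreal, of "\<bar>Im z\<bar>"] by auto
  then show "z \<in> \<real>" by (simp add: complex_is_Real_iff)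
  show "bottom \<le> Re z" using *[OF onto_left, of "bottom - Re z"] by (cases "Re z < bottom") auto
qed

end

lemma min_of_eq:
  assumes "is_min_of S m"
  shows "min_of S = m"
  unfolding min_of_def using assms by (intro the_equality) (force simp: is_min_of_def)+

subsection \<open>Test functions\<close>

text \<open>The derivative is existentially quantified, so closure under sums, products and affine
  maps goes by induction on n with an explicit witness and no equations about iterated
  \<open>deriv\<close>.\<close>

primrec diffable :: "nat \<Rightarrow> (real \<Rightarrow> real) \<Rightarrow> bool" where
  "diffable 0 f \<longleftrightarrow> True"
| "diffable (Suc n) f \<longleftrightarrow> (\<exists>f'. (\<forall>x. (f has_real_derivative f' x) (at x)) \<and> diffable n f')"

lemma diffable_SucI:
  assumes "\<And>x. (f has_real_derivative f' x) (at x)" "diffable n f'"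
  shows "diffable (Suc n) f"
  using assms unfolding diffable.simps by blast

lemma diffable_SucE:
  assumes "diffable (Suc n) f"
  obtains f' where "\<And>x. (f has_real_derivative f' x) (at x)" "diffable n f'"
  using assms unfolding diffable.simps by blast

lemma diffable_Suc_imp: "diffable (Suc n) f \<Longrightarrow> diffable n f"
  by (induction n arbitrary: f) auto

lemma diffable_imp_differentiable:
  "diffable (Suc n) f \<Longrightarrow> ((deriv ^^ n) f) differentiable (at x)"
proof (induction n arbitrary: f)
  case 0
  then show ?case by (auto intro: real_differentiable_def[THEN iffD2])
next
  case (Suc n)
  then obtain f' where f': "\<And>x. (f has_real_derivative f' x) (at x)" "diffable (Suc n) f'" by auto
  have "deriv f = f'" using f'(1) by (intro ext DERIV_imp_deriv)
  then show ?case using Suc.IH[OF f'(2)] by (simp add: funpow_swap1)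
qed

lemma smooth_deriv:
  assumes "smooth f"
  shows "(((deriv ^^ n) f) has_real_derivative (deriv ^^ Suc n) f x) (at x)"
  using assms unfolding smooth_def by (simp add: DERIV_deriv_iff_real_differentiable)

lemma smooth_diffable: "smooth f \<Longrightarrow> diffable n ((deriv ^^ k) f)"
proof (induction n arbitrary: k)
  case (Suc n)
  show ?case by (rule diffable_SucI[OF smooth_deriv[OF Suc.prems] Suc.IH[OF Suc.prems]])
qed simp

lemma smooth_iff_diffable: "smooth f \<longleftrightarrow> (\<forall>n. diffable n f)"
proof
  assume "smooth f"
  then show "\<forall>n. diffable n f" using smooth_diffable[of f _ 0] by simp
next
  assume "\<forall>n. diffable n f"
  then show "smooth f" unfolding smooth_def using diffable_imp_differentiable by blast
qed

lemma diffable_add: "diffable n f \<Longrightarrow> diffable n g \<Longrightarrow> diffable n (\<lambda>x. f x + g x)"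
proof (induction n arbitrary: f g)
  case (Suc n)
  obtain f' where f': "\<And>x. (f has_real_derivative f' x) (at x)" "diffable n f'"
    by (rule diffable_SucE[OF Suc.prems(1)]) (rule that)
  obtain g' where g': "\<And>x. (g has_real_derivative g' x) (at x)" "diffable n g'"
    by (rule diffable_SucE[OF Suc.prems(2)]) (rule that)
  show ?case by (rule diffable_SucI[OF DERIV_add[OF f'(1) g'(1)] Suc.IH[OF f'(2) g'(2)]])
qed simp

lemma diffable_cmult: "diffable n f \<Longrightarrow> diffable n (\<lambda>x. c * f x)"
proof (induction n arbitrary: f)
  case (Suc n)
  obtain f' where f': "\<And>x. (f has_real_derivative f' x) (at x)" "diffable n f'"
    by (rule diffable_SucE[OF Suc.prems]) (rule that)
  show ?case by (rule diffable_SucI[OF DERIV_cmult[OF f'(1)] Suc.IH[OF f'(2)]])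
qed simp

lemma diffable_mult: "diffable n f \<Longrightarrow> diffable n g \<Longrightarrow> diffable n (\<lambda>x. f x * g x)"
proof (induction n arbitrary: f g)
  case (Suc n)
  obtain f' where f': "\<And>x. (f has_real_derivative f' x) (at x)" "diffable n f'"
    by (rule diffable_SucE[OF Suc.prems(1)]) (rule that)
  obtain g' where g': "\<And>x. (g has_real_derivative g' x) (at x)" "diffable n g'"
    by (rule diffable_SucE[OF Suc.prems(2)]) (rule that)
  have "diffable n (\<lambda>x. f x * g' x + f' x * g x)"
    by (rule diffable_add[OF Suc.IH[OF diffable_Suc_imp[OF Suc.prems(1)] g'(2)]
          Suc.IH[OF f'(2) diffable_Suc_imp[OF Suc.prems(2)]]])
  then show ?case by (rule diffable_SucI[OF DERIV_mult'[OF f'(1) g'(1)]])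
qed simp

lemma diffable_affine: "diffable n f \<Longrightarrow> diffable n (\<lambda>x. f (c * x + e))"
proof (induction n arbitrary: f)
  case (Suc n)
  obtain f' where f': "\<And>x. (f has_real_derivative f' x) (at x)" "diffable n f'"
    by (rule diffable_SucE[OF Suc.prems]) (rule that)
  have "((\<lambda>x. f (c * x + e)) has_real_derivative c * f' (c * x + e)) (at x)" for x
    by (rule DERIV_cong[OF DERIV_chain2[OF f'(1)]]) (auto intro!: derivative_eq_intros)
  then show ?case by (rule diffable_SucI[OF _ diffable_cmult[OF Suc.IH[OF f'(2)]]])
qed simp

text \<open>The power of x in the denominator makes the family closed under differentiation, as
  \<open>flat_has_derivative\<close> shows; smoothness is then an induction over all k at
  once.\<close>

definition flat :: "real \<Rightarrow> nat \<Rightarrow> real \<Rightarrow> real" where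
  "flat c k x = (if 0 < x then exp (- c / x) / x ^ k else 0)"

lemma flat_tendsto_0:
  fixes c :: real
  assumes "0 < c"
  shows "((\<lambda>x. exp (- c / x) / x ^ k) \<longlongrightarrow> 0) (at_right 0)"
proof -
  have "filterlim (\<lambda>x. c * inverse x) at_top (at_right (0::real))"
    by (rule filterlim_tendsto_pos_mult_at_top[OF tendsto_const assms filterlim_inverse_at_top_right])
  from filterlim_compose[OF tendsto_power_div_exp_0 this, of k]
  have "((\<lambda>x. (1 / c ^ k) * ((c * inverse x) ^ k / exp (c * inverse x))) \<longlongrightarrow> (1 / c ^ k) * 0) (at_right 0)"
    by (rule tendsto_mult[OF tendsto_const])
  moreover have "(1 / c ^ k) * ((c * inverse x) ^ k / exp (c * inverse x)) = exp (- c / x) / x ^ k" for x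
  proof -
    have "exp (- c / x) = inverse (exp (c * inverse x))" by (simp add: divide_inverse flip: exp_minus)
    then show ?thesis using assms by (simp add: power_mult_distrib divide_inverse power_inverse mult_ac)
  qed
  ultimately show ?thesis by simp
qed

lemma flat_has_derivative:
  assumes c: "0 < c"
  shows "(flat c k has_real_derivative (c * flat c (k + 2) x - k * flat c (k + 1) x)) (at x)"
proof -
  consider "x > 0" | "x < 0" | "x = 0" by linarith
  then show ?thesis
  proof cases
    case 1
    have e: "((\<lambda>x. exp (- c / x)) has_real_derivative exp (- c / x) * (c / x\<^sup>2)) (at x)"
      using 1 by (auto intro!: derivative_eq_intros simp: power2_eq_square)
    have p: "((\<lambda>x. x ^ k) has_real_derivative real k * x ^ (k - 1)) (at x)"
      by (auto intro!: derivative_eq_intros)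
    have "((\<lambda>x. exp (- c / x) / x ^ k) has_real_derivative
        (exp (- c / x) * (c / x\<^sup>2) * x ^ k - exp (- c / x) * (real k * x ^ (k - 1))) / (x ^ k * x ^ k)) (at x)"
      using 1 by (intro DERIV_divide e p) auto
    moreover have "(exp (- c / x) * (c / x\<^sup>2) * x ^ k - exp (- c / x) * (real k * x ^ (k - 1))) / (x ^ k * x ^ k) =
        c * flat c (k + 2) x - k * flat c (k + 1) x"
      using 1 by (cases k) (simp_all add: flat_def field_simps power2_eq_square)
    ultimately have "((\<lambda>x. exp (- c / x) / x ^ k) has_real_derivative (c * flat c (k + 2) x - k * flat c (k + 1) x)) (at x)"
      by simp
    then show ?thesis
      by (rule has_field_derivative_transform_within_open[of _ _ _ "{0<..}"]) (use 1 in \<open>auto simp: flat_def\<close>)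
  next
    case 2
    have "((\<lambda>x. 0) has_real_derivative 0) (at x)" by simp
    then have "(flat c k has_real_derivative 0) (at x)"
      by (rule has_field_derivative_transform_within_open[of _ _ _ "{..<0}"]) (use 2 in \<open>auto simp: flat_def\<close>)
    then show ?thesis using 2 by (simp add: flat_def)
  next
    case 3
    \<comment> \<open>The difference quotient at 0 is the member of the family with exponent k + 1,
      which tends to 0.\<close>
    have "((\<lambda>y. flat c k y / y) \<longlongrightarrow> 0) (at_right 0)"
    proof (rule Lim_transform_eventually[OF flat_tendsto_0[OF c, of "Suc k"]])
      show "\<forall>\<^sub>F y in at_right 0. exp (- c / y) / y ^ Suc k = flat c k y / y"
        using eventually_at_right_less[of "0::real"] by eventually_elim (simp add: flat_def)
    qed
    moreover have "((\<lambda>y. flat c k y / y) \<longlongrightarrow> 0) (at_left 0)"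
    proof (rule Lim_transform_eventually[OF tendsto_const])
      show "\<forall>\<^sub>F y in at_left 0. 0 = flat c k y / y"
        using eventually_at_left_real[of "-1" "0::real"] by (auto elim!: eventually_mono simp: flat_def)
    qed
    ultimately have "((\<lambda>y. flat c k y / y) \<longlongrightarrow> 0) (at 0)" by (simp add: filterlim_split_at)
    then show ?thesis using 3 by (simp add: flat_def DERIV_def)
  qed
qed

lemma diffable_flat: "0 < c \<Longrightarrow> diffable n (flat c k)"
proof (induction n arbitrary: k)
  case (Suc n)
  have "diffable n (\<lambda>x. c * flat c (k + 2) x + (- real k) * flat c (k + 1) x)"
    by (intro diffable_add diffable_cmult Suc)
  moreover have "(flat c k has_real_derivative c * flat c (k + 2) x + (- real k) * flat c (k + 1) x) (at x)" for x
    using flat_has_derivative[OF Suc.prems, of k x] by simp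
  ultimately show ?case by (intro diffable_SucI[of "flat c k" "\<lambda>x. c * flat c (k + 2) x + (- real k) * flat c (k + 1) x"])
qed simp

text \<open>As n grows the constants 1 / Suc n in the exponentials tend to 0, so the bumps converge
  pointwise to the indicator of the open interval while staying in [0, 1]. Testing against them
  therefore tests against intervals.\<close>

definition bump :: "real \<Rightarrow> real \<Rightarrow> nat \<Rightarrow> real \<Rightarrow> real" where
  "bump a b n x = flat (1 / Suc n) 0 (x - a) * flat (1 / Suc n) 0 (b - x)"

lemma bump_nonneg: "0 \<le> bump a b n x" and bump_le_1: "bump a b n x \<le> 1"
  and bump_outside: "x \<notin> {a<..<b} \<Longrightarrow> bump a b n x = 0"
  by (auto simp: bump_def flat_def intro!: mult_le_one)

lemma test_functionI:
  assumes "\<And>n. diffable n f" "\<And>x. x \<notin> {a..b} \<Longrightarrow> f x = 0"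
  shows "f \<in> test_functions"
proof -
  have "{x. f x \<noteq> 0} \<subseteq> {a..b}" using assms(2) by blast
  then have "closure {x. f x \<noteq> 0} \<subseteq> {a..b}" by (intro closure_minimal) auto
  then show ?thesis
    using assms(1) unfolding test_functions_def
    by (auto simp: smooth_iff_diffable compact_eq_bounded_closed intro: bounded_subset[OF bounded_closed_interval])
qed

lemma diffable_bump: "diffable m (bump a b n)"
  using diffable_mult[OF diffable_affine[OF diffable_flat, of "1 / Suc n" m 0 1 "-a"]
      diffable_affine[OF diffable_flat, of "1 / Suc n" m 0 "-1" b]]
  by (simp add: bump_def[abs_def])

lemma bump_test: "bump a b n \<in> test_functions"
  by (rule test_functionI[OF diffable_bump, of a b]) (use bump_outside in fastforce)

lemma bump_measurable [measurable]: "bump a b n \<in> borel_measurable borel"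
proof -
  have "isCont (bump a b n) x" for x
    using diffable_bump[of "Suc 0" a b n] by (rule diffable_SucE) (rule DERIV_isCont)
  then show ?thesis by (intro borel_measurable_continuous_onI) (simp add: continuous_at_imp_continuous_on)
qed

lemma bump_tendsto: "(\<lambda>n. bump a b n x) \<longlonglongrightarrow> indicator {a<..<b} x"
proof (cases "x \<in> {a<..<b}")
  case True
  have "(\<lambda>n. 1 / real (Suc n)) \<longlonglongrightarrow> 0" using LIMSEQ_inverse_real_of_nat by (simp add: inverse_eq_divide)
  then have "(\<lambda>n. exp (- (1 / real (Suc n)) / (x - a)) * exp (- (1 / real (Suc n)) / (b - x))) \<longlonglongrightarrow>
      exp (- 0 / (x - a)) * exp (- 0 / (b - x))"
    using True by (intro tendsto_intros) auto
  then show ?thesis using True by (simp add: bump_def[abs_def] flat_def)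
next
  case False
  then show ?thesis using bump_outside[OF False] by simp
qed

section \<open>Locally integrable functions and their detection by test functions\<close>

definition loc_int :: "(real \<Rightarrow> complex) \<Rightarrow> bool" where
  "loc_int f \<longleftrightarrow> f \<in> borel_measurable borel \<and> (\<forall>a b. set_integrable lborel {a..b} f)"

lemma loc_intD: "loc_int f \<Longrightarrow> set_integrable lborel {a..b} f" "loc_int f \<Longrightarrow> f \<in> borel_measurable borel"
  by (auto simp: loc_int_def)

lemma loc_int_continuous: "continuous_on UNIV f \<Longrightarrow> loc_int f"
  unfolding loc_int_def
  by (auto intro!: borel_measurable_continuous_onI borel_integrable_atLeastAtMost' intro: continuous_on_subset)

lemma loc_int_add: "loc_int f \<Longrightarrow> loc_int g \<Longrightarrow> loc_int (\<lambda>x. f x + g x)"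
  by (auto simp: loc_int_def intro: set_integral_add)

lemma loc_int_diff: "loc_int f \<Longrightarrow> loc_int g \<Longrightarrow> loc_int (\<lambda>x. f x - g x)"
  by (auto simp: loc_int_def intro: set_integral_diff)

lemma loc_int_mult_cont:
  assumes f: "loc_int f" and g: "continuous_on UNIV g"
  shows "loc_int (\<lambda>x. f x * g x)"
  unfolding loc_int_def
proof (intro conjI allI)
  have [measurable]: "f \<in> borel_measurable borel" "g \<in> borel_measurable borel"
    using loc_intD(2)[OF f] borel_measurable_continuous_onI[OF g] by auto
  then show "(\<lambda>x. f x * g x) \<in> borel_measurable borel" by measurable
  fix a b :: real
  have "compact (g ` {a..b})" by (intro compact_continuous_image continuous_on_subset[OF g]) auto
  then obtain B where B: "\<And>x. x \<in> {a..b} \<Longrightarrow> norm (g x) \<le> B"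
    by (auto dest!: compact_imp_bounded simp: bounded_iff) (metis atLeastAtMost_iff that)
  show "set_integrable lborel {a..b} (\<lambda>x. f x * g x)"
    unfolding set_integrable_def
  proof (rule Bochner_Integration.integrable_bound)
    show "integrable lborel (\<lambda>x. B *\<^sub>R (indicator {a..b} x *\<^sub>R f x))"
      using loc_intD(1)[OF f] unfolding set_integrable_def by (intro integrable_scaleR_right)
    show "AE x in lborel. norm (indicator {a..b} x *\<^sub>R (f x * g x)) \<le> norm (B *\<^sub>R (indicator {a..b} x *\<^sub>R f x))"
    proof (rule AE_I2)
      fix x
      show "norm (indicator {a..b} x *\<^sub>R (f x * g x)) \<le> norm (B *\<^sub>R (indicator {a..b} x *\<^sub>R f x))"
        using B[of x] mult_left_mono[of "norm (g x)" "\<bar>B\<bar>" "norm (f x)"]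
        by (auto simp: norm_mult indicator_def mult.commute)
    qed
  qed measurable
qed

lemma L2_indicator: "(\<lambda>x. complex_of_real (indicator {a..b::real} x)) \<in> L2 lborel"
proof (rule L2_dominated)
  show "integrable lborel (indicator {a..b} :: real \<Rightarrow> real)"
    by (simp add: integrable_indicator_iff emeasure_lborel_Icc_eq)
qed (auto simp: indicator_def)

lemma L2_loc_int:
  assumes "f \<in> L2 lborel"
  shows "loc_int f"
  using L2D(1)[OF assms] L2_mult_integrable[OF L2_indicator assms]
  by (simp add: loc_int_def set_integrable_def scaleR_conv_of_real)

lemma bump_integral_tendsto:
  assumes "loc_int f"
  shows "(\<lambda>n. LINT x|lborel. f x * complex_of_real (bump a b n x)) \<longlonglongrightarrow> (LINT x:{a<..<b}|lborel. f x)"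
  unfolding set_lebesgue_integral_def
proof (rule integral_dominated_convergence)
  note [measurable] = loc_intD(2)[OF assms]
  show "integrable lborel (\<lambda>x. norm (indicator {a..b} x *\<^sub>R f x))"
    using loc_intD(1)[OF assms] unfolding set_integrable_def by (rule integrable_norm)
  show "AE x in lborel. norm (f x * complex_of_real (bump a b n x)) \<le> norm (indicator {a..b} x *\<^sub>R f x)" for n
  proof (rule AE_I2)
    fix x
    show "norm (f x * complex_of_real (bump a b n x)) \<le> norm (indicator {a..b} x *\<^sub>R f x)"
      using bump_outside[of x a b n] bump_nonneg[of a b n x] bump_le_1[of a b n x]
      by (cases "x \<in> {a<..<b}") (auto simp: norm_mult indicator_def intro: mult_left_le)
  qed
  show "AE x in lborel. (\<lambda>n. f x * complex_of_real (bump a b n x)) \<longlonglongrightarrow> indicator {a<..<b} x *\<^sub>R f x"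
  proof (rule AE_I2)
    fix x
    show "(\<lambda>n. f x * complex_of_real (bump a b n x)) \<longlonglongrightarrow> indicator {a<..<b} x *\<^sub>R f x"
      using tendsto_mult[OF tendsto_const tendsto_of_real[OF bump_tendsto[of a b x]], of "f x"]
      by (simp add: scaleR_conv_of_real mult.commute)
  qed
qed (use loc_intD(2)[OF assms] in measurable)

text \<open>After truncation to a bounded interval, the sets over which f integrates to 0 are closed
  under complements and disjoint unions, and they contain the open intervals, which are stable under
  intersection. Hence they include all Borel sets and the density vanishes.\<close>

lemma AE_zero_if_intervals:
  fixes f :: "real \<Rightarrow> complex"
  assumes f: "loc_int f" and zero: "\<And>a b. (LINT x:{a<..<b}|lborel. f x) = 0"
  shows "AE x in lborel. f x = 0"
proof -
  have "AE x in lborel. indicator {- real R<..<real R} x *\<^sub>R f x = 0" for R :: nat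
  proof -
    define F where "F x = indicator {- real R<..<real R} x *\<^sub>R f x" for x
    have "set_integrable lborel {- real R<..<real R} f"
      by (rule set_integrable_subset[OF loc_intD(1)[OF f, of "- R" R]]) auto
    then have F: "integrable lborel F" by (simp add: F_def[abs_def] set_integrable_def)
    have box: "set_lebesgue_integral lborel {a<..<b} F = 0" for a b
    proof -
      have "set_lebesgue_integral lborel {a<..<b} F = (LINT x:{max a (-R)<..<min b R}|lborel. f x)"
        unfolding set_lebesgue_integral_def F_def by (intro Bochner_Integration.integral_cong) (auto simp: indicator_def)
      then show ?thesis using zero by simp
    qed
    have total: "(LINT x|lborel. F x) = 0"
      using zero[of "- R" R] by (simp add: F_def[abs_def] set_lebesgue_integral_def)
    show ?thesis unfolding F_def[symmetric]
    proof (rule sigma_finite_measure.density_zero[OF sigma_finite_lborel F])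
      fix A :: "real set" assume A: "A \<in> sets lborel"
      then have A': "A \<in> sigma_sets UNIV (range (\<lambda>(a, b). box a b))" by (simp add: borel_eq_box)
      have stable: "Int_stable (range (\<lambda>(a, b). box a b :: real set))"
        by (auto simp: Int_stable_def box_Int_box intro!: exI)
      show "set_lebesgue_integral lborel A F = 0"
      proof (rule sigma_sets_induct_disjoint[OF stable _ A'])
        fix A assume A: "A \<in> sigma_sets UNIV (range (\<lambda>(a, b). box a b :: real set))"
          and IH: "set_lebesgue_integral lborel A F = 0"
        then have Am: "A \<in> sets lborel" by (simp add: borel_eq_box)
        have "set_lebesgue_integral lborel (UNIV - A) F = (LINT x|lborel. F x - indicator A x *\<^sub>R F x)"
          unfolding set_lebesgue_integral_def by (intro Bochner_Integration.integral_cong) (auto simp: indicator_def)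
        also have "\<dots> = (LINT x|lborel. F x) - set_lebesgue_integral lborel A F"
          unfolding set_lebesgue_integral_def using F Am by (intro Bochner_Integration.integral_diff integrable_mult_indicator) auto
        finally show "set_lebesgue_integral lborel (UNIV - A) F = 0" using total IH by simp
      next
        fix A :: "nat \<Rightarrow> real set"
        assume A: "disjoint_family A" "range A \<subseteq> sigma_sets UNIV (range (\<lambda>(a, b). box a b :: real set))"
          and IH: "\<And>i. set_lebesgue_integral lborel (A i) F = 0"
        have Am [measurable]: "A i \<in> sets lborel" for i using A(2) by (auto simp: borel_eq_box)
        have "(\<Union>i. A i) \<in> sets lborel" by measurable
        then have "set_integrable lborel (\<Union>i. A i) F"
          unfolding set_integrable_def using F by (intro integrable_mult_indicator) auto
        then have "set_lebesgue_integral lborel (\<Union>i. A i) F = (\<Sum>i. set_lebesgue_integral lborel (A i) F)"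
          using A(1) Am by (intro lebesgue_integral_countable_add) (auto simp: disjoint_family_on_def)
        then show "set_lebesgue_integral lborel (\<Union>i. A i) F = 0" using IH by simp
      qed (auto simp: box set_lebesgue_integral_def[of _ "{}"])
    qed
  qed
  then have "AE x in lborel. \<forall>R::nat. indicator {- real R<..<real R} x *\<^sub>R f x = 0"
    unfolding AE_all_countable by blast
  then show ?thesis
  proof eventually_elim
    case (elim x)
    obtain R :: nat where "\<bar>x\<bar> < R" using reals_Archimedean2 by blast
    then show ?case using elim[rule_format, of R] by (simp add: indicator_def split: if_splits)
  qed
qed

text \<open>Fundamental lemma of the calculus of variations, by letting the bumps tend to indicators
  of intervals.\<close>

lemma AE_zero_if_test:
  assumes f: "loc_int f" and "\<And>\<phi>. \<phi> \<in> test_functions \<Longrightarrow> (LINT x|lborel. f x * complex_of_real (\<phi> x)) = 0"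
  shows "AE x in lborel. f x = 0"
proof (rule AE_zero_if_intervals[OF f])
  show "(LINT x:{a<..<b}|lborel. f x) = 0" for a b
    using bump_integral_tendsto[OF f, of a b] assms(2)[OF bump_test] by (simp add: LIMSEQ_const_iff)
qed

lemma test_functionD:
  assumes "\<phi> \<in> test_functions"
  obtains R where "0 < R" "\<And>x. R \<le> \<bar>x\<bar> \<Longrightarrow> \<phi> x = 0" "\<And>x. R \<le> \<bar>x\<bar> \<Longrightarrow> deriv \<phi> x = 0"
    "\<And>x. (\<phi> has_real_derivative deriv \<phi> x) (at x)" "continuous_on UNIV (deriv \<phi>)" "continuous_on UNIV \<phi>"
proof -
  have sm: "smooth \<phi>" and "bounded {x. \<phi> x \<noteq> 0}"
    using assms bounded_subset[OF compact_imp_bounded closure_subset] by (auto simp: test_functions_def)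
  then obtain B where B: "\<And>x. \<phi> x \<noteq> 0 \<Longrightarrow> \<bar>x\<bar> \<le> B" by (auto simp: bounded_iff)
  \<comment> \<open>The margin of 1 makes every point with R <= |x| interior to the zero set, so
    that the derivative vanishes there as well.\<close>
  define R where "R = \<bar>B\<bar> + 1"
  have z: "\<phi> x = 0" if "R - 1 < \<bar>x\<bar>" for x using B[of x] that by (force simp: R_def)
  have der: "(\<phi> has_real_derivative deriv \<phi> x) (at x)" for x using smooth_deriv[OF sm, of 0] by simp
  have der2: "(deriv \<phi> has_real_derivative deriv (deriv \<phi>) x) (at x)" for x using smooth_deriv[OF sm, of 1] by simp
  have "deriv \<phi> x = 0" if "R \<le> \<bar>x\<bar>" for x
  proof (rule DERIV_imp_deriv)
    have "((\<lambda>x. 0) has_real_derivative 0) (at x)" by simp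
    then show "(\<phi> has_real_derivative 0) (at x)"
      by (rule has_field_derivative_transform_within_open[of _ _ _ "{x. R - 1 < \<bar>x\<bar>}"])
        (use that z in \<open>auto intro!: open_Collect_less continuous_intros\<close>)
  qed
  moreover have "continuous_on UNIV (deriv \<phi>)"
    by (intro continuous_at_imp_continuous_on ballI DERIV_isCont[OF der2])
  moreover have "continuous_on UNIV \<phi>"
    by (intro continuous_at_imp_continuous_on ballI DERIV_isCont[OF der])
  moreover have "0 < R" by (simp add: R_def)
  moreover have "\<phi> x = 0" if "R \<le> \<bar>x\<bar>" for x using z[of x] that by simp
  ultimately show ?thesis using that[of R] der by blast
qed

subsection \<open>Absolutely continuous functions\<close>

text \<open>Local absolute continuity, encoded as the fundamental theorem of calculus with an
  explicit density f. This is the form in which products, cutoffs and weak derivatives are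
  handled.\<close>

definition ac :: "(real \<Rightarrow> complex) \<Rightarrow> (real \<Rightarrow> complex) \<Rightarrow> bool" where
  "ac F f \<longleftrightarrow> loc_int f \<and> (\<forall>a b. a \<le> b \<longrightarrow> F b - F a = (LINT x:{a..b}|lborel. f x))"

lemma acD: "ac F f \<Longrightarrow> loc_int f" "ac F f \<Longrightarrow> a \<le> b \<Longrightarrow> (LINT x:{a..b}|lborel. f x) = F b - F a"
  by (auto simp: ac_def)

lemma ac_continuous:
  assumes "ac F f"
  shows "continuous_on UNIV F"
proof (rule continuous_at_imp_continuous_on, rule ballI)
  fix x :: real
  have F: "F t = F (x - 1) + integral {x - 1..t} f" if "x - 1 \<le> t" for t
  proof -
    have "integral {x - 1..t} f = F t - F (x - 1)"
      by (rule trans[OF set_borel_integral_eq_integral(2)[OF loc_intD(1)[OF acD(1)[OF assms]], symmetric] acD(2)[OF assms that]])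
    then show ?thesis by simp
  qed
  have "continuous_on {x - 1..x + 1} (\<lambda>t. F (x - 1) + integral {x - 1..t} f)"
    using set_borel_integral_eq_integral(1)[OF loc_intD(1)[OF acD(1)[OF assms]], of "x - 1" "x + 1"]
    by (intro continuous_intros indefinite_integral_continuous_1)
  then have "continuous_on {x - 1..x + 1} F"
    by (rule continuous_on_eq) (simp add: F[symmetric])
  then show "isCont F x" by (rule continuous_on_interior) simp
qed

lemma ac_C1:
  assumes "\<And>x. (F has_vector_derivative f x) (at x)" "continuous_on UNIV f"
  shows "ac F f"
  unfolding ac_def set_lebesgue_integral_def
proof (intro conjI allI impI loc_int_continuous assms(2))
  fix a b :: real assume "a \<le> b"
  then show "F b - F a = (LINT x|lborel. indicator {a..b} x *\<^sub>R f x)"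
  proof (rule integral_FTC_atLeastAtMost[symmetric])
    show "(F has_vector_derivative f x) (at x within {a..b})" for x
      by (rule has_vector_derivative_at_within[OF assms(1)])
  qed (rule continuous_on_subset[OF assms(2) subset_UNIV])
qed

lemma ac_of_real:
  assumes "\<And>x. (F has_real_derivative f x) (at x)" "continuous_on UNIV f"
  shows "ac (\<lambda>x. complex_of_real (F x)) (\<lambda>x. complex_of_real (f x))"
  using assms by (intro ac_C1 has_vector_derivative_of_real continuous_intros) auto

lemma ac_add_scale:
  assumes "ac F f" "ac G g"
  shows "ac (\<lambda>x. F x + c * G x) (\<lambda>x. f x + c * g x)"
proof -
  have L: "loc_int f" "loc_int (\<lambda>x. c * g x)"
    using acD(1)[OF assms(1)] loc_int_mult_cont[OF acD(1)[OF assms(2)] continuous_on_const, of c]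
    by (auto simp: mult.commute)
  show ?thesis
    unfolding ac_def
  proof (intro conjI allI impI loc_int_add L)
    fix a b :: real assume "a \<le> b"
    then have "F b = F a + (LINT x:{a..b}|lborel. f x)" "G b = G a + (LINT x:{a..b}|lborel. g x)"
      using acD(2)[OF assms(1)] acD(2)[OF assms(2)] by simp_all
    then show "F b + c * G b - (F a + c * G a) = (LINT x:{a..b}|lborel. f x + c * g x)"
      using set_integral_add(2)[OF loc_intD(1)[OF L(1)] loc_intD(1)[OF L(2)], of a b]
      by (simp add: distrib_left)
  qed
qed

lemma ac_cnj:
  assumes "ac F f"
  shows "ac (\<lambda>x. cnj (F x)) (\<lambda>x. cnj (f x))"
  unfolding ac_def loc_int_def
proof (intro conjI allI impI)
  note [measurable] = loc_intD(2)[OF acD(1)[OF assms]]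
  show "(\<lambda>x. cnj (f x)) \<in> borel_measurable borel" by measurable
  have eq: "(\<lambda>x. indicator A x *\<^sub>R cnj (f x)) = (\<lambda>x. cnj (indicator A x *\<^sub>R f x))" for A :: "real set"
    by (auto simp: indicator_def)
  show "set_integrable lborel {a..b} (\<lambda>x. cnj (f x))" for a b
    using loc_intD(1)[OF acD(1)[OF assms]] unfolding set_integrable_def eq by (intro integrable_cnj)
  show "cnj (F b) - cnj (F a) = (LINT x:{a..b}|lborel. cnj (f x))" if "a \<le> b" for a b
    using arg_cong[OF acD(2)[OF assms that], of cnj] unfolding set_lebesgue_integral_def eq Bochner_Integration.integral_cnj
    by (simp only: complex_cnj_diff)
qed

text \<open>Fubini on a square: (F b - F a) (G b - G a) is the double integral of f x * g y.
  Integrating y first on the triangle y <= x and x first on its complement gives the integrals of f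
  * G and g * F, up to boundary constants.\<close>

lemma ac_mult:
  assumes F: "ac F f" and G: "ac G g"
  shows "ac (\<lambda>x. F x * G x) (\<lambda>x. f x * G x + g x * F x)"
  unfolding ac_def
proof (intro conjI allI impI)
  have L: "loc_int (\<lambda>x. f x * G x)" "loc_int (\<lambda>x. g x * F x)"
    by (intro loc_int_mult_cont acD(1)[OF F] acD(1)[OF G] ac_continuous[OF F] ac_continuous[OF G])+
  then show "loc_int (\<lambda>x. f x * G x + g x * F x)" by (rule loc_int_add)
  fix a b :: real assume ab: "a \<le> b"
  note [measurable] = loc_intD(2)[OF acD(1)[OF F]] loc_intD(2)[OF acD(1)[OF G]]
  define A B where "A x = indicator {a..b} x *\<^sub>R f x" and "B x = indicator {a..b} x *\<^sub>R g x" for x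
  have [measurable]: "A \<in> borel_measurable borel" "B \<in> borel_measurable borel"
    unfolding A_def[abs_def] B_def[abs_def] by measurable
  have Ai: "integrable lborel A" and Bi: "integrable lborel B"
    using loc_intD(1)[OF acD(1)[OF F], of a b] loc_intD(1)[OF acD(1)[OF G], of a b]
    unfolding A_def[abs_def] B_def[abs_def] set_integrable_def by auto
  have IA: "(LINT x|lborel. A x) = F b - F a" and IB: "(LINT x|lborel. B x) = G b - G a"
    using acD(2)[OF F ab] acD(2)[OF G ab] unfolding A_def[abs_def] B_def[abs_def] set_lebesgue_integral_def by auto
  have IBx: "A x * (LINT y|lborel. indicator {..x} y *\<^sub>R B y) = A x * (G x - G a)" for x
  proof (cases "x \<in> {a..b}")
    case True
    then have "(LINT y|lborel. indicator {..x} y *\<^sub>R B y) = (LINT y:{a..x}|lborel. g y)"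
      unfolding set_lebesgue_integral_def B_def by (intro Bochner_Integration.integral_cong) (auto simp: indicator_def)
    then show ?thesis using acD(2)[OF G, of a x] True by simp
  qed (simp add: A_def)
  have IAy: "B y * (LINT x|lborel. indicator {..<y} x *\<^sub>R A x) = B y * (F y - F a)" for y
  proof (cases "y \<in> {a..b}")
    case True
    have "(LINT x|lborel. indicator {..<y} x *\<^sub>R A x) = (LINT x:{a..y}|lborel. f x)"
      unfolding set_lebesgue_integral_def
    proof (rule integral_cong_AE)
      \<comment> \<open>The strict inequality comes from complementing the closed triangle; the
        endpoint y is a null set.\<close>
      show "AE x in lborel. indicator {..<y} x *\<^sub>R A x = indicator {a..y} x *\<^sub>R f x"
        using AE_lborel_singleton[of y] by eventually_elim (use True in \<open>auto simp: A_def indicator_def\<close>)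
    qed measurable
    then show ?thesis using acD(2)[OF F, of a y] True by simp
  qed (simp add: B_def)
  have K: "integrable (lborel \<Otimes>\<^sub>M lborel) (\<lambda>(x, y). A x * B y)"
  proof (rule lborel_pair.Fubini_integrable)
    show "integrable lborel (\<lambda>x. LINT y|lborel. norm (case (x, y) of (x, y) \<Rightarrow> A x * B y))"
      using Ai by (simp add: norm_mult)
  qed (use Bi in auto)
  have K1: "integrable (lborel \<Otimes>\<^sub>M lborel) (\<lambda>(x, y). indicator {..x} y *\<^sub>R (A x * B y))"
  proof (rule Bochner_Integration.integrable_bound[OF K])
    have "(\<lambda>z. (if snd z \<le> fst z then A (fst z) * B (snd z) else 0)) \<in> borel_measurable (lborel \<Otimes>\<^sub>M lborel)"
      by measurable
    moreover have "(\<lambda>z. (if snd z \<le> fst z then A (fst z) * B (snd z) else 0)) =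
        (\<lambda>(x, y). indicator {..x} y *\<^sub>R (A x * B y))" by (auto simp: fun_eq_iff indicator_def)
    ultimately show "(\<lambda>(x, y). indicator {..x} y *\<^sub>R (A x * B y)) \<in> borel_measurable (lborel \<Otimes>\<^sub>M lborel)" by simp
  qed (auto simp: indicator_def)
  have K2: "integrable (lborel \<Otimes>\<^sub>M lborel) (\<lambda>(x, y). A x * B y - indicator {..x} y *\<^sub>R (A x * B y))"
    using Bochner_Integration.integrable_diff[OF K K1] unfolding case_prod_unfold .
  have "(F b - F a) * (G b - G a) = (LINT x|lborel. LINT y|lborel. A x * B y)"
    using IA IB by simp
  also have "\<dots> = (LINT z|(lborel \<Otimes>\<^sub>M lborel). (case z of (x, y) \<Rightarrow> A x * B y))"
    by (rule lborel_pair.integral_fst[OF K])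
  also have "\<dots> = (LINT z|(lborel \<Otimes>\<^sub>M lborel). (case z of (x, y) \<Rightarrow> indicator {..x} y *\<^sub>R (A x * B y)) +
      (case z of (x, y) \<Rightarrow> A x * B y - indicator {..x} y *\<^sub>R (A x * B y)))"
    by (intro Bochner_Integration.integral_cong) auto
  also have "\<dots> = (LINT z|(lborel \<Otimes>\<^sub>M lborel). (case z of (x, y) \<Rightarrow> indicator {..x} y *\<^sub>R (A x * B y))) +
      (LINT z|(lborel \<Otimes>\<^sub>M lborel). (case z of (x, y) \<Rightarrow> A x * B y - indicator {..x} y *\<^sub>R (A x * B y)))"
    by (rule Bochner_Integration.integral_add[OF K1 K2])
  also have "\<dots> = (LINT x|lborel. LINT y|lborel. indicator {..x} y *\<^sub>R (A x * B y)) +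
      (LINT y|lborel. LINT x|lborel. A x * B y - indicator {..x} y *\<^sub>R (A x * B y))"
    using lborel_pair.integral_fst[OF K1] lborel_pair.integral_snd[OF K2] by simp
  also have "(LINT x|lborel. LINT y|lborel. indicator {..x} y *\<^sub>R (A x * B y)) = (LINT x|lborel. A x * (G x - G a))"
  proof -
    have "(LINT y|lborel. indicator {..x} y *\<^sub>R (A x * B y)) = A x * (G x - G a)" for x
    proof -
      have eq: "(\<lambda>y. indicator {..x} y *\<^sub>R (A x * B y)) = (\<lambda>y. A x * (indicator {..x} y *\<^sub>R B y))" by auto
      show ?thesis unfolding IBx[symmetric] eq by (rule integral_mult_right_zero)
    qed
    then show ?thesis by simp
  qed
  also have "(LINT y|lborel. LINT x|lborel. A x * B y - indicator {..x} y *\<^sub>R (A x * B y)) =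
      (LINT y|lborel. B y * (F y - F a))"
  proof -
    have eq: "A x * B y - indicator {..x} y *\<^sub>R (A x * B y) = B y * (indicator {..<y} x *\<^sub>R A x)" for x y
      by (auto simp: indicator_def)
    show ?thesis unfolding IAy[symmetric] eq integral_mult_right_zero ..
  qed
  also have "(LINT x|lborel. A x * (G x - G a)) = (LINT x:{a..b}|lborel. f x * G x) - G a * (F b - F a)"
  proof -
    have "(LINT x|lborel. A x * (G x - G a)) = (LINT x|lborel. indicator {a..b} x *\<^sub>R (f x * G x) - A x * G a)"
      by (intro Bochner_Integration.integral_cong) (auto simp: A_def indicator_def algebra_simps)
    then show ?thesis
      using loc_intD(1)[OF L(1), of a b] Ai IA unfolding set_lebesgue_integral_def set_integrable_def by simp
  qed
  also have "(LINT x|lborel. B x * (F x - F a)) = (LINT x:{a..b}|lborel. g x * F x) - F a * (G b - G a)"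
  proof -
    have "(LINT x|lborel. B x * (F x - F a)) = (LINT x|lborel. indicator {a..b} x *\<^sub>R (g x * F x) - B x * F a)"
      by (intro Bochner_Integration.integral_cong) (auto simp: B_def indicator_def algebra_simps)
    then show ?thesis
      using loc_intD(1)[OF L(2), of a b] Bi IB unfolding set_lebesgue_integral_def set_integrable_def by simp
  qed
  finally show "F b * G b - F a * G a = (LINT x:{a..b}|lborel. f x * G x + g x * F x)"
    using set_integral_add(2)[OF loc_intD(1)[OF L(1)] loc_intD(1)[OF L(2)], of a b] by (simp add: algebra_simps)
qed

lemma ac_compact_support:
  assumes "ac F f" "\<And>x. R \<le> \<bar>x\<bar> \<Longrightarrow> F x = 0" "\<And>x. R \<le> \<bar>x\<bar> \<Longrightarrow> f x = 0" "0 < R"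
  shows "(LINT x|lborel. f x) = 0"
proof -
  have "(LINT x|lborel. f x) = (LINT x:{-R..R}|lborel. f x)"
    unfolding set_lebesgue_integral_def using assms(3)
    by (intro Bochner_Integration.integral_cong) (auto simp: indicator_def)
  then show ?thesis using acD(2)[OF assms(1), of "-R" R] assms(2,4) by simp
qed

text \<open>The proof multiplies \<open>F\<close> by the cutoff \<open>1 - (x / n)\<^sup>2\<close>, which vanishes at \<open>\<plusminus>n\<close> and has
  derivative of size at most \<open>2 / n\<close> in between.\<close>

lemma ac_integral_zero:
  assumes F: "ac F f" and Fi: "integrable lborel F" and fi: "integrable lborel f"
  shows "(LINT x|lborel. f x) = 0"
proof -
  define k where "k n = inverse ((real (Suc n))\<^sup>2)" for n
  define c where "c n x = 1 - x\<^sup>2 * k n" for n x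
  define c' where "c' n x = - 2 * x * k n" for n x
  define s where "s n x = indicator {- real (Suc n)..real (Suc n)} x *\<^sub>R
    (f x * complex_of_real (c n x) + complex_of_real (c' n x) * F x)" for n x
  note [measurable] = loc_intD(2)[OF acD(1)[OF F]] borel_measurable_continuous_onI[OF ac_continuous[OF F]]
  have s_zero: "(LINT x|lborel. s n x) = 0" for n
  proof -
    have ac_c: "ac (\<lambda>x. complex_of_real (c n x)) (\<lambda>x. complex_of_real (c' n x))"
      unfolding c_def c'_def
      by (intro ac_of_real continuous_intros) (auto intro!: derivative_eq_intros)

    have "c n (real (Suc n)) = 0" "c n (- real (Suc n)) = 0"
      by (simp_all add: c_def k_def del: of_nat_Suc)
    then show ?thesis using acD(2)[OF ac_mult[OF F ac_c], of "- real (Suc n)" "real (Suc n)"]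
      unfolding s_def set_lebesgue_integral_def by (simp del: of_nat_Suc)
  qed
  have "(\<lambda>n. LINT x|lborel. s n x) \<longlonglongrightarrow> (LINT x|lborel. f x)"
  proof (rule integral_dominated_convergence)
    show "integrable lborel (\<lambda>x. norm (f x) + 2 * norm (F x))" using Fi fi by simp
    show "s n \<in> borel_measurable lborel" for n unfolding s_def[abs_def] c_def[abs_def] c'_def[abs_def] by measurable
    show "AE x in lborel. norm (s n x) \<le> norm (f x) + 2 * norm (F x)" for n
    proof (rule AE_I2)
      fix x :: real
      show "norm (s n x) \<le> norm (f x) + 2 * norm (F x)"
      proof (cases "x \<in> {- real (Suc n)..real (Suc n)}")
        case True
        then have x: "\<bar>x\<bar> \<le> real (Suc n)" by auto
        then have "(x / real (Suc n))\<^sup>2 \<le> 1" by (simp add: power_divide abs_square_le_1 abs_le_square_iff[symmetric])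
        then have 1: "\<bar>c n x\<bar> \<le> 1" by (simp add: c_def k_def divide_inverse power_mult_distrib power_inverse)
        have "\<bar>c' n x\<bar> = 2 * (\<bar>x\<bar> / real (Suc n)) / real (Suc n)"
          by (simp add: c'_def k_def abs_mult power2_eq_square divide_inverse)
        also have "\<dots> \<le> 2 * 1 / 1" using x by (intro frac_le mult_left_mono) auto
        finally have 2: "\<bar>c' n x\<bar> \<le> 2" by simp
        have "norm (s n x) \<le> norm (f x) * \<bar>c n x\<bar> + \<bar>c' n x\<bar> * norm (F x)"
          using True norm_triangle_ineq[of "f x * complex_of_real (c n x)" "complex_of_real (c' n x) * F x"]
          by (simp add: s_def norm_mult)
        also have "\<dots> \<le> norm (f x) * 1 + 2 * norm (F x)"
          using 1 2 by (intro add_mono mult_left_mono mult_right_mono) auto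
        finally show ?thesis by simp
      qed (simp add: s_def)
    qed
    show "AE x in lborel. (\<lambda>n. s n x) \<longlonglongrightarrow> f x"
    proof (rule AE_I2)
      fix x :: real
      have inv: "(\<lambda>n. inverse (real (Suc n))) \<longlonglongrightarrow> 0" by (rule LIMSEQ_inverse_real_of_nat)
      have "(\<lambda>n. 1 - (x * inverse (real (Suc n)))\<^sup>2) \<longlonglongrightarrow> 1 - (x * 0)\<^sup>2"
        "(\<lambda>n. - 2 * x * (inverse (real (Suc n)))\<^sup>2) \<longlonglongrightarrow> - 2 * x * 0\<^sup>2"
        by (intro tendsto_intros inv)+
      then have "(\<lambda>n. c n x) \<longlonglongrightarrow> 1" "(\<lambda>n. c' n x) \<longlonglongrightarrow> 0"
        by (simp_all add: c_def c'_def k_def power_mult_distrib power_inverse)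
      then have "(\<lambda>n. f x * complex_of_real (c n x) + complex_of_real (c' n x) * F x) \<longlonglongrightarrow>
          f x * complex_of_real 1 + complex_of_real 0 * F x" by (intro tendsto_intros)
      then have "(\<lambda>n. f x * complex_of_real (c n x) + complex_of_real (c' n x) * F x) \<longlonglongrightarrow> f x" by simp
      moreover have "\<forall>\<^sub>F n in sequentially. f x * complex_of_real (c n x) + complex_of_real (c' n x) * F x = s n x"
      proof -
        have "\<forall>\<^sub>F n in sequentially. \<bar>x\<bar> \<le> real (Suc n)"
          using eventually_ge_at_top[of "nat \<lceil>\<bar>x\<bar>\<rceil>"] by eventually_elim linarith
        then show ?thesis by eventually_elim (auto simp: s_def indicator_def)
      qed
      ultimately show "(\<lambda>n. s n x) \<longlonglongrightarrow> f x" by (rule Lim_transform_eventually)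
    qed
  qed measurable
  then show ?thesis using s_zero by (simp add: LIMSEQ_const_iff)
qed

lemma ac_cong: "ac F f \<Longrightarrow> (\<And>x. f x = g x) \<Longrightarrow> ac F g"
  by (metis ext)

section \<open>Integration by parts against test functions; weak derivatives have absolutely
  continuous primitives\<close>

lemma L2_compact_support:
  assumes f: "continuous_on UNIV f" and z: "\<And>x::real. R \<le> \<bar>x\<bar> \<Longrightarrow> f x = 0"
  shows "f \<in> L2 lborel"
proof -
  have "set_integrable lborel {-R..R} (\<lambda>x. (cmod (f x))\<^sup>2)"
    by (intro borel_integrable_atLeastAtMost' continuous_intros continuous_on_subset[OF f]) auto
  moreover have "(\<lambda>x. indicator {-R..R} x *\<^sub>R (cmod (f x))\<^sup>2) = (\<lambda>x. (cmod (f x))\<^sup>2)"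
  proof
    fix x show "indicator {-R..R} x *\<^sub>R (cmod (f x))\<^sup>2 = (cmod (f x))\<^sup>2"
      using z[of x] by (cases "x \<in> {-R..R}") (auto simp: abs_le_iff)
  qed
  ultimately show ?thesis
    using borel_measurable_continuous_onI[OF f] by (simp add: L2_def set_integrable_def)
qed

lemma test_ac:
  assumes "\<phi> \<in> test_functions"
  shows "ac (\<lambda>x. complex_of_real (\<phi> x)) (\<lambda>x. complex_of_real (deriv \<phi> x))"
    "(\<lambda>x. complex_of_real (\<phi> x)) \<in> L2 lborel" "(\<lambda>x. complex_of_real (deriv \<phi> x)) \<in> L2 lborel"
proof -
  obtain R where R: "\<And>x. R \<le> \<bar>x\<bar> \<Longrightarrow> \<phi> x = 0" "\<And>x. R \<le> \<bar>x\<bar> \<Longrightarrow> deriv \<phi> x = 0"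
    "\<And>x. (\<phi> has_real_derivative deriv \<phi> x) (at x)" "continuous_on UNIV (deriv \<phi>)" "continuous_on UNIV \<phi>"
    by (rule test_functionD[OF assms]) (rule that)
  show "ac (\<lambda>x. complex_of_real (\<phi> x)) (\<lambda>x. complex_of_real (deriv \<phi> x))" by (rule ac_of_real[OF R(3,4)])
  show "(\<lambda>x. complex_of_real (\<phi> x)) \<in> L2 lborel"
    by (rule L2_compact_support[of _ R]) (intro continuous_intros R, simp add: R)
  show "(\<lambda>x. complex_of_real (deriv \<phi> x)) \<in> L2 lborel"
    by (rule L2_compact_support[of _ R]) (intro continuous_intros R, simp add: R)
qed

lemma ac_test_ibp:
  assumes "ac u v" "\<phi> \<in> test_functions"
  shows "(LINT x|lborel. v x * complex_of_real (\<phi> x) + complex_of_real (deriv \<phi> x) * u x) = 0"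
proof -
  obtain R where R: "0 < R" "\<And>x. R \<le> \<bar>x\<bar> \<Longrightarrow> \<phi> x = 0" "\<And>x. R \<le> \<bar>x\<bar> \<Longrightarrow> deriv \<phi> x = 0"
    by (rule test_functionD[OF assms(2)]) (rule that)
  show ?thesis
    by (rule ac_compact_support[OF ac_mult[OF assms(1) test_ac(1)[OF assms(2)]], of R]) (simp_all add: R)
qed

lemma loc_int_times_compact:
  assumes "loc_int f" "continuous_on UNIV g" "\<And>x. R \<le> \<bar>x\<bar> \<Longrightarrow> g x = 0"
  shows "integrable lborel (\<lambda>x. f x * g x)"
proof -
  have "(\<lambda>x. indicator {-R..R} x *\<^sub>R (f x * g x)) = (\<lambda>x. f x * g x)"
  proof
    fix x show "indicator {-R..R} x *\<^sub>R (f x * g x) = f x * g x"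
      using assms(3)[of x] by (cases "x \<in> {-R..R}"; cases "R \<le> \<bar>x\<bar>") (auto simp: abs_le_iff)
  qed
  then show ?thesis
    using loc_intD(1)[OF loc_int_mult_cont[OF assms(1,2)], of "-R" R] by (simp add: set_integrable_def)
qed

lemma loc_int_times_test:
  assumes "loc_int f" "\<phi> \<in> test_functions"
  shows "integrable lborel (\<lambda>x. f x * complex_of_real (\<phi> x))"
    "integrable lborel (\<lambda>x. f x * complex_of_real (deriv \<phi> x))"
proof -
  obtain R where R: "\<And>x. R \<le> \<bar>x\<bar> \<Longrightarrow> \<phi> x = 0" "\<And>x. R \<le> \<bar>x\<bar> \<Longrightarrow> deriv \<phi> x = 0"
    "continuous_on UNIV (deriv \<phi>)" "continuous_on UNIV \<phi>"
    by (rule test_functionD[OF assms(2)]) (rule that)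
  show "integrable lborel (\<lambda>x. f x * complex_of_real (\<phi> x))"
    by (rule loc_int_times_compact[OF assms(1), of _ R]) (intro continuous_intros R, simp add: R)
  show "integrable lborel (\<lambda>x. f x * complex_of_real (deriv \<phi> x))"
    by (rule loc_int_times_compact[OF assms(1), of _ R]) (intro continuous_intros R, simp add: R)
qed

lemma ac_has_weak_deriv:
  assumes "ac u v" "u \<in> L2 lborel" "v \<in> L2 lborel"
  shows "has_weak_deriv u v"
  unfolding has_weak_deriv_def
proof (intro conjI ballI assms(2,3))
  fix \<phi> assume t: "\<phi> \<in> test_functions"
  have "(LINT x|lborel. v x * complex_of_real (\<phi> x)) + (LINT x|lborel. u x * complex_of_real (deriv \<phi> x)) = 0"
    using ac_test_ibp[OF assms(1) t] loc_int_times_test[OF L2_loc_int[OF assms(2)] t]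
      loc_int_times_test[OF L2_loc_int[OF assms(3)] t] by (simp add: mult.commute)
  then show "(LINT x|lborel. u x * complex_of_real (deriv \<phi> x)) = - (LINT x|lborel. v x * complex_of_real (\<phi> x))"
    by (simp add: eq_neg_iff_add_eq_0 add.commute)
qed

lemma primitive_ac:
  assumes "loc_int v"
  obtains w where "ac w v"
proof -
  \<comment> \<open>One of the two intervals is empty or a single point, so this is the signed
    integral from 0 to x.\<close>
  define w where "w x = integral {0..x} v - integral {x..0} v" for x :: real
  have int: "v integrable_on {a..b}" for a b
    by (rule set_borel_integral_eq_integral(1)[OF loc_intD(1)[OF assms]])
  have comb: "integral {a..c} v + integral {c..b} v = integral {a..b} v" if "a \<le> c" "c \<le> b" for a b c
    by (rule Henstock_Kurzweil_Integration.integral_combine[OF that int])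
  have empty: "integral {b..a} v = 0" if "a \<le> b" for a b :: real
    using that by (cases "a = b") auto
  have "w b - w a = (LINT x:{a..b}|lborel. v x)" if ab: "a \<le> b" for a b
  proof -
    consider "0 \<le> a" | "a \<le> 0" "0 \<le> b" | "b \<le> 0" by linarith
    then have "w b - w a = integral {a..b} v"
    proof cases
      case 1
      then show ?thesis using ab empty[of 0 a] empty[of 0 b] comb[of 0 a b] by (simp add: w_def algebra_simps)
    next
      case 2
      then show ?thesis using ab empty[of a 0] empty[of 0 b] comb[of a 0 b] by (simp add: w_def algebra_simps)
    next
      case 3
      then show ?thesis using ab empty[of a 0] empty[of b 0] comb[of a b 0] by (simp add: w_def algebra_simps)
    qed
    then show ?thesis using set_borel_integral_eq_integral(2)[OF loc_intD(1)[OF assms], of a b] by simp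
  qed
  then have "ac w v" using assms by (simp add: ac_def)
  then show ?thesis by (rule that)
qed

text \<open>Mean zero is exactly what makes the primitive of a test function vanish again to the
  right of its support.\<close>

lemma test_primitive:
  assumes "\<And>n. diffable n g" and z: "\<And>x. R \<le> \<bar>x\<bar> \<Longrightarrow> g x = 0" "0 < R" and total: "integral {- R - 1..R} g = 0"
  obtains \<Phi> where "\<Phi> \<in> test_functions" "deriv \<Phi> = g"
proof -
  \<comment> \<open>Starting one unit before the support makes every x >= - R interior to the
    interval on which the one-sided derivative of the integral is taken.\<close>
  define \<Phi> where "\<Phi> x = integral {- R - 1..x} g" for x
  have gc: "continuous_on UNIV g"
    using assms(1)[of "Suc 0"] by (rule diffable_SucE) (meson DERIV_isCont continuous_at_imp_continuous_on)
  have z1: "\<Phi> x = 0" if "x \<le> -R" for x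
  proof -
    have "\<Phi> x = integral {- R - 1..x} (\<lambda>x. 0)"
      unfolding \<Phi>_def using that z by (intro Henstock_Kurzweil_Integration.integral_cong) auto
    then show ?thesis by simp
  qed
  have z2: "\<Phi> x = 0" if "R \<le> x" for x
  proof -
    have "\<Phi> x = integral {- R - 1..R} g + integral {R..x} g"
      unfolding \<Phi>_def using that z(2)
      by (intro Henstock_Kurzweil_Integration.integral_combine[symmetric] integrable_continuous_real continuous_on_subset[OF gc]) auto
    also have "integral {R..x} g = integral {R..x} (\<lambda>x. 0)"
      using z by (intro Henstock_Kurzweil_Integration.integral_cong) auto
    finally show ?thesis using total by simp
  qed
  have der: "(\<Phi> has_real_derivative g x) (at x)" for x
  proof (cases "x < - R")
    case True
    have "((\<lambda>x. 0) has_real_derivative 0) (at x)" by simp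
    then have "(\<Phi> has_real_derivative 0) (at x)"
      by (rule has_field_derivative_transform_within_open[of _ _ _ "{..<-R}"]) (use True z1 in auto)
    then show ?thesis using z(1)[of x] True by simp
  next
    case False
    then have "(\<Phi> has_real_derivative g x) (at x within {- R - 1..x + 1})"
      unfolding \<Phi>_def[abs_def] by (intro integral_has_real_derivative continuous_on_subset[OF gc]) auto
    moreover have "at x within {- R - 1..x + 1} = at x"
      using False by (intro at_within_interior) auto
    ultimately show ?thesis by simp
  qed
  have "diffable n \<Phi>" for n by (rule diffable_Suc_imp[OF diffable_SucI[OF der assms(1)]])
  then have "\<Phi> \<in> test_functions"
    by (rule test_functionI[of _ "-R" R]) (use z1 z2 in force)
  moreover have "deriv \<Phi> = g" using der by (intro ext DERIV_imp_deriv)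
  ultimately show ?thesis by (rule that)
qed

lemma test_diffable: "\<phi> \<in> test_functions \<Longrightarrow> diffable n \<phi>"
  by (simp add: test_functions_def smooth_iff_diffable)

text \<open>Fix a test function \<theta> of integral 1 and let c be the integral of f * \<theta>.
  Any test function minus its integral times \<theta> has mean zero, hence is a derivative, and f
  integrates to 0 against it; so f - c integrates to 0 against every test function.\<close>

lemma du_bois_reymond:
  assumes f: "loc_int f" and zero: "\<And>\<phi>. \<phi> \<in> test_functions \<Longrightarrow> (LINT x|lborel. f x * complex_of_real (deriv \<phi> x)) = 0"
  obtains c where "AE x in lborel. f x = c"
proof -
  have tint: "integrable lborel \<psi>" if "\<psi> \<in> test_functions" for \<psi> :: "real \<Rightarrow> real"
    using loc_int_times_test(1)[OF loc_int_continuous[OF continuous_on_const[of UNIV 1]] that]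
      complex_of_real_integrable_eq[of lborel \<psi>] by simp
  have one: "loc_int (\<lambda>x. 1)" by (rule loc_int_continuous) (rule continuous_on_const)
  have "(\<lambda>n. LINT x|lborel. 1 * complex_of_real (bump 0 1 n x)) \<longlonglongrightarrow> (LINT x:{0<..<1::real}|lborel. 1)"
    by (rule bump_integral_tendsto[OF one])
  moreover have "(LINT x:{0<..<1::real}|lborel. (1::complex)) = 1"
    by (simp add: set_lebesgue_integral_def scaleR_conv_of_real)
  \<comment> \<open>The integrals of the bumps on (0, 1) tend to 1, so one of them is nonzero and
    can be normalised to give \<theta>.\<close>
  ultimately have "\<exists>n. (LINT x|lborel. 1 * complex_of_real (bump 0 1 n x)) \<noteq> 0"
    by (metis (no_types, lifting) LIMSEQ_const_iff ext zero_neq_one)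
  then obtain n where n: "(LINT x|lborel. bump 0 1 n x) \<noteq> 0" by auto
  define \<theta> where "\<theta> x = (1 / (LINT x|lborel. bump 0 1 n x)) * bump 0 1 n x" for x
  have \<theta>0: "\<theta> x = 0" if "1 \<le> \<bar>x\<bar>" for x using bump_outside[of x 0 1 n] that by (cases "x \<in> {0<..<1}") (auto simp: \<theta>_def)
  have \<theta>d: "diffable m \<theta>" for m unfolding \<theta>_def[abs_def] by (intro diffable_cmult diffable_bump)
  have \<theta>t: "\<theta> \<in> test_functions" by (rule test_functionI[OF \<theta>d, of "-1" 1]) (use \<theta>0 in force)
  have \<theta>1: "(LINT x|lborel. \<theta> x) = 1" using n by (simp add: \<theta>_def)
  define c where "c = (LINT x|lborel. f x * complex_of_real (\<theta> x))"
  have cl: "loc_int (\<lambda>x. c)" by (rule loc_int_continuous) (rule continuous_on_const)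
  have "AE x in lborel. f x - c = 0"
  proof (rule AE_zero_if_test[OF loc_int_diff[OF f cl]])
    fix \<psi> assume t: "\<psi> \<in> test_functions"
    obtain R0 where R0: "0 < R0" "\<And>x. R0 \<le> \<bar>x\<bar> \<Longrightarrow> \<psi> x = 0" by (rule test_functionD[OF t]) (rule that)
    define R where "R = max R0 1"
    have R: "0 < R" by (simp add: R_def)
    define I where "I = (LINT x|lborel. \<psi> x)"
    define g where "g x = \<psi> x + (- I) * \<theta> x" for x
    have gz: "g x = 0" if "R \<le> \<bar>x\<bar>" for x using that R0(2)[of x] \<theta>0[of x] by (simp add: g_def R_def)
    have gd: "diffable m g" for m unfolding g_def[abs_def] by (intro diffable_add diffable_cmult test_diffable t \<theta>t)
    have gi: "integrable lborel g" unfolding g_def[abs_def] using tint[OF t] tint[OF \<theta>t] by simp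
    have "(LINT x|lborel. g x) = 0"
      unfolding g_def using tint[OF t] tint[OF \<theta>t] by (simp add: \<theta>1 I_def)
    moreover have eq: "(\<lambda>x. indicator {- R - 1..R} x *\<^sub>R g x) = g"
    proof
      fix x show "indicator {- R - 1..R} x *\<^sub>R g x = g x"
        using gz[of x] by (cases "R \<le> \<bar>x\<bar>") (auto simp: indicator_def)
    qed
    moreover have "set_integrable lborel {- R - 1..R} g" unfolding set_integrable_def eq by (rule gi)
    ultimately have "integral {- R - 1..R} g = 0"
      using set_borel_integral_eq_integral(2)[of "{- R - 1..R}" g] by (simp add: set_lebesgue_integral_def)
    then obtain \<Phi> where \<Phi>: "\<Phi> \<in> test_functions" "deriv \<Phi> = g"
      using test_primitive[OF gd gz R] by blast
    have "(LINT x|lborel. f x * complex_of_real (g x)) = 0" using zero[OF \<Phi>(1)] \<Phi>(2) by simp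
    moreover have "(LINT x|lborel. f x * complex_of_real (g x)) =
        (LINT x|lborel. f x * complex_of_real (\<psi> x) - complex_of_real I * (f x * complex_of_real (\<theta> x)))"
      by (simp add: g_def algebra_simps)
    ultimately have "(LINT x|lborel. f x * complex_of_real (\<psi> x)) = complex_of_real I * c"
      using loc_int_times_test(1)[OF f t] loc_int_times_test(1)[OF f \<theta>t] by (simp add: c_def)
    then show "(LINT x|lborel. (f x - c) * complex_of_real (\<psi> x)) = 0"
      using loc_int_times_test(1)[OF f t] tint[OF t] by (simp add: left_diff_distrib I_def)
  qed
  then have "AE x in lborel. f x = c" by simp
  then show ?thesis by (rule that)
qed

text \<open>The difference of u and any primitive of its weak derivative has weak derivative 0, so
  it is constant by \<open>du_bois_reymond\<close>.\<close>

lemma weak_deriv_ac: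
  assumes "has_weak_deriv u v"
  obtains w where "ac w v" "AE x in lborel. u x = w x"
proof -
  have uv: "u \<in> L2 lborel" "v \<in> L2 lborel" using assms by (auto simp: has_weak_deriv_def)
  obtain w where w: "ac w v" by (rule primitive_ac[OF L2_loc_int[OF uv(2)]])
  have wl: "loc_int w" by (rule loc_int_continuous[OF ac_continuous[OF w]])
  obtain c where c: "AE x in lborel. u x - w x = c"
  proof (rule du_bois_reymond[OF loc_int_diff[OF L2_loc_int[OF uv(1)] wl]])
    fix \<phi> assume t: "\<phi> \<in> test_functions"
    have "(LINT x|lborel. v x * complex_of_real (\<phi> x)) + (LINT x|lborel. w x * complex_of_real (deriv \<phi> x)) = 0"
      using ac_test_ibp[OF w t] loc_int_times_test[OF wl t]
        loc_int_times_test[OF L2_loc_int[OF uv(2)] t] by (simp add: mult.commute)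
    moreover have "(LINT x|lborel. u x * complex_of_real (deriv \<phi> x)) = - (LINT x|lborel. v x * complex_of_real (\<phi> x))"
      using assms t by (simp add: has_weak_deriv_def)
    ultimately have "(LINT x|lborel. u x * complex_of_real (deriv \<phi> x)) = (LINT x|lborel. w x * complex_of_real (deriv \<phi> x))"
      by (metis add_eq_0_iff)
    then show "(LINT x|lborel. (u x - w x) * complex_of_real (deriv \<phi> x)) = 0"
      using loc_int_times_test[OF wl t] loc_int_times_test[OF L2_loc_int[OF uv(1)] t]
      by (simp add: left_diff_distrib)
  qed
  have "ac (\<lambda>x. w x + c) v" using w by (simp add: ac_def)
  moreover have "AE x in lborel. u x = w x + c" using c by eventually_elim (simp add: algebra_simps)
  ultimately show ?thesis by (rule that)
qed

section \<open>Representatives of elements of the Sobolev space\<close>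

lemma has_weak_deriv_unique:
  assumes "has_weak_deriv u v" "has_weak_deriv u v'"
  shows "AE x in lborel. v x = v' x"
proof -
  have L: "v \<in> L2 lborel" "v' \<in> L2 lborel" using assms by (auto simp: has_weak_deriv_def)
  have "AE x in lborel. v x - v' x = 0"
  proof (rule AE_zero_if_test)
    show "loc_int (\<lambda>x. v x - v' x)" by (intro loc_int_diff L2_loc_int L)
    fix \<phi> assume t: "\<phi> \<in> test_functions"
    have "(LINT x|lborel. v x * complex_of_real (\<phi> x)) = (LINT x|lborel. v' x * complex_of_real (\<phi> x))"
      using assms t by (simp add: has_weak_deriv_def)
    then show "(LINT x|lborel. (v x - v' x) * complex_of_real (\<phi> x)) = 0"
      using loc_int_times_test(1)[OF L2_loc_int[OF L(1)] t] loc_int_times_test(1)[OF L2_loc_int[OF L(2)] t]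
      by (simp add: left_diff_distrib)
  qed
  then show ?thesis by simp
qed

lemma has_weak_deriv_cong:
  assumes "has_weak_deriv u v" "AE x in lborel. u x = u' x" "u' \<in> L2 lborel"
  shows "has_weak_deriv u' v"
proof -
  have L: "u \<in> L2 lborel" "v \<in> L2 lborel" using assms by (auto simp: has_weak_deriv_def)
  have "(LINT x|lborel. u' x * complex_of_real (deriv \<phi> x)) = (LINT x|lborel. u x * complex_of_real (deriv \<phi> x))"
    if "\<phi> \<in> test_functions" for \<phi>
  proof (rule integral_cong_AE)
    show "AE x in lborel. u' x * complex_of_real (deriv \<phi> x) = u x * complex_of_real (deriv \<phi> x)"
      using assms(2) by eventually_elim simp
  qed (use loc_int_times_test(2)[OF L2_loc_int[OF L(1)] that] loc_int_times_test(2)[OF L2_loc_int[OF assms(3)] that] in simp_all)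
  then show ?thesis using assms(1,3) by (simp add: has_weak_deriv_def)
qed

lemma has_weak_deriv_weak_deriv:
  assumes "has_weak_deriv u v"
  shows "has_weak_deriv u (weak_deriv u)" "AE x in lborel. weak_deriv u x = v x"
proof -
  show 1: "has_weak_deriv u (weak_deriv u)" unfolding weak_deriv_def by (rule someI[of "has_weak_deriv u", OF assms])
  show "AE x in lborel. weak_deriv u x = v x" by (rule has_weak_deriv_unique[OF 1 assms])
qed

text \<open>Elements of \<open>H2\<close> and the chosen \<open>weak_deriv\<close> are fixed only up
  to null sets. The triple u0, v, w is a version with u0 and v continuous, on which
  \<open>ac_mult\<close> and the pointwise identities of the quadratic form can be used.\<close>

definition h2rep :: "(real \<Rightarrow> complex) \<Rightarrow> (real \<Rightarrow> complex) \<Rightarrow> (real \<Rightarrow> complex) \<Rightarrow> (real \<Rightarrow> complex) \<Rightarrow> bool" where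
  "h2rep u u0 v w \<longleftrightarrow> ac u0 v \<and> ac v w \<and> u \<in> L2 lborel \<and> u0 \<in> L2 lborel \<and> v \<in> L2 lborel \<and> w \<in> L2 lborel \<and>
    (AE x in lborel. u x = u0 x)"

lemma H2_h2rep:
  assumes "u \<in> H2"
  obtains u0 v w where "h2rep u u0 v w"
proof -
  obtain v w where vw: "has_weak_deriv u v" "has_weak_deriv v w" using assms by (auto simp: H2_def)
  have L: "u \<in> L2 lborel" "v \<in> L2 lborel" "w \<in> L2 lborel" using vw by (auto simp: has_weak_deriv_def)
  obtain v0 where v0: "ac v0 w" "AE x in lborel. v x = v0 x" by (rule weak_deriv_ac[OF vw(2)])
  obtain u0 where u0: "ac u0 v" "AE x in lborel. u x = u0 x" by (rule weak_deriv_ac[OF vw(1)])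
  have m: "v0 \<in> borel_measurable borel" "u0 \<in> borel_measurable borel"
    by (rule borel_measurable_continuous_onI[OF ac_continuous[OF v0(1)]],
        rule borel_measurable_continuous_onI[OF ac_continuous[OF u0(1)]])
  have v0L: "v0 \<in> L2 lborel" using v0(2) m by (intro L2_AE_cong[OF L(2)]) auto
  have u0L: "u0 \<in> L2 lborel" using u0(2) m by (intro L2_AE_cong[OF L(1)]) auto
  \<comment> \<open>Passing from v to its continuous version v0 changes no integral, and v0 is the
    version that has w as density.\<close>
  have "ac u0 v0"
    unfolding ac_def
  proof (intro conjI allI impI L2_loc_int[OF v0L])
    fix a b :: real assume "a \<le> b"
    have "(LINT x:{a..b}|lborel. v0 x) = (LINT x:{a..b}|lborel. v x)"
      unfolding set_lebesgue_integral_def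
    proof (rule integral_cong_AE)
      show "AE x in lborel. indicator {a..b} x *\<^sub>R v0 x = indicator {a..b} x *\<^sub>R v x"
        using v0(2) by eventually_elim simp
    qed (use m(1) L2D(1)[OF L(2)] in measurable)
    then show "u0 b - u0 a = (LINT x:{a..b}|lborel. v0 x)" using acD(2)[OF u0(1) \<open>a \<le> b\<close>] by simp
  qed
  then have "h2rep u u0 v0 w" using v0 u0 L v0L u0L by (simp add: h2rep_def)
  then show ?thesis by (rule that)
qed

lemma h2rep_H2:
  assumes "h2rep u u0 v w"
  shows "u \<in> H2" "AE x in lborel. weak_deriv (weak_deriv u) x = w x" "weak_deriv (weak_deriv u) \<in> L2 lborel"
proof -
  note r = assms[unfolded h2rep_def]
  have AE': "AE x in lborel. u0 x = u x" using r by (auto elim: eventually_mono)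
  have 1: "has_weak_deriv u v" using r by (intro has_weak_deriv_cong[OF ac_has_weak_deriv AE']) auto
  have 2: "has_weak_deriv v w" using r by (intro ac_has_weak_deriv) auto
  show "u \<in> H2" using 1 2 by (auto simp: H2_def)
  have "weak_deriv u \<in> L2 lborel" using has_weak_deriv_weak_deriv(1)[OF 1] by (simp add: has_weak_deriv_def)
  moreover have "AE x in lborel. v x = weak_deriv u x"
    using has_weak_deriv_weak_deriv(2)[OF 1] by (auto elim: eventually_mono)
  ultimately have 3: "has_weak_deriv (weak_deriv u) w" using has_weak_deriv_cong[OF 2] by blast
  show "AE x in lborel. weak_deriv (weak_deriv u) x = w x" by (rule has_weak_deriv_weak_deriv(2)[OF 3])
  show "weak_deriv (weak_deriv u) \<in> L2 lborel"
    using has_weak_deriv_weak_deriv(1)[OF 3] by (simp add: has_weak_deriv_def)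
qed

lemma h2rep_add_scale:
  assumes "h2rep u u0 v w" "h2rep u' u0' v' w'"
  shows "h2rep (\<lambda>x. u x + c * u' x) (\<lambda>x. u0 x + c * u0' x) (\<lambda>x. v x + c * v' x) (\<lambda>x. w x + c * w' x)"
proof -
  note r = assms[unfolded h2rep_def]
  have 1: "AE x in lborel. u x = u0 x" "AE x in lborel. u' x = u0' x" using r by auto
  then have "AE x in lborel. u x + c * u' x = u0 x + c * u0' x" by eventually_elim simp
  then show ?thesis using r by (auto simp: h2rep_def intro: ac_add_scale L2_add L2_scale)
qed

lemma h2rep_zero: "h2rep (\<lambda>x. 0) (\<lambda>x. 0) (\<lambda>x. 0) (\<lambda>x. 0)"
  by (auto simp: h2rep_def L2_zero intro!: ac_C1 derivative_eq_intros)

text \<open>There is no boundary term: the product v * cnj u' and its density are integrable as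
  products of L2 functions, so \<open>ac_integral_zero\<close> applies.\<close>

lemma ac_ip:
  assumes "ac v w" "ac u' v'" "v \<in> L2 lborel" "w \<in> L2 lborel" "u' \<in> L2 lborel" "v' \<in> L2 lborel"
  shows "ip lborel w u' = - ip lborel v v'"
proof -
  have 1: "integrable lborel (\<lambda>x. w x * cnj (u' x))" "integrable lborel (\<lambda>x. v x * cnj (v' x))"
    "integrable lborel (\<lambda>x. v x * cnj (u' x))" using assms by (auto intro: ip_integrable)
  have "(LINT x|lborel. w x * cnj (u' x) + cnj (v' x) * v x) = 0"
    by (rule ac_integral_zero[OF ac_mult[OF assms(1) ac_cnj[OF assms(2)]]])
      (use 1 in \<open>auto simp: mult.commute\<close>)
  then show ?thesis using 1 by (simp add: ip_def mult.commute eq_neg_iff_add_eq_0)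
qed

subsection \<open>The continuous Schroedinger operator\<close>

lemma integrable_exp_half_line:
  fixes c :: real
  assumes "0 < c"
  shows "integrable lborel (\<lambda>s. indicator {0..} s * exp (- c * s))"
proof -
  have "(\<integral>\<^sup>+s. ennreal (exp (- c * s)) * indicator {0..} s \<partial>lborel) = ennreal (0 - (- 1 / c * exp (- c * 0)))"
  proof (rule nn_integral_FTC_atLeast[where F = "\<lambda>s. - 1 / c * exp (- c * s)"])
    have "((\<lambda>s. exp (- (c * s))) \<longlongrightarrow> 0) at_top"
      using assms by (intro filterlim_compose[OF exp_at_bot] filterlim_compose[OF filterlim_uminus_at_bot_at_top]
          filterlim_tendsto_pos_mult_at_top[OF tendsto_const assms filterlim_ident])
    from tendsto_mult[OF tendsto_const this, of "- 1 / c"]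
    show "((\<lambda>s. - 1 / c * exp (- c * s)) \<longlongrightarrow> 0) at_top" by simp
  qed (use assms in \<open>auto intro!: derivative_eq_intros\<close>)
  then have fin: "(\<integral>\<^sup>+s. ennreal (exp (- c * s)) * indicator {0..} s \<partial>lborel) < \<infinity>" by simp
  have eq: "ennreal (norm (indicator {0..} s * exp (- c * s))) = ennreal (exp (- c * s)) * indicator {0..} s" for s
    by (auto simp: indicator_def)
  show ?thesis unfolding integrable_iff_bounded eq using fin by simp
qed

text \<open>Energy estimate: - \<epsilon> (|p|^2)' = 2 \<kappa> |p|^2 - 2 Re (f * cnj p) >= \<kappa>
  |p|^2 - |f|^2 / \<kappa>. Integration over [-n, n] bounds the integral of |p|^2 uniformly in n,
  since the boundary values of |p|^2 are at most B.\<close>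

lemma ac_square_integrable:
  assumes p: "ac p p'" and p': "\<And>x. p' x = complex_of_real (- \<epsilon> * \<kappa>) * p x + complex_of_real \<epsilon> * f x"
    and \<epsilon>: "\<epsilon> = 1 \<or> \<epsilon> = - 1" and \<kappa>: "0 < \<kappa>" and f: "f \<in> L2 lborel" and bd: "\<And>x. (cmod (p x))\<^sup>2 \<le> B"
  shows "p \<in> L2 lborel"
proof -
  have pm [measurable]: "p \<in> borel_measurable borel"
    by (rule borel_measurable_continuous_onI[OF ac_continuous[OF p]])
  define C where "C = 2 * B / \<kappa> + (LINT x|lborel. (cmod (f x))\<^sup>2) / \<kappa>\<^sup>2"
  let ?P = "\<lambda>n x. indicator {- real n..real n} x * (cmod (p x))\<^sup>2"
  have pint: "set_integrable lborel {a..b} (\<lambda>x. (cmod (p x))\<^sup>2)" for a b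
    by (intro borel_integrable_atLeastAtMost' continuous_intros continuous_on_subset[OF ac_continuous[OF p]]) auto
  have fint: "set_integrable lborel {a..b} (\<lambda>x. (cmod (f x))\<^sup>2)" for a b
    using L2D(2)[OF f] unfolding set_integrable_def by (intro integrable_mult_indicator) auto
  have bound: "(LINT x:{- real n..real n}|lborel. (cmod (p x))\<^sup>2) \<le> C" for n
  proof -
    let ?S = "{- real n..real n}"
    define q where "q x = p' x * cnj (p x) + cnj (p' x) * p x" for x
    have acq: "ac (\<lambda>x. p x * cnj (p x)) q" unfolding q_def[abs_def] by (rule ac_mult[OF p ac_cnj[OF p]])
    have q_le: "- \<epsilon> * Re (q x) \<ge> \<kappa> * (cmod (p x))\<^sup>2 - (cmod (f x))\<^sup>2 / \<kappa>" for x
    proof -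
      have "Re (q x) = 2 * Re (p' x * cnj (p x))"
        by (simp add: q_def)
      also have "Re (p' x * cnj (p x)) = - \<epsilon> * \<kappa> * (cmod (p x))\<^sup>2 + \<epsilon> * Re (f x * cnj (p x))"
        unfolding p' cmod_power2 by (simp add: power2_eq_square algebra_simps)
      finally have q: "Re (q x) = 2 * (- \<epsilon> * \<kappa> * (cmod (p x))\<^sup>2 + \<epsilon> * Re (f x * cnj (p x)))" .
      have 1: "- \<epsilon> * Re (q x) = 2 * \<kappa> * (cmod (p x))\<^sup>2 - 2 * Re (f x * cnj (p x))"
        unfolding q using \<epsilon> by (elim disjE) (simp_all add: distrib_left del: complex_cnj_mult times_complex.sel)
      have "Re (f x * cnj (p x)) \<le> cmod (f x) * cmod (p x)"
        using complex_Re_le_cmod[of "f x * cnj (p x)"] by (simp add: norm_mult)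
      moreover have "2 * cmod (f x) * cmod (p x) \<le> (cmod (f x))\<^sup>2 / \<kappa> + \<kappa> * (cmod (p x))\<^sup>2"
      proof -
        have "0 \<le> (cmod (f x) - \<kappa> * cmod (p x))\<^sup>2 / \<kappa>" using \<kappa> by simp
        also have "\<dots> = (cmod (f x))\<^sup>2 / \<kappa> + \<kappa> * (cmod (p x))\<^sup>2 - 2 * cmod (f x) * cmod (p x)"
          using \<kappa> by (simp add: power2_eq_square field_simps)
        finally show ?thesis by simp
      qed
      ultimately show ?thesis unfolding 1 by linarith
    qed
    have qint: "set_integrable lborel ?S (\<lambda>x. Re (q x))"
      using loc_intD(1)[OF acD(1)[OF acq], of "- real n" "real n"] unfolding set_integrable_def
      by (auto dest!: integrable_Re)
    have "(LINT x:?S|lborel. Re (q x)) = Re (LINT x:?S|lborel. q x)"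
      using loc_intD(1)[OF acD(1)[OF acq], of "- real n" "real n"]
      unfolding set_lebesgue_integral_def set_integrable_def by (simp flip: integral_Re)
    also have "\<dots> = (cmod (p (real n)))\<^sup>2 - (cmod (p (- real n)))\<^sup>2"
      using acD(2)[OF acq, of "- real n" "real n"] by (simp add: complex_mult_cnj cmod_power2)
    finally have "- \<epsilon> * (LINT x:?S|lborel. Re (q x)) \<le> 2 * B"
      using \<epsilon> bd[of "real n"] bd[of "- real n"] zero_le_power2[of "cmod (p (real n))"]
        zero_le_power2[of "cmod (p (- real n))"]
      by (elim disjE; simp del: zero_le_power2; linarith)
    moreover have "\<kappa> * (LINT x:?S|lborel. (cmod (p x))\<^sup>2) - (LINT x:?S|lborel. (cmod (f x))\<^sup>2) / \<kappa> \<le> - \<epsilon> * (LINT x:?S|lborel. Re (q x))"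
    proof -
      have "(LINT x:?S|lborel. \<kappa> * (cmod (p x))\<^sup>2 - (cmod (f x))\<^sup>2 / \<kappa>) \<le> (LINT x:?S|lborel. - \<epsilon> * Re (q x))"
      proof (rule set_integral_mono)
        show "set_integrable lborel ?S (\<lambda>x. - \<epsilon> * Re (q x))" by (intro set_integrable_mult_right qint)
        show "set_integrable lborel ?S (\<lambda>x. \<kappa> * (cmod (p x))\<^sup>2 - (cmod (f x))\<^sup>2 / \<kappa>)"
          using pint fint by (intro set_integral_diff set_integrable_mult_right set_integrable_divide)
      qed (rule q_le)
      then show ?thesis
        unfolding set_integral_mult_right using pint[of "- real n" "real n"] fint[of "- real n" "real n"] by simp
    qed
    moreover have "(LINT x:?S|lborel. (cmod (f x))\<^sup>2) \<le> (LINT x|lborel. (cmod (f x))\<^sup>2)"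
      unfolding set_lebesgue_integral_def using L2D(2)[OF f] fint[of "- real n" "real n"]
      by (intro integral_mono) (auto simp: set_integrable_def indicator_def)
    then have "(LINT x:?S|lborel. (cmod (f x))\<^sup>2) / \<kappa> \<le> (LINT x|lborel. (cmod (f x))\<^sup>2) / \<kappa>"
      using \<kappa> by (simp add: divide_right_mono)
    ultimately have "\<kappa> * (LINT x:?S|lborel. (cmod (p x))\<^sup>2) \<le> 2 * B + (LINT x|lborel. (cmod (f x))\<^sup>2) / \<kappa>" by linarith
    also have "\<dots> = \<kappa> * C" using \<kappa> by (simp add: C_def power2_eq_square field_simps)
    finally show ?thesis using \<kappa> by simp
  qed
  have Pint: "integrable lborel (?P n)" for n
    using pint[of "- real n" "real n"] by (simp add: set_integrable_def)
  have "incseq (\<lambda>n. LINT x|lborel. ?P n x)"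
    by (intro monoI integral_mono Pint) (auto simp: indicator_def)
  moreover have PB: "(LINT x|lborel. ?P n x) \<le> C" for n
    using bound[of n] by (simp add: set_lebesgue_integral_def)
  ultimately obtain L where L: "(\<lambda>n. LINT x|lborel. ?P n x) \<longlonglongrightarrow> L"
    using incseq_convergent by (metis (no_types, lifting))
  have "integrable lborel (\<lambda>x. (cmod (p x))\<^sup>2)"
  proof (rule integrable_monotone_convergence[OF Pint _ _ L])
    show "AE x in lborel. mono (\<lambda>n. ?P n x)" by (auto simp: mono_def indicator_def)
    show "AE x in lborel. (\<lambda>n. ?P n x) \<longlonglongrightarrow> (cmod (p x))\<^sup>2"
    proof (rule AE_I2)
      fix x
      have "\<forall>\<^sub>F n in sequentially. ?P n x = (cmod (p x))\<^sup>2"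
        using eventually_ge_at_top[of "nat \<lceil>\<bar>x\<bar>\<rceil>"]
      proof eventually_elim
        case (elim n)
        then have "x \<in> {- real n..real n}" by (auto simp: nat_le_iff) linarith+
        then show ?case by simp
      qed
      then show "(\<lambda>n. ?P n x) \<longlonglongrightarrow> (cmod (p x))\<^sup>2" by (rule tendsto_eventually)
    qed
  qed simp
  then show ?thesis by (simp add: L2_def)
qed

text \<open>Inverts \<kappa> + \<epsilon> d/dx by convolution with a one-sided exponential: p
  integrates exp (- \<kappa> |x - t|) f t over t <= x if \<epsilon> = 1 and over t >= x if
  \<epsilon> = -1. The kernel is written as g x so that p becomes an inner product, bounded
  uniformly in x by Cauchy-Schwarz.\<close>

lemma first_order_onto:
  assumes \<epsilon>: "\<epsilon> = 1 \<or> \<epsilon> = - 1" and \<kappa>: "0 < \<kappa>" and f: "f \<in> L2 lborel"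
  obtains p where "p \<in> L2 lborel" "ac p (\<lambda>x. complex_of_real (- \<epsilon> * \<kappa>) * p x + complex_of_real \<epsilon> * f x)"
proof -
  define g where "g x t = complex_of_real (indicator {0..} (\<epsilon> * (x - t)) * exp (- \<kappa> * (\<epsilon> * (x - t))))" for x t
  define k where "k s = indicator {0..} s * exp (- (2 * \<kappa>) * s)" for s :: real
  have [measurable]: "(\<lambda>t. g x t) \<in> borel_measurable borel" for x unfolding g_def by measurable
  have gk: "(cmod (g x t))\<^sup>2 = k (\<epsilon> * x + (- \<epsilon>) * t)" for x t
    by (simp add: g_def k_def indicator_def power2_eq_square algebra_simps flip: exp_add)
  have ki: "integrable lborel k" unfolding k_def[abs_def] using \<kappa> by (intro integrable_exp_half_line) simp
  have \<epsilon>0: "- \<epsilon> \<noteq> 0" using \<epsilon> by auto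
  have gL: "g x \<in> L2 lborel" for x
    unfolding L2_def using lborel_integrable_real_affine[OF ki \<epsilon>0, of "\<epsilon> * x"] by (simp add: gk)
  have gN: "(L2_norm lborel (g x))\<^sup>2 = (LINT s|lborel. k s)" for x
    using lborel_integral_real_affine[OF \<epsilon>0, of k "\<epsilon> * x"] \<epsilon> gL[of x]
    by (auto simp: L2_norm_def gk integral_nonneg_AE k_def)
  define p where "p x = ip lborel f (g x)" for x
  \<comment> \<open>Integrating factor: the x-dependence of the exponential cancels, leaving a plain
    indefinite integral of F.\<close>
  define W where "W x = complex_of_real (exp (\<epsilon> * \<kappa> * x)) * p x" for x
  define F where "F t = complex_of_real (exp (\<epsilon> * \<kappa> * t)) * f t" for t
  have Fl: "loc_int F"
    unfolding F_def[abs_def] mult.commute[of "complex_of_real _"]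
    by (intro loc_int_mult_cont L2_loc_int f continuous_intros)
  have gF: "complex_of_real (exp (\<epsilon> * \<kappa> * x)) * (f t * cnj (g x t)) = indicator {0..} (\<epsilon> * (x - t)) *\<^sub>R F t" for x t
  proof -
    have "exp (\<epsilon> * \<kappa> * x) * exp (- \<kappa> * (\<epsilon> * (x - t))) = exp (\<epsilon> * \<kappa> * t)"
      by (simp add: algebra_simps flip: exp_add)
    then have "complex_of_real (exp (\<epsilon> * \<kappa> * x)) * complex_of_real (exp (- \<kappa> * (\<epsilon> * (x - t)))) = complex_of_real (exp (\<epsilon> * \<kappa> * t))"
      by (metis of_real_mult)
    then show ?thesis by (auto simp: g_def F_def indicator_def mult_ac)
  qed
  have Wint: "integrable lborel (\<lambda>t. indicator {0..} (\<epsilon> * (x - t)) *\<^sub>R F t)" for x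
    unfolding gF[symmetric] using ip_integrable[OF f gL[of x]] by simp
  have W: "W x = (LINT t|lborel. indicator {0..} (\<epsilon> * (x - t)) *\<^sub>R F t)" for x
    unfolding gF[symmetric] by (simp add: W_def p_def ip_def)
  have acW: "ac W (\<lambda>t. complex_of_real \<epsilon> * F t)"
    unfolding ac_def
  proof (intro conjI allI impI)
    show "loc_int (\<lambda>t. complex_of_real \<epsilon> * F t)"
      using loc_int_mult_cont[OF Fl continuous_on_const[of UNIV "complex_of_real \<epsilon>"]] by (simp add: mult.commute)
    fix a b :: real assume ab: "a \<le> b"
    have "W b - W a = (LINT t|lborel. indicator {0..} (\<epsilon> * (b - t)) *\<^sub>R F t - indicator {0..} (\<epsilon> * (a - t)) *\<^sub>R F t)"
      unfolding W using Wint by simp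
    also have "\<dots> = (LINT t:{a..b}|lborel. complex_of_real \<epsilon> * F t)"
      unfolding set_lebesgue_integral_def
    proof (rule integral_cong_AE)
      show "AE t in lborel. indicator {0..} (\<epsilon> * (b - t)) *\<^sub>R F t - indicator {0..} (\<epsilon> * (a - t)) *\<^sub>R F t =
          indicator {a..b} t *\<^sub>R (complex_of_real \<epsilon> * F t)"
        using AE_lborel_singleton[of a] AE_lborel_singleton[of b]
        by eventually_elim (use \<epsilon> ab in \<open>auto simp: indicator_def\<close>)
    qed (use loc_intD(2)[OF Fl] in measurable)
    finally show "W b - W a = (LINT t:{a..b}|lborel. complex_of_real \<epsilon> * F t)" .
  qed
  have pW: "p x = W x * complex_of_real (exp (- \<epsilon> * \<kappa> * x))" for x
    unfolding W_def by (simp add: exp_minus mult_ac)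
  have ace: "ac (\<lambda>x. complex_of_real (exp (- \<epsilon> * \<kappa> * x))) (\<lambda>x. complex_of_real (- \<epsilon> * \<kappa> * exp (- \<epsilon> * \<kappa> * x)))"
    by (intro ac_of_real continuous_intros) (auto intro!: derivative_eq_intros)
  have "ac p (\<lambda>x. complex_of_real \<epsilon> * F x * complex_of_real (exp (- \<epsilon> * \<kappa> * x)) +
      complex_of_real (- \<epsilon> * \<kappa> * exp (- \<epsilon> * \<kappa> * x)) * W x)"
    using ac_mult[OF acW ace] by (simp only: pW[abs_def, symmetric])
  then have acp: "ac p (\<lambda>x. complex_of_real (- \<epsilon> * \<kappa>) * p x + complex_of_real \<epsilon> * f x)"
  proof (rule ac_cong)
    fix x
    have "F x * complex_of_real (exp (- \<epsilon> * \<kappa> * x)) = f x"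
      unfolding F_def by (simp add: exp_minus)
    then show "complex_of_real \<epsilon> * F x * complex_of_real (exp (- \<epsilon> * \<kappa> * x)) +
      complex_of_real (- \<epsilon> * \<kappa> * exp (- \<epsilon> * \<kappa> * x)) * W x = complex_of_real (- \<epsilon> * \<kappa>) * p x + complex_of_real \<epsilon> * f x"
      unfolding pW by (simp add: mult_ac)
  qed
  have "p \<in> L2 lborel"
  proof (rule ac_square_integrable[OF acp refl \<epsilon> \<kappa> f])
    show "(cmod (p x))\<^sup>2 \<le> (L2_norm lborel f)\<^sup>2 * (LINT s|lborel. k s)" for x
      using power_mono[OF ip_cauchy_schwarz[OF f gL[of x]], of 2] by (simp add: p_def power_mult_distrib gN)
  qed
  then show ?thesis using acp by (rule that)
qed

text \<open>Partial fractions: the inverse of \<kappa>^2 - d^2/dx^2 is the sum of the inverses of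
  \<kappa> + d/dx and \<kappa> - d/dx, divided by 2 \<kappa>. Then u' = (q - p) / 2.\<close>

lemma resolvent_free:
  assumes \<kappa>: "0 < \<kappa>" and f: "f \<in> L2 lborel"
  obtains u v where "h2rep u u v (\<lambda>x. complex_of_real (\<kappa>\<^sup>2) * u x - f x)"
proof -
  obtain p where p: "p \<in> L2 lborel" "ac p (\<lambda>x. complex_of_real (- 1 * \<kappa>) * p x + complex_of_real 1 * f x)"
    by (rule first_order_onto[of 1 \<kappa> f]) (use \<kappa> f in auto)
  obtain q where q: "q \<in> L2 lborel" "ac q (\<lambda>x. complex_of_real (- (- 1) * \<kappa>) * q x + complex_of_real (- 1) * f x)"
    by (rule first_order_onto[of "- 1" \<kappa> f]) (use \<kappa> f in auto)
  let ?k = "complex_of_real \<kappa>"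
  have k0: "?k \<noteq> 0" using \<kappa> by simp
  have c0: "ac (\<lambda>x. 0) (\<lambda>x. 0)" by (intro ac_C1) (auto intro!: derivative_eq_intros)
  \<comment> \<open>The summand 0 and the factors 1 and -1 bring all four functions into the shape f
    + c * g of \<open>ac_add_scale\<close>.\<close>
  define s where "s x = p x + 1 * q x" for x
  define r where "r x = p x + (- 1) * q x" for x
  define u where "u x = 0 + (1 / (2 * ?k)) * s x" for x
  define v where "v x = 0 + (- 1 / 2) * r x" for x
  have sL: "s \<in> L2 lborel" "r \<in> L2 lborel" unfolding s_def[abs_def] r_def[abs_def] by (intro L2_add L2_scale p q)+
  have uL: "u \<in> L2 lborel" "v \<in> L2 lborel" unfolding u_def[abs_def] v_def[abs_def] by (intro L2_add L2_scale L2_zero sL)+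
  have acu: "ac u v" unfolding u_def[abs_def] s_def
    by (rule ac_cong[OF ac_add_scale[OF c0 ac_add_scale[OF p(2) q(2)]]])
      (use k0 in \<open>simp add: v_def r_def field_simps\<close>)
  have acv: "ac v (\<lambda>x. complex_of_real (\<kappa>\<^sup>2) * u x - f x)" unfolding v_def[abs_def] r_def
    by (rule ac_cong[OF ac_add_scale[OF c0 ac_add_scale[OF p(2) q(2)]]])
      (use k0 in \<open>simp add: u_def s_def field_simps power2_eq_square\<close>)
  have "h2rep u u v (\<lambda>x. complex_of_real (\<kappa>\<^sup>2) * u x - f x)"
    using acu acv uL by (auto simp: h2rep_def intro!: L2_diff L2_scale f simp del: of_real_power)
  then show ?thesis by (rule that)
qed

section \<open>The operator with potential and its quadratic form\<close>

lemma P_c_h2rep: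
  assumes "h2rep u u0 v w"
  shows "AE x in lborel. P_c V h u x = - w x + complex_of_real (V (h * x)) * u0 x"
proof -
  have "AE x in lborel. u x = u0 x" using assms by (simp add: h2rep_def)
  with h2rep_H2(2)[OF assms] show ?thesis by eventually_elim (simp add: P_c_def)
qed

lemma ip_potential_sym:
  "ip M (\<lambda>x. complex_of_real (q x) * u x) u' = ip M u (\<lambda>x. complex_of_real (q x) * u' x)"
  unfolding ip_def by (intro Bochner_Integration.integral_cong) auto

context
  fixes V :: "real \<Rightarrow> real" and h B :: real
  assumes V: "continuous_on UNIV V" and V0: "\<And>x. 0 \<le> V x" and VB: "\<And>x. V x \<le> B"
begin

lemma V_L2: "u \<in> L2 lborel \<Longrightarrow> (\<lambda>x. complex_of_real (V (h * x)) * u x) \<in> L2 lborel"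
proof (rule L2_bounded_mult)
  show "(\<lambda>x. complex_of_real (V (h * x))) \<in> borel_measurable lborel"
    using borel_measurable_continuous_onI[OF V] by measurable
  show "cmod (complex_of_real (V (h * x))) \<le> B" for x using V0 VB by simp
qed

lemma P_c_operator: "l2_operator lborel H2 (P_c V h)"
proof
  fix u assume "u \<in> H2"
  then obtain u0 v w where r: "h2rep u u0 v w" by (rule H2_h2rep)
  then show "u \<in> L2 lborel" by (simp add: h2rep_def)
  then show "P_c V h u \<in> L2 lborel"
    unfolding P_c_def[abs_def] by (intro L2_add L2_uminus h2rep_H2(3)[OF r] V_L2)
next
  fix u u' c assume "u \<in> H2" "u' \<in> H2"
  obtain u0 v w where r: "h2rep u u0 v w" by (rule H2_h2rep[OF \<open>u \<in> H2\<close>])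
  obtain u0' v' w' where r': "h2rep u' u0' v' w'" by (rule H2_h2rep[OF \<open>u' \<in> H2\<close>])
  note s = h2rep_add_scale[OF r r', of c]
  show "(\<lambda>x. u x + c * u' x) \<in> H2" by (rule h2rep_H2(1)[OF s])
  show "AE x in lborel. P_c V h (\<lambda>x. u x + c * u' x) x = P_c V h u x + c * P_c V h u' x"
    using P_c_h2rep[OF s, of V h] P_c_h2rep[OF r, of V h] P_c_h2rep[OF r', of V h]
  proof eventually_elim
    case (elim x)
    show ?case unfolding elim by (simp add: algebra_simps)
  qed
qed (rule h2rep_H2(1)[OF h2rep_zero])

lemma P_c_ip:
  assumes r: "h2rep u u0 v w" and r': "h2rep u' u0' v' w'"
  shows "ip lborel (P_c V h u) u' = ip lborel v v' + ip lborel (\<lambda>x. complex_of_real (V (h * x)) * u0 x) u0'"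
proof -
  interpret l2_operator lborel H2 "P_c V h" by (rule P_c_operator)
  note n = r[unfolded h2rep_def] r'[unfolded h2rep_def]
  have "ip lborel (P_c V h u) u' = ip lborel (\<lambda>x. complex_of_real (V (h * x)) * u0 x + (- 1) * w x) u0'"
  proof (rule ip_cong_AE)
    show "AE x in lborel. P_c V h u x = complex_of_real (V (h * x)) * u0 x + (- 1) * w x"
      using P_c_h2rep[OF r, of V h] by eventually_elim simp
    show "AE x in lborel. u' x = u0' x" using n by simp
  next
    have L: "u0 \<in> L2 lborel" "u' \<in> L2 lborel" "u0' \<in> L2 lborel" "w \<in> L2 lborel" using n by auto
    show "P_c V h u \<in> borel_measurable lborel" by (intro L2D(1) T_L2 h2rep_H2(1)[OF r])
    show "u' \<in> borel_measurable lborel" "u0' \<in> borel_measurable lborel" by (intro L2D(1) L)+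
    show "(\<lambda>x. complex_of_real (V (h * x)) * u0 x + (- 1) * w x) \<in> borel_measurable lborel"
      by (intro L2D(1) L2_add L2_scale V_L2 L)
  qed
  also have "\<dots> = ip lborel (\<lambda>x. complex_of_real (V (h * x)) * u0 x) u0' + (- 1) * ip lborel w u0'"
    using n by (intro ip_add_scale V_L2) auto
  also have "ip lborel w u0' = - ip lborel v v'" using n by (intro ac_ip) auto
  finally show ?thesis by simp
qed

lemma P_c_form:
  assumes r: "h2rep u u0 v w"
  shows "Re (ip lborel (P_c V h u) u) = (LINT x|lborel. (cmod (v x))\<^sup>2 + V (h * x) * (cmod (u0 x))\<^sup>2)"
    "integrable lborel (\<lambda>x. (cmod (v x))\<^sup>2 + V (h * x) * (cmod (u0 x))\<^sup>2)"
    "(L2_norm lborel u)\<^sup>2 = (LINT x|lborel. (cmod (u0 x))\<^sup>2)"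
proof -
  note n = r[unfolded h2rep_def]
  have i: "integrable lborel (\<lambda>x. (cmod (v x))\<^sup>2)" using n by (intro L2D(2)) auto
  have eq: "complex_of_real (V (h * x)) * u0 x * cnj (u0 x) = complex_of_real (V (h * x) * (cmod (u0 x))\<^sup>2)" for x
    by (simp add: complex_norm_square mult.assoc del: of_real_power)
  have "integrable lborel (\<lambda>x. complex_of_real (V (h * x) * (cmod (u0 x))\<^sup>2))"
    unfolding eq[symmetric] using n by (intro ip_integrable V_L2) auto
  then have i2: "integrable lborel (\<lambda>x. V (h * x) * (cmod (u0 x))\<^sup>2)"
    by (simp only: complex_of_real_integrable_eq)
  show "integrable lborel (\<lambda>x. (cmod (v x))\<^sup>2 + V (h * x) * (cmod (u0 x))\<^sup>2)" using i i2 by simp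
  have "ip lborel (\<lambda>x. complex_of_real (V (h * x)) * u0 x) u0 = complex_of_real (LINT x|lborel. V (h * x) * (cmod (u0 x))\<^sup>2)"
    unfolding ip_def eq by (rule integral_complex_of_real)
  then show "Re (ip lborel (P_c V h u) u) = (LINT x|lborel. (cmod (v x))\<^sup>2 + V (h * x) * (cmod (u0 x))\<^sup>2)"
    unfolding P_c_ip[OF r r] using i i2 by (simp add: ip_self L2_norm_def del: of_real_power)
  have "L2_norm lborel u = L2_norm lborel u0" using n by (intro L2_norm_cong_AE L2D(1)) auto
  then show "(L2_norm lborel u)\<^sup>2 = (LINT x|lborel. (cmod (u0 x))\<^sup>2)" by (simp add: L2_norm_def)
qed

end

text \<open>The free operator shifted by \<mu> is onto and bounded below by \<mu>, while
  multiplication by the potential has norm at most B < \<mu>; \<open>onto_perturb\<close> combines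
  the two.\<close>

lemma P_c_onto:
  fixes V :: "real \<Rightarrow> real"
  assumes V: "continuous_on UNIV V" and V0: "\<And>x. 0 \<le> V x" and VB: "\<And>x. V x \<le> B" and B: "0 < B" "B < \<mu>"
  shows "onto lborel H2 (\<lambda>u x. P_c V h u x - complex_of_real (- \<mu>) * u x)"
proof -
  have op0: "l2_operator lborel H2 (P_c (\<lambda>_. 0) h)" by (rule P_c_operator[of _ 0]) auto
  interpret l2_operator lborel H2 "\<lambda>u x. P_c (\<lambda>_. 0) h u x - complex_of_real (- \<mu>) * u x"
    by (rule l2_operator.shift[OF op0])
  have "onto lborel H2 (\<lambda>u x. (P_c (\<lambda>_. 0) h u x - complex_of_real (- \<mu>) * u x) + complex_of_real (V (h * x)) * u x)"
  proof (rule onto_perturb[where c = \<mu> and b = B])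
    show "onto lborel H2 (\<lambda>u x. P_c (\<lambda>_. 0) h u x - complex_of_real (- \<mu>) * u x)"
      unfolding onto_def
    proof
      fix f :: "real \<Rightarrow> complex" assume f: "f \<in> L2 lborel"
      obtain u v where r: "h2rep u u v (\<lambda>x. complex_of_real ((sqrt \<mu>)\<^sup>2) * u x - f x)"
        by (rule resolvent_free[OF _ f, of "sqrt \<mu>"]) (use B in auto)
      have "AE x in lborel. P_c (\<lambda>_. 0) h u x - complex_of_real (- \<mu>) * u x = f x"
        using P_c_h2rep[OF r, of "\<lambda>_. 0" h] by eventually_elim (use B in simp)
      then show "\<exists>u\<in>H2. AE x in lborel. P_c (\<lambda>_. 0) h u x - complex_of_real (- \<mu>) * u x = f x"
        using h2rep_H2(1)[OF r] by blast
    qed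
  next
    fix u assume u: "u \<in> H2"
    obtain u0 v w where r: "h2rep u u0 v w" by (rule H2_h2rep[OF u])
    show "(\<lambda>x. complex_of_real (V (h * x)) * u x) \<in> L2 lborel" by (rule V_L2[OF V V0 VB D_L2[OF u]])
    show "L2_norm lborel (\<lambda>x. complex_of_real (V (h * x)) * u x) \<le> B * L2_norm lborel u"
    proof (rule L2_norm_bounded_mult[OF D_L2[OF u]])
      show "(\<lambda>x. complex_of_real (V (h * x))) \<in> borel_measurable lborel"
        using borel_measurable_continuous_onI[OF V] by measurable
      show "cmod (complex_of_real (V (h * x))) \<le> B" for x using V0 VB by simp
    qed (use B in simp)
    let ?S = "\<lambda>x. P_c (\<lambda>_. 0) h u x - complex_of_real (- \<mu>) * u x"
    have "0 \<le> Re (ip lborel (P_c (\<lambda>_. 0) h u) u)"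
      using P_c_form(1)[of "\<lambda>_. 0" 0, OF _ _ _ r, of h] by (simp add: integral_nonneg_AE)
    moreover have "ip lborel ?S u = ip lborel (P_c (\<lambda>_. 0) h u) u + complex_of_real \<mu> * ip lborel u u"
      using ip_add_scale[OF l2_operator.T_L2[OF op0 u] D_L2[OF u] D_L2[OF u], of "complex_of_real \<mu>"] by simp
    ultimately have "\<mu> * (L2_norm lborel u)\<^sup>2 \<le> Re (ip lborel ?S u)"
      by (simp add: ip_self del: of_real_power)
    also have "\<dots> \<le> cmod (ip lborel ?S u)" by (rule complex_Re_le_cmod)
    also have "\<dots> \<le> L2_norm lborel ?S * L2_norm lborel u" by (intro ip_cauchy_schwarz T_L2 D_L2 u)
    finally have "(\<mu> * L2_norm lborel u) * L2_norm lborel u \<le> L2_norm lborel ?S * L2_norm lborel u"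
      by (simp add: power2_eq_square mult.assoc)
    then show "\<mu> * L2_norm lborel u \<le> L2_norm lborel ?S"
      by (cases "L2_norm lborel u = 0") (simp_all add: mult_le_cancel_right order.strict_iff_order)
  qed (use B in \<open>simp_all add: algebra_simps\<close>)
  moreover have "(\<lambda>u x. (P_c (\<lambda>_. 0) h u x - complex_of_real (- \<mu>) * u x) + complex_of_real (V (h * x)) * u x) =
      (\<lambda>u x. P_c V h u x - complex_of_real (- \<mu>) * u x)" by (simp add: P_c_def fun_eq_iff)
  ultimately show ?thesis by (simp only:)
qed

lemma P_c_nonneg_operator:
  fixes V :: "real \<Rightarrow> real"
  assumes V: "continuous_on UNIV V" and V0: "\<And>x. 0 \<le> V x" and VB: "\<And>x. V x \<le> B"
  shows "nonneg_operator lborel H2 (P_c V h)"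
proof -
  note VV = V V0 VB
  interpret l2_operator lborel H2 "P_c V h" by (rule P_c_operator[OF VV])
  show ?thesis
  proof
    fix u u' assume "u \<in> H2" "u' \<in> H2"
    obtain u0 v w where r: "h2rep u u0 v w" by (rule H2_h2rep[OF \<open>u \<in> H2\<close>])
    obtain u0' v' w' where r': "h2rep u' u0' v' w'" by (rule H2_h2rep[OF \<open>u' \<in> H2\<close>])
    have "ip lborel u (P_c V h u') = cnj (ip lborel (P_c V h u') u)" by (rule ip_sym)
    also have "\<dots> = cnj (ip lborel v' v) + cnj (ip lborel (\<lambda>x. complex_of_real (V (h * x)) * u0' x) u0)"
      unfolding P_c_ip[OF VV r' r] by simp
    also have "\<dots> = ip lborel v v' + ip lborel u0 (\<lambda>x. complex_of_real (V (h * x)) * u0' x)"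
      using ip_sym[of lborel v v'] ip_sym[of lborel u0] by simp
    also have "\<dots> = ip lborel (P_c V h u) u'"
      unfolding P_c_ip[OF VV r r'] ip_potential_sym[where M = lborel and q = "\<lambda>x. V (h * x)"] ..
    finally show "ip lborel (P_c V h u) u' = ip lborel u (P_c V h u')" by simp
  next
    fix u assume "u \<in> H2"
    then obtain u0 v w where r: "h2rep u u0 v w" by (rule H2_h2rep)
    show "0 \<le> Re (ip lborel (P_c V h u) u)"
      unfolding P_c_form(1)[OF VV r] using V0 by (intro integral_nonneg_AE AE_I2) simp
  next
    \<comment> \<open>A nonzero element of \<open>H2\<close> is produced by the free resolvent from
      an indicator: if it vanished almost everywhere, so would its weak derivatives and then the
      indicator.\<close>
    obtain p where p: "p \<in> L2 lborel" "p = (\<lambda>x. complex_of_real (indicator {0..1::real} x))" using L2_indicator by blast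
    obtain u v where r: "h2rep u u v (\<lambda>x. complex_of_real (1\<^sup>2) * u x - p x)"
      by (rule resolvent_free[OF _ p(1), of 1]) auto
    have "L2_norm lborel u \<noteq> 0"
    proof
      assume "L2_norm lborel u = 0"
      then have z: "AE x in lborel. u x = 0" using r by (intro L2_norm_eq_0) (auto simp: h2rep_def)
      have wk: "has_weak_deriv u v" "has_weak_deriv v (\<lambda>x. complex_of_real (1\<^sup>2) * u x - p x)"
        using r by (auto simp: h2rep_def intro: ac_has_weak_deriv)
      have wk0: "has_weak_deriv (\<lambda>x. 0) v" by (rule has_weak_deriv_cong[OF wk(1) z L2_zero])
      have h0: "has_weak_deriv (\<lambda>x. 0) (\<lambda>x. 0)" by (simp add: has_weak_deriv_def L2_zero)
      have v0: "AE x in lborel. v x = 0" by (rule has_weak_deriv_unique[OF wk0 h0])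
      have "AE x in lborel. complex_of_real (1\<^sup>2) * u x - p x = 0"
        by (rule has_weak_deriv_unique[OF has_weak_deriv_cong[OF wk(2) v0 L2_zero] h0])
      with z have "AE x in lborel. p x = 0" by eventually_elim simp
      then have "AE x in lborel. x \<notin> {0..1::real}" by eventually_elim (auto simp: p(2))
      then have "{0..1::real} \<in> null_sets lborel" by (subst AE_iff_null_sets) auto
      then show False by (auto dest: null_setsD1)
    qed
    then show "\<exists>u\<in>H2. L2_norm lborel u \<noteq> 0" using h2rep_H2(1)[OF r] by blast
  next
    have "0 \<le> B" using V0[of 0] VB[of 0] by simp
    then show "\<exists>\<mu>0. \<forall>\<mu>\<ge>\<mu>0. onto lborel H2 (\<lambda>u x. P_c V h u x - complex_of_real (- \<mu>) * u x)"
      \<comment> \<open>\<open>P_c_onto\<close> wants a strictly positive bound of the potential,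
        hence B + 1, and B + 2 lies above it.\<close>
      using add_increasing2[OF zero_le_one VB] by (intro exI[of _ "B + 2"] allI impI P_c_onto[OF V V0, of "B + 1"]) auto
  qed
qed

text \<open>Barta-type lower bound: \<open>g = \<psi>' / \<psi>\<close> for a positive supersolution \<open>\<psi>\<close>, and
  \<open>0 \<le> \<bar>u' - g u\<bar>\<^sup>2\<close>.\<close>

lemma P_c_form_ge:
  fixes V :: "real \<Rightarrow> real"
  assumes V: "continuous_on UNIV V" and V0: "\<And>x. 0 \<le> V x" and VB: "\<And>x. V x \<le> B"
    and g: "\<And>x. (g has_real_derivative g' x) (at x)" "continuous_on UNIV g'" "\<And>x. \<bar>g x\<bar> \<le> C" "\<And>x. \<bar>g' x\<bar> \<le> C"
    and E: "\<And>x. E \<le> V (h * x) - (g x)\<^sup>2 - g' x"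
    and u: "u \<in> H2"
  shows "E * (L2_norm lborel u)\<^sup>2 \<le> Re (ip lborel (P_c V h u) u)"
proof -
  obtain u0 v w where r: "h2rep u u0 v w" by (rule H2_h2rep[OF u])
  note n = r[unfolded h2rep_def]
  note form = P_c_form[OF V V0 VB r]
  have gc: "continuous_on UNIV g" using g(1) by (intro continuous_at_imp_continuous_on ballI DERIV_isCont)
  have [measurable]: "g \<in> borel_measurable borel" "g' \<in> borel_measurable borel"
    using borel_measurable_continuous_onI[OF gc] borel_measurable_continuous_onI[OF g(2)] by auto
  \<comment> \<open>The density f of g |u0|^2 contains the cross term of |v - g u0|^2, and its
    integral over the line is 0.\<close>
  define F where "F x = complex_of_real (g x) * (u0 x * cnj (u0 x))" for x
  define f where "f x = complex_of_real (g' x) * (u0 x * cnj (u0 x)) +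
    (v x * cnj (u0 x) + cnj (v x) * u0 x) * complex_of_real (g x)" for x
  have acF: "ac F f"
    unfolding F_def[abs_def] f_def[abs_def]
    by (intro ac_mult[OF ac_of_real[OF g(1,2)]] ac_mult ac_cnj) (use n in auto)
  have gu: "(\<lambda>x. complex_of_real (g x) * u0 x) \<in> L2 lborel" "(\<lambda>x. complex_of_real (g' x) * u0 x) \<in> L2 lborel"
    using n g(3,4) by (auto intro!: L2_bounded_mult[where B = C])
  have u0: "u0 \<in> L2 lborel" "v \<in> L2 lborel" using n by auto
  have i1: "integrable lborel F" unfolding F_def[abs_def] using ip_integrable[OF gu(1) u0(1)] by (simp add: mult.assoc)
  have i2: "integrable lborel f"
  proof -
    have "f = (\<lambda>x. complex_of_real (g' x) * u0 x * cnj (u0 x) + (v x * cnj (complex_of_real (g x) * u0 x) + complex_of_real (g x) * u0 x * cnj (v x)))"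
      by (auto simp: f_def algebra_simps)
    then show ?thesis using ip_integrable[OF gu(2) u0(1)] ip_integrable[OF u0(2) gu(1)] ip_integrable[OF gu(1) u0(2)] by simp
  qed
  have "(LINT x|lborel. f x) = 0" by (rule ac_integral_zero[OF acF i1 i2])
  then have zero: "(LINT x|lborel. Re (f x)) = 0" using i2 by simp
  have Ref: "integrable lborel (\<lambda>x. Re (f x))" using i2 by simp
  have iu: "integrable lborel (\<lambda>x. (cmod (u0 x))\<^sup>2)" using L2D(2)[OF u0(1)] .
  have "E * (cmod (u0 x))\<^sup>2 \<le> (cmod (v x))\<^sup>2 + V (h * x) * (cmod (u0 x))\<^sup>2 - Re (f x)" for x
  proof -
    have "0 \<le> (cmod (v x - complex_of_real (g x) * u0 x))\<^sup>2" by simp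
    also have "\<dots> = (cmod (v x))\<^sup>2 - Re (f x) + (g' x + (g x)\<^sup>2) * (cmod (u0 x))\<^sup>2"
      unfolding cmod_power2 f_def by (simp add: power2_eq_square algebra_simps)
    finally have 1: "0 \<le> (cmod (v x))\<^sup>2 - Re (f x) + (g' x + (g x)\<^sup>2) * (cmod (u0 x))\<^sup>2" .
    have "E * (cmod (u0 x))\<^sup>2 \<le> (V (h * x) - (g x)\<^sup>2 - g' x) * (cmod (u0 x))\<^sup>2"
      using E[of x] by (intro mult_right_mono) auto
    with 1 show ?thesis by (simp add: algebra_simps)
  qed
  then have "(LINT x|lborel. E * (cmod (u0 x))\<^sup>2) \<le> (LINT x|lborel. (cmod (v x))\<^sup>2 + V (h * x) * (cmod (u0 x))\<^sup>2 - Re (f x))"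
    using iu form(2) Ref by (intro integral_mono) auto
  then show ?thesis using form iu Ref zero by simp
qed

text \<open>A nonnegative compactly supported subsolution is its own trial function: multiply the
  inequality by y >= 0 and integrate.\<close>

lemma P_c_form_le:
  fixes V y y' y'' :: "real \<Rightarrow> real"
  assumes V: "continuous_on UNIV V" and V0: "\<And>x. 0 \<le> V x" and VB: "\<And>x. V x \<le> B"
    and y: "\<And>x. (y has_real_derivative y' x) (at x)" "\<And>x. (y' has_real_derivative y'' x) (at x)" "continuous_on UNIV y''"
    and supp: "\<And>x. R \<le> \<bar>x\<bar> \<Longrightarrow> y x = 0 \<and> y' x = 0 \<and> y'' x = 0"
    and nn: "\<And>x. 0 \<le> y x" "y z > 0"
    and sub: "\<And>x. - y'' x + V (h * x) * y x \<le> E * y x"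
  obtains u where "u \<in> H2" "L2_norm lborel u \<noteq> 0" "Re (ip lborel (P_c V h u) u) \<le> E * (L2_norm lborel u)\<^sup>2"
proof -
  define u where "u x = complex_of_real (y x)" for x
  define v where "v x = complex_of_real (y' x)" for x
  define w where "w x = complex_of_real (y'' x)" for x
  have yc: "continuous_on UNIV y" "continuous_on UNIV y'"
    using y by (auto intro!: continuous_at_imp_continuous_on DERIV_isCont)
  have L: "u \<in> L2 lborel" "v \<in> L2 lborel" "w \<in> L2 lborel"
    unfolding u_def[abs_def] v_def[abs_def] w_def[abs_def]
    by (rule L2_compact_support[of _ R]; (intro continuous_intros yc y(3))?; use supp in simp)+
  have r: "h2rep u u v w"
    using L unfolding h2rep_def u_def v_def w_def by (auto intro!: ac_of_real y yc)
  interpret l2_operator lborel H2 "P_c V h" by (rule P_c_operator[OF V V0 VB])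
  have uH: "u \<in> H2" by (rule h2rep_H2(1)[OF r])
  have "L2_norm lborel u \<noteq> 0"
  proof
    assume "L2_norm lborel u = 0"
    then have "AE x in lborel. u x = 0" by (rule L2_norm_eq_0[OF L(1)])
    then have AE0: "AE x in lborel. x \<notin> {x. y x > 0}" by eventually_elim (simp add: u_def)
    have op: "open {x. y x > 0}" using yc by (intro open_Collect_less continuous_intros)
    then obtain e where e: "e > 0" "ball z e \<subseteq> {x. y x > 0}" using nn(2) unfolding open_contains_ball by auto
    from AE0 have "AE x in lborel. x \<notin> {z - e<..<z + e}"
      by eventually_elim (use e in \<open>auto simp: ball_eq_greaterThanLessThan\<close>)
    then have "{z - e<..<z + e} \<in> null_sets lborel" by (subst AE_iff_null_sets) auto
    then show False using e(1) by (auto dest: null_setsD1)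
  qed
  moreover have "Re (ip lborel (P_c V h u) u) \<le> E * (L2_norm lborel u)\<^sup>2"
  proof -
    have "ip lborel (P_c V h u) u = ip lborel (\<lambda>x. complex_of_real (- y'' x + V (h * x) * y x)) u"
    proof (rule ip_cong_AE)
      show "AE x in lborel. P_c V h u x = complex_of_real (- y'' x + V (h * x) * y x)"
        using P_c_h2rep[OF r, of V h] by eventually_elim (simp add: u_def w_def)
      have "(\<lambda>x. - w x + complex_of_real (V (h * x)) * u x) \<in> L2 lborel"
        by (intro L2_add L2_uminus L V_L2[OF V V0 VB])
      from L2D(1)[OF this] show "(\<lambda>x. complex_of_real (- y'' x + V (h * x) * y x)) \<in> borel_measurable lborel"
        by (simp add: w_def u_def)
    qed (rule AE_I2 refl L2D(1)[OF T_L2[OF uH]] L2D(1)[OF L(1)])+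
    also have "\<dots> = complex_of_real (LINT x|lborel. (- y'' x + V (h * x) * y x) * y x)"
    proof -
      have "complex_of_real (- y'' x + V (h * x) * y x) * cnj (u x) = complex_of_real ((- y'' x + V (h * x) * y x) * y x)" for x
        by (simp add: u_def)
      then show ?thesis unfolding ip_def by (simp only: integral_complex_of_real)
    qed
    finally have eq: "Re (ip lborel (P_c V h u) u) = (LINT x|lborel. (- y'' x + V (h * x) * y x) * y x)" by simp
    have "integrable lborel (\<lambda>x. (- w x + complex_of_real (V (h * x)) * u x) * u x)"
      by (intro L2_mult_integrable L2_add L2_uminus L V_L2[OF V V0 VB])
    then have "integrable lborel (\<lambda>x. complex_of_real ((- y'' x + V (h * x) * y x) * y x))"
      by (simp add: u_def w_def)
    then have i1: "integrable lborel (\<lambda>x. (- y'' x + V (h * x) * y x) * y x)"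
      by (simp only: complex_of_real_integrable_eq)
    have i2: "integrable lborel (\<lambda>x. (y x)\<^sup>2)" using L2D(2)[OF L(1)] by (simp add: u_def)
    have "(LINT x|lborel. (- y'' x + V (h * x) * y x) * y x) \<le> (LINT x|lborel. E * (y x)\<^sup>2)"
      using i1 i2 mult_right_mono[OF sub nn(1)] by (intro integral_mono) (auto simp: power2_eq_square mult.assoc)
    then show ?thesis unfolding eq using i2 integral_nonneg_AE[where M = lborel and f = "\<lambda>x. (y x)\<^sup>2"]
      by (simp add: L2_norm_def u_def)
  qed
  ultimately show ?thesis using uH by (intro that)
qed

subsection \<open>The discrete Schroedinger operator\<close>

abbreviation cs :: "int measure" where "cs \<equiv> count_space UNIV"

lemma bij_shift: "bij_betw (\<lambda>\<gamma>::int. \<gamma> + k) UNIV UNIV"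
  by (rule bij_betwI[of _ _ _ "\<lambda>\<gamma>. \<gamma> - k"]) auto

lemma integrable_shift:
  fixes f :: "int \<Rightarrow> 'a::{banach, second_countable_topology}"
  shows "integrable cs f \<Longrightarrow> integrable cs (\<lambda>\<gamma>. f (\<gamma> + k))"
  using integrable_bij_count_space[OF bij_shift, of f k] by simp

lemma integral_shift:
  fixes f :: "int \<Rightarrow> 'a::{banach, second_countable_topology}"
  shows "(LINT \<gamma>|cs. f (\<gamma> + k)) = (LINT \<gamma>|cs. f \<gamma>)"
  by (rule integral_bij_count_space[OF bij_shift])

lemma L2_shift: "u \<in> L2 cs \<Longrightarrow> (\<lambda>\<gamma>. u (\<gamma> + k)) \<in> L2 cs"
  using integrable_shift[of "\<lambda>x. (cmod (u x))\<^sup>2" k] by (simp add: L2_def)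

lemma L2_norm_shift: "L2_norm cs (\<lambda>\<gamma>. u (\<gamma> + k)) = L2_norm cs u"
  unfolding L2_norm_def using integral_shift[of "\<lambda>x. (cmod (u x))\<^sup>2" k] by simp

lemma ip_shift_adjoint: "ip cs (\<lambda>\<gamma>. u (\<gamma> + k)) v = ip cs u (\<lambda>\<gamma>. v (\<gamma> + (- k)))"
  unfolding ip_def using integral_shift[of "\<lambda>\<gamma>. u \<gamma> * cnj (v (\<gamma> + (- k)))" k] by simp

lemma integrable_finite_support:
  fixes f :: "int \<Rightarrow> real"
  assumes "finite S" "\<And>x. x \<notin> S \<Longrightarrow> f x = 0"
  shows "integrable cs f"
proof -
  have "f = (\<lambda>x. \<Sum>a\<in>S. f a * indicator {a} x)"
  proof
    fix x show "f x = (\<Sum>a\<in>S. f a * indicator {a} x)"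
      using assms by (cases "x \<in> S") (auto simp: indicator_def sum.delta)
  qed
  moreover have "integrable cs (\<lambda>x. \<Sum>a\<in>S. f a * indicator {a} x)"
    by (intro Bochner_Integration.integrable_sum integrable_mult_right integrable_real_indicator) auto
  ultimately show ?thesis by simp
qed

context
  fixes V :: "real \<Rightarrow> real" and h B :: real
  assumes V0: "\<And>x. 0 \<le> V x" and VB: "\<And>x. V x \<le> B"
begin

lemma V_L2_d: "u \<in> L2 cs \<Longrightarrow> (\<lambda>\<gamma>. complex_of_real (V (h * of_int \<gamma>)) * u \<gamma>) \<in> L2 cs"
proof (rule L2_bounded_mult)
  show "cmod (complex_of_real (V (h * of_int \<gamma>))) \<le> B" for \<gamma> using V0 VB by simp
qed auto

text \<open>Differences appear as + (- 1) * ... so that \<open>L2_add\<close>,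
  \<open>L2_scale\<close> and \<open>ip_add_scale\<close> apply term by term.\<close>

lemma P_d_eq: "P_d V h u = (\<lambda>\<gamma>. (complex_of_real (V (h * of_int \<gamma>)) * u \<gamma> + 2 * u \<gamma>) + (- 1) * u (\<gamma> + 1) + (- 1) * u (\<gamma> + (- 1)))"
  by (auto simp: P_d_def)

lemma P_d_L2: "u \<in> L2 cs \<Longrightarrow> P_d V h u \<in> L2 cs"
  unfolding P_d_eq by (intro L2_add L2_scale V_L2_d L2_shift)

lemma P_d_operator: "l2_operator cs (L2 cs) (P_d V h)"
  by unfold_locales (auto intro: L2_add L2_scale L2_zero P_d_L2 simp: P_d_def algebra_simps)

lemma P_d_ip:
  assumes "u \<in> L2 cs" "v \<in> L2 cs"
  shows "ip cs (P_d V h u) v = ip cs (\<lambda>\<gamma>. complex_of_real (V (h * of_int \<gamma>)) * u \<gamma>) v + 2 * ip cs u v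
    - ip cs (\<lambda>\<gamma>. u (\<gamma> + 1)) v - ip cs (\<lambda>\<gamma>. u (\<gamma> + (- 1))) v"
proof -
  let ?V = "\<lambda>\<gamma>. complex_of_real (V (h * of_int \<gamma>)) * u \<gamma>"
  note L = V_L2_d[OF assms(1)] assms(1) L2_shift[OF assms(1)]
  have "ip cs (P_d V h u) v = ip cs (\<lambda>\<gamma>. (?V \<gamma> + 2 * u \<gamma>) + (- 1) * u (\<gamma> + 1)) v + (- 1) * ip cs (\<lambda>\<gamma>. u (\<gamma> + (- 1))) v"
    unfolding P_d_eq by (intro ip_add_scale L2_add L2_scale L assms)
  also have "ip cs (\<lambda>\<gamma>. (?V \<gamma> + 2 * u \<gamma>) + (- 1) * u (\<gamma> + 1)) v = ip cs (\<lambda>\<gamma>. ?V \<gamma> + 2 * u \<gamma>) v + (- 1) * ip cs (\<lambda>\<gamma>. u (\<gamma> + 1)) v"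
    by (intro ip_add_scale L2_add L2_scale L assms)
  also have "ip cs (\<lambda>\<gamma>. ?V \<gamma> + 2 * u \<gamma>) v = ip cs ?V v + 2 * ip cs u v"
    by (intro ip_add_scale L assms)
  finally show ?thesis by simp
qed

lemma P_d_symmetric:
  assumes "u \<in> L2 cs" "v \<in> L2 cs"
  shows "ip cs (P_d V h u) v = ip cs u (P_d V h v)"
proof -
  have pot: "ip cs (\<lambda>\<gamma>. complex_of_real (V (h * of_int \<gamma>)) * u \<gamma>) v = ip cs u (\<lambda>\<gamma>. complex_of_real (V (h * of_int \<gamma>)) * v \<gamma>)"
    unfolding ip_def by (intro Bochner_Integration.integral_cong) auto
  have "ip cs u (P_d V h v) = cnj (ip cs (P_d V h v) u)" by (rule ip_sym)
  also have "\<dots> = ip cs u (\<lambda>\<gamma>. complex_of_real (V (h * of_int \<gamma>)) * v \<gamma>) + 2 * ip cs u v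
    - ip cs u (\<lambda>\<gamma>. v (\<gamma> + 1)) - ip cs u (\<lambda>\<gamma>. v (\<gamma> + (- 1)))"
    unfolding P_d_ip[OF assms(2,1)] complex_cnj_add complex_cnj_diff complex_cnj_mult ip_sym[of cs u, symmetric] by simp
  finally show ?thesis
    unfolding P_d_ip[OF assms] pot using ip_shift_adjoint[of u 1 v] ip_shift_adjoint[of u "-1" v] by simp
qed

text \<open>Here \<open>r \<gamma> = \<psi> (\<gamma> + 1) / \<psi> \<gamma>\<close> for a positive
  supersolution \<open>\<psi>\<close>.\<close>

lemma P_d_form_ge:
  assumes r: "\<And>\<gamma>. 0 < r \<gamma>" "\<And>\<gamma>. r \<gamma> \<le> C" "\<And>\<gamma>. 1 / r \<gamma> \<le> C"
    and E: "\<And>\<gamma>. E \<le> 2 - r \<gamma> - 1 / r (\<gamma> - 1) + V (h * of_int \<gamma>)"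
    and u: "u \<in> L2 cs"
  shows "E * (L2_norm cs u)\<^sup>2 \<le> Re (ip cs (P_d V h u) u)"
proof -
  \<comment> \<open>Arithmetic-geometric mean on the bond from \<gamma> to \<gamma> + 1 with weight
    r \<gamma>: twice the real part of u (\<gamma> + 1) * cnj (u \<gamma>) is at most A \<gamma> + G
    (\<gamma> + 1).\<close>
  define A where "A \<gamma> = r \<gamma> * (cmod (u \<gamma>))\<^sup>2" for \<gamma>
  define G where "G \<gamma> = 1 / r (\<gamma> - 1) * (cmod (u \<gamma>))\<^sup>2" for \<gamma>
  have iu: "integrable cs (\<lambda>\<gamma>. (cmod (u \<gamma>))\<^sup>2)" using L2D(2)[OF u] .
  have iA: "integrable cs A"
  proof (rule Bochner_Integration.integrable_bound)
    show "integrable cs (\<lambda>\<gamma>. C * (cmod (u \<gamma>))\<^sup>2)" using iu by simp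
  qed (use r in \<open>auto simp: A_def abs_mult intro!: mult_right_mono order_trans[OF r(2) abs_ge_self] simp: less_imp_le\<close>)
  have iG: "integrable cs G"
  proof (rule Bochner_Integration.integrable_bound)
    show "integrable cs (\<lambda>\<gamma>. C * (cmod (u \<gamma>))\<^sup>2)" using iu by simp
    show "AE \<gamma> in cs. norm (G \<gamma>) \<le> norm (C * (cmod (u \<gamma>))\<^sup>2)"
    proof (rule AE_I2)
      fix \<gamma>
      have "1 / r (\<gamma> - 1) * (cmod (u \<gamma>))\<^sup>2 \<le> C * (cmod (u \<gamma>))\<^sup>2" using r(3) by (intro mult_right_mono) auto
      moreover have "0 \<le> 1 / r (\<gamma> - 1) * (cmod (u \<gamma>))\<^sup>2" using r(1)[of "\<gamma> - 1"] by simp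
      ultimately show "norm (G \<gamma>) \<le> norm (C * (cmod (u \<gamma>))\<^sup>2)" unfolding G_def by (simp only: real_norm_def)
    qed
  qed auto
  have iA': "integrable cs (\<lambda>\<gamma>. A (\<gamma> - 1))" and iG': "integrable cs (\<lambda>\<gamma>. G (\<gamma> + 1))"
    using integrable_shift[OF iA, of "-1"] integrable_shift[OF iG, of 1] by simp_all
  have sA: "(LINT \<gamma>|cs. A (\<gamma> - 1)) = (LINT \<gamma>|cs. A \<gamma>)" and sG: "(LINT \<gamma>|cs. G (\<gamma> + 1)) = (LINT \<gamma>|cs. G \<gamma>)"
    using integral_shift[of A "-1"] integral_shift[of G 1] by simp_all
  have cross: "Re (a * cnj b) \<le> (s * (cmod b)\<^sup>2 + 1 / s * (cmod a)\<^sup>2) / 2" if "0 < s" for a b s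
  proof -
    have "Re (a * cnj b) \<le> cmod a * cmod b"
      using complex_Re_le_cmod[of "a * cnj b"] by (simp add: norm_mult)
    moreover have "0 \<le> (s * cmod b - cmod a)\<^sup>2 / s" using that by simp
    then have "2 * (cmod a * cmod b) \<le> s * (cmod b)\<^sup>2 + 1 / s * (cmod a)\<^sup>2"
      using that by (simp add: power2_eq_square field_simps)
    ultimately show ?thesis by simp
  qed
  \<comment> \<open>Each bond contributes half to either end. The two half differences sum to zero
    over the lattice, which leaves E times the squared norm.\<close>
  have pt: "E * (cmod (u \<gamma>))\<^sup>2 + (A \<gamma> - A (\<gamma> - 1)) / 2 + (G \<gamma> - G (\<gamma> + 1)) / 2 \<le> Re (P_d V h u \<gamma> * cnj (u \<gamma>))" for \<gamma>
  proof -
    have "Re (u (\<gamma> + 1) * cnj (u \<gamma>)) \<le> (A \<gamma> + G (\<gamma> + 1)) / 2"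
      using cross[OF r(1), of "u (\<gamma> + 1)" "u \<gamma>" \<gamma>] by (simp add: A_def G_def)
    moreover have "Re (u (\<gamma> - 1) * cnj (u \<gamma>)) \<le> (G \<gamma> + A (\<gamma> - 1)) / 2"
    proof -
      have "0 < 1 / r (\<gamma> - 1)" using r(1) by simp
      from cross[OF this, of "u (\<gamma> - 1)" "u \<gamma>"] show ?thesis by (simp add: A_def G_def)
    qed
    moreover have "E * (cmod (u \<gamma>))\<^sup>2 \<le> (2 - r \<gamma> - 1 / r (\<gamma> - 1) + V (h * of_int \<gamma>)) * (cmod (u \<gamma>))\<^sup>2"
      using E[of \<gamma>] by (intro mult_right_mono) auto
    moreover have "(2 - r \<gamma> - 1 / r (\<gamma> - 1) + V (h * of_int \<gamma>)) * (cmod (u \<gamma>))\<^sup>2 =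
        (2 + V (h * of_int \<gamma>)) * (cmod (u \<gamma>))\<^sup>2 - A \<gamma> - G \<gamma>"
      by (simp add: A_def G_def algebra_simps)
    moreover have "Re (P_d V h u \<gamma> * cnj (u \<gamma>)) = (2 + V (h * of_int \<gamma>)) * (cmod (u \<gamma>))\<^sup>2
        - Re (u (\<gamma> + 1) * cnj (u \<gamma>)) - Re (u (\<gamma> - 1) * cnj (u \<gamma>))"
      unfolding P_d_def cmod_power2 by (simp add: power2_eq_square algebra_simps)
    moreover have "e + (a - a') / 2 + (g - g') / 2 \<le> P"
      if "x \<le> (a + g') / 2" "y \<le> (g + a') / 2" "e \<le> W" "W = b - a - g" "P = b - x - y" for P W x y a a' g g' e b :: real
      using that by argo
    ultimately show ?thesis by blast
  qed
  have iP: "integrable cs (\<lambda>\<gamma>. P_d V h u \<gamma> * cnj (u \<gamma>))" by (intro ip_integrable P_d_L2 u)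
  have "E * (L2_norm cs u)\<^sup>2 = (LINT \<gamma>|cs. E * (cmod (u \<gamma>))\<^sup>2 + (A \<gamma> - A (\<gamma> - 1)) / 2 + (G \<gamma> - G (\<gamma> + 1)) / 2)"
    using iu iA iG iA' iG' sA sG by (simp add: L2_norm_def)
  also have "\<dots> \<le> (LINT \<gamma>|cs. Re (P_d V h u \<gamma> * cnj (u \<gamma>)))"
    using iu iA iG iA' iG' iP pt by (intro integral_mono integrable_Re) auto
  also have "\<dots> = Re (ip cs (P_d V h u) u)" unfolding ip_def using iP by (rule integral_Re)
  finally show ?thesis .
qed

lemma P_d_form_le:
  fixes v :: "int \<Rightarrow> real"
  assumes "finite S" "\<And>\<gamma>. \<gamma> \<notin> S \<Longrightarrow> v \<gamma> = 0" and nn: "\<And>\<gamma>. 0 \<le> v \<gamma>" "v z > 0"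
    and sub: "\<And>\<gamma>. 2 * v \<gamma> - v (\<gamma> + 1) - v (\<gamma> - 1) + V (h * of_int \<gamma>) * v \<gamma> \<le> E * v \<gamma>"
  obtains u where "u \<in> L2 cs" "L2_norm cs u \<noteq> 0" "Re (ip cs (P_d V h u) u) \<le> E * (L2_norm cs u)\<^sup>2"
proof -
  define u where "u \<gamma> = complex_of_real (v \<gamma>)" for \<gamma>
  define Pv where "Pv \<gamma> = 2 * v \<gamma> - v (\<gamma> + 1) - v (\<gamma> - 1) + V (h * of_int \<gamma>) * v \<gamma>" for \<gamma>
  have i2: "integrable cs (\<lambda>\<gamma>. (v \<gamma>)\<^sup>2)" by (rule integrable_finite_support[OF assms(1)]) (simp add: assms(2))
  have iP: "integrable cs (\<lambda>\<gamma>. Pv \<gamma> * v \<gamma>)" by (rule integrable_finite_support[OF assms(1)]) (simp add: assms(2))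
  have uL: "u \<in> L2 cs" using i2 by (simp add: L2_def u_def)
  have "L2_norm cs u \<noteq> 0"
  proof
    assume "L2_norm cs u = 0"
    then have "AE \<gamma> in cs. u \<gamma> = 0" by (rule L2_norm_eq_0[OF uL])
    then show False using nn(2) by (simp add: AE_count_space u_def)
  qed
  moreover have "Re (ip cs (P_d V h u) u) \<le> E * (L2_norm cs u)\<^sup>2"
  proof -
    have eq: "P_d V h u \<gamma> * cnj (u \<gamma>) = complex_of_real (Pv \<gamma> * v \<gamma>)" for \<gamma>
      by (simp add: P_d_def u_def Pv_def)
    have "Re (ip cs (P_d V h u) u) = (LINT \<gamma>|cs. Pv \<gamma> * v \<gamma>)"
      unfolding ip_def eq integral_complex_of_real by simp
    also have "\<dots> \<le> (LINT \<gamma>|cs. E * (v \<gamma>)\<^sup>2)"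
      using i2 iP mult_right_mono[OF sub nn(1)] by (intro integral_mono) (auto simp: power2_eq_square mult.assoc Pv_def)
    also have "\<dots> = E * (L2_norm cs u)\<^sup>2"
      using integral_nonneg_AE[where M = cs and f = "\<lambda>x. (v x)\<^sup>2"] by (simp add: L2_norm_def u_def)
    finally show ?thesis .
  qed
  ultimately show ?thesis using uL by (intro that)
qed

lemma P_d_norm_le:
  assumes u: "u \<in> L2 cs" and "0 \<le> B"
  shows "L2_norm cs (P_d V h u) \<le> (4 + B) * L2_norm cs u"
proof -
  let ?V = "\<lambda>\<gamma>. complex_of_real (V (h * of_int \<gamma>)) * u \<gamma>"
  note L = V_L2_d[OF u] L2_scale[OF u, of 2] L2_scale[OF L2_shift[OF u, of 1], of "-1"] L2_scale[OF L2_shift[OF u, of "-1"], of "-1"]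
  have "L2_norm cs ?V \<le> B * L2_norm cs u"
    using V0 VB assms by (intro L2_norm_bounded_mult) auto
  moreover have "L2_norm cs (\<lambda>\<gamma>. ?V \<gamma> + 2 * u \<gamma>) \<le> L2_norm cs ?V + L2_norm cs (\<lambda>\<gamma>. 2 * u \<gamma>)"
    by (rule L2_norm_triangle[OF L(1,2)])
  moreover have "L2_norm cs (\<lambda>\<gamma>. (?V \<gamma> + 2 * u \<gamma>) + (- 1) * u (\<gamma> + 1)) \<le>
      L2_norm cs (\<lambda>\<gamma>. ?V \<gamma> + 2 * u \<gamma>) + L2_norm cs (\<lambda>\<gamma>. (- 1) * u (\<gamma> + 1))"
    by (rule L2_norm_triangle[OF L2_add[OF L(1,2)] L(3)])
  moreover have "L2_norm cs (P_d V h u) \<le> L2_norm cs (\<lambda>\<gamma>. (?V \<gamma> + 2 * u \<gamma>) + (- 1) * u (\<gamma> + 1)) +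
      L2_norm cs (\<lambda>\<gamma>. (- 1) * u (\<gamma> + (- 1)))"
    unfolding P_d_eq by (rule L2_norm_triangle[OF L2_add[OF L2_add[OF L(1,2)] L(3)] L(4)])
  moreover have "L2_norm cs (\<lambda>\<gamma>. 2 * u \<gamma>) = 2 * L2_norm cs u" by (simp add: L2_norm_scale)
  moreover have "L2_norm cs (\<lambda>\<gamma>. (- 1) * u (\<gamma> + 1)) = L2_norm cs u" "L2_norm cs (\<lambda>\<gamma>. (- 1) * u (\<gamma> + (- 1))) = L2_norm cs u"
    unfolding L2_norm_scale L2_norm_shift by simp_all
  moreover have "(4 + B) * L2_norm cs u = 4 * L2_norm cs u + B * L2_norm cs u" by (rule distrib_right)
  ultimately show ?thesis by linarith
qed

text \<open>On the lattice the whole operator is bounded, by 4 + B, so it is treated as a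
  perturbation of \<mu> times the identity.\<close>

lemma P_d_onto:
  assumes B: "0 \<le> B" "4 + B < \<mu>"
  shows "onto cs (L2 cs) (\<lambda>u x. P_d V h u x - complex_of_real (- \<mu>) * u x)"
proof -
  have op: "l2_operator cs (L2 cs) (\<lambda>u x. complex_of_real \<mu> * u x)"
    by unfold_locales (auto intro!: L2_add L2_zero L2_scale simp: distrib_left mult.left_commute)
  have "onto cs (L2 cs) (\<lambda>u x. complex_of_real \<mu> * u x + P_d V h u x)"
  proof (rule l2_operator.onto_perturb[OF op, where c = \<mu> and b = "4 + B"])
    show "onto cs (L2 cs) (\<lambda>u x. complex_of_real \<mu> * u x)"
      unfolding onto_def
    proof
      fix f assume "f \<in> L2 cs"
      then have "(\<lambda>x. (1 / complex_of_real \<mu>) * f x) \<in> L2 cs" by (rule L2_scale)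
      then show "\<exists>u\<in>L2 cs. AE x in cs. complex_of_real \<mu> * u x = f x"
        by (rule rev_bexI) (use B in simp)
    qed
    show "P_d V h u \<in> L2 cs" if "u \<in> L2 cs" for u by (rule P_d_L2[OF that])
    show "L2_norm cs (P_d V h u) \<le> (4 + B) * L2_norm cs u" if "u \<in> L2 cs" for u by (rule P_d_norm_le[OF that B(1)])
    show "P_d V h (\<lambda>x. u x + t * v x) x = P_d V h u x + t * P_d V h v x" for u v t x
      by (simp add: P_d_def algebra_simps)
  qed (use B in \<open>auto simp: L2_norm_scale\<close>)
  moreover have "(\<lambda>u x. complex_of_real \<mu> * u x + P_d V h u x) = (\<lambda>u x. P_d V h u x - complex_of_real (- \<mu>) * u x)"
    by (simp add: fun_eq_iff)
  ultimately show ?thesis by (simp only:)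
qed

lemma P_d_nonneg_operator: "nonneg_operator cs (L2 cs) (P_d V h)"
proof -
  have B: "0 \<le> B" using V0[of 0] VB[of 0] by simp
  interpret l2_operator cs "L2 cs" "P_d V h" by (rule P_d_operator)
  show ?thesis
  proof
    \<comment> \<open>The comparison function is constant here: ratio 1 and E = 0.\<close>
    show "0 \<le> Re (ip cs (P_d V h u) u)" if "u \<in> L2 cs" for u
      using P_d_form_ge[of "\<lambda>_. 1" 1 0, OF _ _ _ _ that] V0 by simp
    obtain u where "u \<in> L2 cs" "L2_norm cs u \<noteq> 0"
    proof (rule P_d_form_le[of "{0}" "\<lambda>\<gamma>. if \<gamma> = 0 then 1 else 0" 0 "2 + B"])
      show "2 * (if \<gamma> = 0 then 1 else 0) - (if \<gamma> + 1 = 0 then 1 else 0) - (if \<gamma> - 1 = 0 then 1 else 0) +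
         V (h * of_int \<gamma>) * (if \<gamma> = 0 then 1 else 0) \<le> (2 + B) * (if \<gamma> = 0 then 1 else 0)" for \<gamma> :: int
        using VB[of 0] by auto
    qed auto
    then show "\<exists>u\<in>L2 cs. L2_norm cs u \<noteq> 0" by blast
    show "\<exists>\<mu>0. \<forall>\<mu>\<ge>\<mu>0. onto cs (L2 cs) (\<lambda>u x. P_d V h u x - complex_of_real (- \<mu>) * u x)"
      using B by (intro exI[of _ "5 + B"] allI impI P_d_onto) auto
  qed (rule P_d_symmetric)
qed

end

subsection \<open>Approximate solutions of the Riccati equations near the well\<close>

text \<open>Formal WKB calculus in which \<open>y\<close> has weight 1 and \<open>h\<close> has weight 2: the predicate
  \<open>wt n f\<close> says that \<open>f\<close> only contains terms of weight at least \<open>n\<close>.\<close>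

definition wkb :: "(real \<times> real) filter" where
  "wkb = nhds 0 \<times>\<^sub>F at_right 0"

definition wt :: "nat \<Rightarrow> (real \<Rightarrow> real \<Rightarrow> real) \<Rightarrow> bool" where
  "wt n f \<longleftrightarrow> (\<exists>C. eventually (\<lambda>(y, h). \<bar>f y h\<bar> \<le> C * (\<bar>y\<bar> + sqrt h) ^ n) wkb)"

lemma wkb_eventually:
  "eventually P wkb \<longleftrightarrow> (\<exists>\<eta>>0. \<forall>y h. \<bar>y\<bar> \<le> \<eta> \<longrightarrow> 0 < h \<longrightarrow> h \<le> \<eta> \<longrightarrow> P (y, h))"
proof
  assume "eventually P wkb"
  then obtain A B where AB: "eventually A (nhds 0)" "eventually B (at_right 0)" "\<And>y h. A y \<Longrightarrow> B h \<Longrightarrow> P (y, h)"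
    unfolding wkb_def eventually_prod_filter by auto
  obtain r where r: "0 < r" "\<And>y. dist y 0 < r \<Longrightarrow> A y" using AB(1) unfolding eventually_nhds_metric by auto
  obtain s where s: "0 < s" "\<And>h. 0 < h \<Longrightarrow> h < s \<Longrightarrow> B h" using AB(2) unfolding eventually_at_right_field by auto
  show "\<exists>\<eta>>0. \<forall>y h. \<bar>y\<bar> \<le> \<eta> \<longrightarrow> 0 < h \<longrightarrow> h \<le> \<eta> \<longrightarrow> P (y, h)"
    using r s AB(3) by (intro exI[of _ "min (r / 2) (s / 2)"]) (auto simp: dist_real_def)
next
  assume "\<exists>\<eta>>0. \<forall>y h. \<bar>y\<bar> \<le> \<eta> \<longrightarrow> 0 < h \<longrightarrow> h \<le> \<eta> \<longrightarrow> P (y, h)"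
  then obtain \<eta> where \<eta>: "0 < \<eta>" "\<And>y h. \<bar>y\<bar> \<le> \<eta> \<Longrightarrow> 0 < h \<Longrightarrow> h \<le> \<eta> \<Longrightarrow> P (y, h)" by auto
  have "eventually (\<lambda>y. \<bar>y\<bar> \<le> \<eta>) (nhds 0)"
    unfolding eventually_nhds_metric using \<eta>(1) by (intro exI[of _ \<eta>]) (auto simp: dist_real_def)
  moreover have "eventually (\<lambda>h. 0 < h \<and> h \<le> \<eta>) (at_right 0)"
    unfolding eventually_at_right_field using \<eta>(1) by (intro exI[of _ \<eta>]) auto
  ultimately show "eventually P wkb"
    unfolding wkb_def eventually_prod_filter using \<eta>(2) by blast
qed

lemma wkb_pos: "eventually (\<lambda>(y, h). 0 < h) wkb"
  unfolding wkb_eventually by (auto intro: exI[of _ 1])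

lemma wkb_elim:
  assumes "eventually (\<lambda>(y, h). P y h) wkb" "\<And>y h. P y h \<Longrightarrow> R y h"
  shows "eventually (\<lambda>(y, h). R y h) wkb"
  using assms(1) by (rule eventually_mono) (use assms(2) in auto)

lemma wkb_elim2:
  assumes "eventually (\<lambda>(y, h). P y h) wkb" "eventually (\<lambda>(y, h). Q y h) wkb"
    "\<And>y h. P y h \<Longrightarrow> Q y h \<Longrightarrow> R y h"
  shows "eventually (\<lambda>(y, h). R y h) wkb"
  using assms(1,2) by (rule eventually_elim2) (use assms(3) in auto)

lemma wtI: "eventually (\<lambda>(y, h). \<bar>f y h\<bar> \<le> C * (\<bar>y\<bar> + sqrt h) ^ n) wkb \<Longrightarrow> wt n f"
  by (auto simp: wt_def)

lemma wtE:
  assumes "wt n f"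
  obtains C where "0 \<le> C" "eventually (\<lambda>(y, h). \<bar>f y h\<bar> \<le> C * (\<bar>y\<bar> + sqrt h) ^ n) wkb"
proof -
  obtain C where C: "eventually (\<lambda>(y, h). \<bar>f y h\<bar> \<le> C * (\<bar>y\<bar> + sqrt h) ^ n) wkb"
    using assms by (auto simp: wt_def)
  have "eventually (\<lambda>(y, h). \<bar>f y h\<bar> \<le> \<bar>C\<bar> * (\<bar>y\<bar> + sqrt h) ^ n) wkb"
    using C wkb_pos
  proof (rule wkb_elim2)
    fix y h :: real assume *: "\<bar>f y h\<bar> \<le> C * (\<bar>y\<bar> + sqrt h) ^ n" "0 < h"
    have "C * (\<bar>y\<bar> + sqrt h) ^ n \<le> \<bar>C\<bar> * (\<bar>y\<bar> + sqrt h) ^ n"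
      using *(2) by (intro mult_right_mono) auto
    with * show "\<bar>f y h\<bar> \<le> \<bar>C\<bar> * (\<bar>y\<bar> + sqrt h) ^ n" by linarith
  qed
  then show ?thesis by (intro that) auto
qed

lemma wt_add:
  assumes "wt n f" "wt n g"
  shows "wt n (\<lambda>y h. f y h + g y h)"
proof -
  obtain C D where "eventually (\<lambda>(y, h). \<bar>f y h\<bar> \<le> C * (\<bar>y\<bar> + sqrt h) ^ n) wkb"
    "eventually (\<lambda>(y, h). \<bar>g y h\<bar> \<le> D * (\<bar>y\<bar> + sqrt h) ^ n) wkb"
    using assms by (auto simp: wt_def)
  then have "eventually (\<lambda>(y, h). \<bar>f y h + g y h\<bar> \<le> (C + D) * (\<bar>y\<bar> + sqrt h) ^ n) wkb"
    by (rule wkb_elim2) (simp add: distrib_right)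
  then show ?thesis by (rule wtI)
qed

lemma wt_mult:
  assumes "wt m f" "wt n g"
  shows "wt (m + n) (\<lambda>y h. f y h * g y h)"
proof -
  obtain C where C: "0 \<le> C" "eventually (\<lambda>(y, h). \<bar>f y h\<bar> \<le> C * (\<bar>y\<bar> + sqrt h) ^ m) wkb" by (rule wtE[OF assms(1)])
  obtain E where E: "0 \<le> E" "eventually (\<lambda>(y, h). \<bar>g y h\<bar> \<le> E * (\<bar>y\<bar> + sqrt h) ^ n) wkb" by (rule wtE[OF assms(2)])
  have "eventually (\<lambda>(y, h). \<bar>f y h * g y h\<bar> \<le> C * E * (\<bar>y\<bar> + sqrt h) ^ (m + n)) wkb"
    using C(2) E(2)
  proof (rule wkb_elim2)
    fix y h :: real assume *: "\<bar>f y h\<bar> \<le> C * (\<bar>y\<bar> + sqrt h) ^ m" "\<bar>g y h\<bar> \<le> E * (\<bar>y\<bar> + sqrt h) ^ n"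
    have "\<bar>f y h\<bar> * \<bar>g y h\<bar> \<le> (C * (\<bar>y\<bar> + sqrt h) ^ m) * (E * (\<bar>y\<bar> + sqrt h) ^ n)"
      using * by (intro mult_mono order_trans[OF abs_ge_zero *(1)]) auto
    then show "\<bar>f y h * g y h\<bar> \<le> C * E * (\<bar>y\<bar> + sqrt h) ^ (m + n)"
      by (simp add: abs_mult power_add mult_ac)
  qed
  then show ?thesis by (rule wtI)
qed

lemma wt_mono:
  assumes "wt n f" "m \<le> n"
  shows "wt m f"
proof -
  obtain C where C: "0 \<le> C" "eventually (\<lambda>(y, h). \<bar>f y h\<bar> \<le> C * (\<bar>y\<bar> + sqrt h) ^ n) wkb" by (rule wtE[OF assms(1)])
  have "eventually (\<lambda>(y, h). \<bar>y\<bar> + sqrt h \<le> 1 \<and> 0 < h) wkb"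
    unfolding wkb_eventually
  proof (intro exI[of _ "1/4"] conjI allI impI)
    fix y h :: real assume "\<bar>y\<bar> \<le> 1/4" "0 < h" "h \<le> 1/4"
    then have "sqrt h \<le> sqrt (1/4)" by (intro real_sqrt_le_mono)
    also have "sqrt (1/4) = 1/2" by (simp add: real_sqrt_divide)
    finally show "case (y, h) of (y, h) \<Rightarrow> \<bar>y\<bar> + sqrt h \<le> 1 \<and> 0 < h" using \<open>\<bar>y\<bar> \<le> 1/4\<close> \<open>0 < h\<close> by simp
  qed simp
  with C(2) have "eventually (\<lambda>(y, h). \<bar>f y h\<bar> \<le> C * (\<bar>y\<bar> + sqrt h) ^ m) wkb"
  proof (rule wkb_elim2)
    fix y h :: real assume *: "\<bar>f y h\<bar> \<le> C * (\<bar>y\<bar> + sqrt h) ^ n" "\<bar>y\<bar> + sqrt h \<le> 1 \<and> 0 < h"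
    have "C * (\<bar>y\<bar> + sqrt h) ^ n \<le> C * (\<bar>y\<bar> + sqrt h) ^ m"
      using * C(1) assms(2) by (intro mult_left_mono power_decreasing) auto
    with *(1) show "\<bar>f y h\<bar> \<le> C * (\<bar>y\<bar> + sqrt h) ^ m" by linarith
  qed
  then show ?thesis by (rule wtI)
qed

lemma wt_const: "wt 0 (\<lambda>_ _. c)"
  using wkb_pos by (intro wtI[of _ "\<bar>c\<bar>"]) (rule wkb_elim, auto)

lemma wt_y: "wt 1 (\<lambda>y _. y)" and wt_h: "wt 2 (\<lambda>_ h. h)"
proof -
  have "eventually (\<lambda>(y, h). \<bar>y\<bar> \<le> 1 * (\<bar>y\<bar> + sqrt h) ^ 1) wkb"
    using wkb_pos by (rule wkb_elim) auto
  then show "wt 1 (\<lambda>y _. y)" by (rule wtI)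
  have "eventually (\<lambda>(y, h). \<bar>h\<bar> \<le> 1 * (\<bar>y\<bar> + sqrt h) ^ 2) wkb"
    using wkb_pos
  proof (rule wkb_elim)
    fix y h :: real assume "0 < h"
    then have "\<bar>h\<bar> = sqrt h ^ 2" by simp
    also have "\<dots> \<le> (\<bar>y\<bar> + sqrt h) ^ 2" using \<open>0 < h\<close> by (intro power_mono) auto
    finally show "\<bar>h\<bar> \<le> 1 * (\<bar>y\<bar> + sqrt h) ^ 2" by simp
  qed
  then show "wt 2 (\<lambda>_ h. h)" by (rule wtI)
qed

lemma wt_cmult: "wt n f \<Longrightarrow> wt n (\<lambda>y h. c * f y h)"
  using wt_mult[OF wt_const, of n f c] by simp

lemma wt_diff: "wt n f \<Longrightarrow> wt n g \<Longrightarrow> wt n (\<lambda>y h. f y h - g y h)"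
  using wt_add[OF _ wt_cmult[of n g "-1"], of f] by simp

lemma wt_power: "wt m f \<Longrightarrow> wt (k * m) (\<lambda>y h. f y h ^ k)"
  by (induction k) (auto intro: wt_mult wt_const[of 1, simplified])

lemma wt_monom: "wt (i + 2 * j) (\<lambda>y h. y ^ i * h ^ j)"
  using wt_mult[OF wt_power[OF wt_y, of i] wt_power[OF wt_h, of j]] by (simp add: mult.commute)

lemma wt_mult': "wt m f \<Longrightarrow> wt n g \<Longrightarrow> k \<le> m + n \<Longrightarrow> wt k (\<lambda>y h. f y h * g y h)"
  by (rule wt_mono[OF wt_mult])

lemma wt_monom': "n \<le> i + 2 * j \<Longrightarrow> wt n (\<lambda>y h. c * (y ^ i * h ^ j))"
  by (intro wt_cmult wt_mono[OF wt_monom])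

text \<open>Translates weight 6 back into explicit powers: (|y| + sqrt h)^6 is at most (2 max)^6 =
  64 max^6, and the maximum of y^6 and h^3 is at most their sum.\<close>

lemma wt_6_bound:
  assumes "wt 6 f"
  obtains C \<eta> where "0 \<le> C" "0 < \<eta>" "\<And>y h. \<bar>y\<bar> \<le> \<eta> \<Longrightarrow> 0 < h \<Longrightarrow> h \<le> \<eta> \<Longrightarrow> \<bar>f y h\<bar> \<le> C * (y ^ 6 + h ^ 3)"
proof -
  obtain C where C: "0 \<le> C" "eventually (\<lambda>(y, h). \<bar>f y h\<bar> \<le> C * (\<bar>y\<bar> + sqrt h) ^ 6) wkb" by (rule wtE[OF assms])
  obtain \<eta> where \<eta>: "0 < \<eta>" "\<And>y h. \<bar>y\<bar> \<le> \<eta> \<Longrightarrow> 0 < h \<Longrightarrow> h \<le> \<eta> \<Longrightarrow> \<bar>f y h\<bar> \<le> C * (\<bar>y\<bar> + sqrt h) ^ 6"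
    using C(2) unfolding wkb_eventually by auto
  have "\<bar>f y h\<bar> \<le> (64 * C) * (y ^ 6 + h ^ 3)" if "\<bar>y\<bar> \<le> \<eta>" "0 < h" "h \<le> \<eta>" for y h
  proof -
    let ?m = "max \<bar>y\<bar> (sqrt h)"
    have s6: "sqrt h ^ 6 = h ^ 3"
    proof -
      have "sqrt h ^ 6 = (sqrt h ^ 2) ^ 3" by (simp flip: power_mult)
      then show ?thesis using that by simp
    qed
    have "(\<bar>y\<bar> + sqrt h) ^ 6 \<le> (2 * ?m) ^ 6" using that by (intro power_mono) auto
    also have "\<dots> = 64 * ?m ^ 6" by (simp add: power_mult_distrib)
    also have "?m ^ 6 \<le> y ^ 6 + h ^ 3"
      using that s6 by (cases "\<bar>y\<bar> \<le> sqrt h") (auto simp: max_def)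
    finally have "C * (\<bar>y\<bar> + sqrt h) ^ 6 \<le> C * (64 * (y ^ 6 + h ^ 3))" using C(1) by (intro mult_left_mono) auto
    then show ?thesis using \<eta>(2)[OF that] by (simp add: mult_ac)
  qed
  with C(1) \<eta>(1) show ?thesis by (intro that[of "64 * C" \<eta>]) auto
qed

text \<open>All monomials of weight 1 to 4, grouped by weight; s, t and u mark the coefficients of
  h^0, h^1 and h^2, and the index is the power of y. Stopping at weight 4 leaves errors of weight 1
  + 5 in the square and 2 + 4 in h times the derivative.\<close>

definition pol :: "real \<Rightarrow> real \<Rightarrow> real \<Rightarrow> real \<Rightarrow> real \<Rightarrow> real \<Rightarrow> real \<Rightarrow> real \<Rightarrow> real \<Rightarrow> real \<Rightarrow> real" where
  "pol w s2 t0 s3 t1 s4 t2 u0 y h =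
    w * y + (s2 * y^2 + t0 * h) + (s3 * y^3 + t1 * h * y) + (s4 * y^4 + t2 * h * y^2 + u0 * h^2)"

definition pol' :: "real \<Rightarrow> real \<Rightarrow> real \<Rightarrow> real \<Rightarrow> real \<Rightarrow> real \<Rightarrow> real \<Rightarrow> real \<Rightarrow> real" where
  "pol' w s2 s3 t1 s4 t2 y h = w + 2 * s2 * y + (3 * s3 * y^2 + t1 * h) + (4 * s4 * y^3 + 2 * t2 * h * y)"

lemma pol_deriv: "((\<lambda>y. pol w s2 t0 s3 t1 s4 t2 u0 y h) has_real_derivative pol' w s2 s3 t1 s4 t2 y h) (at y)"
  unfolding pol_def pol'_def by (auto intro!: derivative_eq_intros simp: algebra_simps)

lemma wt_parts:
  "wt 1 (\<lambda>y h. w * y)" "wt 2 (\<lambda>y h. s2 * y^2 + t0 * h)" "wt 3 (\<lambda>y h. s3 * y^3 + t1 * h * y)"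
  "wt 4 (\<lambda>y h. s4 * y^4 + t2 * h * y^2 + u0 * h^2)"
  using wt_monom'[of 1 1 0 w] wt_add[OF wt_monom'[of 2 2 0 s2] wt_monom'[of 2 0 1 t0]]
    wt_add[OF wt_monom'[of 3 3 0 s3] wt_monom'[of 3 1 1 t1]]
    wt_add[OF wt_add[OF wt_monom'[of 4 4 0 s4] wt_monom'[of 4 2 1 t2]] wt_monom'[of 4 0 2 u0]]
  by (simp_all add: mult_ac)

text \<open>In weight 2, y^2 and h cancel by the choice of w. The eight equations are, in order, the
  vanishing coefficients of y^3, h y, y^4, h y^2, h^2, y^5, h y^3 and h^2 y. What remains are
  products of parts of total weight at least 6.\<close>

lemma riccati_c_residual:
  assumes U: "wt 6 (\<lambda>y h. U y - (w^2 * y^2 + b * y^3 + c * y^4 + e * y^5))"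
    and eqs: "b = 2 * w * s2" "s2 = w * t0" "c = s2^2 + 2 * w * s3" "3 * s3 = 2 * s2 * t0 + 2 * w * t1"
      "e2 = t1 - t0^2" "e = 2 * s2 * s3 + 2 * w * s4" "4 * s4 = 2 * s2 * t1 + 2 * t0 * s3 + 2 * w * t2"
      "t2 = t0 * t1 + w * u0"
  shows "wt 6 (\<lambda>y h. h * pol' w s2 s3 t1 s4 t2 y h - (pol w s2 t0 s3 t1 s4 t2 u0 y h)^2 + U y - (w * h + e2 * h^2))"
proof -
  define p1 p2 p3 p4 where "p1 y h = w * y" and "p2 y h = s2 * y^2 + t0 * h" and "p3 y h = s3 * y^3 + t1 * h * y"
    and "p4 y h = s4 * y^4 + t2 * h * y^2 + u0 * h^2" for y h :: real
  have p: "wt 1 p1" "wt 2 p2" "wt 3 p3" "wt 4 p4"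
    unfolding p1_def p2_def p3_def p4_def by (rule wt_parts)+
  have "h * pol' w s2 s3 t1 s4 t2 y h - (pol w s2 t0 s3 t1 s4 t2 u0 y h)^2 + U y - (w * h + e2 * h^2) =
    (U y - (w^2 * y^2 + b * y^3 + c * y^4 + e * y^5)) -
    (2 * (p2 y h * p4 y h) + p3 y h * p3 y h + 2 * (p3 y h * p4 y h) + p4 y h * p4 y h)" for y h
  proof -
    have "h * pol' w s2 s3 t1 s4 t2 y h - (pol w s2 t0 s3 t1 s4 t2 u0 y h)^2 + U y - (w * h + e2 * h^2) -
      ((U y - (w^2 * y^2 + b * y^3 + c * y^4 + e * y^5)) -
      (2 * (p2 y h * p4 y h) + p3 y h * p3 y h + 2 * (p3 y h * p4 y h) + p4 y h * p4 y h)) =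
      (b - 2 * w * s2) * y^3 + 2 * (s2 - w * t0) * h * y + (c - (s2^2 + 2 * w * s3)) * y^4 +
      (3 * s3 - (2 * s2 * t0 + 2 * w * t1)) * h * y^2 + (t1 - t0^2 - e2) * h^2 + (e - (2 * s2 * s3 + 2 * w * s4)) * y^5 +
      (4 * s4 - (2 * s2 * t1 + 2 * t0 * s3 + 2 * w * t2)) * h * y^3 + 2 * (t2 - (t0 * t1 + w * u0)) * h^2 * y"
      unfolding pol_def pol'_def p2_def p3_def p4_def by algebra
    also have "\<dots> = 0" using eqs by simp
    finally show ?thesis by simp
  qed
  moreover have "wt 6 (\<lambda>y h. (U y - (w^2 * y^2 + b * y^3 + c * y^4 + e * y^5)) -
    (2 * (p2 y h * p4 y h) + p3 y h * p3 y h + 2 * (p3 y h * p4 y h) + p4 y h * p4 y h))"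
    by (intro wt_diff U wt_add wt_cmult wt_mult'[OF p(2,4)] wt_mult'[OF p(3,3)] wt_mult'[OF p(3,4)] wt_mult'[OF p(4,4)]) auto
  ultimately show ?thesis by (simp only:)
qed

text \<open>The same eight monomials in the same order. The additional terms stem from the
  second-order part of p (y + h) - p y, namely s2 h^2 and 3 s3 h^2 y, and from the powers p^3 to p^5
  of the expansion of p^2 / (1 - p).\<close>

lemma riccati_d_residual:
  assumes U: "wt 6 (\<lambda>y h. U y - (w^2 * y^2 + b * y^3 + c * y^4 + e * y^5))"
    and eqs: "b = 2 * w * s2 + w^3" "s2 = w * t0" "c = s2^2 + 2 * w * s3 + 3 * w^2 * s2 + w^4"
      "3 * s3 = 2 * s2 * t0 + 2 * w * t1 + 3 * w^2 * t0"
      "e2 = s2 + t1 - t0^2" "e = 2 * s2 * s3 + 2 * w * s4 + 3 * w^2 * s3 + 3 * w * s2^2 + 4 * w^3 * s2 + w^5"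
      "4 * s4 = 2 * s2 * t1 + 2 * t0 * s3 + 2 * w * t2 + 3 * w^2 * t1 + 6 * w * s2 * t0 + 4 * w^3 * t0"
      "3 * s3 + 2 * t2 = 2 * t0 * t1 + 2 * w * u0 + 3 * w * t0^2"
  shows "wt 6 (\<lambda>y h. pol w s2 t0 s3 t1 s4 t2 u0 (y + h) h - pol w s2 t0 s3 t1 s4 t2 u0 y h
    - (pol w s2 t0 s3 t1 s4 t2 u0 y h)^2 / (1 - pol w s2 t0 s3 t1 s4 t2 u0 y h) + U y - (w * h + e2 * h^2))"
proof -
  define p1 p2 p3 p4 where "p1 y h = w * y" and "p2 y h = s2 * y^2 + t0 * h" and "p3 y h = s3 * y^3 + t1 * h * y"
    and "p4 y h = s4 * y^4 + t2 * h * y^2 + u0 * h^2" for y h :: real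
  define p where "p = pol w s2 t0 s3 t1 s4 t2 u0"
  define q where "q y h = p2 y h + p3 y h + p4 y h" for y h
  define r where "r y h = p3 y h + p4 y h" for y h
  have pe: "p y h = p1 y h + p2 y h + p3 y h + p4 y h" for y h
    by (simp add: p_def pol_def p1_def p2_def p3_def p4_def)
  have W: "wt 1 p1" "wt 2 p2" "wt 3 p3" "wt 4 p4"
    unfolding p1_def p2_def p3_def p4_def by (rule wt_parts)+
  have Wr: "wt 3 r" unfolding r_def by (intro wt_add W(3) wt_mono[OF W(4)]) simp
  have Wq: "wt 2 q" unfolding q_def by (intro wt_add W(2) wt_mono[OF W(3)] wt_mono[OF W(4)]) simp_all
  have Wp: "wt 1 p" unfolding pe[abs_def]
    by (intro wt_add W(1) wt_mono[OF W(2)] wt_mono[OF W(3)] wt_mono[OF W(4)]) simp_all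
  \<comment> \<open>The part of weight at least 6 in p^2 + p^3 + p^4 + p^5, one line for each power.
    In the last line q = p - p1, so it is p^5 - p1^5 factored.\<close>
  define T where "T y h = (2 * (p2 y h * p4 y h) + p3 y h * p3 y h + 2 * (p3 y h * p4 y h) + p4 y h * p4 y h) +
    (3 * (p1 y h ^ 2 * p4 y h) + 3 * (p1 y h * (2 * (p2 y h * r y h) + r y h ^ 2)) + q y h ^ 3) +
    (4 * (p1 y h ^ 3 * r y h) + 6 * (p1 y h ^ 2 * q y h ^ 2) + 4 * (p1 y h * q y h ^ 3) + q y h ^ 4) +
    q y h * (p y h ^ 4 + p y h ^ 3 * p1 y h + p y h ^ 2 * p1 y h ^ 2 + p y h * p1 y h ^ 3 + p1 y h ^ 4)" for y h
  \<comment> \<open>The part of weight at least 6 in p (y + h) - p y.\<close>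
  define Z where "Z y h = s3 * (y ^ 0 * h ^ 3) + 6 * s4 * (y ^ 2 * h ^ 2) + 4 * s4 * (y ^ 1 * h ^ 3) + s4 * (y ^ 0 * h ^ 4) + t2 * (y ^ 0 * h ^ 3)" for y h :: real
  note P = wt_power[OF W(1)] wt_power[OF Wq] wt_power[OF Wp] wt_power[OF Wr]
  have WT: "wt 6 T"
    unfolding T_def
    apply (intro wt_add wt_cmult)
    subgoal by (rule wt_mult'[OF W(2,4)]) simp
    subgoal by (rule wt_mult'[OF W(3,3)]) simp
    subgoal by (rule wt_mult'[OF W(3,4)]) simp
    subgoal by (rule wt_mult'[OF W(4,4)]) simp
    subgoal by (rule wt_mult'[OF P(1)[of 2] W(4)]) simp
    subgoal by (rule wt_mult'[OF W(1) wt_add[OF wt_cmult[OF wt_mult'[OF W(2) Wr order.refl]] wt_mono[OF P(4)[of 2]]]]) simp_all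
    subgoal by (rule wt_mono[OF P(2)[of 3]]) simp
    subgoal by (rule wt_mult'[OF P(1)[of 3] Wr]) simp
    subgoal by (rule wt_mult'[OF P(1)[of 2] P(2)[of 2]]) simp
    subgoal by (rule wt_mult'[OF W(1) P(2)[of 3]]) simp
    subgoal by (rule wt_mono[OF P(2)[of 4]]) simp
    apply (rule wt_mult'[OF Wq, of 4])
     apply (intro wt_add)
    subgoal by (rule wt_mono[OF P(3)[of 4]]) simp
    subgoal by (rule wt_mult'[OF P(3)[of 3] W(1)]) simp
    subgoal by (rule wt_mult'[OF P(3)[of 2] P(1)[of 2]]) simp
    subgoal by (rule wt_mult'[OF Wp P(1)[of 3]]) simp
    subgoal by (rule wt_mono[OF P(1)[of 4]]) simp
    by simp
  have WZ: "wt 6 Z" unfolding Z_def by (intro wt_add wt_monom') simp_all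
  have small: "eventually (\<lambda>(y, h). \<bar>p y h\<bar> \<le> 1 / 2) wkb"
  proof -
    obtain C where C: "0 \<le> C" "eventually (\<lambda>(y, h). \<bar>p y h\<bar> \<le> C * (\<bar>y\<bar> + sqrt h) ^ 1) wkb" by (rule wtE[OF Wp])
    define m where "m = 1 / (4 * (C + 1))"
    have m: "0 < m" "C * m \<le> 1 / 4" using C(1) by (auto simp: m_def field_simps)
    have "eventually (\<lambda>(y, h). \<bar>y\<bar> + sqrt h \<le> 2 * m) wkb"
      unfolding wkb_eventually
    proof (intro exI[of _ "min m (m\<^sup>2)"] conjI allI impI)
      fix y h :: real assume *: "\<bar>y\<bar> \<le> min m (m\<^sup>2)" "0 < h" "h \<le> min m (m\<^sup>2)"
      then have "sqrt h \<le> sqrt (m\<^sup>2)" by (intro real_sqrt_le_mono) simp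
      then show "case (y, h) of (y, h) \<Rightarrow> \<bar>y\<bar> + sqrt h \<le> 2 * m" using * m by simp
    qed (use m in simp)
    with C(2) show ?thesis
    proof (rule wkb_elim2)
      fix y h :: real assume *: "\<bar>p y h\<bar> \<le> C * (\<bar>y\<bar> + sqrt h) ^ 1" "\<bar>y\<bar> + sqrt h \<le> 2 * m"
      have "C * (\<bar>y\<bar> + sqrt h) \<le> C * (2 * m)" using *(2) C(1) by (rule mult_left_mono)
      then show "\<bar>p y h\<bar> \<le> 1 / 2" using *(1) m(2) by simp
    qed
  qed
  have W6: "wt 6 (\<lambda>y h. p y h ^ 6 / (1 - p y h))"
  proof -
    obtain C where C: "0 \<le> C" "eventually (\<lambda>(y, h). \<bar>p y h ^ 6\<bar> \<le> C * (\<bar>y\<bar> + sqrt h) ^ 6) wkb"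
      using wtE[OF P(3)[of 6]] by auto
    have "eventually (\<lambda>(y, h). \<bar>p y h ^ 6 / (1 - p y h)\<bar> \<le> (2 * C) * (\<bar>y\<bar> + sqrt h) ^ 6) wkb"
      using C(2) small
    proof (rule wkb_elim2)
      fix y h :: real assume *: "\<bar>p y h ^ 6\<bar> \<le> C * (\<bar>y\<bar> + sqrt h) ^ 6" "\<bar>p y h\<bar> \<le> 1 / 2"
      then have "1 / 2 \<le> \<bar>1 - p y h\<bar>" by linarith
      then have "\<bar>p y h ^ 6\<bar> / \<bar>1 - p y h\<bar> \<le> \<bar>p y h ^ 6\<bar> / (1 / 2)" by (intro divide_left_mono) auto
      then show "\<bar>p y h ^ 6 / (1 - p y h)\<bar> \<le> (2 * C) * (\<bar>y\<bar> + sqrt h) ^ 6" using *(1) by (simp add: abs_divide)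
    qed
    then show ?thesis by (rule wtI)
  qed
  \<comment> \<open>The geometric series is cut after p^5; its tail p^6 / (1 - p) is
    \<open>W6\<close>.\<close>
  have main: "p (y + h) h - p y h - (p y h ^ 2 + p y h ^ 3 + p y h ^ 4 + p y h ^ 5) + U y - (w * h + e2 * h^2) =
    (U y - (w^2 * y^2 + b * y^3 + c * y^4 + e * y^5)) + Z y h - T y h" for y h
  proof -
    have powers: "p y h ^ 2 + p y h ^ 3 + p y h ^ 4 + p y h ^ 5 = T y h + p1 y h ^ 2 + (2 * p1 y h * p2 y h + p1 y h ^ 3) +
        (p2 y h ^ 2 + 2 * p1 y h * p3 y h + 3 * p1 y h ^ 2 * p2 y h + p1 y h ^ 4) +
        (2 * p1 y h * p4 y h + 2 * p2 y h * p3 y h + 3 * p1 y h ^ 2 * p3 y h + 3 * p1 y h * p2 y h ^ 2 + 4 * p1 y h ^ 3 * p2 y h + p1 y h ^ 5)"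
      unfolding T_def q_def r_def pe by algebra
    have "p (y + h) h - p y h - (p1 y h ^ 2 + (2 * p1 y h * p2 y h + p1 y h ^ 3) +
        (p2 y h ^ 2 + 2 * p1 y h * p3 y h + 3 * p1 y h ^ 2 * p2 y h + p1 y h ^ 4) +
        (2 * p1 y h * p4 y h + 2 * p2 y h * p3 y h + 3 * p1 y h ^ 2 * p3 y h + 3 * p1 y h * p2 y h ^ 2 + 4 * p1 y h ^ 3 * p2 y h + p1 y h ^ 5))
        + (w^2 * y^2 + b * y^3 + c * y^4 + e * y^5) - (w * h + e2 * h^2) - Z y h =
      (b - (2 * w * s2 + w^3)) * y^3 + 2 * (s2 - w * t0) * h * y +
      (c - (s2^2 + 2 * w * s3 + 3 * w^2 * s2 + w^4)) * y^4 +
      (3 * s3 - (2 * s2 * t0 + 2 * w * t1 + 3 * w^2 * t0)) * h * y^2 + (s2 + t1 - t0^2 - e2) * h^2 +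
      (e - (2 * s2 * s3 + 2 * w * s4 + 3 * w^2 * s3 + 3 * w * s2^2 + 4 * w^3 * s2 + w^5)) * y^5 +
      (4 * s4 - (2 * s2 * t1 + 2 * t0 * s3 + 2 * w * t2 + 3 * w^2 * t1 + 6 * w * s2 * t0 + 4 * w^3 * t0)) * h * y^3 +
      (3 * s3 + 2 * t2 - (2 * t0 * t1 + 2 * w * u0 + 3 * w * t0^2)) * h^2 * y"
      unfolding p_def pol_def p1_def p2_def p3_def p4_def Z_def by algebra
    also have "\<dots> = 0" using eqs by simp
    finally show ?thesis unfolding powers by linarith
  qed
  have "wt 6 (\<lambda>y h. (U y - (w^2 * y^2 + b * y^3 + c * y^4 + e * y^5)) + Z y h - T y h - p y h ^ 6 / (1 - p y h))"
    by (intro wt_diff wt_add U WZ WT W6)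
  then obtain C where "eventually (\<lambda>(y, h). \<bar>(U y - (w^2 * y^2 + b * y^3 + c * y^4 + e * y^5)) + Z y h - T y h - p y h ^ 6 / (1 - p y h)\<bar> \<le>
    C * (\<bar>y\<bar> + sqrt h) ^ 6) wkb" by (auto simp: wt_def)
  then have "eventually (\<lambda>(y, h). \<bar>p (y + h) h - p y h - (p y h)^2 / (1 - p y h) + U y - (w * h + e2 * h^2)\<bar> \<le>
    C * (\<bar>y\<bar> + sqrt h) ^ 6) wkb"
    using small
  proof (rule wkb_elim2)
    fix y h :: real assume *: "\<bar>(U y - (w^2 * y^2 + b * y^3 + c * y^4 + e * y^5)) + Z y h - T y h - p y h ^ 6 / (1 - p y h)\<bar> \<le>
      C * (\<bar>y\<bar> + sqrt h) ^ 6" "\<bar>p y h\<bar> \<le> 1 / 2"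
    have ne: "1 - p y h \<noteq> 0" using *(2) by auto
    have "p y h ^ 2 / (1 - p y h) = p y h ^ 2 + p y h ^ 3 + p y h ^ 4 + p y h ^ 5 + p y h ^ 6 / (1 - p y h)"
      using ne by (simp add: divide_simps) algebra
    then show "\<bar>p (y + h) h - p y h - (p y h)^2 / (1 - p y h) + U y - (w * h + e2 * h^2)\<bar> \<le> C * (\<bar>y\<bar> + sqrt h) ^ 6"
      using *(1) main[of y h] by linarith
  qed
  then show ?thesis unfolding p_def by (rule wtI)
qed

text \<open>Both systems are triangular: each new unknown carries a nonzero multiple of a power of
  w, so they are solved one after the other. The content is the comparison of the h^2 coefficients,
  where s3' = s3 - w s2 + w^3 / 8 removes b and c and leaves w^2 / 16.\<close>

lemma riccati_coefficients:
  fixes w b c e :: real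
  assumes w: "0 < w"
  obtains e2 s2 t0 s3 t1 s4 t2 u0 s2' t0' s3' t1' s4' t2' u0' where
    "b = 2 * w * s2" "s2 = w * t0" "c = s2^2 + 2 * w * s3" "3 * s3 = 2 * s2 * t0 + 2 * w * t1"
      "e2 = t1 - t0^2" "e = 2 * s2 * s3 + 2 * w * s4" "4 * s4 = 2 * s2 * t1 + 2 * t0 * s3 + 2 * w * t2"
      "t2 = t0 * t1 + w * u0"
    "b = 2 * w * s2' + w^3" "s2' = w * t0'" "c = s2'^2 + 2 * w * s3' + 3 * w^2 * s2' + w^4"
      "3 * s3' = 2 * s2' * t0' + 2 * w * t1' + 3 * w^2 * t0'"
      "e2 - w^2 / 16 = s2' + t1' - t0'^2" "e = 2 * s2' * s3' + 2 * w * s4' + 3 * w^2 * s3' + 3 * w * s2'^2 + 4 * w^3 * s2' + w^5"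
      "4 * s4' = 2 * s2' * t1' + 2 * t0' * s3' + 2 * w * t2' + 3 * w^2 * t1' + 6 * w * s2' * t0' + 4 * w^3 * t0'"
      "3 * s3' + 2 * t2' = 2 * t0' * t1' + 2 * w * u0' + 3 * w * t0'^2"
proof -
  define t0 where "t0 = b / (2 * w^2)"
  define s2 where "s2 = w * t0"
  define s3 where "s3 = (c - s2^2) / (2 * w)"
  define t1 where "t1 = (3 * s3 - 2 * s2 * t0) / (2 * w)"
  define s4 where "s4 = (e - 2 * s2 * s3) / (2 * w)"
  define t2 where "t2 = (4 * s4 - 2 * s2 * t1 - 2 * t0 * s3) / (2 * w)"
  define u0 where "u0 = (t2 - t0 * t1) / w"
  \<comment> \<open>Forced by b = 2 w s2' + w^3 and s2' = w t0', compared with b = 2 w^2 t0.\<close>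
  define t0' where "t0' = t0 - w / 2"
  define s2' where "s2' = w * t0'"
  define s3' where "s3' = (c - s2'^2 - 3 * w^2 * s2' - w^4) / (2 * w)"
  define t1' where "t1' = (3 * s3' - 2 * s2' * t0' - 3 * w^2 * t0') / (2 * w)"
  define s4' where "s4' = (e - 2 * s2' * s3' - 3 * w^2 * s3' - 3 * w * s2'^2 - 4 * w^3 * s2' - w^5) / (2 * w)"
  define t2' where "t2' = (4 * s4' - 2 * s2' * t1' - 2 * t0' * s3' - 3 * w^2 * t1' - 6 * w * s2' * t0' - 4 * w^3 * t0') / (2 * w)"
  define u0' where "u0' = (3 * s3' + 2 * t2' - 2 * t0' * t1' - 3 * w * t0'^2) / (2 * w)"
  have b: "b = 2 * w * s2" using w by (simp add: s2_def t0_def power2_eq_square)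
  have s2's: "s2' = s2 - w^2 / 2" by (simp add: s2'_def t0'_def s2_def algebra_simps power2_eq_square)
  have s3d: "2 * w * s3' = 2 * w * s3 + s2^2 - s2'^2 - 3 * w^2 * s2' - w^4" using w by (simp add: s3'_def s3_def)
  have s3s: "s3' = s3 - w * s2 + w^3 / 8"
  proof -
    have "2 * w * s3' = 2 * w * (s3 - w * s2 + w^3 / 8)"
      unfolding s3d s2's by (simp add: power2_eq_square power3_eq_cube power4_eq_xxxx algebra_simps)
    then show ?thesis using w by simp
  qed
  have t1w: "2 * w * t1 = 3 * s3 - 2 * s2 * t0" using w by (simp add: t1_def)
  have t1'w: "2 * w * t1' = 3 * s3' - 2 * s2' * t0' - 3 * w^2 * t0'" using w by (simp add: t1'_def)
  have "2 * w * (t1 - t0^2 - w^2 / 16) = 2 * w * (s2' + t1' - t0'^2)"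
  proof -
    have "2 * w * (t1 - t0^2 - w^2 / 16) = (3 * s3 - 2 * s2 * t0) - 2 * w * t0^2 - w^3 / 8"
      unfolding t1w[symmetric] by (simp add: power2_eq_square power3_eq_cube algebra_simps)
    also have "\<dots> = 2 * w * s2' + (3 * s3' - 2 * s2' * t0' - 3 * w^2 * t0') - 2 * w * t0'^2"
      unfolding s3s s2's t0'_def unfolding s2_def by (simp add: power2_eq_square power3_eq_cube algebra_simps)
    also have "\<dots> = 2 * w * (s2' + t1' - t0'^2)"
      unfolding t1'w[symmetric] by (simp add: algebra_simps)
    finally show ?thesis .
  qed
  then have e2: "t1 - t0^2 - w^2 / 16 = s2' + t1' - t0'^2" using w by simp
  show ?thesis
  proof (rule that[of s2 t0 s3 t1 "t1 - t0^2" s4 t2 u0 s2' t0' s3' t1' s4' t2' u0'])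
    show "b = 2 * w * s2' + w^3" unfolding s2's b by (simp add: power2_eq_square power3_eq_cube algebra_simps)
  qed (use w b e2 in \<open>simp_all add: s2_def s3_def t1_def s4_def t2_def u0_def s2'_def s3'_def t1'_def s4'_def t2'_def u0'_def\<close>)
qed

subsection \<open>Global sub- and supersolutions\<close>

text \<open>Young's inequality for y^4 h = (y^6)^(2/3) (h^3)^(1/3), proved by asking which of K h
  and k y^2 is larger. It says that errors h y^4 cost only a small multiple of y^6 plus
  O(h^3).\<close>

lemma young_slack:
  fixes k K :: real
  assumes "0 < k" "0 \<le> K"
  obtains C where "0 \<le> C" "\<And>y h. 0 < h \<Longrightarrow> K * (y ^ 4 * h) \<le> k * y ^ 6 + C * h ^ 3"
proof -
  define C where "C = K * (K / k)\<^sup>2"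
  have C: "0 \<le> C" using assms by (simp add: C_def)
  have "K * (y ^ 4 * h) \<le> k * y ^ 6 + C * h ^ 3" if h: "0 < h" for y h
  proof (cases "K * h \<le> k * y\<^sup>2")
    case True
    have "K * (y ^ 4 * h) = y ^ 4 * (K * h)" by simp
    also have "\<dots> \<le> y ^ 4 * (k * y\<^sup>2)" using True by (intro mult_left_mono) auto
    also have "\<dots> = k * y ^ 6" by (simp flip: power_add)
    finally show ?thesis using C h by (simp add: add_increasing2)
  next
    case False
    then have "y\<^sup>2 \<le> K * h / k" using assms by (simp add: pos_le_divide_eq mult.commute)
    then have "(y\<^sup>2)\<^sup>2 \<le> (K * h / k)\<^sup>2" by (intro power_mono) auto
    then have "y ^ 4 \<le> (K * h / k)\<^sup>2" by (simp flip: power_mult)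
    then have "(K * h) * y ^ 4 \<le> (K * h) * (K * h / k)\<^sup>2" using assms h by (intro mult_left_mono) auto
    also have "\<dots> = C * h ^ 3" by (simp add: C_def power2_eq_square power3_eq_cube)
    finally have "K * (y ^ 4 * h) \<le> C * h ^ 3" by (simp add: mult_ac)
    moreover have "0 \<le> k * y ^ 6" using assms by (simp add: zero_le_even_power)
    ultimately show ?thesis by linarith
  qed
  with C show ?thesis by (rule that)
qed

text \<open>Here R is the residual of the unbent ansatz, ch the cutoff and D its discretised or true
  derivative term. The gain (1 - ch) u is at least 2 k z^6: one half absorbs C z^6, since \<delta>
  is small enough for C <= k, and the other half, through \<open>young_slack\<close>, the errors h
  z^4 from E and D.\<close>

lemma lower_tail:
  fixes C c0 M K \<delta> :: real
  assumes "0 \<le> C" "0 < c0" "0 \<le> M" "0 \<le> K" "0 < \<delta>" "2 * C * \<delta> ^ 4 \<le> c0"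
  obtains C' where "0 \<le> C'" "\<And>z h ch R u E D. 0 < h \<Longrightarrow> h \<le> 1 \<Longrightarrow> 0 \<le> ch \<Longrightarrow> z ^ 4 / \<delta> ^ 4 \<le> 1 - ch \<Longrightarrow> 1 - ch \<le> 2 * (z ^ 4 / \<delta> ^ 4) \<Longrightarrow>
    \<bar>R\<bar> \<le> C * (z ^ 6 + h ^ 3) \<Longrightarrow> c0 * z\<^sup>2 \<le> u \<Longrightarrow> E \<le> M * h \<Longrightarrow> \<bar>D\<bar> \<le> K * (h * (z ^ 4 + h ^ 4)) / \<delta> ^ 4 \<Longrightarrow>
    - C' * h ^ 3 \<le> ch * R + (1 - ch) * (u - E) + D"
proof -
  define k where "k = c0 / (2 * \<delta> ^ 4)"
  have k: "0 < k" "C \<le> k" "c0 / \<delta> ^ 4 = 2 * k" using assms by (auto simp: k_def field_simps)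
  define K2 where "K2 = (2 * M + K) / \<delta> ^ 4"
  have K2: "0 \<le> K2" using assms by (simp add: K2_def)
  obtain Cy where Cy: "0 \<le> Cy" "\<And>y h. 0 < h \<Longrightarrow> K2 * (y ^ 4 * h) \<le> k * y ^ 6 + Cy * h ^ 3"
    by (rule young_slack[OF k(1) K2]) (rule that)
  define C' where "C' = C + K / \<delta> ^ 4 + Cy"
  show ?thesis
  proof (rule that)
    show "0 \<le> C'" using assms Cy(1) by (simp add: C'_def)
    fix z h ch R u E D :: real
    assume h: "0 < h" "h \<le> 1" and ch: "0 \<le> ch" "z ^ 4 / \<delta> ^ 4 \<le> 1 - ch" "1 - ch \<le> 2 * (z ^ 4 / \<delta> ^ 4)"
      and R: "\<bar>R\<bar> \<le> C * (z ^ 6 + h ^ 3)" and u: "c0 * z\<^sup>2 \<le> u" and E: "E \<le> M * h"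
      and D: "\<bar>D\<bar> \<le> K * (h * (z ^ 4 + h ^ 4)) / \<delta> ^ 4"
    let ?t = "z ^ 4 / \<delta> ^ 4"
    have t0: "0 \<le> ?t" using assms by simp
    have "ch \<le> 1" using ch(2) t0 by linarith
    then have "\<bar>ch * R\<bar> \<le> 1 * \<bar>R\<bar>" unfolding abs_mult using ch(1) by (intro mult_right_mono) auto
    then have 1: "- (C * (z ^ 6 + h ^ 3)) \<le> ch * R" using R by linarith
    have "?t * (c0 * z\<^sup>2) \<le> (1 - ch) * u" using ch t0 u assms by (intro mult_mono) auto
    moreover have "?t * (c0 * z\<^sup>2) = (c0 / \<delta> ^ 4) * z ^ 6" by (simp add: power_add[of z 4 2, simplified])
    ultimately have 2: "2 * k * z ^ 6 \<le> (1 - ch) * u" unfolding k(3) by simp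
    have "(1 - ch) * E \<le> (1 - ch) * (M * h)" using E \<open>ch \<le> 1\<close> by (intro mult_left_mono) auto
    also have "\<dots> \<le> (2 * ?t) * (M * h)" using ch(3) assms h by (intro mult_right_mono) auto
    finally have 3: "(1 - ch) * E \<le> (2 * M / \<delta> ^ 4) * (z ^ 4 * h)" by (simp add: mult_ac)
    have "h * h ^ 4 \<le> h ^ 3" using h power_decreasing[of 3 5 h] by (simp flip: power_Suc)
    then have "(K / \<delta> ^ 4) * (h * h ^ 4) \<le> (K / \<delta> ^ 4) * h ^ 3" using assms by (intro mult_left_mono) auto
    moreover have "K * (h * (z ^ 4 + h ^ 4)) / \<delta> ^ 4 = (K / \<delta> ^ 4) * (z ^ 4 * h) + (K / \<delta> ^ 4) * (h * h ^ 4)"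
      by (simp add: distrib_left add_divide_distrib mult_ac)
    ultimately have "\<bar>D\<bar> \<le> (K / \<delta> ^ 4) * (z ^ 4 * h) + (K / \<delta> ^ 4) * h ^ 3" using D by (metis add_left_mono order_trans)
    then have 4: "- ((K / \<delta> ^ 4) * (z ^ 4 * h) + (K / \<delta> ^ 4) * h ^ 3) \<le> D" by (simp only: abs_le_iff neg_le_iff_le minus_le_iff)
    have 5: "(2 * M / \<delta> ^ 4) * (z ^ 4 * h) + (K / \<delta> ^ 4) * (z ^ 4 * h) \<le> k * z ^ 6 + Cy * h ^ 3"
      using Cy(2)[OF h(1), of z] by (simp add: K2_def add_divide_distrib distrib_right)
    have 6: "C * (z ^ 6 + h ^ 3) \<le> k * z ^ 6 + C * h ^ 3"
      using mult_right_mono[OF k(2), of "z ^ 6"] by (simp add: distrib_left zero_le_even_power)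
    have 7: "(1 - ch) * (u - E) = (1 - ch) * u - (1 - ch) * E" by (rule right_diff_distrib)
    have 8: "- C' * h ^ 3 = - (C * h ^ 3) - (K / \<delta> ^ 4) * h ^ 3 - Cy * h ^ 3" by (simp add: C'_def algebra_simps)
    show "- C' * h ^ 3 \<le> ch * R + (1 - ch) * (u - E) + D"
      unfolding 7 8 using 1 2 3 4 5 6 by linarith
  qed
qed

text \<open>Mirror image with the factor 1 + t, t = z^4 / \<delta>^4, and the gain - t u. Range
  \<eta> and bending scale \<delta> are separate, because the lattice case needs t large inside the
  range; the residual is then amplified by up to 1 + \<eta>^4 / \<delta>^4, whence the
  assumption.\<close>

lemma upper_tail:
  fixes C c0 M K \<delta> \<eta> :: real
  assumes "0 \<le> C" "0 < c0" "0 \<le> M" "0 \<le> K" "0 < \<delta>" "2 * C * (\<delta> ^ 4 + \<eta> ^ 4) \<le> c0"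
  obtains C' where "0 \<le> C'" "\<And>z h R u E D. 0 < h \<Longrightarrow> h \<le> 1 \<Longrightarrow> \<bar>z\<bar> \<le> \<eta> \<Longrightarrow>
    R \<le> C * (z ^ 6 + h ^ 3) \<Longrightarrow> c0 * z\<^sup>2 \<le> u \<Longrightarrow> E \<le> M * h \<Longrightarrow> D \<le> K * (h * (z ^ 4 + h ^ 4)) / \<delta> ^ 4 \<Longrightarrow>
    (1 + z ^ 4 / \<delta> ^ 4) * R - z ^ 4 / \<delta> ^ 4 * (u - E) + D \<le> C' * h ^ 3"
proof -
  define k where "k = c0 / (2 * \<delta> ^ 4)"
  have "C + C * \<eta> ^ 4 / \<delta> ^ 4 = 2 * C * (\<delta> ^ 4 + \<eta> ^ 4) / (2 * \<delta> ^ 4)" using assms(5) by (simp add: field_simps)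
  also have "\<dots> \<le> k" unfolding k_def using assms by (intro divide_right_mono) auto
  finally have k: "0 < k" "C + C * \<eta> ^ 4 / \<delta> ^ 4 \<le> k" "c0 / \<delta> ^ 4 = 2 * k" using assms by (auto simp: k_def)
  define K2 where "K2 = (M + K) / \<delta> ^ 4"
  have K2: "0 \<le> K2" using assms by (simp add: K2_def)
  obtain Cy where Cy: "0 \<le> Cy" "\<And>y h. 0 < h \<Longrightarrow> K2 * (y ^ 4 * h) \<le> k * y ^ 6 + Cy * h ^ 3"
    by (rule young_slack[OF k(1) K2]) (rule that)
  define C' where "C' = C * (1 + \<eta> ^ 4 / \<delta> ^ 4) + K / \<delta> ^ 4 + Cy"
  have \<eta>4: "0 \<le> \<eta> ^ 4" by simp
  show ?thesis
  proof (rule that)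
    show "0 \<le> C'" using assms Cy(1) by (simp add: C'_def)
    fix z h R u E D :: real
    assume h: "0 < h" "h \<le> 1" and z: "\<bar>z\<bar> \<le> \<eta>"
      and R: "R \<le> C * (z ^ 6 + h ^ 3)" and u: "c0 * z\<^sup>2 \<le> u" and E: "E \<le> M * h"
      and D: "D \<le> K * (h * (z ^ 4 + h ^ 4)) / \<delta> ^ 4"
    let ?t = "z ^ 4 / \<delta> ^ 4"
    have t0: "0 \<le> ?t" using assms by simp
    have "\<bar>z\<bar> ^ 4 \<le> \<eta> ^ 4" using z by (intro power_mono) auto
    then have t1: "?t \<le> \<eta> ^ 4 / \<delta> ^ 4" using assms by (simp add: divide_right_mono)
    have "(1 + ?t) * R \<le> (1 + ?t) * (C * (z ^ 6 + h ^ 3))" using R t0 by (intro mult_left_mono) auto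
    also have "\<dots> \<le> (1 + \<eta> ^ 4 / \<delta> ^ 4) * (C * (z ^ 6 + h ^ 3))"
      using t1 assms h by (intro mult_right_mono) (auto simp: zero_le_even_power)
    also have "\<dots> = (C + C * \<eta> ^ 4 / \<delta> ^ 4) * z ^ 6 + C * (1 + \<eta> ^ 4 / \<delta> ^ 4) * h ^ 3" by (simp add: algebra_simps)
    also have "\<dots> \<le> k * z ^ 6 + C * (1 + \<eta> ^ 4 / \<delta> ^ 4) * h ^ 3"
      using k(2) by (intro add_right_mono mult_right_mono) (auto simp: zero_le_even_power)
    finally have 1: "(1 + ?t) * R \<le> k * z ^ 6 + C * (1 + \<eta> ^ 4 / \<delta> ^ 4) * h ^ 3" .
    have "?t * (c0 * z\<^sup>2) \<le> ?t * u" using t0 u by (intro mult_left_mono) auto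
    moreover have "?t * (c0 * z\<^sup>2) = (c0 / \<delta> ^ 4) * z ^ 6" by (simp add: power_add[of z 4 2, simplified])
    ultimately have 2: "2 * k * z ^ 6 \<le> ?t * u" unfolding k(3) by simp
    have "?t * E \<le> ?t * (M * h)" using E t0 by (intro mult_left_mono) auto
    then have 3: "?t * E \<le> (M / \<delta> ^ 4) * (z ^ 4 * h)" by (simp add: mult_ac)
    have "h * h ^ 4 \<le> h ^ 3" using h power_decreasing[of 3 5 h] by (simp flip: power_Suc)
    then have "(K / \<delta> ^ 4) * (h * h ^ 4) \<le> (K / \<delta> ^ 4) * h ^ 3" using assms by (intro mult_left_mono) auto
    moreover have "K * (h * (z ^ 4 + h ^ 4)) / \<delta> ^ 4 = (K / \<delta> ^ 4) * (z ^ 4 * h) + (K / \<delta> ^ 4) * (h * h ^ 4)"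
      by (simp add: distrib_left add_divide_distrib mult_ac)
    ultimately have 4: "D \<le> (K / \<delta> ^ 4) * (z ^ 4 * h) + (K / \<delta> ^ 4) * h ^ 3" using D by linarith
    have 5: "(M / \<delta> ^ 4) * (z ^ 4 * h) + (K / \<delta> ^ 4) * (z ^ 4 * h) \<le> k * z ^ 6 + Cy * h ^ 3"
      using Cy(2)[OF h(1), of z] by (simp add: K2_def add_divide_distrib distrib_right)
    have 7: "?t * (u - E) = ?t * u - ?t * E" by (rule right_diff_distrib)
    have 8: "C' * h ^ 3 = C * (1 + \<eta> ^ 4 / \<delta> ^ 4) * h ^ 3 + (K / \<delta> ^ 4) * h ^ 3 + Cy * h ^ 3" by (simp add: C'_def distrib_right)
    show "(1 + ?t) * R - ?t * (u - E) + D \<le> C' * h ^ 3"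
      unfolding 7 8 using 1 2 3 4 5 by linarith
  qed
qed

section \<open>Cutoff functions\<close>

definition cutoff :: "real \<Rightarrow> (real \<Rightarrow> real) \<Rightarrow> real \<Rightarrow> real" where
  "cutoff \<delta> g y = (if \<bar>y\<bar> \<le> \<delta> then g y else 0)"

lemma cutoff_deriv:
  assumes g: "\<And>y. \<bar>y\<bar> \<le> \<delta> \<Longrightarrow> (g has_real_derivative g' y) (at y)"
    and z: "g \<delta> = 0" "g (- \<delta>) = 0" "g' \<delta> = 0" "g' (- \<delta>) = 0"
  shows "(cutoff \<delta> g has_real_derivative cutoff \<delta> g' y) (at y)"
proof -
  consider "\<bar>y\<bar> < \<delta>" | "\<delta> < \<bar>y\<bar>" | "\<bar>y\<bar> = \<delta>" by linarith
  then show ?thesis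
  proof cases
    case 1
    have "(cutoff \<delta> g has_real_derivative g' y) (at y)"
      by (rule has_field_derivative_transform_within_open[OF g[OF less_imp_le[OF 1]], of "{-\<delta><..<\<delta>}"])
        (use 1 in \<open>auto simp: cutoff_def\<close>)
    then show ?thesis using 1 by (simp add: cutoff_def)
  next
    case 2
    have "((\<lambda>x. 0) has_real_derivative 0) (at y)" by simp
    then have "(cutoff \<delta> g has_real_derivative 0) (at y)"
      by (rule has_field_derivative_transform_within_open[of _ _ _ "{x. \<delta> < \<bar>x\<bar>}"])
        (use 2 in \<open>auto simp: cutoff_def intro!: open_Collect_less continuous_intros\<close>)
    then show ?thesis using 2 by (simp add: cutoff_def)
  next
    case 3
    then have y: "y = \<delta> \<or> y = - \<delta>" by linarith
    have gy: "g y = 0" "g' y = 0" using y z by auto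
    \<comment> \<open>At the gluing points the difference quotient of the cut function is either
      that of g or 0, so it is dominated by the former, which tends to 0.\<close>
    have "((\<lambda>x. (g x - g y) / (x - y)) \<longlongrightarrow> 0) (at y)"
      using g[of y] gy 3 by (simp add: has_field_derivative_iff)
    then have "((\<lambda>x. (cutoff \<delta> g x - cutoff \<delta> g y) / (x - y)) \<longlongrightarrow> 0) (at y)"
      by (rule Lim_null_comparison[rotated, OF tendsto_norm_zero])
        (auto simp: cutoff_def gy intro!: always_eventually)
    then show ?thesis using gy 3 by (simp add: has_field_derivative_iff cutoff_def)
  qed
qed

lemma cutoff_continuous:
  assumes g: "continuous_on {-\<delta>..\<delta>} g" and z: "g \<delta> = 0" "g (- \<delta>) = 0"
  shows "continuous_on UNIV (cutoff \<delta> g)"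
proof -
  have "cutoff \<delta> g = (\<lambda>y. if y \<in> {-\<delta>..\<delta>} then g y else 0)" by (auto simp: cutoff_def fun_eq_iff)
  moreover have "continuous_on ({-\<delta>..\<delta>} \<union> {x. \<delta> \<le> \<bar>x\<bar>}) (\<lambda>y. if y \<in> {-\<delta>..\<delta>} then g y else 0)"
  proof (rule continuous_on_cases)
    show "closed {x. \<delta> \<le> \<bar>x\<bar>}" by (intro closed_Collect_le continuous_intros)
    show "\<forall>x. x \<in> {- \<delta>..\<delta>} \<and> \<not> x \<in> {- \<delta>..\<delta>} \<or> x \<in> {x. \<delta> \<le> \<bar>x\<bar>} \<and> x \<in> {- \<delta>..\<delta>} \<longrightarrow> g x = 0"
    proof (intro allI impI)
      fix x assume "x \<in> {- \<delta>..\<delta>} \<and> \<not> x \<in> {- \<delta>..\<delta>} \<or> x \<in> {x. \<delta> \<le> \<bar>x\<bar>} \<and> x \<in> {- \<delta>..\<delta>}"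
      then have "x = \<delta> \<or> x = - \<delta>" by auto
      then show "g x = 0" using z by auto
    qed
  qed (auto intro: g)
  moreover have "{-\<delta>..\<delta>} \<union> {x. \<delta> \<le> \<bar>x\<bar>} = (UNIV :: real set)" by auto
  ultimately show ?thesis by simp
qed

text \<open>Flatness of order 4 at the well is the point: 1 - chi is comparable to y^4 / \<delta>^4,
  so its product with the potential is at least of size y^6, while chi' = O(y^3) makes h p chi' an
  error of order h y^4. The outer square makes it C^1 at the edges.\<close>

definition chi :: "real \<Rightarrow> real \<Rightarrow> real" where "chi \<delta> = cutoff \<delta> (\<lambda>y. (1 - y ^ 4 / \<delta> ^ 4)\<^sup>2)"
definition chi' :: "real \<Rightarrow> real \<Rightarrow> real" where "chi' \<delta> = cutoff \<delta> (\<lambda>y. - 8 * y ^ 3 / \<delta> ^ 4 * (1 - y ^ 4 / \<delta> ^ 4))"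

lemma chi_deriv:
  assumes "0 < \<delta>"
  shows "(chi \<delta> has_real_derivative chi' \<delta> y) (at y)"
  unfolding chi_def chi'_def
proof (rule cutoff_deriv)
  show "((\<lambda>y. (1 - y ^ 4 / \<delta> ^ 4)\<^sup>2) has_real_derivative - 8 * y ^ 3 / \<delta> ^ 4 * (1 - y ^ 4 / \<delta> ^ 4)) (at y)" for y
  proof -
    define k where "k = inverse (\<delta> ^ 4)"
    show ?thesis unfolding divide_inverse k_def[symmetric]
      by (auto intro!: derivative_eq_intros simp: algebra_simps power2_eq_square)
  qed
qed (use assms in auto)

lemma chi_cont: "0 < \<delta> \<Longrightarrow> continuous_on UNIV (chi' \<delta>)"
  unfolding chi'_def by (intro cutoff_continuous continuous_intros) auto

lemma chi_props:
  assumes \<delta>: "0 < \<delta>"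
  shows "0 \<le> chi \<delta> y" "chi \<delta> y \<le> 1" "\<bar>y\<bar> \<le> \<delta> \<Longrightarrow> y ^ 4 / \<delta> ^ 4 \<le> 1 - chi \<delta> y"
    "\<bar>y\<bar> \<le> \<delta> \<Longrightarrow> 1 - chi \<delta> y \<le> 2 * (y ^ 4 / \<delta> ^ 4)" "\<bar>chi' \<delta> y\<bar> \<le> 8 * \<bar>y\<bar> ^ 3 / \<delta> ^ 4"
    "\<delta> < \<bar>y\<bar> \<Longrightarrow> chi \<delta> y = 0" "\<delta> < \<bar>y\<bar> \<Longrightarrow> chi' \<delta> y = 0"
proof -
  let ?t = "y ^ 4 / \<delta> ^ 4"
  have t: "0 \<le> ?t" using \<delta> by simp
  have t1: "?t \<le> 1" if "\<bar>y\<bar> \<le> \<delta>"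
  proof -
    have "\<bar>y\<bar> ^ 4 \<le> \<delta> ^ 4" using that by (intro power_mono) auto
    then show ?thesis using \<delta> by simp
  qed
  have eq: "1 - (1 - ?t)\<^sup>2 = 2 * ?t - ?t * ?t" by (simp add: power2_eq_square algebra_simps)
  show "0 \<le> chi \<delta> y" by (simp add: chi_def cutoff_def)
  have sq: "?t * ?t \<le> ?t" "0 \<le> ?t * ?t" if "\<bar>y\<bar> \<le> \<delta>" using t t1[OF that] mult_left_le[of ?t ?t] by auto
  show *: "?t \<le> 1 - chi \<delta> y" if "\<bar>y\<bar> \<le> \<delta>"
    using sq[OF that] eq that unfolding chi_def cutoff_def by simp
  show "1 - chi \<delta> y \<le> 2 * ?t" if "\<bar>y\<bar> \<le> \<delta>"
    using sq[OF that] eq that unfolding chi_def cutoff_def by simp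
  show "chi \<delta> y \<le> 1"
  proof (cases "\<bar>y\<bar> \<le> \<delta>")
    case True
    then show ?thesis using * t by linarith
  qed (simp add: chi_def cutoff_def)
  show "\<bar>chi' \<delta> y\<bar> \<le> 8 * \<bar>y\<bar> ^ 3 / \<delta> ^ 4"
  proof (cases "\<bar>y\<bar> \<le> \<delta>")
    case True
    then have "\<bar>chi' \<delta> y\<bar> = 8 * \<bar>y\<bar> ^ 3 / \<delta> ^ 4 * (1 - ?t)"
      using t1[OF True] by (simp add: chi'_def cutoff_def abs_mult power_abs)
    also have "\<dots> \<le> 8 * \<bar>y\<bar> ^ 3 / \<delta> ^ 4 * 1" using t by (intro mult_left_mono) auto
    finally show ?thesis by simp
  qed (simp add: chi'_def cutoff_def)
qed (auto simp: chi_def chi'_def cutoff_def)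

text \<open>Lattice counterpart of the bound on chi', by the mean value theorem.\<close>

lemma chi_diff:
  assumes \<delta>: "0 < \<delta>" and h: "0 < h"
  shows "\<bar>chi \<delta> (z + h) - chi \<delta> z\<bar> \<le> 8 * h * (\<bar>z\<bar> + h) ^ 3 / \<delta> ^ 4"
proof -
  obtain x where x: "z < x" "x < z + h" "chi \<delta> (z + h) - chi \<delta> z = (z + h - z) * chi' \<delta> x"
    using MVT2[of z "z + h" "chi \<delta>" "chi' \<delta>"] chi_deriv[OF \<delta>] h by auto
  have "\<bar>chi' \<delta> x\<bar> \<le> 8 * \<bar>x\<bar> ^ 3 / \<delta> ^ 4" by (rule chi_props[OF \<delta>])
  also have "\<dots> \<le> 8 * (\<bar>z\<bar> + h) ^ 3 / \<delta> ^ 4"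
    using x h by (intro divide_right_mono mult_left_mono power_mono) auto
  finally have "h * \<bar>chi' \<delta> x\<bar> \<le> h * (8 * (\<bar>z\<bar> + h) ^ 3 / \<delta> ^ 4)" using h by (intro mult_left_mono) auto
  then show ?thesis using x(3) h by (simp add: abs_mult mult_ac)
qed

lemma sum_power4_le:
  fixes a b :: real
  assumes "0 \<le> a" "0 \<le> b"
  shows "(a + b) ^ 4 \<le> 16 * (a ^ 4 + b ^ 4)"
proof -
  have "(a + b) ^ 4 \<le> (2 * max a b) ^ 4" using assms by (intro power_mono) auto
  also have "\<dots> = 16 * max a b ^ 4" by (simp add: power_mult_distrib)
  also have "max a b ^ 4 \<le> a ^ 4 + b ^ 4" by (auto simp: max_def)
  finally show ?thesis by simp
qed

section \<open>Comparison functions from an approximate Riccati solution\<close>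

locale riccati =
  fixes U E :: "real \<Rightarrow> real" and p p' :: "real \<Rightarrow> real \<Rightarrow> real" and w c0 B M C \<eta> :: real
  assumes w: "0 < w" and c0: "0 < c0" and M: "0 \<le> M" and C: "0 \<le> C" and \<eta>: "0 < \<eta>" "\<eta> \<le> 1/4"
    and U_ge: "\<And>y. \<bar>y\<bar> \<le> 1/2 \<Longrightarrow> c0 * y\<^sup>2 \<le> U y" and U_nn: "\<And>y. 0 \<le> U y" and U_le: "\<And>y. U y \<le> B"
    and E_le: "\<And>h. 0 < h \<Longrightarrow> h \<le> 1 \<Longrightarrow> \<bar>E h\<bar> \<le> M * h" and E_pos: "\<And>h. 0 < h \<Longrightarrow> h \<le> \<eta> \<Longrightarrow> 0 < E h"
    and p_deriv: "\<And>y h. ((\<lambda>y. p y h) has_real_derivative p' y h) (at y)"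
    and p'_cont: "\<And>h. continuous_on UNIV (\<lambda>y. p' y h)"
    and p_lin: "\<And>y h. \<bar>y\<bar> \<le> 1 \<Longrightarrow> 0 < h \<Longrightarrow> h \<le> 1 \<Longrightarrow> \<bar>p y h - w * y\<bar> \<le> M * (y\<^sup>2 + h)"
begin

lemma p_le:
  assumes "\<bar>y\<bar> \<le> 1" "0 < h" "h \<le> 1"
  shows "\<bar>p y h\<bar> \<le> (w + M) * (\<bar>y\<bar> + h)"
proof -
  have "y\<^sup>2 \<le> \<bar>y\<bar>" using assms(1) power_decreasing[of 1 2 "\<bar>y\<bar>"] by simp
  then have "M * (y\<^sup>2 + h) \<le> M * (\<bar>y\<bar> + h)" using M by (intro mult_left_mono) auto
  moreover have "\<bar>w * y\<bar> \<le> w * (\<bar>y\<bar> + h)" using w assms by (simp add: abs_mult)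
  ultimately show ?thesis using p_lin[OF assms] by (simp add: distrib_right)
qed

text \<open>The bound with C serves the tail estimates; 4 M \<delta> <= w keeps M y^2 below a
  quarter of w |y|, so that w y governs p; the last bound gives |p| <= 1/2 near the well, keeping 1
  - p away from 0 on the lattice.\<close>

lemma delta_exists:
  obtains \<delta> where "0 < \<delta>" "\<delta> \<le> \<eta>" "4 * C * \<delta> ^ 4 \<le> c0" "4 * M * \<delta> \<le> w" "\<delta> * (8 * (w + M)) \<le> 1"
proof -
  define \<delta> where "\<delta> = Min {\<eta>, c0 / (4 * C + 1), w / (4 * M + 1), 1 / (8 * (w + M))}"
  have pos: "0 < \<delta>" using \<eta> c0 w M C by (auto simp: \<delta>_def)
  have le: "\<delta> \<le> \<eta>" "\<delta> \<le> c0 / (4 * C + 1)" "\<delta> \<le> w / (4 * M + 1)" "\<delta> \<le> 1 / (8 * (w + M))"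
    by (simp_all add: \<delta>_def min_le_iff_disj)
  have "\<delta> * (4 * C + 1) \<le> c0" using le(2) C by (simp add: pos_le_divide_eq)
  moreover have "\<delta> ^ 4 \<le> \<delta>" using pos le(1) \<eta> power_decreasing[of 1 4 \<delta>] by simp
  then have "4 * C * \<delta> ^ 4 \<le> 4 * C * \<delta>" using C by (intro mult_left_mono) auto
  ultimately have 1: "4 * C * \<delta> ^ 4 \<le> c0" using pos by (simp add: algebra_simps)
  have "\<delta> * (4 * M + 1) \<le> w" using le(3) M by (simp add: pos_le_divide_eq)
  then have 2: "4 * M * \<delta> \<le> w" using pos by (simp add: algebra_simps)
  have 3: "\<delta> * (8 * (w + M)) \<le> 1" using le(4) w M by (subst (asm) pos_le_divide_eq) auto
  show ?thesis by (rule that[OF pos le(1) 1 2 3])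
qed

end

locale riccati_c = riccati +
  assumes res: "\<And>y h. \<bar>y\<bar> \<le> \<eta> \<Longrightarrow> 0 < h \<Longrightarrow> h \<le> \<eta> \<Longrightarrow> \<bar>h * p' y h - (p y h)\<^sup>2 + U y - E h\<bar> \<le> C * (y ^ 6 + h ^ 3)"

locale riccati_d = riccati +
  assumes res: "\<And>y h. \<bar>y\<bar> \<le> \<eta> \<Longrightarrow> 0 < h \<Longrightarrow> h \<le> \<eta> \<Longrightarrow>
      \<bar>p (y + h) h - p y h - (p y h)\<^sup>2 / (1 - p y h) + U y - E h\<bar> \<le> C * (y ^ 6 + h ^ 3)"

context riccati_c begin

text \<open>For \<sigma> = p chi the left-hand side of the Riccati equation minus E is chi R + (1 -
  chi) (U - E) + h p chi' + chi (1 - chi) p^2. The last term is nonnegative and the rest is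
  \<open>lower_tail\<close>. Off the support U alone exceeds E.\<close>

lemma supersolution:
  obtains \<delta> h1 C' where "0 < \<delta>" "\<delta> \<le> 1/4" "0 < h1" "0 \<le> C'"
    "\<And>h z. 0 < h \<Longrightarrow> h \<le> h1 \<Longrightarrow> \<bar>z\<bar> \<le> 1/2 \<Longrightarrow> E h - C' * h ^ 3 \<le>
      U z - (p z h * chi \<delta> z)\<^sup>2 + h * (p' z h * chi \<delta> z + p z h * chi' \<delta> z)"
proof -
  obtain \<delta> where \<delta>: "0 < \<delta>" "\<delta> \<le> \<eta>" "4 * C * \<delta> ^ 4 \<le> c0" by (rule delta_exists) (rule that)
  define K where "K = 8 * 16 * (w + M)"
  have K: "0 \<le> K" using w M by (simp add: K_def)
  have "0 \<le> C * \<delta> ^ 4" using C by simp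
  then have \<delta>c: "2 * C * \<delta> ^ 4 \<le> c0" using \<delta>(3) by linarith
  obtain C' where C': "0 \<le> C'" "\<And>z h ch R u E D. 0 < h \<Longrightarrow> h \<le> 1 \<Longrightarrow> 0 \<le> ch \<Longrightarrow> z ^ 4 / \<delta> ^ 4 \<le> 1 - ch \<Longrightarrow> 1 - ch \<le> 2 * (z ^ 4 / \<delta> ^ 4) \<Longrightarrow>
    \<bar>R\<bar> \<le> C * (z ^ 6 + h ^ 3) \<Longrightarrow> c0 * z\<^sup>2 \<le> u \<Longrightarrow> E \<le> M * h \<Longrightarrow> \<bar>D\<bar> \<le> K * (h * (z ^ 4 + h ^ 4)) / \<delta> ^ 4 \<Longrightarrow>
    - C' * h ^ 3 \<le> ch * R + (1 - ch) * (u - E) + D"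
    using lower_tail[OF C c0 M K \<delta>(1) \<delta>c] by blast
  \<comment> \<open>The second bound gives E h <= c0 \<delta>^2, the value U is known to exceed
    outside the cutoff.\<close>
  define h1 where "h1 = min \<eta> (c0 * \<delta>\<^sup>2 / (M + 1))"
  show ?thesis
  proof (rule that[of \<delta> h1 C'])
    show "0 < h1" using \<eta> c0 \<delta> M by (simp add: h1_def)
    fix h z :: real assume h: "0 < h" "h \<le> h1" and z: "\<bar>z\<bar> \<le> 1/2"
    have h': "h \<le> \<eta>" "h \<le> 1" "h * (M + 1) \<le> c0 * \<delta>\<^sup>2"
      using h \<eta> M by (auto simp: h1_def pos_le_divide_eq)
    show "E h - C' * h ^ 3 \<le> U z - (p z h * chi \<delta> z)\<^sup>2 + h * (p' z h * chi \<delta> z + p z h * chi' \<delta> z)"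
    proof (cases "\<bar>z\<bar> \<le> \<delta>")
      case True
      let ?ch = "chi \<delta> z" and ?R = "h * p' z h - (p z h)\<^sup>2 + U z - E h" and ?D = "h * p z h * chi' \<delta> z"
      have "\<bar>?D\<bar> \<le> K * (h * (z ^ 4 + h ^ 4)) / \<delta> ^ 4"
      proof -
        have "\<bar>p z h\<bar> * \<bar>chi' \<delta> z\<bar> \<le> ((w + M) * (\<bar>z\<bar> + h)) * (8 * \<bar>z\<bar> ^ 3 / \<delta> ^ 4)"
          using p_le[of z h] z h h' chi_props(5)[OF \<delta>(1), of z] w M by (intro mult_mono) auto
        also have "\<dots> \<le> ((w + M) * (\<bar>z\<bar> + h)) * (8 * (\<bar>z\<bar> + h) ^ 3 / \<delta> ^ 4)"
          using h w M by (intro mult_left_mono divide_right_mono power_mono) auto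
        also have "\<dots> = 8 * (w + M) * (\<bar>z\<bar> + h) ^ 4 / \<delta> ^ 4"
        proof -
          have "(m * a) * (8 * a ^ 3 / b) = 8 * m * a ^ 4 / b" for m a b :: real
            by (simp add: power4_eq_xxxx power3_eq_cube)
          then show ?thesis .
        qed
        also have "\<dots> \<le> 8 * (w + M) * (16 * (\<bar>z\<bar> ^ 4 + h ^ 4)) / \<delta> ^ 4"
          using sum_power4_le[of "\<bar>z\<bar>" h] h w M by (intro divide_right_mono mult_left_mono) auto
        finally have "h * (\<bar>p z h\<bar> * \<bar>chi' \<delta> z\<bar>) \<le> h * (8 * (w + M) * (16 * (\<bar>z\<bar> ^ 4 + h ^ 4)) / \<delta> ^ 4)"
          using h by (intro mult_left_mono) auto
        also have "\<dots> = K * (h * (z ^ 4 + h ^ 4)) / \<delta> ^ 4" by (simp add: K_def algebra_simps)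
        finally show ?thesis using h by (simp add: abs_mult mult_ac)
      qed
      then have "- C' * h ^ 3 \<le> ?ch * ?R + (1 - ?ch) * (U z - E h) + ?D"
        using C'(2)[OF h(1) h'(2), of ?ch z ?R "U z" "E h" ?D] chi_props[OF \<delta>(1)] True res[of z h] \<delta>(2) h h'
          U_ge[OF z] E_le[OF h(1) h'(2)] by simp
      moreover have "?ch * ?R + (1 - ?ch) * (U z - E h) + ?D + ?ch * (1 - ?ch) * (p z h)\<^sup>2 =
          U z - (p z h * ?ch)\<^sup>2 + h * (p' z h * ?ch + p z h * chi' \<delta> z) - E h"
        by (simp add: power2_eq_square algebra_simps)
      moreover have "0 \<le> ?ch * (1 - ?ch) * (p z h)\<^sup>2" using chi_props(1,2)[OF \<delta>(1), of z] by simp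
      ultimately show ?thesis by linarith
    next
      case False
      then have "\<delta>\<^sup>2 \<le> z\<^sup>2" using \<delta>(1) by (intro abs_le_square_iff[THEN iffD1]) auto
      then have "c0 * \<delta>\<^sup>2 \<le> U z" using U_ge[OF z] c0 by (meson mult_le_cancel_left_pos order_trans)
      moreover have "E h \<le> h * (M + 1)" using E_le[OF h(1) h'(2)] h by (simp add: algebra_simps)
      moreover have "0 \<le> C' * h ^ 3" using C'(1) h by simp
      ultimately show ?thesis using False chi_props(6,7)[OF \<delta>(1), of z] h'(3) by simp
    qed
  qed (use \<delta> \<eta> C' in auto)
qed

end

context riccati_d begin

text \<open>As in the continuous case, with the increment of chi in place of h chi' and the convex
  function s^2 / (1 - s), zero at 0, in place of s^2.\<close>

lemma supersolution:
  obtains \<delta> h1 C' where "0 < \<delta>" "\<delta> \<le> 1/4" "0 < h1" "h1 \<le> 1/4" "0 \<le> C'"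
    "\<And>h z. 0 < h \<Longrightarrow> h \<le> h1 \<Longrightarrow> \<bar>p z h * chi \<delta> z\<bar> \<le> 1/2"
    "\<And>h z. 0 < h \<Longrightarrow> h \<le> h1 \<Longrightarrow> \<bar>z\<bar> \<le> 1/2 \<Longrightarrow> E h - C' * h ^ 3 \<le>
      p (z + h) h * chi \<delta> (z + h) - p z h * chi \<delta> z - (p z h * chi \<delta> z)\<^sup>2 / (1 - p z h * chi \<delta> z) + U z"
proof -
  obtain \<delta> where \<delta>: "0 < \<delta>" "\<delta> \<le> \<eta>" "4 * C * \<delta> ^ 4 \<le> c0" "\<delta> * (8 * (w + M)) \<le> 1" by (rule delta_exists) (rule that)
  define K where "K = 8 * 16 * (w + M) * 2"
  have K: "0 \<le> K" using w M by (simp add: K_def)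
  have "0 \<le> C * \<delta> ^ 4" using C by simp
  then have \<delta>c: "2 * C * \<delta> ^ 4 \<le> c0" using \<delta>(3) by linarith
  obtain C' where C': "0 \<le> C'" "\<And>z h ch R u E D. 0 < h \<Longrightarrow> h \<le> 1 \<Longrightarrow> 0 \<le> ch \<Longrightarrow> z ^ 4 / \<delta> ^ 4 \<le> 1 - ch \<Longrightarrow> 1 - ch \<le> 2 * (z ^ 4 / \<delta> ^ 4) \<Longrightarrow>
    \<bar>R\<bar> \<le> C * (z ^ 6 + h ^ 3) \<Longrightarrow> c0 * z\<^sup>2 \<le> u \<Longrightarrow> E \<le> M * h \<Longrightarrow> \<bar>D\<bar> \<le> K * (h * (z ^ 4 + h ^ 4)) / \<delta> ^ 4 \<Longrightarrow>
    - C' * h ^ 3 \<le> ch * R + (1 - ch) * (u - E) + D"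
    using lower_tail[OF C c0 M K \<delta>(1) \<delta>c] by blast
  define h1 where "h1 = Min {\<delta>, c0 * \<delta>\<^sup>2 / (M + 1 + 64 / \<delta> ^ 4)}"
  have den: "0 < M + 1 + 64 / \<delta> ^ 4" using M \<delta>(1) by (simp add: add_nonneg_pos)
  show ?thesis
  proof (rule that[of \<delta> h1 C'])
    show "0 < h1" using c0 \<delta> den by (simp add: h1_def)
    have "h1 \<le> \<delta>" by (simp add: h1_def)
    then show "h1 \<le> 1/4" using \<delta> \<eta> by linarith
    fix h z :: real assume h: "0 < h" "h \<le> h1"
    have h': "h \<le> \<delta>" "h \<le> \<eta>" "h \<le> 1" "h * (M + 1 + 64 / \<delta> ^ 4) \<le> c0 * \<delta>\<^sup>2"
      using h \<eta> \<delta> den by (auto simp: h1_def pos_le_divide_eq)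
    have p_half: "\<bar>p y h\<bar> \<le> 1/2" if "\<bar>y\<bar> \<le> 2 * \<delta>" for y
    proof -
      have "\<bar>p y h\<bar> \<le> (w + M) * (\<bar>y\<bar> + h)" using that \<delta> \<eta> h h' by (intro p_le) auto
      also have "\<dots> \<le> (w + M) * (4 * \<delta>)" using that h' w M by (intro mult_left_mono) auto
      finally show ?thesis using \<delta>(4) by (simp add: algebra_simps)
    qed
    have p_chi: "\<bar>p y h * chi \<delta> y\<bar> \<le> 1/2" for y
    proof (cases "\<bar>y\<bar> \<le> \<delta>")
      case True
      then have "\<bar>p y h\<bar> * \<bar>chi \<delta> y\<bar> \<le> (1/2) * 1"
        using p_half[of y] chi_props(1,2)[OF \<delta>(1), of y] by (intro mult_mono) auto
      then show ?thesis by (simp add: abs_mult)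
    qed (simp add: chi_props(6)[OF \<delta>(1)])
    then show "\<bar>p z h * chi \<delta> z\<bar> \<le> 1/2" .
    assume z: "\<bar>z\<bar> \<le> 1/2"
    let ?ch = "chi \<delta> z" and ?s = "p z h * chi \<delta> z"
    show "E h - C' * h ^ 3 \<le> p (z + h) h * chi \<delta> (z + h) - ?s - ?s\<^sup>2 / (1 - ?s) + U z"
    proof (cases "\<bar>z\<bar> \<le> \<delta>")
      case True
      let ?R = "p (z + h) h - p z h - (p z h)\<^sup>2 / (1 - p z h) + U z - E h"
      let ?D = "(chi \<delta> (z + h) - chi \<delta> z) * p (z + h) h"
      have "\<bar>?D\<bar> \<le> K * (h * (z ^ 4 + h ^ 4)) / \<delta> ^ 4"
      proof -
        have "\<bar>z + h\<bar> \<le> 1" using True \<delta> \<eta> h h' by linarith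
        then have "\<bar>p (z + h) h\<bar> \<le> (w + M) * (\<bar>z + h\<bar> + h)" using h h' by (intro p_le) auto
        also have "\<dots> \<le> (w + M) * (2 * (\<bar>z\<bar> + h))" using h w M by (intro mult_left_mono) auto
        finally have "\<bar>chi \<delta> (z + h) - chi \<delta> z\<bar> * \<bar>p (z + h) h\<bar> \<le>
            (8 * h * (\<bar>z\<bar> + h) ^ 3 / \<delta> ^ 4) * ((w + M) * (2 * (\<bar>z\<bar> + h)))"
          using chi_diff[OF \<delta>(1) h(1), of z] h \<delta> by (intro mult_mono) auto
        also have "\<dots> = 8 * h * (w + M) * 2 * (\<bar>z\<bar> + h) ^ 4 / \<delta> ^ 4"
        proof -
          have "(8 * h * a ^ 3 / b) * (m * (2 * a)) = 8 * h * m * 2 * a ^ 4 / b" for m a b :: real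
            by (simp add: power4_eq_xxxx power3_eq_cube)
          then show ?thesis .
        qed
        also have "\<dots> \<le> 8 * h * (w + M) * 2 * (16 * (\<bar>z\<bar> ^ 4 + h ^ 4)) / \<delta> ^ 4"
          using sum_power4_le[of "\<bar>z\<bar>" h] h w M by (intro divide_right_mono mult_left_mono) auto
        also have "\<dots> = K * (h * (z ^ 4 + h ^ 4)) / \<delta> ^ 4" by (simp add: K_def algebra_simps)
        finally show ?thesis by (simp only: abs_mult)
      qed
      then have 1: "- C' * h ^ 3 \<le> ?ch * ?R + (1 - ?ch) * (U z - E h) + ?D"
        using C'(2)[OF h(1) h'(3), of ?ch z ?R "U z" "E h" ?D] chi_props[OF \<delta>(1)] True res[of z h] \<delta>(2) h h'
          U_ge[OF z] E_le[OF h(1) h'(3)] by simp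
      \<comment> \<open>Convexity along the segment from 0 to p, with chi in [0, 1] as the
        parameter.\<close>
      have conv: "?s\<^sup>2 / (1 - ?s) \<le> ?ch * ((p z h)\<^sup>2 / (1 - p z h))"
      proof -
        have pz: "\<bar>p z h\<bar> \<le> 1/2" using p_half[of z] True \<delta>(1) by simp
        have pos: "0 < 1 - p z h" "0 < 1 - ?s" using pz p_chi[of z] by linarith+
        have "?ch * (1 - p z h) \<le> 1 - ?s" using chi_props(2)[OF \<delta>(1), of z] by (simp add: algebra_simps)
        then have "?ch * (p z h)\<^sup>2 * (?ch * (1 - p z h)) \<le> ?ch * (p z h)\<^sup>2 * (1 - ?s)"
          using chi_props(1)[OF \<delta>(1), of z] by (intro mult_left_mono) auto
        then have "?s\<^sup>2 * (1 - p z h) \<le> (?ch * (p z h)\<^sup>2) * (1 - ?s)"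
          by (simp add: power2_eq_square mult_ac)
        then have "?s\<^sup>2 / (1 - ?s) \<le> (?ch * (p z h)\<^sup>2) / (1 - p z h)" using pos by (simp add: divide_simps)
        then show ?thesis by simp
      qed
      have "?ch * ?R + (1 - ?ch) * (U z - E h) + ?D =
          p (z + h) h * chi \<delta> (z + h) - ?s - ?ch * ((p z h)\<^sup>2 / (1 - p z h)) + U z - E h"
        by (simp add: algebra_simps)
      then show ?thesis using 1 conv by linarith
    next
      case False
      then have "\<delta>\<^sup>2 \<le> z\<^sup>2" using \<delta>(1) by (intro abs_le_square_iff[THEN iffD1]) auto
      then have "c0 * \<delta>\<^sup>2 \<le> U z" using U_ge[OF z] c0 by (meson mult_le_cancel_left_pos order_trans)
      moreover have "E h \<le> h * (M + 1)" using E_le[OF h(1) h'(3)] h by (simp add: algebra_simps)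
      moreover have "0 \<le> C' * h ^ 3" using C'(1) h by simp
      \<comment> \<open>A site z left of the support may be followed by z + h inside it. There chi
        is O(h), because it vanishes at z; the constant 64 = 8 * 2^3 comes from |z| + h <= 2 and is
        provided for in \<open>h1\<close>.\<close>
      moreover have "\<bar>p (z + h) h * chi \<delta> (z + h)\<bar> \<le> h * (64 / \<delta> ^ 4)"
      proof (cases "\<bar>z + h\<bar> \<le> \<delta>")
        case True
        have "\<bar>chi \<delta> (z + h)\<bar> \<le> 8 * h * (\<bar>z\<bar> + h) ^ 3 / \<delta> ^ 4"
          using chi_diff[OF \<delta>(1) h(1), of z] chi_props(6)[OF \<delta>(1), of z] False by simp
        also have "\<dots> \<le> 8 * h * 2 ^ 3 / \<delta> ^ 4"
          using z h h' by (intro divide_right_mono mult_left_mono power_mono) auto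
        finally have "\<bar>p (z + h) h\<bar> * \<bar>chi \<delta> (z + h)\<bar> \<le> 1 * (8 * h * 2 ^ 3 / \<delta> ^ 4)"
          using p_half[of "z + h"] True \<delta>(1) by (intro mult_mono) auto
        then show ?thesis by (simp add: abs_mult mult.commute)
      next
        case False
        then show ?thesis using chi_props(6)[OF \<delta>(1), of "z + h"] h by simp
      qed
      moreover have "h * (M + 1 + 64 / \<delta> ^ 4) = h * (M + 1) + h * (64 / \<delta> ^ 4)" by (rule distrib_left)
      ultimately show ?thesis using False chi_props(6)[OF \<delta>(1), of z] h'(4) by simp
    qed
  qed (use \<delta> \<eta> C' in auto)
qed

end

context riccati_c begin

text \<open>The function is m^3 exp (- S / h) with S' = p (1 + y^4 / \<delta>^4) and m = 1 - (y /
  \<delta>)^6; the cube makes it C^2 at the edges. The inequality must hold up to the edge, where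
  the function itself vanishes. There the term 6 m m'^2 in the second derivative of m^3 has the
  right sign and dominates; near the well the cutoff costs O(h^2 y^4) + O(h^3).\<close>

lemma subsolution:
  obtains \<delta> h1 C' where "0 < \<delta>" "0 < h1" "0 \<le> C'"
    "\<And>h. 0 < h \<Longrightarrow> h \<le> h1 \<Longrightarrow> \<exists>Y Y' Y''. (\<forall>y. (Y has_real_derivative Y' y) (at y)) \<and>
      (\<forall>y. (Y' has_real_derivative Y'' y) (at y)) \<and> continuous_on UNIV Y'' \<and>
      (\<forall>y. \<delta> < \<bar>y\<bar> \<longrightarrow> Y y = 0 \<and> Y' y = 0 \<and> Y'' y = 0) \<and> (\<forall>y. 0 \<le> Y y) \<and> 0 < Y 0 \<and>
      (\<forall>y. - h\<^sup>2 * Y'' y + U y * Y y \<le> (E h + C' * h ^ 3) * Y y)"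
proof -
  obtain \<delta> where \<delta>: "0 < \<delta>" "\<delta> \<le> \<eta>" "4 * C * \<delta> ^ 4 \<le> c0" "4 * M * \<delta> \<le> w" by (rule delta_exists) (rule that)
  define K where "K = 64 * (w + M) + 180 / \<delta>\<^sup>2"
  have K: "0 \<le> K" using w M by (simp add: K_def)
  have "2 * C * (\<delta> ^ 4 + \<delta> ^ 4) \<le> c0" using \<delta>(3) by simp
  then obtain C1 where C1: "0 \<le> C1" "\<And>z h R u E D. 0 < h \<Longrightarrow> h \<le> 1 \<Longrightarrow> \<bar>z\<bar> \<le> \<delta> \<Longrightarrow>
    R \<le> C * (z ^ 6 + h ^ 3) \<Longrightarrow> c0 * z\<^sup>2 \<le> u \<Longrightarrow> E \<le> M * h \<Longrightarrow> D \<le> K * (h * (z ^ 4 + h ^ 4)) / \<delta> ^ 4 \<Longrightarrow>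
    (1 + z ^ 4 / \<delta> ^ 4) * R - z ^ 4 / \<delta> ^ 4 * (u - E) + D \<le> C1 * h ^ 3"
    using upper_tail[OF C c0 M K \<delta>(1)] by blast
  define C2 where "C2 = 144 * (M\<^sup>2 / w) / \<delta>\<^sup>2"
  have C2: "0 \<le> C2" using w by (simp add: C2_def)
  define h1 where "h1 = min \<eta> (w * \<delta> / (4 * (M + 1)))"
  show ?thesis
  proof (rule that[of \<delta> h1 "C1 + C2"])
    show "0 < \<delta>" by (rule \<delta>(1))
    show "0 < h1" using \<eta> w \<delta> M by (simp add: h1_def)
    show "0 \<le> C1 + C2" using C1 C2 by simp
    fix h :: real assume h: "0 < h" "h \<le> h1"
    have h': "h \<le> \<eta>" "h \<le> 1" "h * (4 * (M + 1)) \<le> w * \<delta>"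
      using h \<eta> M by (auto simp: h1_def pos_le_divide_eq)
    define \<sigma> where "\<sigma> y = p y h * (1 + y ^ 4 / \<delta> ^ 4)" for y
    define \<sigma>' where "\<sigma>' y = p' y h * (1 + y ^ 4 / \<delta> ^ 4) + p y h * (4 * y ^ 3 / \<delta> ^ 4)" for y
    have \<sigma>d: "(\<sigma> has_real_derivative \<sigma>' y) (at y)" for y
    proof -
      define k where "k = inverse (\<delta> ^ 4)"
      have "((\<lambda>y. 1 + y ^ 4 * k) has_real_derivative 4 * y ^ 3 * k) (at y)"
        by (auto intro!: derivative_eq_intros)
      from DERIV_mult'[OF p_deriv[of h y] this] show ?thesis
        unfolding \<sigma>_def[abs_def] \<sigma>'_def divide_inverse k_def[symmetric] by (simp add: algebra_simps)
    qed
    have \<sigma>c: "continuous_on UNIV \<sigma>" "continuous_on A \<sigma>" for A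
      using \<sigma>d by (auto intro!: continuous_at_imp_continuous_on DERIV_isCont)
    have pc: "continuous_on UNIV (\<lambda>y. p y h)"
      by (intro continuous_at_imp_continuous_on ballI DERIV_isCont[OF p_deriv])
    have \<sigma>'c: "continuous_on UNIV \<sigma>'" unfolding \<sigma>'_def[abs_def]
      using \<delta>(1) by (intro continuous_intros p'_cont pc) auto
    \<comment> \<open>Another base point would only multiply the test function by a positive
      constant.\<close>
    define S where "S y = integral {-1..y} \<sigma>" for y
    have Sd: "(S has_real_derivative \<sigma> y) (at y)" if "\<bar>y\<bar> \<le> \<delta>" for y
    proof -
      have "\<bar>y\<bar> < 1" using that \<delta> \<eta> by linarith
      then have "(S has_real_derivative \<sigma> y) (at y within {-1..1})"
        unfolding S_def[abs_def] by (intro integral_has_real_derivative \<sigma>c) auto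
      moreover have "at y within {-1..1} = at y" using \<open>\<bar>y\<bar> < 1\<close> by (intro at_within_interior) auto
      ultimately show ?thesis by simp
    qed
    define e where "e y = exp (- S y / h)" for y
    have ed: "(e has_real_derivative - (\<sigma> y / h) * e y) (at y)" if "\<bar>y\<bar> \<le> \<delta>" for y
    proof -
      have "((\<lambda>y. - S y / h) has_real_derivative - \<sigma> y / h) (at y)"
        by (intro DERIV_cdivide DERIV_minus Sd that)
      from DERIV_fun_exp[OF this] show ?thesis unfolding e_def[abs_def] by (simp add: mult.commute)
    qed
    define c where "c = inverse (\<delta> ^ 6)"
    have c: "0 < c" "c * \<delta> ^ 6 = 1" using \<delta>(1) by (auto simp: c_def)
    define m where "m y = 1 - c * y ^ 6" for y
    define m' where "m' y = - 6 * c * y ^ 5" for y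
    define m'' where "m'' y = - 30 * c * y ^ 4" for y
    have md: "(m has_real_derivative m' y) (at y)" "(m' has_real_derivative m'' y) (at y)" for y
      unfolding m_def[abs_def] m'_def[abs_def] m''_def by (auto intro!: derivative_eq_intros)
    have m_end: "m \<delta> = 0" "m (- \<delta>) = 0" using c by (auto simp: m_def)
    have m01: "0 \<le> m y" "m y \<le> 1" if "\<bar>y\<bar> \<le> \<delta>" for y
    proof -
      have "\<bar>y\<bar> ^ 6 \<le> \<delta> ^ 6" using that by (intro power_mono) auto
      then have "c * y ^ 6 \<le> c * \<delta> ^ 6" using c by (intro mult_left_mono) (auto simp: power_even_abs)
      then show "0 \<le> m y" using c by (simp add: m_def)
      show "m y \<le> 1" using c by (simp add: m_def zero_le_even_power)
    qed
    define G where "G y = m y ^ 3 * e y" for y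
    define G' where "G' y = (3 * m y ^ 2 * m' y - m y ^ 3 * (\<sigma> y / h)) * e y" for y
    \<comment> \<open>The second derivative with the exponential factored out, so that the
      differential inequality becomes one between polynomial expressions.\<close>
    define Q where "Q y = 6 * m y * m' y ^ 2 + 3 * m y ^ 2 * m'' y - 6 * m y ^ 2 * m' y * (\<sigma> y / h) - m y ^ 3 * (\<sigma>' y / h)
        + m y ^ 3 * (\<sigma> y / h) ^ 2" for y
    define G'' where "G'' y = Q y * e y" for y
    have Gd: "(G has_real_derivative G' y) (at y)" if "\<bar>y\<bar> \<le> \<delta>" for y
    proof -
      have "((\<lambda>y. m y ^ 3) has_real_derivative 3 * m y ^ 2 * m' y) (at y)"
        using DERIV_power[OF md(1)[of y], of 3] by (simp add: mult_ac)
      from DERIV_mult'[OF this ed[OF that]] show ?thesis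
        unfolding G_def[abs_def] G'_def by (simp add: algebra_simps)
    qed
    have G'd: "(G' has_real_derivative G'' y) (at y)" if "\<bar>y\<bar> \<le> \<delta>" for y
    proof -
      have 1: "((\<lambda>y. m y ^ 3) has_real_derivative 3 * m y ^ 2 * m' y) (at y)"
        using DERIV_power[OF md(1)[of y], of 3] by (simp add: mult_ac)
      have 2: "((\<lambda>y. m y ^ 2) has_real_derivative 2 * m y * m' y) (at y)"
        using DERIV_power[OF md(1)[of y], of 2] by (simp add: mult_ac)
      have 3: "((\<lambda>y. \<sigma> y / h) has_real_derivative \<sigma>' y / h) (at y)" by (intro DERIV_cdivide \<sigma>d)
      have "((\<lambda>y. 3 * (m y ^ 2 * m' y) - m y ^ 3 * (\<sigma> y / h)) has_real_derivative
          3 * (m y ^ 2 * m'' y + 2 * m y * m' y * m' y) - (m y ^ 3 * (\<sigma>' y / h) + 3 * m y ^ 2 * m' y * (\<sigma> y / h))) (at y)"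
        by (intro DERIV_diff DERIV_cmult DERIV_mult' 1 2 3 md)
      from DERIV_mult'[OF this ed[OF that]] show ?thesis
        unfolding G'_def[abs_def] G''_def Q_def
        by (rule DERIV_cong[OF back_subst[of "\<lambda>f. (f has_real_derivative _) _"]])
          (simp_all add: algebra_simps power2_eq_square)
    qed
    have Qc: "continuous_on {-\<delta>..\<delta>} G''"
    proof -
      have "continuous_on {-\<delta>..\<delta>} e"
        by (intro continuous_at_imp_continuous_on ballI DERIV_isCont[OF ed]) auto
      moreover have "continuous_on {-\<delta>..\<delta>} \<sigma>'" by (rule continuous_on_subset[OF \<sigma>'c]) simp
      ultimately show ?thesis
        unfolding G''_def Q_def m_def m'_def m''_def using h \<sigma>c(2) by (intro continuous_intros) auto
    qed
    have ends: "G \<delta> = 0" "G (- \<delta>) = 0" "G' \<delta> = 0" "G' (- \<delta>) = 0" "G'' \<delta> = 0" "G'' (- \<delta>) = 0"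
      by (simp_all add: G_def G'_def G''_def Q_def m_end)
    have ineq: "- h\<^sup>2 * Q y + U y * m y ^ 3 \<le> (E h + (C1 + C2) * h ^ 3) * m y ^ 3" if y: "\<bar>y\<bar> \<le> \<delta>" for y
    proof -
      have y1: "\<bar>y\<bar> \<le> 1" "\<bar>y\<bar> \<le> 1/2" "\<bar>y\<bar> \<le> \<eta>" using y \<delta> \<eta> by auto
      let ?m = "m y"
      have m: "0 \<le> ?m" "?m \<le> 1" using m01[OF y] by auto
      let ?F = "U y - (\<sigma> y)\<^sup>2 + h * \<sigma>' y"
      have split: "- h\<^sup>2 * Q y + U y * ?m ^ 3 = - h\<^sup>2 * (6 * ?m * m' y ^ 2 + 3 * ?m ^ 2 * m'' y) + 6 * h * ?m ^ 2 * m' y * \<sigma> y + ?m ^ 3 * ?F"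
        unfolding Q_def using h by (simp add: field_simps power2_eq_square)
      \<comment> \<open>p has the sign of y up to an error O(h), by \<open>p_lin\<close> and 4 M
        \<delta> <= w.\<close>
      have yp: "3 * w / 4 * y\<^sup>2 - M * h * \<bar>y\<bar> \<le> y * p y h"
      proof -
        have "\<bar>y * p y h - w * y\<^sup>2\<bar> = \<bar>y\<bar> * \<bar>p y h - w * y\<bar>"
          by (simp add: power2_eq_square right_diff_distrib mult.left_commute flip: abs_mult)
        also have "\<dots> \<le> \<bar>y\<bar> * (M * (y\<^sup>2 + h))" using p_lin[OF y1(1) h(1) h'(2)] by (intro mult_left_mono) auto
        also have "\<dots> = (M * \<bar>y\<bar>) * y\<^sup>2 + M * h * \<bar>y\<bar>" by (simp add: algebra_simps)
        also have "\<dots> \<le> (w / 4) * y\<^sup>2 + M * h * \<bar>y\<bar>"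
        proof -
          have "M * \<bar>y\<bar> \<le> M * \<delta>" using y M by (intro mult_left_mono) auto
          then show ?thesis using \<delta>(4) by (intro add_right_mono mult_right_mono) auto
        qed
        finally show ?thesis by (simp add: abs_le_iff algebra_simps)
      qed
      \<comment> \<open>At |y| < \<delta> / 2 the subtracted term c y^6 is below 1/64, so m < 1/2
        happens only in the outer half.\<close>
      have m_small: "\<delta> / 2 \<le> \<bar>y\<bar>" "1/2 \<le> c * y ^ 6" if "?m < 1/2"
      proof -
        show 1: "1/2 \<le> c * y ^ 6" using that by (simp add: m_def)
        show "\<delta> / 2 \<le> \<bar>y\<bar>"
        proof (rule ccontr)
          assume "\<not> \<delta> / 2 \<le> \<bar>y\<bar>"
          then have "\<bar>y\<bar> ^ 6 \<le> (\<delta> / 2) ^ 6" by (intro power_mono) auto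
          then have "c * y ^ 6 \<le> c * ((\<delta> / 2) ^ 6)" using c by (intro mult_left_mono) (auto simp: power_even_abs)
          also have "\<dots> = 1 / 64" using c(2) by (simp add: power_divide)
          finally show False using 1 by simp
        qed
      qed
      have c\<delta>: "c * y ^ 4 \<le> 1 / \<delta>\<^sup>2"
      proof -
        have "\<bar>y\<bar> ^ 4 \<le> \<delta> ^ 4" using y by (intro power_mono) auto
        then have "c * y ^ 4 \<le> c * \<delta> ^ 4" using c by (intro mult_left_mono) (auto simp: power_even_abs)
        also have "\<dots> = 1 / \<delta>\<^sup>2" using \<delta>(1) by (simp add: c_def field_simps flip: power_add)
        finally show ?thesis .
      qed
      have cy: "0 \<le> c * y ^ 4" using c by simp
      \<comment> \<open>216 c y^6 comes from m'^2 and 90 m from m''. For m < 1/2 the former wins;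
        otherwise m <= 2 m^2 supplies the power of m needed to factor out m^3.\<close>
      have A: "- h\<^sup>2 * (6 * ?m * m' y ^ 2 + 3 * ?m ^ 2 * m'' y) \<le> ?m ^ 3 * (180 * h\<^sup>2 * (c * y ^ 4))"
      proof -
        have eq: "- h\<^sup>2 * (6 * ?m * m' y ^ 2 + 3 * ?m ^ 2 * m'' y) = h\<^sup>2 * ?m * (c * y ^ 4) * (90 * ?m - 216 * (c * y ^ 6))"
          unfolding m'_def m''_def by algebra
        have "90 * ?m - 216 * (c * y ^ 6) \<le> 180 * ?m ^ 2"
        proof (cases "?m < 1/2")
          case True
          then have "90 * ?m - 216 * (c * y ^ 6) \<le> 0" using m_small(2)[OF True] by linarith
          also have "0 \<le> 180 * ?m ^ 2" by simp
          finally show ?thesis .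
        next
          case False
          then have "?m * (1/2) \<le> ?m * ?m" using m by (intro mult_left_mono) auto
          moreover have "0 \<le> c * y ^ 6" using c by (simp add: zero_le_even_power)
          ultimately show ?thesis by (simp add: power2_eq_square)
        qed
        then have "h\<^sup>2 * ?m * (c * y ^ 4) * (90 * ?m - 216 * (c * y ^ 6)) \<le> h\<^sup>2 * ?m * (c * y ^ 4) * (180 * ?m ^ 2)"
          using m cy by (intro mult_left_mono) auto
        then show ?thesis unfolding eq by (simp add: power2_eq_square power3_eq_cube mult_ac)
      qed
      \<comment> \<open>m' is opposite in sign to y, so the term is nonpositive where y p >= 0, in
        particular where m < 1/2. Elsewhere completing the square gives y p >= - (M^2 / w) h^2, and
        m^2 <= 2 m^3.\<close>
      have Bb: "6 * h * ?m ^ 2 * m' y * \<sigma> y \<le> ?m ^ 3 * (C2 * h ^ 3)"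
      proof -
        let ?o = "1 + y ^ 4 / \<delta> ^ 4"
        have "\<bar>y\<bar> ^ 4 \<le> \<delta> ^ 4" using y by (intro power_mono) auto
        then have o: "0 \<le> ?o" "?o \<le> 2" using \<delta>(1) by (auto simp: power_even_abs)
        have eq: "6 * h * ?m ^ 2 * m' y * \<sigma> y = (36 * h * ?m ^ 2 * (c * y ^ 4) * ?o) * (- (y * p y h))"
          unfolding m'_def \<sigma>_def by (simp add: power_Suc[of y 4, simplified] mult_ac numeral_eq_Suc)
        have pre: "0 \<le> 36 * h * ?m ^ 2 * (c * y ^ 4) * ?o" using h cy o by simp
        show ?thesis
        proof (cases "?m < 1/2")
          case True
          have "M * h \<le> 3 * w / 4 * \<bar>y\<bar>"
          proof -
            have "4 * (M * h) \<le> w * \<delta>" using h'(3) h by (simp add: algebra_simps)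
            moreover have "w * \<delta> \<le> w * (2 * \<bar>y\<bar>)" using m_small(1)[OF True] w by (intro mult_left_mono) auto
            moreover have "0 \<le> w * \<bar>y\<bar>" using w by simp
            ultimately have "M * h \<le> 3 / 4 * (w * \<bar>y\<bar>)" by simp
            then show ?thesis by simp
          qed
          then have "M * h * \<bar>y\<bar> \<le> 3 * w / 4 * \<bar>y\<bar> * \<bar>y\<bar>" by (intro mult_right_mono) auto
          then have "0 \<le> y * p y h" using yp by (simp add: power2_eq_square mult.assoc)
          then have "(36 * h * ?m ^ 2 * (c * y ^ 4) * ?o) * (- (y * p y h)) \<le> 0"
            using pre by (simp only: mult_nonneg_nonpos neg_le_0_iff_le)
          also have "0 \<le> ?m ^ 3 * (C2 * h ^ 3)" using m C2 h by simp
          finally show ?thesis unfolding eq .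
        next
          case False
          have "0 \<le> 3 * w / 4 * y\<^sup>2 - M * h * \<bar>y\<bar> + M\<^sup>2 / w * h\<^sup>2"
          proof -
            have "0 \<le> (w / 2 * \<bar>y\<bar> - M * h)\<^sup>2 / w + w / 2 * y\<^sup>2" using w by simp
            also have "\<dots> = 3 * w / 4 * y\<^sup>2 - M * h * \<bar>y\<bar> + M\<^sup>2 / w * h\<^sup>2"
              using w by (simp add: power2_eq_square field_simps)
            finally show ?thesis .
          qed
          then have "- (y * p y h) \<le> M\<^sup>2 / w * h\<^sup>2" using yp by linarith
          then have "(36 * h * ?m ^ 2 * (c * y ^ 4) * ?o) * (- (y * p y h)) \<le> (36 * h * ?m ^ 2 * (c * y ^ 4) * ?o) * (M\<^sup>2 / w * h\<^sup>2)"
            using pre by (rule mult_left_mono)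
          also have "\<dots> = (36 * h ^ 3 * ?m ^ 2 * (M\<^sup>2 / w)) * ((c * y ^ 4) * ?o)"
            by (simp add: power2_eq_square power3_eq_cube mult_ac)
          also have "\<dots> \<le> (36 * h ^ 3 * ?m ^ 2 * (M\<^sup>2 / w)) * ((1 / \<delta>\<^sup>2) * 2)"
            using h w o cy c\<delta> by (intro mult_left_mono mult_mono) auto
          also have "\<dots> = (72 * h ^ 3 * (M\<^sup>2 / w) / \<delta>\<^sup>2) * ?m ^ 2" by simp
          also have "\<dots> \<le> (72 * h ^ 3 * (M\<^sup>2 / w) / \<delta>\<^sup>2) * (2 * ?m ^ 3)"
          proof (rule mult_left_mono)
            have "?m ^ 2 * (1/2) \<le> ?m ^ 2 * ?m" using False by (intro mult_left_mono) auto
            then show "?m ^ 2 \<le> 2 * ?m ^ 3" by (simp add: power2_eq_square power3_eq_cube)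
          qed (use h w in simp)
          also have "\<dots> = ?m ^ 3 * (C2 * h ^ 3)" by (simp add: C2_def)
          finally show ?thesis unfolding eq .
        qed
      qed
      \<comment> \<open>The error of \<open>A\<close> joins the derivative of the bending factor in
        D for \<open>upper_tail\<close>. With t = y^4 / \<delta>^4, the term (1 + t) t p^2 >= 0 is
        given away.\<close>
      have Cc: "?F + 180 * h\<^sup>2 * (c * y ^ 4) \<le> E h + C1 * h ^ 3"
      proof -
        let ?o = "1 + y ^ 4 / \<delta> ^ 4" and ?R = "h * p' y h - (p y h)\<^sup>2 + U y - E h"
        let ?D = "h * p y h * (4 * y ^ 3 / \<delta> ^ 4) + 180 * h\<^sup>2 * (c * y ^ 4)"
        have D1: "h * p y h * (4 * y ^ 3 / \<delta> ^ 4) \<le> 64 * (w + M) * (h * (y ^ 4 + h ^ 4)) / \<delta> ^ 4"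
        proof -
          have "\<bar>p y h\<bar> * \<bar>4 * y ^ 3 / \<delta> ^ 4\<bar> \<le> ((w + M) * (\<bar>y\<bar> + h)) * (4 * (\<bar>y\<bar> + h) ^ 3 / \<delta> ^ 4)"
          proof (rule mult_mono)
            show "\<bar>p y h\<bar> \<le> (w + M) * (\<bar>y\<bar> + h)" by (rule p_le[OF y1(1) h(1) h'(2)])
            have "\<bar>4 * y ^ 3 / \<delta> ^ 4\<bar> = 4 * \<bar>y\<bar> ^ 3 / \<delta> ^ 4" using \<delta>(1) by (simp add: abs_mult power_abs)
            also have "\<dots> \<le> 4 * (\<bar>y\<bar> + h) ^ 3 / \<delta> ^ 4" using h by (intro divide_right_mono mult_left_mono power_mono) auto
            finally show "\<bar>4 * y ^ 3 / \<delta> ^ 4\<bar> \<le> 4 * (\<bar>y\<bar> + h) ^ 3 / \<delta> ^ 4" .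
          qed (use w M h in auto)
          also have "\<dots> = 4 * (w + M) * (\<bar>y\<bar> + h) ^ 4 / \<delta> ^ 4"
          proof -
            have "(a * b) * (4 * b ^ 3 / d') = 4 * a * b ^ 4 / d'" for a b d' :: real
              by (simp add: power4_eq_xxxx power3_eq_cube)
            then show ?thesis .
          qed
          also have "\<dots> \<le> 4 * (w + M) * (16 * (\<bar>y\<bar> ^ 4 + h ^ 4)) / \<delta> ^ 4"
            using sum_power4_le[of "\<bar>y\<bar>" h] h w M by (intro divide_right_mono mult_left_mono) auto
          finally have D1a: "h * (\<bar>p y h\<bar> * \<bar>4 * y ^ 3 / \<delta> ^ 4\<bar>) \<le> h * (4 * (w + M) * (16 * (\<bar>y\<bar> ^ 4 + h ^ 4)) / \<delta> ^ 4)"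
            using h by (intro mult_left_mono) auto
          have D1b: "h * p y h * (4 * y ^ 3 / \<delta> ^ 4) \<le> h * (\<bar>p y h\<bar> * \<bar>4 * y ^ 3 / \<delta> ^ 4\<bar>)"
            using abs_ge_self[of "h * p y h * (4 * y ^ 3 / \<delta> ^ 4)"] h by (simp add: abs_mult mult.assoc)
          have D1c: "h * (4 * (w + M) * (16 * (\<bar>y\<bar> ^ 4 + h ^ 4)) / \<delta> ^ 4) = 64 * (w + M) * (h * (y ^ 4 + h ^ 4)) / \<delta> ^ 4"
            by (simp add: algebra_simps)
          show ?thesis by (rule order_trans[OF D1b D1a[unfolded D1c]])
        qed
        have D2: "180 * h\<^sup>2 * (c * y ^ 4) \<le> 180 / \<delta>\<^sup>2 * (h * (y ^ 4 + h ^ 4)) / \<delta> ^ 4"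
        proof -
          have "h * h \<le> h * 1" using h h' by (intro mult_left_mono) auto
          then have "180 * c * y ^ 4 * (h * h) \<le> 180 * c * y ^ 4 * h" using c by (intro mult_left_mono) auto
          also have "\<dots> \<le> 180 * c * (h * (y ^ 4 + h ^ 4))" using c h by (simp add: algebra_simps)
          finally have "180 * c * y ^ 4 * (h * h) \<le> 180 * c * (h * (y ^ 4 + h ^ 4))" .
          moreover have "c = 1 / \<delta>\<^sup>2 / \<delta> ^ 4" by (simp add: c_def field_simps flip: power_add)
          ultimately show ?thesis by (simp add: power2_eq_square mult_ac)
        qed
        have "?D \<le> K * (h * (y ^ 4 + h ^ 4)) / \<delta> ^ 4"
          using add_mono[OF D1 D2] by (simp add: K_def distrib_right add_divide_distrib)
        then have "?o * ?R - y ^ 4 / \<delta> ^ 4 * (U y - E h) + ?D \<le> C1 * h ^ 3"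
          using C1(2)[OF h(1) h'(2) y, of ?R "U y" "E h" ?D] res[of y h] y1 h h' U_ge[OF y1(2)] E_le[OF h(1) h'(2)] by simp
        moreover have "(1 + t) * (h * b - a\<^sup>2 + u - v) - t * (u - v) + (h * a * g + k) - (1 + t) * t * a\<^sup>2 =
            u - (a * (1 + t))\<^sup>2 + h * (b * (1 + t) + a * g) + k - v" for t a b g k u v :: real
          by (simp add: power2_eq_square algebra_simps)
        then have "?o * ?R - y ^ 4 / \<delta> ^ 4 * (U y - E h) + ?D - ?o * (y ^ 4 / \<delta> ^ 4) * (p y h)\<^sup>2 =
            ?F + 180 * h\<^sup>2 * (c * y ^ 4) - E h"
          unfolding \<sigma>_def \<sigma>'_def .
        moreover have "0 \<le> ?o * (y ^ 4 / \<delta> ^ 4) * (p y h)\<^sup>2" by simp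
        ultimately show ?thesis by linarith
      qed
      have "?m ^ 3 * (?F + 180 * h\<^sup>2 * (c * y ^ 4)) \<le> ?m ^ 3 * (E h + C1 * h ^ 3)"
        using Cc m by (intro mult_left_mono) auto
      then show ?thesis unfolding split using A Bb by (simp add: algebra_simps)
    qed
    show "\<exists>Y Y' Y''. (\<forall>y. (Y has_real_derivative Y' y) (at y)) \<and>
      (\<forall>y. (Y' has_real_derivative Y'' y) (at y)) \<and> continuous_on UNIV Y'' \<and>
      (\<forall>y. \<delta> < \<bar>y\<bar> \<longrightarrow> Y y = 0 \<and> Y' y = 0 \<and> Y'' y = 0) \<and> (\<forall>y. 0 \<le> Y y) \<and> 0 < Y 0 \<and>
      (\<forall>y. - h\<^sup>2 * Y'' y + U y * Y y \<le> (E h + (C1 + C2) * h ^ 3) * Y y)"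
    proof (rule exI[of _ "cutoff \<delta> G"], rule exI[of _ "cutoff \<delta> G'"], rule exI[of _ "cutoff \<delta> G''"], intro conjI allI impI)
      fix y
      show "(cutoff \<delta> G has_real_derivative cutoff \<delta> G' y) (at y)" by (rule cutoff_deriv[OF Gd ends(1-4)])
      show "(cutoff \<delta> G' has_real_derivative cutoff \<delta> G'' y) (at y)" by (rule cutoff_deriv[OF G'd ends(3-6)])
      show "0 \<le> cutoff \<delta> G y" using m01(1)[of y] by (simp add: cutoff_def G_def e_def)
      show "- h\<^sup>2 * cutoff \<delta> G'' y + U y * cutoff \<delta> G y \<le> (E h + (C1 + C2) * h ^ 3) * cutoff \<delta> G y"
      proof (cases "\<bar>y\<bar> \<le> \<delta>")
        case True
        have "(- h\<^sup>2 * Q y + U y * m y ^ 3) * e y \<le> ((E h + (C1 + C2) * h ^ 3) * m y ^ 3) * e y"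
          using ineq[OF True] by (intro mult_right_mono) (auto simp: e_def)
        then show ?thesis using True by (simp add: cutoff_def G_def G''_def algebra_simps)
      qed (simp add: cutoff_def)
    next
      show "continuous_on UNIV (cutoff \<delta> G'')" by (rule cutoff_continuous[OF Qc ends(5,6)])
      show "0 < cutoff \<delta> G 0" using \<delta>(1) by (simp add: cutoff_def G_def m_def e_def)
    qed (simp_all add: cutoff_def)
  qed
qed

end

context riccati_d begin

text \<open>On the lattice s itself can end the test function: a factor 1 - s <= 0 stops it on the
  right, and 1 - s >= 3 + B at the left start outweighs the missing neighbour. So s = p (1 + y^4 /
  \<delta>^4) is bent on a scale \<delta> small enough that |s| >= 2 + B for \<zeta> / 2 <= |y| <=
  \<zeta>.\<close>

lemma subsolution:
  obtains \<zeta> h1 C' where "0 < \<zeta>" "\<zeta> \<le> 1/4" "0 < h1" "0 \<le> C'"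
    "\<And>h. 0 < h \<Longrightarrow> h \<le> h1 \<Longrightarrow> 8 * h \<le> \<zeta> \<and> (\<exists>s. (\<forall>y. \<bar>y\<bar> \<le> \<zeta> \<longrightarrow> s y < 1 \<longrightarrow>
        s (y + h) - s y - (s y)\<^sup>2 / (1 - s y) + U y \<le> E h + C' * h ^ 3) \<and>
      (\<forall>y. \<zeta> / 2 \<le> y \<longrightarrow> y \<le> \<zeta> \<longrightarrow> 1 \<le> s y) \<and> (\<forall>y. - \<zeta> \<le> y \<longrightarrow> y \<le> - \<zeta> / 2 \<longrightarrow> s y \<le> - (2 + B)))"
proof -
  obtain \<zeta> where \<zeta>: "0 < \<zeta>" "\<zeta> \<le> \<eta>" "4 * C * \<zeta> ^ 4 \<le> c0" "4 * M * \<zeta> \<le> w" "\<zeta> * (8 * (w + M)) \<le> 1"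
    by (rule delta_exists) (rule that)
  have B: "0 \<le> B" using U_nn[of 0] U_le[of 0] by simp
  \<comment> \<open>w \<zeta> / 8 is a lower bound of |p| for \<zeta> / 2 <= |y| <= \<zeta>;
    together with \<delta>^4 <= \<delta> <= q this pushes |s| above 2 + B.\<close>
  define q where "q = (w * \<zeta> / 8) * (\<zeta> / 2) ^ 4 / (2 + B)"
  have q: "0 < q" using w \<zeta> B by (simp add: q_def)
  define \<delta> where "\<delta> = min \<zeta> q"
  have \<delta>: "0 < \<delta>" "\<delta> \<le> \<zeta>" "\<delta> \<le> q" using \<zeta> q by (auto simp: \<delta>_def)
  have "\<delta> ^ 4 \<le> \<delta>" using \<delta> \<zeta> \<eta> power_decreasing[of 1 4 \<delta>] by simp
  then have "\<delta> ^ 4 * (2 + B) \<le> q * (2 + B)" using \<delta> B by (intro mult_right_mono) auto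
  also have "\<dots> = (w * \<zeta> / 8) * (\<zeta> / 2) ^ 4"
  proof -
    have "x / (2 + B) * (2 + B) = x" for x using B by (subst times_divide_eq_left) simp
    then show ?thesis unfolding q_def .
  qed
  finally have big: "2 + B \<le> (w * \<zeta> / 8) * ((\<zeta> / 2) ^ 4 / \<delta> ^ 4)" using \<delta>(1) by (simp add: pos_le_divide_eq mult.commute)
  have "\<delta> ^ 4 \<le> \<zeta> ^ 4" using \<delta> by (intro power_mono) auto
  then have "2 * C * (\<delta> ^ 4 + \<zeta> ^ 4) \<le> 2 * C * (\<zeta> ^ 4 + \<zeta> ^ 4)" using C by (intro mult_left_mono) auto
  then have \<delta>c: "2 * C * (\<delta> ^ 4 + \<zeta> ^ 4) \<le> c0" using \<zeta>(3) by simp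
  define K where "K = 128 * (w + M)"
  have K: "0 \<le> K" using w M by (simp add: K_def)
  obtain C1 where C1: "0 \<le> C1" "\<And>z h R u E D. 0 < h \<Longrightarrow> h \<le> 1 \<Longrightarrow> \<bar>z\<bar> \<le> \<zeta> \<Longrightarrow>
    R \<le> C * (z ^ 6 + h ^ 3) \<Longrightarrow> c0 * z\<^sup>2 \<le> u \<Longrightarrow> E \<le> M * h \<Longrightarrow> D \<le> K * (h * (z ^ 4 + h ^ 4)) / \<delta> ^ 4 \<Longrightarrow>
    (1 + z ^ 4 / \<delta> ^ 4) * R - z ^ 4 / \<delta> ^ 4 * (u - E) + D \<le> C1 * h ^ 3"
    using upper_tail[OF C c0 M K \<delta>(1) \<delta>c] by blast
  define h1 where "h1 = min (\<zeta> / 8) (w * \<zeta> / (8 * (M + 1)))"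
  show ?thesis
  proof (rule that[of \<zeta> h1 C1])
    show "0 < h1" using \<zeta> w M by (simp add: h1_def)
    fix h :: real assume h: "0 < h" "h \<le> h1"
    have h': "8 * h \<le> \<zeta>" "h \<le> \<zeta>" "h \<le> \<eta>" "h \<le> 1" "h * (8 * (M + 1)) \<le> w * \<zeta>"
      using h \<eta> \<zeta> M by (auto simp: h1_def pos_le_divide_eq)
    define s where "s y = p y h * (1 + y ^ 4 / \<delta> ^ 4)" for y
    have main: "s (y + h) - s y - (s y)\<^sup>2 / (1 - s y) + U y \<le> E h + C1 * h ^ 3" if y: "\<bar>y\<bar> \<le> \<zeta>" and s1: "s y < 1" for y
    proof -
      have y1: "\<bar>y\<bar> \<le> 1" "\<bar>y\<bar> \<le> 1/2" "\<bar>y\<bar> \<le> \<eta>" "\<bar>y + h\<bar> \<le> 1" using y \<zeta> \<eta> h h' by auto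
      let ?t = "y ^ 4 / \<delta> ^ 4"
      let ?R = "p (y + h) h - p y h - (p y h)\<^sup>2 / (1 - p y h) + U y - E h"
      let ?D = "((y + h) ^ 4 / \<delta> ^ 4 - ?t) * p (y + h) h"
      have "\<bar>p y h\<bar> \<le> (w + M) * (\<bar>y\<bar> + h)" by (rule p_le[OF y1(1) h(1) h'(4)])
      also have "\<dots> \<le> (w + M) * (4 * \<zeta>)" using y h' h w M by (intro mult_left_mono) auto
      finally have pz: "\<bar>p y h\<bar> \<le> 1/2" using \<zeta>(5) by (simp add: algebra_simps)
      have D: "?D \<le> K * (h * (y ^ 4 + h ^ 4)) / \<delta> ^ 4"
      proof -
        have dif: "\<bar>(y + h) ^ 4 / \<delta> ^ 4 - ?t\<bar> \<le> 4 * h * (\<bar>y\<bar> + h) ^ 3 / \<delta> ^ 4"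
        proof -
          have "((\<lambda>x. x ^ 4) has_real_derivative 4 * x ^ 3) (at x)" for x :: real
            by (auto intro!: derivative_eq_intros)
          then obtain x where x: "y < x" "x < y + h" "(y + h) ^ 4 - y ^ 4 = (y + h - y) * (4 * x ^ 3)"
            using MVT2[of y "y + h" "\<lambda>x. x ^ 4" "\<lambda>x. 4 * x ^ 3"] h by auto
          have "\<bar>x\<bar> ^ 3 \<le> (\<bar>y\<bar> + h) ^ 3" using x h by (intro power_mono) auto
          then have "h * (4 * \<bar>x\<bar> ^ 3) \<le> h * (4 * (\<bar>y\<bar> + h) ^ 3)" using h by simp
          moreover have "\<bar>(y + h) ^ 4 - y ^ 4\<bar> = h * (4 * \<bar>x\<bar> ^ 3)" unfolding x(3) using h by (simp add: abs_mult power_abs)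
          ultimately have "\<bar>(y + h) ^ 4 - y ^ 4\<bar> / \<delta> ^ 4 \<le> h * (4 * (\<bar>y\<bar> + h) ^ 3) / \<delta> ^ 4"
            by (intro divide_right_mono) auto
          then show ?thesis using \<delta>(1) by (simp add: diff_divide_distrib[symmetric] mult_ac)
        qed
        have "\<bar>p (y + h) h\<bar> \<le> (w + M) * (\<bar>y + h\<bar> + h)" by (rule p_le[OF y1(4) h(1) h'(4)])
        also have "\<dots> \<le> (w + M) * (2 * (\<bar>y\<bar> + h))" using h w M by (intro mult_left_mono) auto
        finally have "\<bar>(y + h) ^ 4 / \<delta> ^ 4 - ?t\<bar> * \<bar>p (y + h) h\<bar> \<le> (4 * h * (\<bar>y\<bar> + h) ^ 3 / \<delta> ^ 4) * ((w + M) * (2 * (\<bar>y\<bar> + h)))"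
          using dif h \<delta> by (intro mult_mono) auto
        also have "\<dots> = 8 * h * (w + M) * (\<bar>y\<bar> + h) ^ 4 / \<delta> ^ 4"
        proof -
          have "(4 * h * a ^ 3 / b) * (m * (2 * a)) = 8 * h * m * a ^ 4 / b" for m a b :: real
            by (simp add: power4_eq_xxxx power3_eq_cube)
          then show ?thesis .
        qed
        also have "\<dots> \<le> 8 * h * (w + M) * (16 * (\<bar>y\<bar> ^ 4 + h ^ 4)) / \<delta> ^ 4"
          using sum_power4_le[of "\<bar>y\<bar>" h] h w M by (intro divide_right_mono mult_left_mono) auto
        also have "\<dots> = K * (h * (y ^ 4 + h ^ 4)) / \<delta> ^ 4" by (simp add: K_def algebra_simps)
        finally show ?thesis using order_trans[OF abs_ge_self[of ?D]] by (simp only: abs_mult)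
      qed
      have "(1 + ?t) * ?R - ?t * (U y - E h) + ?D \<le> C1 * h ^ 3"
        using C1(2)[OF h(1) h'(4) y, of ?R "U y" "E h" ?D] D res[of y h] y1 h h' U_ge[OF y1(2)] E_le[OF h(1) h'(4)] by simp
      \<comment> \<open>Convexity with a factor 1 + t >= 1 goes the other way: s = (1 + t) p gives 1
        - s <= (1 + t) (1 - p), and s < 1 permits the division.\<close>
      moreover have "(1 + ?t) * ((p y h)\<^sup>2 / (1 - p y h)) \<le> (s y)\<^sup>2 / (1 - s y)"
      proof -
        let ?o = "1 + ?t"
        have o: "1 \<le> ?o" by simp
        have pos: "0 < 1 - p y h" "0 < 1 - s y" using pz s1 by linarith+
        have "(1 + t) * (1 - x) = 1 - x * (1 + t) + t" for t x :: real by (simp add: algebra_simps)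
        from this[of ?t "p y h"] have "1 - s y \<le> ?o * (1 - p y h)" unfolding s_def by simp
        then have "?o * (p y h)\<^sup>2 * (1 - s y) \<le> ?o * (p y h)\<^sup>2 * (?o * (1 - p y h))"
          using o by (intro mult_left_mono) auto
        then have "(?o * (p y h)\<^sup>2) * (1 - s y) \<le> (s y)\<^sup>2 * (1 - p y h)"
          unfolding s_def by (simp add: power2_eq_square mult_ac)
        then have "(?o * (p y h)\<^sup>2) / (1 - p y h) \<le> (s y)\<^sup>2 / (1 - s y)" using pos by (simp add: divide_simps)
        then show ?thesis by simp
      qed
      moreover have "(1 + t) * (a - b - f + u - v) - t * (u - v) + (t' - t) * a = a * (1 + t') - b * (1 + t) - (1 + t) * f + u - v"
        for t t' a b f u v :: real by (simp add: algebra_simps)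
      then have "(1 + ?t) * ?R - ?t * (U y - E h) + ?D =
          s (y + h) - s y - (1 + ?t) * ((p y h)\<^sup>2 / (1 - p y h)) + U y - E h"
        unfolding s_def .
      ultimately show ?thesis by linarith
    qed
    have size: "2 + B \<le> a * (1 + y ^ 4 / \<delta> ^ 4)" if "w * \<zeta> / 8 \<le> a" "\<zeta> / 2 \<le> \<bar>y\<bar>" for a y
    proof -
      have "(\<zeta> / 2) ^ 4 \<le> \<bar>y\<bar> ^ 4" using that \<zeta> by (intro power_mono) auto
      then have t4: "(\<zeta> / 2) ^ 4 / \<delta> ^ 4 \<le> y ^ 4 / \<delta> ^ 4" using \<delta>(1) by (intro divide_right_mono) (auto simp: power_even_abs)
      have "(w * \<zeta> / 8) * ((\<zeta> / 2) ^ 4 / \<delta> ^ 4) \<le> a * (1 + y ^ 4 / \<delta> ^ 4)"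
      proof (rule mult_mono)
        have "0 \<le> w * \<zeta> / 8" using w \<zeta> by simp
        then show "0 \<le> a" using that(1) by linarith
      qed (use that \<delta> \<zeta> t4 in auto)
      then show ?thesis using big by linarith
    qed
    have lin: "\<bar>p y h - w * y\<bar> \<le> w / 4 * \<bar>y\<bar> + w * \<zeta> / 8" if "\<bar>y\<bar> \<le> \<zeta>" for y
    proof -
      have "\<bar>p y h - w * y\<bar> \<le> M * (y\<^sup>2 + h)" using that \<zeta> \<eta> h h' by (intro p_lin) auto
      moreover have "M * \<bar>y\<bar> * \<bar>y\<bar> \<le> (w / 4) * \<bar>y\<bar>"
      proof (rule mult_right_mono)
        have "M * \<bar>y\<bar> \<le> M * \<zeta>" using that M by (intro mult_left_mono) auto
        then show "M * \<bar>y\<bar> \<le> w / 4" using \<zeta>(4) by simp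
      qed simp
      then have "M * y\<^sup>2 \<le> (w / 4) * \<bar>y\<bar>" by (simp add: power2_eq_square mult.assoc)
      moreover have "M * h \<le> w * \<zeta> / 8" using h'(5) h by (simp add: algebra_simps)
      ultimately show ?thesis unfolding distrib_left by linarith
    qed
    have right: "1 \<le> s y" if "\<zeta> / 2 \<le> y" "y \<le> \<zeta>" for y
    proof -
      have "w * (\<zeta> / 2) \<le> w * y" using that w by (intro mult_left_mono) auto
      then have "w * \<zeta> / 8 \<le> p y h" using lin[of y] that \<zeta> by (simp add: abs_le_iff)
      then show ?thesis using size[of "p y h" y] that \<zeta> B unfolding s_def by simp
    qed
    have left: "s y \<le> - (2 + B)" if "- \<zeta> \<le> y" "y \<le> - \<zeta> / 2" for y
    proof -
      have "w * (\<zeta> / 2) \<le> w * (- y)" using that w by (intro mult_left_mono) auto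
      then have "w * \<zeta> / 8 \<le> - p y h" using lin[of y] that \<zeta> by (simp add: abs_le_iff)
      then show ?thesis using size[of "- p y h" y] that \<zeta> unfolding s_def by simp
    qed
    show "8 * h \<le> \<zeta> \<and> (\<exists>s. (\<forall>y. \<bar>y\<bar> \<le> \<zeta> \<longrightarrow> s y < 1 \<longrightarrow>
        s (y + h) - s y - (s y)\<^sup>2 / (1 - s y) + U y \<le> E h + C1 * h ^ 3) \<and>
      (\<forall>y. \<zeta> / 2 \<le> y \<longrightarrow> y \<le> \<zeta> \<longrightarrow> 1 \<le> s y) \<and> (\<forall>y. - \<zeta> \<le> y \<longrightarrow> y \<le> - \<zeta> / 2 \<longrightarrow> s y \<le> - (2 + B)))"
      using h'(1) main right left by (intro conjI exI[of _ s]) auto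
  qed (use \<zeta> \<eta> C1 in auto)
qed

end

subsection \<open>The potential\<close>

locale single_well =
  fixes V :: "real \<Rightarrow> real" and x0 a0 :: real
  assumes smooth_V: "smooth V"
    and periodic: "\<And>x. V (x + 1) = V x"
    and minima: "\<And>x. (\<forall>y. V x \<le> V y) \<longleftrightarrow> x - x0 \<in> \<int>"
    and expansion: "(\<lambda>x. V x - a0 * (x - x0)\<^sup>2) \<in> O[at x0](\<lambda>x. \<bar>x - x0\<bar> ^ 3)"
    and a0: "a0 > 0"
begin

abbreviation U :: "real \<Rightarrow> real" where "U y \<equiv> V (x0 + y)"

lemma V_cont: "isCont V x" "continuous_on A V"
  using DERIV_isCont[OF smooth_deriv[OF smooth_V, of 0]] by (auto intro: continuous_at_imp_continuous_on)

lemma expansion_bound: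
  obtains c r where "0 < r" "\<And>y. y \<noteq> 0 \<Longrightarrow> \<bar>y\<bar> < r \<Longrightarrow> \<bar>U y - a0 * y\<^sup>2\<bar> \<le> c * \<bar>y\<bar> ^ 3"
proof -
  obtain c where "eventually (\<lambda>x. norm (V x - a0 * (x - x0)\<^sup>2) \<le> c * norm (\<bar>x - x0\<bar> ^ 3)) (at x0)"
    using landau_o.bigE[OF expansion] by blast
  then obtain r where r: "0 < r" "\<And>x. x \<noteq> x0 \<Longrightarrow> dist x x0 < r \<Longrightarrow> norm (V x - a0 * (x - x0)\<^sup>2) \<le> c * norm (\<bar>x - x0\<bar> ^ 3)"
    unfolding eventually_at by auto
  show ?thesis
  proof (rule that[OF r(1)])
    fix y :: real assume "y \<noteq> 0" "\<bar>y\<bar> < r"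
    then show "\<bar>U y - a0 * y\<^sup>2\<bar> \<le> c * \<bar>y\<bar> ^ 3" using r(2)[of "x0 + y"] by (simp add: dist_real_def)
  qed
qed

text \<open>The expansion is a statement on the punctured filter \<open>at x0\<close>; the value at
  x0 itself comes from continuity.\<close>

lemma V_x0: "V x0 = 0"
proof -
  obtain c r where r: "0 < r" "\<And>y. y \<noteq> 0 \<Longrightarrow> \<bar>y\<bar> < r \<Longrightarrow> \<bar>U y - a0 * y\<^sup>2\<bar> \<le> c * \<bar>y\<bar> ^ 3"
    by (rule expansion_bound) (rule that)
  have "((\<lambda>y. U y - a0 * y\<^sup>2) \<longlongrightarrow> 0) (at 0)"
  proof (rule Lim_null_comparison)
    show "eventually (\<lambda>y. norm (U y - a0 * y\<^sup>2) \<le> c * \<bar>y\<bar> ^ 3) (at 0)"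
      unfolding eventually_at using r by (intro exI[of _ r]) (auto simp: dist_real_def)
    show "((\<lambda>y. c * \<bar>y\<bar> ^ 3) \<longlongrightarrow> 0) (at 0)"
      by (rule tendsto_eq_intros refl | simp)+
  qed
  moreover have "((\<lambda>y. U y - a0 * y\<^sup>2) \<longlongrightarrow> U 0 - a0 * 0\<^sup>2) (at 0)"
  proof -
    have "isCont (\<lambda>y. U y - a0 * y\<^sup>2) 0"
      by (intro continuous_intros isCont_o2[OF _ V_cont(1)])
    then show ?thesis by (simp add: isCont_def)
  qed
  ultimately have "U 0 - a0 * 0\<^sup>2 = 0" by (rule tendsto_unique[OF trivial_limit_at, rotated])
  then show ?thesis by simp
qed

lemma V_nonneg: "0 \<le> V x"
  using minima[of x0] V_x0 by simp

lemma V_pos: "x - x0 \<notin> \<int> \<Longrightarrow> 0 < V x"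
  using minima[of x] V_nonneg by (metis order.not_eq_order_implies_strict)

lemma V_int: "V (x + of_int n) = V x"
proof -
  have nat: "V (x + of_nat k) = V x" for x k
  proof (induction k)
    case (Suc k)
    then show ?case using periodic[of "x + of_nat k"] by (simp add: add.assoc add.commute[of 1])
  qed simp
  show ?thesis
  proof (cases "0 \<le> n")
    case True
    then show ?thesis using nat[of x "nat n"] by simp
  next
    case False
    then show ?thesis using nat[of "x + of_int n" "nat (- n)"] by simp
  qed
qed

lemma V_bounded:
  obtains B where "\<And>x. V x \<le> B"
proof -
  have "compact (V ` {0..1})" by (intro compact_continuous_image V_cont(2) compact_Icc)
  then have "bounded (V ` {0..1})" by (rule compact_imp_bounded)
  then obtain B where "\<forall>z\<in>V ` {0..1}. norm z \<le> B" unfolding bounded_iff by (rule exE)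
  then have B: "\<bar>V x\<bar> \<le> B" if "x \<in> {0..1}" for x using that by simp
  have "V x \<le> B" for x
    using B[of "frac x"] V_int[of "frac x" "\<lfloor>x\<rfloor>"] frac_ge_0[of x] frac_lt_1[of x] by (auto simp: frac_def)
  then show ?thesis by (rule that)
qed

text \<open>Order 5 is what a residual of weight 6 requires. The constant, linear and quadratic
  coefficients come from \<open>V_x0\<close>, minimality and the given expansion.\<close>

lemma U_taylor:
  obtains b c e C where "0 \<le> C" "\<And>y. \<bar>y\<bar> \<le> 1 \<Longrightarrow> \<bar>U y - (a0 * y^2 + b * y^3 + c * y^4 + e * y^5)\<bar> \<le> C * y ^ 6"
proof -
  define k where "k m = (deriv ^^ m) V x0 / fact m" for m
  have "continuous_on {x0 - 1..x0 + 1} ((deriv ^^ 6) V)"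
    by (intro continuous_at_imp_continuous_on ballI DERIV_isCont[OF smooth_deriv[OF smooth_V]])
  then have "compact ((deriv ^^ 6) V ` {x0 - 1..x0 + 1})" by (intro compact_continuous_image compact_Icc)
  then have "bounded ((deriv ^^ 6) V ` {x0 - 1..x0 + 1})" by (rule compact_imp_bounded)
  then obtain D where "\<forall>z\<in>(deriv ^^ 6) V ` {x0 - 1..x0 + 1}. norm z \<le> D" unfolding bounded_iff by (rule exE)
  then have D: "\<bar>(deriv ^^ 6) V t\<bar> \<le> D" if "t \<in> {x0 - 1..x0 + 1}" for t using that by simp
  define C where "C = \<bar>D\<bar> / fact 6"
  have sum6: "(\<Sum>m<6. k m * y ^ m) = k 0 + k 1 * y + k 2 * y^2 + k 3 * y^3 + k 4 * y^4 + k 5 * y^5" for y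
    by (simp add: eval_nat_numeral)
  have tay: "\<bar>U y - (\<Sum>m<6. k m * y ^ m)\<bar> \<le> C * y ^ 6" if y: "\<bar>y\<bar> \<le> 1" for y
  proof (cases "y = 0")
    case True
    then show ?thesis unfolding sum6 by (simp add: k_def)
  next
    case False
    have "\<exists>t. (if x0 + y < x0 then x0 + y < t \<and> t < x0 else x0 < t \<and> t < x0 + y) \<and>
      V (x0 + y) = (\<Sum>m<6. (deriv ^^ m) V x0 / fact m * (x0 + y - x0) ^ m) + (deriv ^^ 6) V t / fact 6 * (x0 + y - x0) ^ 6"
    proof (rule Taylor[where a = "x0 - 1" and b = "x0 + 1"])
      show "\<forall>m t. m < 6 \<and> x0 - 1 \<le> t \<and> t \<le> x0 + 1 \<longrightarrow> DERIV ((deriv ^^ m) V) t :> (deriv ^^ Suc m) V t"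
        using smooth_deriv[OF smooth_V] by blast
    qed (use y False in auto)
    then obtain t where t1: "if x0 + y < x0 then x0 + y < t \<and> t < x0 else x0 < t \<and> t < x0 + y" and
      t2: "V (x0 + y) = (\<Sum>m<6. (deriv ^^ m) V x0 / fact m * (x0 + y - x0) ^ m) + (deriv ^^ 6) V t / fact 6 * (x0 + y - x0) ^ 6"
      by blast
    have t: "t \<in> {x0 - 1..x0 + 1}" "U y = (\<Sum>m<6. k m * y ^ m) + (deriv ^^ 6) V t / fact 6 * y ^ 6"
      using t1 y t2 by (auto simp only: atLeastAtMost_iff k_def add_diff_cancel_left' split: if_splits)
    have "\<bar>(deriv ^^ 6) V t / fact 6 * y ^ 6\<bar> = \<bar>(deriv ^^ 6) V t\<bar> / fact 6 * y ^ 6"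
      by (simp add: abs_mult zero_le_even_power)
    also have "\<dots> \<le> C * y ^ 6"
      unfolding C_def using D[OF t(1)] by (intro mult_right_mono divide_right_mono) (auto simp: zero_le_even_power)
    finally show ?thesis using t(2) by simp
  qed
  have k0: "k 0 = 0" by (simp add: k_def V_x0)
  have k1: "k 1 = 0"
  proof -
    have "deriv V x0 = 0"
    proof (rule DERIV_local_min)
      show "DERIV V x0 :> deriv V x0" using smooth_deriv[OF smooth_V, of 0] by simp
      show "0 < (1::real)" by simp
      show "\<forall>y. \<bar>x0 - y\<bar> < 1 \<longrightarrow> V x0 \<le> V y" using V_nonneg V_x0 by simp
    qed
    then show ?thesis by (simp add: k_def)
  qed
  have k2: "k 2 = a0"
  proof -
    obtain c r where r: "0 < r" "\<And>y. y \<noteq> 0 \<Longrightarrow> \<bar>y\<bar> < r \<Longrightarrow> \<bar>U y - a0 * y\<^sup>2\<bar> \<le> c * \<bar>y\<bar> ^ 3"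
      by (rule expansion_bound) (rule that)
    \<comment> \<open>k 2 y^2 and a0 y^2 both approximate U up to O(y^3), with constants collected
      in L; dividing by y^2 and letting y tend to 0 identifies the coefficients.\<close>
    define L where "L = \<bar>c\<bar> + \<bar>k 3\<bar> + \<bar>k 4\<bar> + \<bar>k 5\<bar> + C"
    have C0: "0 \<le> C" by (simp add: C_def)
    have "\<bar>k 2 - a0\<bar> \<le> L * y" if y: "0 < y" "y < min r 1" for y
    proof -
      have le: "y ^ n \<le> y ^ 3" if "3 \<le> n" for n using that y by (intro power_decreasing) auto
      have tri: "\<bar>k n * y ^ n\<bar> \<le> \<bar>k n\<bar> * y ^ 3" if "3 \<le> n" for n
        using le[OF that] y by (simp add: abs_mult mult_left_mono)
      have "\<bar>U y - a0 * y\<^sup>2\<bar> \<le> \<bar>c\<bar> * y ^ 3"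
        using r(2)[of y] y by (intro order_trans[OF r(2)]) (auto intro: mult_right_mono)
      moreover have "\<bar>U y - (k 2 * y^2 + k 3 * y^3 + k 4 * y^4 + k 5 * y^5)\<bar> \<le> C * y ^ 3"
        using tay[of y] y sum6[of y] k0 k1 mult_left_mono[OF le[of 6] C0] by simp
      moreover have gen: "\<bar>q2 - q0\<bar> \<le> c1 + a3 + a4 + a5 + c2" if "\<bar>u - q0\<bar> \<le> c1" "\<bar>u - (q2 + x3 + x4 + x5)\<bar> \<le> c2"
        "\<bar>x3\<bar> \<le> a3" "\<bar>x4\<bar> \<le> a4" "\<bar>x5\<bar> \<le> a5" for u q0 q2 x3 x4 x5 c1 c2 a3 a4 a5 :: real
        using that by (simp only: abs_le_iff) linarith
      ultimately have "\<bar>(k 2 - a0) * y\<^sup>2\<bar> \<le> L * y ^ 3"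
        using gen[OF _ _ tri[of 3] tri[of 4] tri[of 5]] unfolding L_def distrib_right left_diff_distrib by simp
      then have "\<bar>k 2 - a0\<bar> * y\<^sup>2 \<le> (L * y) * y\<^sup>2" using y by (simp add: abs_mult power2_eq_square power3_eq_cube mult.assoc)
      then show ?thesis using y by simp
    qed
    then have "eventually (\<lambda>y. \<bar>k 2 - a0\<bar> \<le> L * y) (at_right 0)"
      unfolding eventually_at_right_field using r(1) by (intro exI[of _ "min r 1"]) auto
    moreover have "((\<lambda>y. L * y) \<longlongrightarrow> L * 0) (at_right 0)" by (intro tendsto_intros)
    ultimately have "\<bar>k 2 - a0\<bar> \<le> L * 0"
      by (intro tendsto_lowerbound[of "\<lambda>y. L * y"]) (auto simp: trivial_limit_at_right_real)
    then show ?thesis by simp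
  qed
  show ?thesis
  proof (rule that[of C "k 3" "k 4" "k 5"])
    show "0 \<le> C" by (simp add: C_def)
    show "\<bar>U y - (a0 * y^2 + k 3 * y^3 + k 4 * y^4 + k 5 * y^5)\<bar> \<le> C * y ^ 6" if "\<bar>y\<bar> \<le> 1" for y
      using tay[OF that] unfolding sum6 k0 k1 k2 by simp
  qed
qed

text \<open>Near 0 half of the quadratic term survives the cubic error. On the compact rest of the
  cell U attains a minimum at some m with 0 < |m| <= 1/2, which is not an integer, so U m > 0 by
  uniqueness of the minimum.\<close>

lemma U_quadratic_lower:
  obtains c0 where "0 < c0" "\<And>y. \<bar>y\<bar> \<le> 1/2 \<Longrightarrow> c0 * y\<^sup>2 \<le> U y"
proof -
  obtain c r where r: "0 < r" "\<And>y. y \<noteq> 0 \<Longrightarrow> \<bar>y\<bar> < r \<Longrightarrow> \<bar>U y - a0 * y\<^sup>2\<bar> \<le> c * \<bar>y\<bar> ^ 3"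
    by (rule expansion_bound) (rule that)
  define q where "q = Min {r / 2, 1 / 2, a0 / (2 * (\<bar>c\<bar> + 1))}"
  have "q \<le> r / 2" "q \<le> 1 / 2" "q \<le> a0 / (2 * (\<bar>c\<bar> + 1))" unfolding q_def by (intro Min_le; simp)+
  moreover have "0 < q" using r(1) a0 by (simp add: q_def)
  ultimately have q: "0 < q" "q \<le> r / 2" "q \<le> 1 / 2" "q \<le> a0 / (2 * (\<bar>c\<bar> + 1))" by blast+
  have near: "a0 / 2 * y\<^sup>2 \<le> U y" if "\<bar>y\<bar> \<le> q" for y
  proof (cases "y = 0")
    case True
    then show ?thesis using V_x0 by simp
  next
    case False
    have "\<bar>U y - a0 * y\<^sup>2\<bar> \<le> c * \<bar>y\<bar> ^ 3" using that q r(1) False by (intro r(2)) auto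
    also have "\<dots> = (c * \<bar>y\<bar>) * y\<^sup>2" by (simp add: power2_eq_square power3_eq_cube)
    also have "\<dots> \<le> (a0 / 2) * y\<^sup>2"
    proof (rule mult_right_mono)
      have "c * \<bar>y\<bar> \<le> (\<bar>c\<bar> + 1) * q" using that by (intro mult_mono) auto
      also have "\<dots> \<le> a0 / 2" using q(4) by (simp add: pos_le_divide_eq algebra_simps)
      finally show "c * \<bar>y\<bar> \<le> a0 / 2" .
    qed simp
    finally have "- (U y - a0 * y\<^sup>2) \<le> a0 / 2 * y\<^sup>2" by (rule abs_le_D2)
    then show ?thesis by (simp add: field_simps)
  qed
  let ?K = "{-1/2..-q} \<union> {q..1/2}"
  have "compact ?K" "?K \<noteq> {}" using q by auto
  moreover have "continuous_on ?K U" by (intro continuous_on_compose2[OF V_cont(2)[of UNIV]] continuous_intros) auto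
  ultimately obtain m where m: "m \<in> ?K" "\<And>y. y \<in> ?K \<Longrightarrow> U m \<le> U y"
    using continuous_attains_inf[of ?K U] by blast
  have "m \<notin> \<int>"
  proof
    assume "m \<in> \<int>"
    then obtain i where "m = of_int i" by (auto elim: Ints_cases)
    then have "\<bar>real_of_int i\<bar> < 1" "i \<noteq> 0" using m(1) q by auto
    then show False by linarith
  qed
  then have Um: "0 < U m" using V_pos[of "x0 + m"] by simp
  show ?thesis
  proof (rule that[of "min (a0 / 2) (U m)"])
    show "0 < min (a0 / 2) (U m)" using a0 Um by simp
    fix y :: real assume y: "\<bar>y\<bar> \<le> 1/2"
    show "min (a0 / 2) (U m) * y\<^sup>2 \<le> U y"
    proof (cases "\<bar>y\<bar> \<le> q")
      case True
      have "min (a0 / 2) (U m) * y\<^sup>2 \<le> a0 / 2 * y\<^sup>2" by (intro mult_right_mono) auto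
      then show ?thesis using near[OF True] by linarith
    next
      case False
      have "\<bar>y\<bar> * \<bar>y\<bar> \<le> 1 * 1" using y by (intro mult_mono) auto
      then have "y\<^sup>2 \<le> 1" by (simp add: power2_eq_square)
      then have "min (a0 / 2) (U m) * y\<^sup>2 \<le> U m * 1" using Um by (intro mult_mono) auto
      also have "\<dots> \<le> U y" using False y by (simp, intro m(2)) (auto simp: abs_le_iff abs_if split: if_splits)
      finally show ?thesis .
    qed
  qed
qed

lemma pol_lin:
  assumes "\<bar>y\<bar> \<le> 1" "0 < h" "h \<le> 1"
  shows "\<bar>pol w s2 t0 s3 t1 s4 t2 u0 y h - w * y\<bar> \<le> (\<bar>s2\<bar> + \<bar>t0\<bar> + \<bar>s3\<bar> + \<bar>t1\<bar> + \<bar>s4\<bar> + \<bar>t2\<bar> + \<bar>u0\<bar>) * (y\<^sup>2 + h)"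
proof -
  let ?r = "y\<^sup>2 + h"
  have pw: "\<bar>y\<bar> ^ n \<le> ?r" if "2 \<le> n" for n
    using power_decreasing[OF that, of "\<bar>y\<bar>"] assms by simp
  have hy: "h * \<bar>y\<bar> ^ n \<le> ?r" for n
  proof -
    have "h * \<bar>y\<bar> ^ n \<le> h * 1" using assms by (intro mult_left_mono power_le_one) auto
    then show ?thesis by (simp add: add_increasing)
  qed
  have hh: "h\<^sup>2 \<le> ?r"
  proof -
    have "h * h \<le> h * 1" using assms by (intro mult_left_mono) auto
    then show ?thesis by (simp add: power2_eq_square add_increasing)
  qed
  have bd: "\<bar>a * b\<bar> \<le> \<bar>a\<bar> * ?r" if "\<bar>b\<bar> \<le> ?r" for a b using that by (simp add: abs_mult mult_left_mono)
  have "pol w s2 t0 s3 t1 s4 t2 u0 y h - w * y =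
    s2 * y^2 + t0 * h + s3 * y^3 + t1 * (h * y) + s4 * y^4 + t2 * (h * y^2) + u0 * h^2" by (simp add: pol_def)
  also have "\<bar>\<dots>\<bar> \<le> \<bar>s2\<bar> * ?r + \<bar>t0\<bar> * ?r + \<bar>s3\<bar> * ?r + \<bar>t1\<bar> * ?r + \<bar>s4\<bar> * ?r + \<bar>t2\<bar> * ?r + \<bar>u0\<bar> * ?r"
  proof (intro order_trans[OF abs_triangle_ineq add_mono] bd)
    show "\<bar>y ^ 3\<bar> \<le> ?r" "\<bar>y ^ 4\<bar> \<le> ?r" "\<bar>h * y\<bar> \<le> ?r" "\<bar>h * y\<^sup>2\<bar> \<le> ?r"
      using pw[of 3] pw[of 4] hy[of 1] hy[of 2] assms by (simp_all add: power_abs abs_mult)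
  qed (use hh assms in simp_all)
  finally show ?thesis by (simp only: distrib_right)
qed

lemma riccati_intro:
  fixes w e2 :: real
  assumes w: "0 < w" and c0: "0 < c0" "\<And>y. \<bar>y\<bar> \<le> 1/2 \<Longrightarrow> c0 * y\<^sup>2 \<le> U y" and B: "\<And>y. U y \<le> B"
    and C: "0 \<le> C" and \<eta>0: "0 < \<eta>0"
  obtains M \<eta> where "\<eta> \<le> \<eta>0"
    "riccati U (\<lambda>h. w * h + e2 * h\<^sup>2) (pol w s2 t0 s3 t1 s4 t2 u0) (pol' w s2 s3 t1 s4 t2) w c0 B M C \<eta>"
proof -
  define m where "m = \<bar>s2\<bar> + \<bar>t0\<bar> + \<bar>s3\<bar> + \<bar>t1\<bar> + \<bar>s4\<bar> + \<bar>t2\<bar> + \<bar>u0\<bar>"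
  define M where "M = m + w + \<bar>e2\<bar>"
  have M: "0 \<le> M" "m \<le> M" "w + \<bar>e2\<bar> \<le> M" using w by (auto simp: M_def m_def)
  \<comment> \<open>The third bound makes w + e2 h positive, and with it the approximate
    energy.\<close>
  define \<eta> where "\<eta> = Min {\<eta>0, 1/4, w / (2 * (\<bar>e2\<bar> + 1))}"
  have "\<eta> \<le> \<eta>0" "\<eta> \<le> 1/4" "\<eta> \<le> w / (2 * (\<bar>e2\<bar> + 1))" unfolding \<eta>_def by (intro Min_le; simp)+
  moreover have "0 < \<eta>" using \<eta>0 w by (simp add: \<eta>_def)
  ultimately have \<eta>: "0 < \<eta>" "\<eta> \<le> \<eta>0" "\<eta> \<le> 1/4" "\<eta> \<le> w / (2 * (\<bar>e2\<bar> + 1))" by blast+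
  have "riccati U (\<lambda>h. w * h + e2 * h\<^sup>2) (pol w s2 t0 s3 t1 s4 t2 u0) (pol' w s2 s3 t1 s4 t2) w c0 B M C \<eta>"
  proof
    show "\<bar>w * h + e2 * h\<^sup>2\<bar> \<le> M * h" if "0 < h" "h \<le> 1" for h
    proof -
      have "h * h \<le> h * 1" using that by (intro mult_left_mono) auto
      then have "\<bar>e2\<bar> * h\<^sup>2 \<le> \<bar>e2\<bar> * h" by (intro mult_left_mono) (auto simp: power2_eq_square)
      then have "\<bar>w * h + e2 * h\<^sup>2\<bar> \<le> (w + \<bar>e2\<bar>) * h"
        using abs_triangle_ineq[of "w * h" "e2 * h\<^sup>2"] w that by (simp add: abs_mult distrib_right)
      also have "\<dots> \<le> M * h" using M(3) that by (intro mult_right_mono) auto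
      finally show ?thesis .
    qed
    show "0 < w * h + e2 * h\<^sup>2" if "0 < h" "h \<le> \<eta>" for h
    proof -
      have "h * (2 * (\<bar>e2\<bar> + 1)) \<le> \<eta> * (2 * (\<bar>e2\<bar> + 1))" using that by (intro mult_right_mono) auto
      also have "\<dots> \<le> w" using \<eta>(4) by (subst (asm) pos_le_divide_eq) auto
      finally have "h * (2 * (\<bar>e2\<bar> + 1)) \<le> w" .
      then have "2 * (\<bar>e2\<bar> * h) + 2 * h \<le> w" by (simp add: algebra_simps)
      moreover have "- (e2 * h) \<le> \<bar>e2\<bar> * h" using mult_right_mono[of "- e2" "\<bar>e2\<bar>" h] that by auto
      moreover have "0 \<le> \<bar>e2\<bar> * h" using that by simp
      ultimately have "0 < w + e2 * h" using that by linarith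
      then have "0 < h * (w + e2 * h)" using that by simp
      then show ?thesis by (simp add: power2_eq_square algebra_simps)
    qed
    show "((\<lambda>y. pol w s2 t0 s3 t1 s4 t2 u0 y h) has_real_derivative pol' w s2 s3 t1 s4 t2 y h) (at y)" for y h
      by (rule pol_deriv)
    show "continuous_on UNIV (\<lambda>y. pol' w s2 s3 t1 s4 t2 y h)" for h
      unfolding pol'_def by (intro continuous_intros)
    show "\<bar>pol w s2 t0 s3 t1 s4 t2 u0 y h - w * y\<bar> \<le> M * (y\<^sup>2 + h)" if "\<bar>y\<bar> \<le> 1" "0 < h" "h \<le> 1" for y h
    proof -
      have "m * (y\<^sup>2 + h) \<le> M * (y\<^sup>2 + h)" using M(2) that by (intro mult_right_mono) auto
      then show ?thesis using pol_lin[OF that, of w s2 t0 s3 t1 s4 t2 u0] unfolding m_def by linarith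
    qed
  qed (use w c0 M C \<eta> B V_nonneg in auto)
  then show ?thesis using \<eta>(2) by (intro that)
qed

lemma riccati_solutions:
  obtains e2 c0 B p p' M C \<eta> q q' M' C' \<eta>' where
    "riccati_c U (\<lambda>h. sqrt a0 * h + e2 * h\<^sup>2) p p' (sqrt a0) c0 B M C \<eta>"
    "riccati_d U (\<lambda>h. sqrt a0 * h + (e2 - a0 / 16) * h\<^sup>2) q q' (sqrt a0) c0 B M' C' \<eta>'"
    "\<And>x. V x \<le> B"
proof -
  define w where "w = sqrt a0"
  have w: "0 < w" "w\<^sup>2 = a0" using a0 by (auto simp: w_def)
  obtain b c e C0 where tay: "0 \<le> C0" "\<And>y. \<bar>y\<bar> \<le> 1 \<Longrightarrow> \<bar>U y - (a0 * y^2 + b * y^3 + c * y^4 + e * y^5)\<bar> \<le> C0 * y ^ 6"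
    by (rule U_taylor) (rule that)
  obtain c0 where c0: "0 < c0" "\<And>y. \<bar>y\<bar> \<le> 1/2 \<Longrightarrow> c0 * y\<^sup>2 \<le> U y" by (rule U_quadratic_lower) (rule that)
  obtain B where B: "\<And>x. V x \<le> B" by (rule V_bounded) (rule that)
  have UB: "\<And>y. U y \<le> B" by (rule B)
  have W: "wt 6 (\<lambda>y h. U y - (w^2 * y^2 + b * y^3 + c * y^4 + e * y^5))"
    unfolding wt_def wkb_eventually
  proof (rule exI[of _ C0], rule exI[of _ 1], intro conjI allI impI)
    fix y h :: real assume y: "\<bar>y\<bar> \<le> 1" "0 < h"
    have "y ^ 6 = \<bar>y\<bar> ^ 6" by (simp add: power_even_abs)
    also have "\<dots> \<le> (\<bar>y\<bar> + sqrt h) ^ 6" using y by (intro power_mono) auto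
    finally have "C0 * y ^ 6 \<le> C0 * (\<bar>y\<bar> + sqrt h) ^ 6" using tay(1) by (rule mult_left_mono)
    then show "case (y, h) of (y, h) \<Rightarrow> \<bar>U y - (w^2 * y^2 + b * y^3 + c * y^4 + e * y^5)\<bar> \<le> C0 * (\<bar>y\<bar> + sqrt h) ^ 6"
      using tay(2)[OF y(1)] by (simp add: w(2))
  qed simp
  obtain e2 s2 t0 s3 t1 s4 t2 u0 s2' t0' s3' t1' s4' t2' u0' where eqs:
    "b = 2 * w * s2" "s2 = w * t0" "c = s2^2 + 2 * w * s3" "3 * s3 = 2 * s2 * t0 + 2 * w * t1"
      "e2 = t1 - t0^2" "e = 2 * s2 * s3 + 2 * w * s4" "4 * s4 = 2 * s2 * t1 + 2 * t0 * s3 + 2 * w * t2"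
      "t2 = t0 * t1 + w * u0" and eqs':
    "b = 2 * w * s2' + w^3" "s2' = w * t0'" "c = s2'^2 + 2 * w * s3' + 3 * w^2 * s2' + w^4"
      "3 * s3' = 2 * s2' * t0' + 2 * w * t1' + 3 * w^2 * t0'"
      "e2 - w^2 / 16 = s2' + t1' - t0'^2" "e = 2 * s2' * s3' + 2 * w * s4' + 3 * w^2 * s3' + 3 * w * s2'^2 + 4 * w^3 * s2' + w^5"
      "4 * s4' = 2 * s2' * t1' + 2 * t0' * s3' + 2 * w * t2' + 3 * w^2 * t1' + 6 * w * s2' * t0' + 4 * w^3 * t0'"
      "3 * s3' + 2 * t2' = 2 * t0' * t1' + 2 * w * u0' + 3 * w * t0'^2"
    by (rule riccati_coefficients[OF w(1), of b c e]) (rule that)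
  obtain C \<eta>0 where C: "0 \<le> C" "0 < \<eta>0" "\<And>y h. \<bar>y\<bar> \<le> \<eta>0 \<Longrightarrow> 0 < h \<Longrightarrow> h \<le> \<eta>0 \<Longrightarrow>
     \<bar>h * pol' w s2 s3 t1 s4 t2 y h - (pol w s2 t0 s3 t1 s4 t2 u0 y h)^2 + U y - (w * h + e2 * h^2)\<bar> \<le> C * (y ^ 6 + h ^ 3)"
    by (rule wt_6_bound[OF riccati_c_residual[OF W eqs]]) (rule that)
  obtain C' \<eta>0' where C': "0 \<le> C'" "0 < \<eta>0'" "\<And>y h. \<bar>y\<bar> \<le> \<eta>0' \<Longrightarrow> 0 < h \<Longrightarrow> h \<le> \<eta>0' \<Longrightarrow>
     \<bar>pol w s2' t0' s3' t1' s4' t2' u0' (y + h) h - pol w s2' t0' s3' t1' s4' t2' u0' y h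
    - (pol w s2' t0' s3' t1' s4' t2' u0' y h)^2 / (1 - pol w s2' t0' s3' t1' s4' t2' u0' y h) + U y - (w * h + (e2 - w^2 / 16) * h^2)\<bar> \<le> C' * (y ^ 6 + h ^ 3)"
    by (rule wt_6_bound[OF riccati_d_residual[OF W eqs']]) (rule that)
  obtain M \<eta> where 1: "\<eta> \<le> \<eta>0"
    "riccati U (\<lambda>h. w * h + e2 * h\<^sup>2) (pol w s2 t0 s3 t1 s4 t2 u0) (pol' w s2 s3 t1 s4 t2) w c0 B M C \<eta>"
    by (rule riccati_intro[where w = w and ?c0.0 = c0 and B = B and C = C and ?\<eta>0.0 = \<eta>0 and ?e2.0 = e2 and ?s2.0 = s2 and ?t0.0 = t0
      and ?s3.0 = s3 and ?t1.0 = t1 and ?s4.0 = s4 and ?t2.0 = t2 and ?u0.0 = u0]) (assumption | rule w(1) c0 UB C(1,2) that)+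
  obtain M' \<eta>' where 2: "\<eta>' \<le> \<eta>0'"
    "riccati U (\<lambda>h. w * h + (e2 - w^2 / 16) * h\<^sup>2) (pol w s2' t0' s3' t1' s4' t2' u0') (pol' w s2' s3' t1' s4' t2') w c0 B M' C' \<eta>'"
    by (rule riccati_intro[where w = w and ?c0.0 = c0 and B = B and C = C' and ?\<eta>0.0 = \<eta>0' and ?e2.0 = "e2 - w^2 / 16" and ?s2.0 = s2' and ?t0.0 = t0'
      and ?s3.0 = s3' and ?t1.0 = t1' and ?s4.0 = s4' and ?t2.0 = t2' and ?u0.0 = u0']) (assumption | rule w(1) c0 UB C'(1,2) that)+
  have "riccati_c U (\<lambda>h. w * h + e2 * h\<^sup>2) (pol w s2 t0 s3 t1 s4 t2 u0) (pol' w s2 s3 t1 s4 t2) w c0 B M C \<eta>"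
    using 1 C(3) by (intro riccati_c.intro riccati_c_axioms.intro) auto
  moreover have "riccati_d U (\<lambda>h. w * h + (e2 - a0 / 16) * h\<^sup>2) (pol w s2' t0' s3' t1' s4' t2' u0') (pol' w s2' s3' t1' s4' t2') w c0 B M' C' \<eta>'"
    using 2 C'(3) unfolding w(2) by (intro riccati_d.intro riccati_d_axioms.intro) auto
  ultimately show ?thesis using B unfolding w_def by (rule that)
qed

end

subsection \<open>Periodization of functions supported near the origin\<close>

text \<open>The argument is moved to the representative in [-1/2, 1/2) relative to the nearest
  integer, the cell in which \<open>V_rep\<close> places the well.\<close>

definition per :: "(real \<Rightarrow> real) \<Rightarrow> real \<Rightarrow> real" where
  "per q x = q (x - of_int \<lfloor>x + 1/2\<rfloor>)"

text \<open>Support within 1/4 leaves a gap between neighbouring copies: if x and y lie within 1/4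
  of each other but are nearest to different integers, then y is more than 1/4 away from both, and
  both values are 0.\<close>

lemma per_local:
  assumes q: "\<And>y. 1/4 < \<bar>y\<bar> \<Longrightarrow> q y = 0" and y: "\<bar>y - x\<bar> < 1/4"
  shows "per q y = q (y - of_int \<lfloor>x + 1/2\<rfloor>)"
proof -
  define n m where "n = \<lfloor>x + 1/2\<rfloor>" and "m = \<lfloor>y + 1/2\<rfloor>"
  have n: "of_int n \<le> x + 1/2" "x + 1/2 < of_int n + 1" and m: "of_int m \<le> y + 1/2" "y + 1/2 < of_int m + 1"
    unfolding n_def m_def by linarith+
  have y1: "x < y + 1/4" "y < x + 1/4" using y by linarith+
  consider "m = n" | "n + 1 \<le> m" | "m + 1 \<le> n" by linarith
  then have "q (y - of_int m) = q (y - of_int n)"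
  proof cases
    case 2
    then have "of_int n + 1 \<le> (of_int m :: real)" by linarith
    then have "1/4 < \<bar>y - of_int m\<bar>" "1/4 < \<bar>y - of_int n\<bar>" using n m y1 by linarith+
    then show ?thesis using q by simp
  next
    case 3
    then have "of_int m + 1 \<le> (of_int n :: real)" by linarith
    then have "1/4 < \<bar>y - of_int m\<bar>" "1/4 < \<bar>y - of_int n\<bar>" using n m y1 by linarith+
    then show ?thesis using q by simp
  qed simp
  then show ?thesis by (simp add: per_def n_def m_def)
qed

lemma per_deriv:
  assumes "\<And>y. 1/4 < \<bar>y\<bar> \<Longrightarrow> q y = 0" and der: "\<And>y. (q has_real_derivative q' y) (at y)"
  shows "(per q has_real_derivative per q' x) (at x)"
proof -
  define n where "n = \<lfloor>x + 1/2\<rfloor>"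
  have "((\<lambda>y. q (y - of_int n)) has_real_derivative q' (x - of_int n) * 1) (at x)"
    by (rule DERIV_chain2[OF der]) (auto intro!: derivative_eq_intros)
  then have "((\<lambda>y. q (y - of_int n)) has_real_derivative per q' x) (at x)" by (simp add: per_def n_def)
  then show ?thesis
  proof (rule has_field_derivative_transform_within_open[where S = "ball x (1/4)"])
    show "q (y - of_int n) = per q y" if "y \<in> ball x (1/4)" for y
      using per_local[where q = q and x = x and y = y, OF assms(1)] that by (simp add: n_def dist_real_def abs_minus_commute)
  qed auto
qed

lemma per_continuous:
  assumes "\<And>y. 1/4 < \<bar>y\<bar> \<Longrightarrow> q y = 0" and cont: "continuous_on UNIV q"
  shows "continuous_on UNIV (per q)"
proof (intro continuous_at_imp_continuous_on ballI)
  fix x :: real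
  define n where "n = \<lfloor>x + 1/2\<rfloor>"
  have "continuous_on (ball x (1/4)) (\<lambda>y. q (y - of_int n))"
    by (rule continuous_on_compose2[OF cont]) (auto intro!: continuous_intros)
  moreover have "q (y - of_int n) = per q y" if "y \<in> ball x (1/4)" for y
    using per_local[where q = q and x = x and y = y, OF assms(1)] that by (simp add: n_def dist_real_def abs_minus_commute)
  ultimately have "continuous_on (ball x (1/4)) (per q)" by (rule continuous_on_eq)
  then show "isCont (per q) x" by (simp add: continuous_on_eq_continuous_at)
qed

lemma per_bounded:
  assumes "\<And>y. 1/4 < \<bar>y\<bar> \<Longrightarrow> q y = 0" and cont: "continuous_on UNIV q"
  obtains C where "0 \<le> C" "\<And>x. \<bar>per q x\<bar> \<le> C"
proof -
  have "compact (q ` {-1/4..1/4})" by (intro compact_continuous_image continuous_on_subset[OF cont]) auto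
  then have "bounded (q ` {-1/4..1/4})" by (rule compact_imp_bounded)
  then obtain C where "\<forall>z\<in>q ` {-1/4..1/4}. norm z \<le> C" unfolding bounded_iff by (rule exE)
  then have C: "\<bar>q y\<bar> \<le> C" if "y \<in> {-1/4..1/4}" for y using that by simp
  have "\<bar>q y\<bar> \<le> \<bar>C\<bar>" for y
  proof (cases "1/4 < \<bar>y\<bar>")
    case False
    then have "y \<in> {-1/4..1/4}" by (intro atLeastAtMost_iff[THEN iffD2] conjI; linarith)
    then show ?thesis using C[of y] by linarith
  qed (simp add: assms(1))
  then show ?thesis by (intro that[of "\<bar>C\<bar>"]) (auto simp: per_def)
qed

subsection \<open>The bottoms of the two spectra\<close>

context single_well begin

lemma V_rep:
  obtains z n where "z = x - x0 - of_int n" "n = \<lfloor>(x - x0) + 1/2\<rfloor>" "\<bar>z\<bar> \<le> 1/2" "V x = U z"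
proof (rule that[OF refl refl])
  show "\<bar>x - x0 - of_int \<lfloor>(x - x0) + 1/2\<rfloor>\<bar> \<le> 1/2" by linarith
  show "V x = U (x - x0 - of_int \<lfloor>(x - x0) + 1/2\<rfloor>)"
    using V_int[of "x0 + (x - x0 - of_int \<lfloor>(x - x0) + 1/2\<rfloor>)" "\<lfloor>(x - x0) + 1/2\<rfloor>"] by simp
qed

text \<open>It is the logarithmic derivative that is continued periodically; its mean over a period
  may be nonzero, so the positive function behind it need not be periodic. The minus sign in g
  reflects \<psi> = exp (- S / h).\<close>

lemma min_Spec_c_ge:
  assumes R: "riccati_c U E p p' w c0 B M C \<eta>" and VB: "\<And>x. V x \<le> B"
  obtains h1 C' where "0 < h1" "0 \<le> C'" "\<And>h. 0 < h \<Longrightarrow> h \<le> h1 \<Longrightarrow> E h - C' * h ^ 3 \<le> min_of (Spec_c V h)"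
proof -
  interpret R: riccati_c U E p p' w c0 B M C \<eta> by (rule R)
  obtain \<delta> h1 C' where \<delta>: "0 < \<delta>" "\<delta> \<le> 1/4" and hC: "0 < h1" "0 \<le> C'"
    and super: "\<And>h z. 0 < h \<Longrightarrow> h \<le> h1 \<Longrightarrow> \<bar>z\<bar> \<le> 1/2 \<Longrightarrow> E h - C' * h ^ 3 \<le>
      U z - (p z h * chi \<delta> z)\<^sup>2 + h * (p' z h * chi \<delta> z + p z h * chi' \<delta> z)"
    by (rule R.supersolution) (rule that)
  show ?thesis
  proof (rule that[OF hC])
    fix h :: real assume h: "0 < h" "h \<le> h1"
    interpret N: nonneg_operator lborel H2 "P_c V h"
      by (rule P_c_nonneg_operator[OF V_cont(2) V_nonneg VB])
    define \<sigma> where "\<sigma> z = p z h * chi \<delta> z" for z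
    define \<sigma>' where "\<sigma>' z = p' z h * chi \<delta> z + p z h * chi' \<delta> z" for z
    have z0: "\<sigma> y = 0" "\<sigma>' y = 0" if "1/4 < \<bar>y\<bar>" for y
      using chi_props(6,7)[OF \<delta>(1), of y] that \<delta>(2) by (auto simp: \<sigma>_def \<sigma>'_def)
    have der: "(\<sigma> has_real_derivative \<sigma>' y) (at y)" for y
      unfolding \<sigma>_def[abs_def] \<sigma>'_def using DERIV_mult[OF R.p_deriv chi_deriv[OF \<delta>(1)]]
      by (rule DERIV_cong) (simp add: algebra_simps)
    have pc: "continuous_on UNIV (\<lambda>y. p y h)" "continuous_on UNIV (chi \<delta>)"
      using R.p_deriv chi_deriv[OF \<delta>(1)] by (auto intro!: continuous_at_imp_continuous_on DERIV_isCont)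
    have cont: "continuous_on UNIV \<sigma>" "continuous_on UNIV \<sigma>'"
      unfolding \<sigma>_def[abs_def] \<sigma>'_def[abs_def]
      by (intro continuous_intros pc R.p'_cont chi_cont \<delta>)+
    obtain C1 where C1: "0 \<le> C1" "\<And>x. \<bar>per \<sigma> x\<bar> \<le> C1" by (rule per_bounded[OF z0(1) cont(1)]) (assumption | rule that)+
    obtain C2 where C2: "0 \<le> C2" "\<And>x. \<bar>per \<sigma>' x\<bar> \<le> C2" by (rule per_bounded[OF z0(2) cont(2)]) (assumption | rule that)+
    have "E h - C' * h ^ 3 \<le> N.bottom"
    proof (rule N.bottom_greatest)
      fix u assume "u \<in> H2"
      show "(E h - C' * h ^ 3) * (L2_norm lborel u)\<^sup>2 \<le> Re (ip lborel (P_c V h u) u)"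
      proof (rule P_c_form_ge[OF V_cont(2) V_nonneg VB _ _ _ _ _ \<open>u \<in> H2\<close>,
          where g = "\<lambda>x. - per \<sigma> (h * x - x0)" and g' = "\<lambda>x. - (h * per \<sigma>' (h * x - x0))" and C = "C1 + h * C2"])
        fix x :: real
        have "((\<lambda>x. per \<sigma> (h * x - x0)) has_real_derivative per \<sigma>' (h * x - x0) * h) (at x)"
          by (rule DERIV_chain2[OF per_deriv[OF z0(1) der]]) (auto intro!: derivative_eq_intros)
        then show "((\<lambda>x. - per \<sigma> (h * x - x0)) has_real_derivative - (h * per \<sigma>' (h * x - x0))) (at x)"
          by (rule DERIV_cong[OF DERIV_minus]) simp
        have "0 \<le> h * C2" using h C2(1) by simp
        then show "\<bar>- per \<sigma> (h * x - x0)\<bar> \<le> C1 + h * C2" using C1(2)[of "h * x - x0"] by simp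
        have "\<bar>h * per \<sigma>' (h * x - x0)\<bar> \<le> h * C2" using C2(2) h by (simp add: abs_mult)
        then show "\<bar>- (h * per \<sigma>' (h * x - x0))\<bar> \<le> C1 + h * C2" using C1(1) by simp
        obtain z n where z: "z = h * x - x0 - of_int n" "n = \<lfloor>(h * x - x0) + 1/2\<rfloor>" "\<bar>z\<bar> \<le> 1/2" "V (h * x) = U z"
          by (rule V_rep) (rule that)
        have "per \<sigma> (h * x - x0) = \<sigma> z" "per \<sigma>' (h * x - x0) = \<sigma>' z" unfolding per_def z(1,2) by simp_all
        then show "E h - C' * h ^ 3 \<le> V (h * x) - (- per \<sigma> (h * x - x0))\<^sup>2 - - (h * per \<sigma>' (h * x - x0))"
          using super[OF h z(3)] by (simp add: z(4) \<sigma>_def \<sigma>'_def)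
      next
        show "continuous_on UNIV (\<lambda>x. - (h * per \<sigma>' (h * x - x0)))"
          by (intro continuous_intros continuous_on_compose2[OF per_continuous[OF z0(2) cont(2)]]) auto
      qed
    qed
    then show "E h - C' * h ^ 3 \<le> min_of (Spec_c V h)"
      unfolding Spec_c_def min_of_eq[OF N.is_min_of_Spec] .
  qed
qed

lemma min_Spec_c_le:
  assumes R: "riccati_c U E p p' w c0 B M C \<eta>" and VB: "\<And>x. V x \<le> B"
  obtains h1 C' where "0 < h1" "0 \<le> C'" "\<And>h. 0 < h \<Longrightarrow> h \<le> h1 \<Longrightarrow> min_of (Spec_c V h) \<le> E h + C' * h ^ 3"
proof -
  interpret R: riccati_c U E p p' w c0 B M C \<eta> by (rule R)
  obtain \<delta> h1 C' where \<delta>: "0 < \<delta>" and hC: "0 < h1" "0 \<le> C'"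
    and sub: "\<And>h. 0 < h \<Longrightarrow> h \<le> h1 \<Longrightarrow> \<exists>Y Y' Y''. (\<forall>y. (Y has_real_derivative Y' y) (at y)) \<and> (\<forall>y. (Y' has_real_derivative Y'' y) (at y)) \<and>
      continuous_on UNIV Y'' \<and> (\<forall>y. \<delta> < \<bar>y\<bar> \<longrightarrow> Y y = 0 \<and> Y' y = 0 \<and> Y'' y = 0) \<and> (\<forall>y. 0 \<le> Y y) \<and> 0 < Y 0 \<and>
      (\<forall>y. - h\<^sup>2 * Y'' y + U y * Y y \<le> (E h + C' * h ^ 3) * Y y)"
    by (rule R.subsolution) (rule that)
  show ?thesis
  proof (rule that[OF hC])
    fix h :: real assume h: "0 < h" "h \<le> h1"
    interpret N: nonneg_operator lborel H2 "P_c V h"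
      by (rule P_c_nonneg_operator[OF V_cont(2) V_nonneg VB])
    obtain Y Y' Y'' where Y: "\<And>y. (Y has_real_derivative Y' y) (at y)" "\<And>y. (Y' has_real_derivative Y'' y) (at y)"
      "continuous_on UNIV Y''" "\<And>y. \<delta> < \<bar>y\<bar> \<Longrightarrow> Y y = 0 \<and> Y' y = 0 \<and> Y'' y = 0" "\<And>y. 0 \<le> Y y" "0 < Y 0"
      "\<And>y. - h\<^sup>2 * Y'' y + U y * Y y \<le> (E h + C' * h ^ 3) * Y y"
      using sub[OF h] by blast
    have lin: "((\<lambda>x. h * x - x0) has_real_derivative h) (at x)" for x by (auto intro!: derivative_eq_intros)
    have far: "\<delta> < \<bar>h * x - x0\<bar>" if "(\<delta> + \<bar>x0\<bar> + 1) / h \<le> \<bar>x\<bar>" for x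
    proof -
      have "\<delta> + \<bar>x0\<bar> + 1 \<le> \<bar>x\<bar> * h" using that h(1) by (simp add: pos_divide_le_eq)
      also have "\<dots> = \<bar>h * x\<bar>" using h(1) by (simp add: abs_mult)
      finally show ?thesis using abs_triangle_ineq2[of "h * x" x0] by linarith
    qed
    obtain u where u: "u \<in> H2" "L2_norm lborel u \<noteq> 0"
      "Re (ip lborel (P_c V h u) u) \<le> (E h + C' * h ^ 3) * (L2_norm lborel u)\<^sup>2"
    proof (rule P_c_form_le[OF V_cont(2) V_nonneg VB, where y = "\<lambda>x. Y (h * x - x0)" and y' = "\<lambda>x. h * Y' (h * x - x0)"
        and y'' = "\<lambda>x. h\<^sup>2 * Y'' (h * x - x0)" and R = "(\<delta> + \<bar>x0\<bar> + 1) / h" and z = "x0 / h" and E = "E h + C' * h ^ 3"])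
      fix x
      show "((\<lambda>x. Y (h * x - x0)) has_real_derivative h * Y' (h * x - x0)) (at x)"
        by (rule DERIV_cong[OF DERIV_chain2[OF Y(1) lin]]) simp
      show "((\<lambda>x. h * Y' (h * x - x0)) has_real_derivative h\<^sup>2 * Y'' (h * x - x0)) (at x)"
        by (rule DERIV_cong[OF DERIV_cmult[OF DERIV_chain2[OF Y(2) lin]]]) (simp add: power2_eq_square)
      show "Y (h * x - x0) = 0 \<and> h * Y' (h * x - x0) = 0 \<and> h\<^sup>2 * Y'' (h * x - x0) = 0" if "(\<delta> + \<bar>x0\<bar> + 1) / h \<le> \<bar>x\<bar>"
        using Y(4)[OF far[OF that]] by simp
      show "0 \<le> Y (h * x - x0)" by (rule Y(5))
      show "- (h\<^sup>2 * Y'' (h * x - x0)) + V (h * x) * Y (h * x - x0) \<le> (E h + C' * h ^ 3) * Y (h * x - x0)"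
        using Y(7)[of "h * x - x0"] by simp
    next
      show "continuous_on UNIV (\<lambda>x. h\<^sup>2 * Y'' (h * x - x0))"
        by (intro continuous_intros continuous_on_compose2[OF Y(3)]) auto
      show "0 < Y (h * (x0 / h) - x0)" using h Y(6) by simp
    qed (rule that)
    have "N.bottom * (L2_norm lborel u)\<^sup>2 \<le> (E h + C' * h ^ 3) * (L2_norm lborel u)\<^sup>2"
      using N.bottom_le[OF u(1)] u(3) by linarith
    then have "N.bottom \<le> E h + C' * h ^ 3" using u(2) by simp
    then show "min_of (Spec_c V h) \<le> E h + C' * h ^ 3"
      unfolding Spec_c_def min_of_eq[OF N.is_min_of_Spec] .
  qed
qed

lemma min_Spec_d_ge:
  assumes R: "riccati_d U E p p' w c0 B M C \<eta>" and VB: "\<And>x. V x \<le> B"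
  obtains h1 C' where "0 < h1" "0 \<le> C'" "\<And>h. 0 < h \<Longrightarrow> h \<le> h1 \<Longrightarrow> E h - C' * h ^ 3 \<le> min_of (Spec_d V h)"
proof -
  interpret R: riccati_d U E p p' w c0 B M C \<eta> by (rule R)
  obtain \<delta> h1 C' where \<delta>: "0 < \<delta>" "\<delta> \<le> 1/4" and hC: "0 < h1" "h1 \<le> 1/4" "0 \<le> C'"
    and small: "\<And>h z. 0 < h \<Longrightarrow> h \<le> h1 \<Longrightarrow> \<bar>p z h * chi \<delta> z\<bar> \<le> 1/2"
    and super: "\<And>h z. 0 < h \<Longrightarrow> h \<le> h1 \<Longrightarrow> \<bar>z\<bar> \<le> 1/2 \<Longrightarrow> E h - C' * h ^ 3 \<le>
      p (z + h) h * chi \<delta> (z + h) - p z h * chi \<delta> z - (p z h * chi \<delta> z)\<^sup>2 / (1 - p z h * chi \<delta> z) + U z"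
    by (rule R.supersolution) (rule that)
  show ?thesis
  proof (rule that[of "h1 / 2" C'])
    show "0 < h1 / 2" "0 \<le> C'" using hC by auto
    \<comment> \<open>Halving h1 <= 1/4 makes h < 1/4 strict, the step length
      \<open>per_local\<close> allows.\<close>
    fix h :: real assume "0 < h" "h \<le> h1 / 2"
    then have h: "0 < h" "h \<le> h1" "h < 1/4" using hC by auto
    interpret N: nonneg_operator cs "L2 cs" "P_d V h" by (rule P_d_nonneg_operator[OF V_nonneg VB])
    define \<sigma> where "\<sigma> z = p z h * chi \<delta> z" for z
    have z0: "\<sigma> y = 0" if "1/4 < \<bar>y\<bar>" for y
      using chi_props(6)[OF \<delta>(1), of y] that \<delta>(2) by (auto simp: \<sigma>_def)
    have \<sigma>: "\<bar>per \<sigma> y\<bar> \<le> 1/2" for y using small[OF h(1,2)] by (simp add: per_def \<sigma>_def)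
    \<comment> \<open>The ratio of \<psi> at \<gamma> + 1 and \<gamma> is 1 - s at the new site
      \<gamma> + 1. Hence r (\<gamma> - 1) involves \<sigma> at z and r \<gamma> at z + h.\<close>
    define r where "r \<gamma> = 1 - per \<sigma> (h * of_int (\<gamma> + 1) - x0)" for \<gamma> :: int
    have r: "1/2 \<le> r \<gamma>" "r \<gamma> \<le> 3/2" for \<gamma> using \<sigma>[of "h * of_int (\<gamma> + 1) - x0"] unfolding r_def by linarith+
    have "E h - C' * h ^ 3 \<le> N.bottom"
    proof (rule N.bottom_greatest)
      fix u assume "u \<in> L2 cs"
      show "(E h - C' * h ^ 3) * (L2_norm cs u)\<^sup>2 \<le> Re (ip cs (P_d V h u) u)"
      proof (rule P_d_form_ge[OF V_nonneg VB _ _ _ _ \<open>u \<in> L2 cs\<close>, where r = r and C = 2])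
        fix \<gamma> :: int
        show "0 < r \<gamma>" "r \<gamma> \<le> 2" using r[of \<gamma>] by linarith+
        then show "1 / r \<gamma> \<le> 2" using r(1)[of \<gamma>] by (simp add: pos_divide_le_eq)
        obtain z n where z: "z = h * of_int \<gamma> - x0 - of_int n" "n = \<lfloor>(h * of_int \<gamma> - x0) + 1/2\<rfloor>" "\<bar>z\<bar> \<le> 1/2" "V (h * of_int \<gamma>) = U z"
          by (rule V_rep) (rule that)
        have r0: "r (\<gamma> - 1) = 1 - \<sigma> z" by (simp add: r_def per_def z(1,2))
        \<comment> \<open>The next site may be nearest to another integer, but
          \<open>per_local\<close> allows the same n as for \<gamma>.\<close>
        have "per \<sigma> (h * of_int (\<gamma> + 1) - x0) = \<sigma> (h * of_int (\<gamma> + 1) - x0 - of_int n)"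
          unfolding z(2) by (rule per_local[OF z0]) (use h in \<open>auto simp: algebra_simps\<close>)
        also have "h * of_int (\<gamma> + 1) - x0 - of_int n = z + h" by (simp add: z(1) algebra_simps)
        finally have r1: "r \<gamma> = 1 - \<sigma> (z + h)" by (simp add: r_def)
        have "1 - \<sigma> z \<noteq> 0" using r(1)[of "\<gamma> - 1"] unfolding r0 by simp
        then have "1 - 1 / (1 - \<sigma> z) = - \<sigma> z - (\<sigma> z)\<^sup>2 / (1 - \<sigma> z)" by (simp add: divide_simps) (simp add: algebra_simps power2_eq_square)
        then show "E h - C' * h ^ 3 \<le> 2 - r \<gamma> - 1 / r (\<gamma> - 1) + V (h * of_int \<gamma>)"
          using super[OF h(1,2) z(3)] unfolding r0 r1 z(4) \<sigma>_def[symmetric] by linarith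
      qed
    qed
    then show "E h - C' * h ^ 3 \<le> min_of (Spec_d V h)"
      unfolding Spec_d_def min_of_eq[OF N.is_min_of_Spec] .
  qed
qed

text \<open>v is the running product of the ratios 1 - s, started with value 1 at \<gamma>0 and
  truncated by max 0: once a factor with s >= 1 occurs the product stays 0, which gives finite
  support without losing nonnegativity.\<close>

lemma discrete_test_function:
  fixes s :: "real \<Rightarrow> real"
  assumes h: "0 < h" "8 * h \<le> \<zeta>" and K: "0 \<le> K" and VB: "\<And>x. V x \<le> B"
    and s: "\<And>y. \<bar>y\<bar> \<le> \<zeta> \<Longrightarrow> s y < 1 \<Longrightarrow> s (y + h) - s y - (s y)\<^sup>2 / (1 - s y) + U y \<le> K"
    and right: "\<And>y. \<zeta>/2 \<le> y \<Longrightarrow> y \<le> \<zeta> \<Longrightarrow> 1 \<le> s y"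
    and left: "\<And>y. - \<zeta> \<le> y \<Longrightarrow> y \<le> - \<zeta>/2 \<Longrightarrow> s y \<le> - (2 + B)"
  obtains S v z where "finite S" "\<And>\<gamma>. \<gamma> \<notin> S \<Longrightarrow> v \<gamma> = 0" "\<And>\<gamma>. 0 \<le> v \<gamma>" "v z > 0"
    "\<And>\<gamma>. 2 * v \<gamma> - v (\<gamma> + 1) - v (\<gamma> - 1) + V (h * of_int \<gamma>) * v \<gamma> \<le> K * v \<gamma>"
proof -
  have near: "\<exists>\<gamma>::int. a \<le> h * of_int \<gamma> - x0 \<and> h * of_int \<gamma> - x0 \<le> a + h" for a
  proof (intro exI[of _ "\<lceil>(a + x0) / h\<rceil>"] conjI)
    have "(a + x0) / h \<le> of_int \<lceil>(a + x0) / h\<rceil>" "of_int \<lceil>(a + x0) / h\<rceil> \<le> (a + x0) / h + 1" by linarith+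
    then have "(a + x0) / h * h \<le> of_int \<lceil>(a + x0) / h\<rceil> * h" "of_int \<lceil>(a + x0) / h\<rceil> * h \<le> ((a + x0) / h + 1) * h"
      using h(1) by (intro mult_right_mono; simp)+
    moreover have "(a + x0) / h * h = a + x0" using h(1) by simp
    ultimately show "a \<le> h * of_int \<lceil>(a + x0) / h\<rceil> - x0" "h * of_int \<lceil>(a + x0) / h\<rceil> - x0 \<le> a + h"
      unfolding distrib_right mult.commute[of h] by linarith+
  qed
  define y where "y \<gamma> = h * of_int \<gamma> - x0" for \<gamma> :: int
  have y_Suc: "y (\<gamma> + 1) = y \<gamma> + h" for \<gamma> by (simp add: y_def algebra_simps)
  have y_mono: "y \<gamma> \<le> y \<gamma>'" if "\<gamma> \<le> \<gamma>'" for \<gamma> \<gamma>' using that h(1) by (simp add: y_def)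
  have Uy: "U (y \<gamma>) = V (h * of_int \<gamma>)" for \<gamma> by (simp add: y_def)
  \<comment> \<open>7/8 leaves room for two lattice steps: since 8 h <= \<zeta>, both \<gamma>0 and
    \<gamma>0 + 1 land between - \<zeta> and - \<zeta> / 2.\<close>
  obtain \<gamma>0 where \<gamma>0: "- (7 * \<zeta> / 8) \<le> y \<gamma>0" "y \<gamma>0 \<le> - (7 * \<zeta> / 8) + h" using near unfolding y_def by blast
  obtain \<gamma>1 where \<gamma>1: "\<zeta> / 2 \<le> y \<gamma>1" "y \<gamma>1 \<le> \<zeta> / 2 + h" using near unfolding y_def by blast
  have less: "\<gamma>0 < \<gamma>1"
  proof (rule ccontr)
    assume "\<not> \<gamma>0 < \<gamma>1"
    then have "y \<gamma>1 \<le> y \<gamma>0" by (intro y_mono) simp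
    then show False using \<gamma>0 \<gamma>1 h by linarith
  qed
  define v where "v \<gamma> = (if \<gamma> < \<gamma>0 then 0 else \<Prod>k<nat (\<gamma> - \<gamma>0). max 0 (1 - s (y (\<gamma>0 + 1 + int k))))" for \<gamma>
  have v_nn: "0 \<le> v \<gamma>" for \<gamma> by (auto simp: v_def intro!: prod_nonneg)
  have v_0: "v \<gamma>0 = 1" by (simp add: v_def)
  have v_Suc: "v (\<gamma> + 1) = v \<gamma> * max 0 (1 - s (y \<gamma> + h))" if "\<gamma>0 \<le> \<gamma>" for \<gamma>
  proof -
    have "nat (\<gamma> + 1 - \<gamma>0) = Suc (nat (\<gamma> - \<gamma>0))" "\<gamma>0 + 1 + int (nat (\<gamma> - \<gamma>0)) = \<gamma> + 1" using that by auto
    then have "v (\<gamma> + 1) = v \<gamma> * max 0 (1 - s (y (\<gamma> + 1)))" using that by (simp only: v_def prod.lessThan_Suc) simp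
    then show ?thesis by (simp only: y_Suc)
  qed
  have v_end: "v \<gamma> = 0" if "\<gamma>1 \<le> \<gamma>" for \<gamma>
  proof -
    let ?k = "nat (\<gamma>1 - \<gamma>0 - 1)"
    have "1 \<le> s (y \<gamma>1)" using \<gamma>1 h by (intro right) auto
    moreover have "\<gamma>0 + 1 + int ?k = \<gamma>1" using less by simp
    ultimately have "max 0 (1 - s (y (\<gamma>0 + 1 + int ?k))) = 0" by simp
    moreover have "?k \<in> {..<nat (\<gamma> - \<gamma>0)}" using less that by auto
    ultimately have "(\<Prod>k<nat (\<gamma> - \<gamma>0). max 0 (1 - s (y (\<gamma>0 + 1 + int k)))) = 0"
      by (intro prod_zero bexI[of _ ?k]) auto
    then show ?thesis by (simp add: v_def)
  qed
  have sub: "2 * v \<gamma> - v (\<gamma> + 1) - v (\<gamma> - 1) + V (h * of_int \<gamma>) * v \<gamma> \<le> K * v \<gamma>" for \<gamma>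
  proof (cases "v \<gamma> = 0")
    case True
    \<comment> \<open>At a zero of v only the neighbours remain, and they enter with a minus
      sign.\<close>
    then show ?thesis using v_nn[of "\<gamma> + 1"] v_nn[of "\<gamma> - 1"] by simp
  next
    case False
    then have pos: "0 < v \<gamma>" using v_nn[of \<gamma>] by simp
    have g: "\<gamma>0 \<le> \<gamma>" "\<gamma> < \<gamma>1" using False v_end[of \<gamma>] by (auto simp: v_def not_less[symmetric])
    have yg: "\<bar>y \<gamma>\<bar> \<le> \<zeta>" using y_mono[OF g(1)] y_mono[of \<gamma> \<gamma>1] g(2) \<gamma>0 \<gamma>1 h by (simp add: abs_le_iff)
    have "(1 - s (y \<gamma> + h)) * v \<gamma> \<le> max 0 (1 - s (y \<gamma> + h)) * v \<gamma>" using pos by (intro mult_right_mono) auto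
    then have up: "(1 - s (y \<gamma> + h)) * v \<gamma> \<le> v (\<gamma> + 1)" by (simp add: v_Suc[OF g(1)] mult.commute)
    have "2 * v \<gamma> - (1 - s (y \<gamma> + h)) * v \<gamma> - v (\<gamma> - 1) + U (y \<gamma>) * v \<gamma> \<le> K * v \<gamma>"
    proof (cases "\<gamma> = \<gamma>0")
      case True
      \<comment> \<open>At the first site the left neighbour is 0, and the equation for s is
        replaced by size: 2 - (1 - s) + U <= -1 because the right neighbour is so large.\<close>
      have "s (y \<gamma> + h) \<le> - (2 + B)" using \<gamma>0 h True by (intro left) auto
      then have "(2 - (1 - s (y \<gamma> + h)) + U (y \<gamma>)) * v \<gamma> \<le> K * v \<gamma>"
        using VB[of "x0 + y \<gamma>"] K pos by (intro mult_right_mono) auto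
      moreover have "v (\<gamma> - 1) = 0" by (simp add: v_def True)
      ultimately show ?thesis by (simp add: algebra_simps)
    next
      case False
      then have v: "v \<gamma> = v (\<gamma> - 1) * max 0 (1 - s (y \<gamma>))"
        using g v_Suc[of "\<gamma> - 1"] y_Suc[of "\<gamma> - 1"] by simp
      then have s1: "s (y \<gamma>) < 1" using pos by (cases "s (y \<gamma>) < 1") (auto simp: max_def split: if_splits)
      then have v1: "v (\<gamma> - 1) = 1 / (1 - s (y \<gamma>)) * v \<gamma>" using v by (simp add: max_def)
      have "1 - 1 / (1 - s (y \<gamma>)) = - s (y \<gamma>) - (s (y \<gamma>))\<^sup>2 / (1 - s (y \<gamma>))"
        using s1 by (simp add: divide_simps) (simp add: algebra_simps power2_eq_square)
      then have "(2 - (1 - s (y \<gamma> + h)) - 1 / (1 - s (y \<gamma>)) + U (y \<gamma>)) * v \<gamma> \<le> K * v \<gamma>"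
        using s[OF yg s1] pos by (intro mult_right_mono) auto
      then show ?thesis unfolding v1 by (simp add: left_diff_distrib distrib_right)
    qed
    then show ?thesis using up unfolding Uy by linarith
  qed
  show ?thesis
  proof (rule that[of "{\<gamma>0..<\<gamma>1}" v \<gamma>0])
    show "v \<gamma> = 0" if "\<gamma> \<notin> {\<gamma>0..<\<gamma>1}" for \<gamma>
      using that v_end[of \<gamma>] by (cases "\<gamma> < \<gamma>0") (auto simp: v_def)
  qed (use v_nn v_0 sub in auto)
qed

lemma min_Spec_d_le:
  assumes R: "riccati_d U E p p' w c0 B M C \<eta>" and VB: "\<And>x. V x \<le> B"
  obtains h1 C' where "0 < h1" "0 \<le> C'" "\<And>h. 0 < h \<Longrightarrow> h \<le> h1 \<Longrightarrow> min_of (Spec_d V h) \<le> E h + C' * h ^ 3"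
proof -
  interpret R: riccati_d U E p p' w c0 B M C \<eta> by (rule R)
  obtain \<zeta> h1 C' where hC: "0 < h1" "0 \<le> C'"
    and sub: "\<And>h. 0 < h \<Longrightarrow> h \<le> h1 \<Longrightarrow> 8 * h \<le> \<zeta> \<and>
      (\<exists>s. (\<forall>y. \<bar>y\<bar> \<le> \<zeta> \<longrightarrow> s y < 1 \<longrightarrow> s (y + h) - s y - (s y)\<^sup>2 / (1 - s y) + U y \<le> E h + C' * h ^ 3) \<and>
        (\<forall>y. \<zeta> / 2 \<le> y \<longrightarrow> y \<le> \<zeta> \<longrightarrow> 1 \<le> s y) \<and> (\<forall>y. - \<zeta> \<le> y \<longrightarrow> y \<le> - \<zeta> / 2 \<longrightarrow> s y \<le> - (2 + B)))"
    by (rule R.subsolution) (rule that)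
  show ?thesis
  proof (rule that[of "min h1 \<eta>" C'])
    show "0 < min h1 \<eta>" "0 \<le> C'" using hC R.\<eta> by auto
    fix h :: real assume "0 < h" "h \<le> min h1 \<eta>"
    then have h: "0 < h" "h \<le> h1" "h \<le> \<eta>" by auto
    let ?K = "E h + C' * h ^ 3"
    have K: "0 \<le> ?K" using R.E_pos[OF h(1,3)] hC(2) h(1) by simp
    interpret N: nonneg_operator cs "L2 cs" "P_d V h" by (rule P_d_nonneg_operator[OF V_nonneg VB])
    obtain s where s: "8 * h \<le> \<zeta>" "\<And>y. \<bar>y\<bar> \<le> \<zeta> \<Longrightarrow> s y < 1 \<Longrightarrow> s (y + h) - s y - (s y)\<^sup>2 / (1 - s y) + U y \<le> ?K"
      "\<And>y. \<zeta> / 2 \<le> y \<Longrightarrow> y \<le> \<zeta> \<Longrightarrow> 1 \<le> s y" "\<And>y. - \<zeta> \<le> y \<Longrightarrow> y \<le> - \<zeta> / 2 \<Longrightarrow> s y \<le> - (2 + B)"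
      using sub[OF h(1,2)] by blast
    obtain S v z where v: "finite S" "\<And>\<gamma>. \<gamma> \<notin> S \<Longrightarrow> v \<gamma> = 0" "\<And>\<gamma>. 0 \<le> v \<gamma>" "v z > 0"
      "\<And>\<gamma>. 2 * v \<gamma> - v (\<gamma> + 1) - v (\<gamma> - 1) + V (h * of_int \<gamma>) * v \<gamma> \<le> ?K * v \<gamma>"
      by (rule discrete_test_function[where s = s and h = h and \<zeta> = \<zeta> and K = ?K and B = B]) (assumption | rule h(1) s K VB that)+
    obtain u where u: "u \<in> L2 cs" "L2_norm cs u \<noteq> 0" "Re (ip cs (P_d V h u) u) \<le> ?K * (L2_norm cs u)\<^sup>2"
      by (rule P_d_form_le[OF V_nonneg VB v]) (assumption | rule that)+
    have "N.bottom * (L2_norm cs u)\<^sup>2 \<le> ?K * (L2_norm cs u)\<^sup>2"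
      using N.bottom_le[OF u(1)] u(3) by linarith
    then have "N.bottom \<le> ?K" using u(2) by simp
    then show "min_of (Spec_d V h) \<le> ?K"
      unfolding Spec_d_def min_of_eq[OF N.is_min_of_Spec] .
  qed
qed

section \<open>Asymptotics of the two minima and of their ratio\<close>

lemma spectral_asymptotics:
  obtains e2 C h1 where "0 < h1" "0 \<le> C"
    "\<And>h. 0 < h \<Longrightarrow> h \<le> h1 \<Longrightarrow> \<bar>min_of (Spec_c V h) - (sqrt a0 * h + e2 * h\<^sup>2)\<bar> \<le> C * h ^ 3"
    "\<And>h. 0 < h \<Longrightarrow> h \<le> h1 \<Longrightarrow> \<bar>min_of (Spec_d V h) - (sqrt a0 * h + (e2 - a0 / 16) * h\<^sup>2)\<bar> \<le> C * h ^ 3"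
proof -
  obtain e2 c0 B p p' M C \<eta> q q' M' C' \<eta>' where
    c: "riccati_c U (\<lambda>h. sqrt a0 * h + e2 * h\<^sup>2) p p' (sqrt a0) c0 B M C \<eta>" and
    d: "riccati_d U (\<lambda>h. sqrt a0 * h + (e2 - a0 / 16) * h\<^sup>2) q q' (sqrt a0) c0 B M' C' \<eta>'" and
    VB: "\<And>x. V x \<le> B"
    by (rule riccati_solutions) (rule that)
  obtain h1 C1 where 1: "0 < h1" "0 \<le> C1" "\<And>h. 0 < h \<Longrightarrow> h \<le> h1 \<Longrightarrow> sqrt a0 * h + e2 * h\<^sup>2 - C1 * h ^ 3 \<le> min_of (Spec_c V h)"
    by (rule min_Spec_c_ge[OF c VB]) (rule that)
  obtain h2 C2 where 2: "0 < h2" "0 \<le> C2" "\<And>h. 0 < h \<Longrightarrow> h \<le> h2 \<Longrightarrow> min_of (Spec_c V h) \<le> sqrt a0 * h + e2 * h\<^sup>2 + C2 * h ^ 3"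
    by (rule min_Spec_c_le[OF c VB]) (rule that)
  obtain h3 C3 where 3: "0 < h3" "0 \<le> C3" "\<And>h. 0 < h \<Longrightarrow> h \<le> h3 \<Longrightarrow> sqrt a0 * h + (e2 - a0 / 16) * h\<^sup>2 - C3 * h ^ 3 \<le> min_of (Spec_d V h)"
    by (rule min_Spec_d_ge[OF d VB]) (rule that)
  obtain h4 C4 where 4: "0 < h4" "0 \<le> C4" "\<And>h. 0 < h \<Longrightarrow> h \<le> h4 \<Longrightarrow> min_of (Spec_d V h) \<le> sqrt a0 * h + (e2 - a0 / 16) * h\<^sup>2 + C4 * h ^ 3"
    by (rule min_Spec_d_le[OF d VB]) (rule that)
  let ?C = "C1 + C2 + C3 + C4"
  have le: "C1 * h ^ 3 \<le> ?C * h ^ 3" "C2 * h ^ 3 \<le> ?C * h ^ 3" "C3 * h ^ 3 \<le> ?C * h ^ 3" "C4 * h ^ 3 \<le> ?C * h ^ 3" if "0 < h" for h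
    using 1(2) 2(2) 3(2) 4(2) that by (intro mult_right_mono; simp)+
  show ?thesis
  proof (rule that[of "Min {h1, h2, h3, h4}" ?C e2])
    show "0 < Min {h1, h2, h3, h4}" using 1(1) 2(1) 3(1) 4(1) by simp
    show "0 \<le> ?C" using 1(2) 2(2) 3(2) 4(2) by simp
    fix h assume h: "0 < h" "h \<le> Min {h1, h2, h3, h4}"
    then have "h \<le> h1" "h \<le> h2" "h \<le> h3" "h \<le> h4" by simp_all
    note b = 1(3)[OF h(1) this(1)] 2(3)[OF h(1) this(2)] 3(3)[OF h(1) this(3)] 4(3)[OF h(1) this(4)]
    show "\<bar>min_of (Spec_c V h) - (sqrt a0 * h + e2 * h\<^sup>2)\<bar> \<le> ?C * h ^ 3"
      using b(1,2) le(1,2)[OF h(1)] unfolding abs_le_iff by linarith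
    show "\<bar>min_of (Spec_d V h) - (sqrt a0 * h + (e2 - a0 / 16) * h\<^sup>2)\<bar> \<le> ?C * h ^ 3"
      using b(3,4) le(3,4)[OF h(1)] unfolding abs_le_iff by linarith
  qed
qed

lemma ratio_asymptotics: "(\<lambda>h. d V h - (1 - sqrt a0 / 16 * h)) \<in> O[at_right 0](\<lambda>h. h\<^sup>2)"
proof -
  define w where "w = sqrt a0"
  have w: "0 < w" "a0 = w\<^sup>2" using a0 by (auto simp: w_def)
  obtain e2 C h1 where h1: "0 < h1" and C: "0 \<le> C"
    and c: "\<And>h. 0 < h \<Longrightarrow> h \<le> h1 \<Longrightarrow> \<bar>min_of (Spec_c V h) - (w * h + e2 * h\<^sup>2)\<bar> \<le> C * h ^ 3"
    and dd: "\<And>h. 0 < h \<Longrightarrow> h \<le> h1 \<Longrightarrow> \<bar>min_of (Spec_d V h) - (w * h + (e2 - a0 / 16) * h\<^sup>2)\<bar> \<le> C * h ^ 3"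
    using spectral_asymptotics unfolding w_def[symmetric] by metis
  define L where "L = \<bar>e2\<bar> + C"
  \<comment> \<open>2 C collects the two cubic remainders; the other part comes from multiplying the
    deviation of the continuous minimum from w h, at most L h^2, by w h / 16.\<close>
  define K where "K = 2 * C + w / 16 * L"
  \<comment> \<open>The third bound keeps the denominator at least w h / 2.\<close>
  define h2 where "h2 = Min {h1, 1, w / (2 * L + 1)}"
  have L: "0 \<le> L" using C by (simp add: L_def)
  have h2: "0 < h2" using h1 w L by (simp add: h2_def)
  have "\<bar>d V h - (1 - w / 16 * h)\<bar> \<le> (2 * K / w) * h\<^sup>2" if h: "0 < h" "h < h2" for h
  proof -
    have "h2 \<le> h1" "h2 \<le> 1" "h2 \<le> w / (2 * L + 1)" unfolding h2_def by (intro Min_le; simp)+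
    then have hh: "h \<le> h1" "h \<le> 1" "h \<le> w / (2 * L + 1)" using h by linarith+
    define lc ld where "lc = min_of (Spec_c V h)" and "ld = min_of (Spec_d V h)"
    have C3: "C * h ^ 3 \<le> C * h\<^sup>2" using hh(2) h(1) C by (intro mult_left_mono power_decreasing) auto
    have e2: "\<bar>e2 * h\<^sup>2\<bar> = \<bar>e2\<bar> * h\<^sup>2" by (simp add: abs_mult)
    have A: "\<bar>lc - w * h\<bar> \<le> L * h\<^sup>2"
      using c[OF h(1) hh(1), folded lc_def] C3 e2 unfolding L_def distrib_right by linarith
    have "h * (2 * L + 1) \<le> w" using hh(3) L by (simp add: pos_le_divide_eq)
    then have "L * h \<le> w / 2" using h(1) by (simp add: algebra_simps)
    then have "L * h * h \<le> w / 2 * h" using h(1) by (intro mult_right_mono) auto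
    then have "L * h\<^sup>2 \<le> w * h / 2" by (simp add: power2_eq_square mult.assoc)
    then have lc: "w * h / 2 \<le> lc" using A by linarith
    have wh: "0 < w * h / 2" using w h by simp
    have B: "\<bar>w / 16 * h * (lc - w * h)\<bar> \<le> w / 16 * L * h ^ 3"
    proof -
      have "\<bar>w / 16 * h * (lc - w * h)\<bar> = w / 16 * h * \<bar>lc - w * h\<bar>" using w h by (simp add: abs_mult)
      also have "\<dots> \<le> w / 16 * h * (L * h\<^sup>2)" using A w h by (intro mult_left_mono) auto
      finally show ?thesis by (simp add: power2_eq_square power3_eq_cube mult_ac)
    qed
    \<comment> \<open>The second-order terms differ by - w^2 h^2 / 16, which cancels against w h /
      16 times the leading part w h of lc; only cubic terms survive.\<close>
    have "ld - lc * (1 - w / 16 * h) = (ld - (w * h + (e2 - w\<^sup>2 / 16) * h\<^sup>2)) - (lc - (w * h + e2 * h\<^sup>2)) + w / 16 * h * (lc - w * h)"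
      by (simp add: field_simps power2_eq_square)
    then have N: "\<bar>ld - lc * (1 - w / 16 * h)\<bar> \<le> K * h ^ 3"
      using c[OF h(1) hh(1), folded lc_def] dd[OF h(1) hh(1), folded ld_def, unfolded w(2)] B unfolding K_def distrib_right by linarith
    have "d V h - (1 - w / 16 * h) = (ld - lc * (1 - w / 16 * h)) / lc"
      using lc wh by (simp add: d_def lc_def[symmetric] ld_def[symmetric] diff_divide_distrib)
    then have "\<bar>d V h - (1 - w / 16 * h)\<bar> = \<bar>ld - lc * (1 - w / 16 * h)\<bar> / lc" using lc wh by simp
    also have "\<dots> \<le> (K * h ^ 3) / (w * h / 2)" using N lc wh by (intro frac_le) auto
    also have "\<dots> = (2 * K / w) * h\<^sup>2" using w h by (simp add: power2_eq_square power3_eq_cube)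
    finally show ?thesis .
  qed
  then have "eventually (\<lambda>h. norm (d V h - (1 - w / 16 * h)) \<le> (2 * K / w) * norm (h\<^sup>2)) (at_right 0)"
    unfolding eventually_at_right_field using h2 by (intro exI[of _ h2]) auto
  then show ?thesis unfolding w_def by (rule bigoI)
qed

end

text \<open>The first conjunct ensures that the definite descriptions \<open>min_of\<close> inside
  \<open>d\<close> denote actual minima.\<close>

theorem proposition7:
  fixes V :: "real \<Rightarrow> real" and x0 a0 :: real
  assumes "smooth V"
    and "\<And>x. V (x + 1) = V x"
    and "\<And>x. (\<forall>y. V x \<le> V y) \<longleftrightarrow> x - x0 \<in> \<int>"
    and "(\<lambda>x. V x - a0 * (x - x0)\<^sup>2) \<in> O[at x0](\<lambda>x. \<bar>x - x0\<bar> ^ 3)"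
    and "a0 > 0"
  shows "(\<forall>h>0. (\<exists>m. is_min_of (Spec_d V h) m) \<and> (\<exists>m. is_min_of (Spec_c V h) m)) \<and>
    (\<lambda>h. d V h - (1 - sqrt a0 / 16 * h)) \<in> O[at_right 0](\<lambda>h. h\<^sup>2)"
proof -
  interpret single_well V x0 a0 by (rule single_well.intro[OF assms])
  obtain B where B: "\<And>x. V x \<le> B" by (rule V_bounded) (rule that)
  have "is_min_of (Spec_d V h) (nonneg_operator.bottom cs (L2 cs) (P_d V h))" for h
    unfolding Spec_d_def by (rule nonneg_operator.is_min_of_Spec[OF P_d_nonneg_operator[OF V_nonneg B]])
  moreover have "is_min_of (Spec_c V h) (nonneg_operator.bottom lborel H2 (P_c V h))" for h
    unfolding Spec_c_def by (rule nonneg_operator.is_min_of_Spec[OF P_c_nonneg_operator[OF V_cont(2) V_nonneg B]])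
  ultimately show ?thesis using ratio_asymptotics by blast
qed

end
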